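(* Let $m\ge 2$ be an integer. For each $d\in{\bf N}$, define a discrete random variable $X_d$ by $${\bf P}(X_d=k)=\frac{1}{\chi({\rm H}_{d,1}^{(m)})}\cdot\dim H^{(m-1)d(d-1)-2k}({\rm H}_{d,1}^{(m)})\qquad (k\in{\bf Z}_{\ge 0}).$$ Then the sequence of discrete random variables $$\sqrt{\frac{8}{m(m-1)}}\cdot d^{-\frac{3}{2}}\cdot X_d$$ has the Airy distribution as a limit law as $d\to\infty$ (i.e. it converges in distribution to the Airy distribution).
   Context: The ground field is ${\bf C}$. The variety ${\rm H}_{d,1}^{(m)}$: let $W$ be a ${\bf C}$-vector space of dimension $d$. The group ${\rm GL}(W)$ acts on $X=W\oplus{\rm End}(W)^m$ by $g(f,\varphi_1,\ldots,\varphi_m)=(gf,g\varphi_1g^{-1},\ldots,g\varphi_mg^{-1})$. A tuple is stable if the smallest subspace of $W$ containing the vector $f$ and invariant under all $\varphi_i$ is $W$. Let $X^s\subset X$ be the open subset of stable tuples; ${\rm H}_{d,1}^{(m)}=X^s/{\rm GL}(W)$ is the (geometric) quotient variety. $H^i$ denotes singular cohomology (e.g. with rational coefficients) of the complex variety, with $H^i=0$ for $i<0$, and $\chi=\sum_i(-1)^i\dim H^i$. The Airy distribution is the law of a positive random variable $X$ which is uniquely determined by its $k$-th moments $${\bf E}(X^k)=\frac{2\sqrt{\pi}}{\Gamma(\frac{3k-1}{2})}\cdot\Omega_k,$$ where the $\Omega_k$ are defined recursively by $\Omega_0=-1$ and, for $k\ge 1$, $2\Omega_k=(3k-4)k\,\Omega_{k-1}+\sum_{i=1}^{k-1}\binom{k}{i}\Omega_i\Omega_{k-i}$.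 *)

theory Defs
  imports
    "HOL-Probability.Probability"
    "HOL-Homology.Homology"
    "Jordan_Normal_Form.VS_Connect"
begin

section \<open>Singular cohomology with rational coefficients\<close>

text \<open>A singular cochain is a function on the singular \<open>p\<close>-simplices of \<open>X\<close>, extended by zero to
  all other functions.\<close>

type_synonym 'a cochain = "((nat \<Rightarrow> real) \<Rightarrow> 'a) \<Rightarrow> rat"

definition singular_cochains :: "nat \<Rightarrow> 'a topology \<Rightarrow> 'a cochain set" where
  "singular_cochains p X = {c. \<forall>\<sigma>. \<not> singular_simplex p X \<sigma> \<longrightarrow> c \<sigma> = 0}"

definition coboundary :: "nat \<Rightarrow> 'a topology \<Rightarrow> 'a cochain \<Rightarrow> 'a cochain" where
  "coboundary p X c = (\<lambda>\<sigma>.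
     if singular_simplex (Suc p) X \<sigma>
     then (\<Sum>k\<le>Suc p. (-1) ^ k * c (singular_face (Suc p) k \<sigma>)) else 0)"

definition cocycles :: "nat \<Rightarrow> 'a topology \<Rightarrow> 'a cochain set" where
  "cocycles p X = {c \<in> singular_cochains p X. coboundary p X c = (\<lambda>_. 0)}"

definition coboundaries :: "nat \<Rightarrow> 'a topology \<Rightarrow> 'a cochain set" where
  "coboundaries p X =
     (case p of 0 \<Rightarrow> {\<lambda>_. 0} | Suc q \<Rightarrow> coboundary q X ` singular_cochains q X)"

text \<open>The ring fields \<open>mult\<close> and \<open>one\<close> of a module record play no role, and are left unspecified as
  in \<^const>\<open>module_vec\<close>.\<close>

definition cocycle_module :: "nat \<Rightarrow> 'a topology \<Rightarrow> (rat, 'a cochain) module" where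
  "cocycle_module p X =
     \<lparr>carrier = cocycles p X, mult = undefined, one = undefined, zero = (\<lambda>_. 0),
      add = (\<lambda>a b \<sigma>. a \<sigma> + b \<sigma>), smult = (\<lambda>r a \<sigma>. r * a \<sigma>)\<rparr>"

definition quotient_module :: "('r, 'v) module \<Rightarrow> 'v set \<Rightarrow> ('r, 'v set) module" where
  "quotient_module M N =
     \<lparr>carrier = a_rcosets\<^bsub>M\<^esub> N, mult = undefined, one = undefined, zero = N,
      add = (\<lambda>A B. A <+>\<^bsub>M\<^esub> B), smult = (\<lambda>r A. \<Union>a\<in>A. N +>\<^bsub>M\<^esub> (r \<odot>\<^bsub>M\<^esub> a))\<rparr>"

definition singular_cohomology :: "nat \<Rightarrow> 'a topology \<Rightarrow> (rat, 'a cochain set) module" where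
  "singular_cohomology p X = quotient_module (cocycle_module p X) (coboundaries p X)"

definition betti_number :: "int \<Rightarrow> 'a topology \<Rightarrow> nat" where
  "betti_number i X =
     (if i < 0 then 0
      else vectorspace.dim (class_ring :: rat ring) (singular_cohomology (nat i) X))"

text \<open>Meaningful only if the total cohomology is finite-dimensional: otherwise \<open>sum\<close> over an
  infinite index set, or \<open>vectorspace.dim\<close>, gives a junk value.\<close>

definition euler_characteristic :: "'a topology \<Rightarrow> int" where
  "euler_characteristic X =
     (\<Sum>i | betti_number (int i) X \<noteq> 0. (-1) ^ i * int (betti_number (int i) X))"


section \<open>Quotient topologies\<close>

definition quotient_topology :: "'a topology \<Rightarrow> ('a \<Rightarrow> 'b) \<Rightarrow> 'b topology" where
  "quotient_topology X f =
     topology (\<lambda>U. U \<subseteq> f ` topspace X \<and> openin X {x \<in> topspace X. f x \<in> U})"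

lemma openin_quotient_topology:
  "openin (quotient_topology X f) U \<longleftrightarrow>
     U \<subseteq> f ` topspace X \<and> openin X {x \<in> topspace X. f x \<in> U}"
proof -
  have "istopology (\<lambda>U. U \<subseteq> f ` topspace X \<and> openin X {x \<in> topspace X. f x \<in> U})"
    unfolding istopology_def
  proof (intro conjI allI impI; (elim conjE)?)
    fix S T
    assume "openin X {x \<in> topspace X. f x \<in> S}" "openin X {x \<in> topspace X. f x \<in> T}"
    then have "openin X ({x \<in> topspace X. f x \<in> S} \<inter> {x \<in> topspace X. f x \<in> T})"
      by (rule openin_Int)
    also have "{x \<in> topspace X. f x \<in> S} \<inter> {x \<in> topspace X. f x \<in> T} =
        {x \<in> topspace X. f x \<in> S \<inter> T}" by auto
    finally show "openin X {x \<in> topspace X. f x \<in> S \<inter> T}" .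
  next
    fix K
    assume K: "\<forall>S\<in>K. S \<subseteq> f ` topspace X \<and> openin X {x \<in> topspace X. f x \<in> S}"
    then have "openin X (\<Union>S\<in>K. {x \<in> topspace X. f x \<in> S})" by blast
    also have "(\<Union>S\<in>K. {x \<in> topspace X. f x \<in> S}) = {x \<in> topspace X. f x \<in> \<Union>K}" by auto
    finally show "openin X {x \<in> topspace X. f x \<in> \<Union>K}" .
    from K show "\<Union>K \<subseteq> f ` topspace X" by blast
  qed blast
  then show ?thesis
    by (simp add: quotient_topology_def topology_inverse')
qed

lemma quotient_map_quotient_topology: "quotient_map X (quotient_topology X f) f"
proof -
  have "topspace (quotient_topology X f) = f ` topspace X"
  proof
    show "topspace (quotient_topology X f) \<subseteq> f ` topspace X"
      using openin_topspace[of "quotient_topology X f"]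
      unfolding openin_quotient_topology by blast
    have "{x \<in> topspace X. f x \<in> f ` topspace X} = topspace X" by auto
    then show "f ` topspace X \<subseteq> topspace (quotient_topology X f)"
      by (intro openin_subset) (simp add: openin_quotient_topology)
  qed
  then show ?thesis
    by (simp add: quotient_map_def openin_quotient_topology)
qed


section \<open>The varieties $\mathrm{H}_{d,1}^{(m)}$\<close>

text \<open>We take \<open>W = \<complex>\<^sup>d\<close>; a point of \<open>W \<oplus> End(W)\<^sup>m\<close> is a vector together with a list of \<open>m\<close>
  matrices.\<close>

definition rep_space :: "nat \<Rightarrow> nat \<Rightarrow> (complex vec \<times> complex mat list) set" where
  "rep_space m d = {(f, \<phi>s). f \<in> carrier_vec d \<and> length \<phi>s = m \<and> set \<phi>s \<subseteq> carrier_mat d d}"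

definition rep_coords ::
  "nat \<Rightarrow> nat \<Rightarrow> complex vec \<times> complex mat list \<Rightarrow>
     (nat \<Rightarrow> complex) \<times> (nat \<Rightarrow> nat \<Rightarrow> nat \<Rightarrow> complex)" where
  "rep_coords m d = (\<lambda>(f, \<phi>s).
     (\<lambda>i. if i < d then vec_index f i else 0,
      \<lambda>l i j. if l < m \<and> i < d \<and> j < d then (\<phi>s ! l) $$ (i, j) else 0))"

text \<open>The usual (analytic) topology of the complex vector space \<open>W \<oplus> End(W)\<^sup>m\<close>.\<close>

definition rep_topology :: "nat \<Rightarrow> nat \<Rightarrow> (complex vec \<times> complex mat list) topology" where
  "rep_topology m d = pullback_topology (rep_space m d) (rep_coords m d) euclidean"

definition stable_tuples :: "nat \<Rightarrow> nat \<Rightarrow> (complex vec \<times> complex mat list) set" where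
  "stable_tuples m d = {(f, \<phi>s) \<in> rep_space m d.
     \<Inter>{U. VectorSpace.subspace class_ring U (module_vec TYPE(complex) d) \<and> f \<in> U \<and>
          (\<forall>\<phi>\<in>set \<phi>s. \<forall>u\<in>U. \<phi> *\<^sub>v u \<in> U)} = carrier_vec d}"

definition GL_orbit ::
  "nat \<Rightarrow> complex vec \<times> complex mat list \<Rightarrow> (complex vec \<times> complex mat list) set" where
  "GL_orbit d = (\<lambda>(f, \<phi>s).
     {(g *\<^sub>v f, map (\<lambda>\<phi>. g * \<phi> * h) \<phi>s) | g h.
        g \<in> carrier_mat d d \<and> h \<in> carrier_mat d d \<and> g * h = 1\<^sub>m d \<and> h * g = 1\<^sub>m d})"

text \<open>\<open>GL(W)\<close> acts freely and properly on the stable locus, so the analytic topology of the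
  geometric quotient is the quotient topology on the set of orbits.\<close>

definition nc_hilbert :: "nat \<Rightarrow> nat \<Rightarrow> (complex vec \<times> complex mat list) set topology" where
  "nc_hilbert m d =
     quotient_topology (subtopology (rep_topology m d) (stable_tuples m d)) (GL_orbit d)"


section \<open>The Airy distribution\<close>

function airy_Omega :: "nat \<Rightarrow> real" where
  "airy_Omega k = (if k = 0 then -1 else
     ((3 * real k - 4) * real k * airy_Omega (k - 1) +
      (\<Sum>i = 1..k - 1. real (k choose i) * airy_Omega i * airy_Omega (k - i))) / 2)"
  by auto
termination by (relation "Wellfounded.measure id") auto

declare airy_Omega.simps [simp del]

definition is_airy_distribution :: "real measure \<Rightarrow> bool" where
  "is_airy_distribution \<mu> \<longleftrightarrow>
     real_distribution \<mu> \<and> (AE x in \<mu>. 0 < x) \<and>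
     (\<forall>k::nat. integrable \<mu> (\<lambda>x. x ^ k) \<and>
        (\<integral>x. x ^ k \<partial>\<mu>) = 2 * sqrt pi / Gamma ((3 * real k - 1) / 2) * airy_Omega k)"

definition airy_distribution :: "real measure" where
  "airy_distribution = (THE \<mu>. is_airy_distribution \<mu>)"

end

theory Submission
  imports
    Defs
    "HOL-Algebra.Free_Abelian_Groups"
    "HOL-Library.List_Lexorder"
    "HOL-Computational_Algebra.Formal_Power_Series"
    "HOL-Real_Asymp.Real_Asymp"
begin

text \<open>
  A point of the noncommutative Hilbert scheme is a cyclic representation of the free algebra on \<open>m\<close>
  letters. Those whose lexicographically first basis of words is a given tree \<open>S\<close> form a complex affine
  cell, so the homology is free and \<open>dim H\<^sup>2\<^sup>c\<close> is the number of \<open>m\<close>-ary trees with \<open>d\<close> nodes whose cell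
  has codimension \<open>c\<close>. This codimension is \<open>(m - 1) d (d - 1) / 2\<close> minus an area statistic additive over
  the subtrees at the root, so \<open>X\<^sub>d\<close> is the area of a uniformly random tree.

  The moment series of the area are Laurent polynomials in \<open>Y = m - (m - 1) T\<close>, where \<open>T\<close> is
  the generating series of trees; their leading coefficients satisfy the recursion of the \<open>\<Omega>\<^sub>k\<close>, and
  Stirling's formula turns this into convergence of all moments. The Airy moments grow slowly enough to
  determine a law, hence the method of moments applies and even produces the limit law. That the limit
  does not charge \<open>x \<le> 0\<close> follows from a first moment bound on the number of nodes of small weight.
\<close>

section \<open>Cohomology of spaces with free homology\<close>

text \<open>A cell is closed in the union of the charts up to its own, so it contributes to homology
  in the degree of its codimension, not of its dimension.

  \<open>airy_distribution\<close> is a definite description, so existence and uniqueness of the law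
  must both be proved. The weak limit itself is the witness, which is why its positivity needs a
  separate estimate.

  Complex singularity analysis is avoided through Z = 1/Y. The Euler operator X d/dX sends Z^r to a
  linear combination of Z^(r+2), Z^(r+1) and Z^r, so the coefficients of all powers follow from r =
  1, an explicit binomial coefficient, and r = 2, a self-convolution. The k-th moment has a pole of
  order 3k - 1 in Y; divided by the tree numbers this grows like n^(3k/2), the source of the scaling
  d^(-3/2). The factor sqrt(8/(m(m-1))) cancels the geometric factor that remains in the k-th
  moment. The constant in Stirling's formula is found by comparing the case m = 2 with the Gamma
  function.\<close>

definition pairing :: "('b \<Rightarrow> rat) \<Rightarrow> ('b \<Rightarrow>\<^sub>0 int) \<Rightarrow> rat" where
  "pairing c x = (\<Sum>\<sigma>\<in>Poly_Mapping.keys x. of_int (Poly_Mapping.lookup x \<sigma>) * c \<sigma>)"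

lemma pairing_eq_sum:
  assumes "finite S" "Poly_Mapping.keys x \<subseteq> S"
  shows "pairing c x = (\<Sum>\<sigma>\<in>S. of_int (Poly_Mapping.lookup x \<sigma>) * c \<sigma>)"
  unfolding pairing_def using assms
  by (intro sum.mono_neutral_left) (auto simp: in_keys_iff)

lemma pairing_add: "pairing c (x + y) = pairing c x + pairing c y"
proof -
  let ?S = "Poly_Mapping.keys x \<union> Poly_Mapping.keys y"
  have "Poly_Mapping.keys (x + y) \<subseteq> ?S" by (rule keys_add)
  then show ?thesis
    by (simp add: pairing_eq_sum[of ?S] lookup_add algebra_simps sum.distrib)
qed

lemma pairing_0 [simp]: "pairing c 0 = 0"
  by (simp add: pairing_def)

lemma pairing_frag_cmul: "pairing c (frag_cmul n x) = of_int n * pairing c x"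
proof -
  have "Poly_Mapping.keys (frag_cmul n x) \<subseteq> Poly_Mapping.keys x" by (rule keys_cmul)
  then show ?thesis
    by (simp add: pairing_eq_sum[of "Poly_Mapping.keys x"] sum_distrib_left algebra_simps)
qed

lemma pairing_diff: "pairing c (x - y) = pairing c x - pairing c y"
  using pairing_add[of c "x - y" y] by simp

lemma pairing_sum: "pairing c (\<Sum>i\<in>I. f i) = (\<Sum>i\<in>I. pairing c (f i))"
  by (induction I rule: infinite_finite_induct) (auto simp: pairing_add)

lemma pairing_frag_of [simp]: "pairing c (frag_of \<sigma>) = c \<sigma>"
  by (simp add: pairing_def)

lemma pairing_add_left: "pairing (\<lambda>\<sigma>. c \<sigma> + d \<sigma>) x = pairing c x + pairing d x"
  by (simp add: pairing_def algebra_simps sum.distrib)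

lemma pairing_mult_left: "pairing (\<lambda>\<sigma>. r * c \<sigma>) x = r * pairing c x"
  by (simp add: pairing_def algebra_simps sum_distrib_left)

lemma pairing_diff_left: "pairing (\<lambda>\<sigma>. c \<sigma> - d \<sigma>) x = pairing c x - pairing d x"
  by (simp add: pairing_def algebra_simps sum_subtractf)

lemma pairing_zero_left [simp]: "pairing (\<lambda>\<sigma>. 0) x = 0"
  by (simp add: pairing_def)

lemma pairing_cong:
  "(\<And>\<sigma>. \<sigma> \<in> Poly_Mapping.keys x \<Longrightarrow> c \<sigma> = d \<sigma>) \<Longrightarrow> pairing c x = pairing d x"
  by (simp add: pairing_def)

section \<open>Additive maps on subgroups of free abelian groups\<close>

context
  fixes B :: "('b \<Rightarrow>\<^sub>0 int) set" and \<phi> :: "('b \<Rightarrow>\<^sub>0 int) \<Rightarrow> 'r::ring_1"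
  assumes zero: "0 \<in> B" and diff: "\<And>x y. x \<in> B \<Longrightarrow> y \<in> B \<Longrightarrow> x - y \<in> B"
    and add: "\<And>x y. x \<in> B \<Longrightarrow> y \<in> B \<Longrightarrow> \<phi> (x + y) = \<phi> x + \<phi> y"
begin

lemma additive_uminus: "x \<in> B \<Longrightarrow> - x \<in> B \<and> \<phi> (- x) = - \<phi> x"
  using diff[OF zero, of x] add[of x "- x"] add[OF zero zero]
  by (simp add: eq_neg_iff_add_eq_0 add.commute)

lemma additive_plus: "x \<in> B \<Longrightarrow> y \<in> B \<Longrightarrow> x + y \<in> B"
  using diff[of x "- y"] additive_uminus[of y] by simp

lemma additive_frag_cmul:
  assumes "x \<in> B"
  shows "frag_cmul n x \<in> B \<and> \<phi> (frag_cmul n x) = of_int n * \<phi> x"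
proof -
  have nat: "frag_cmul (int k) x \<in> B \<and> \<phi> (frag_cmul (int k) x) = of_nat k * \<phi> x" for k
  proof (induction k)
    case 0
    then show ?case using zero add[OF zero zero] by simp
  next
    case (Suc k)
    have "frag_cmul (int (Suc k)) x = x + frag_cmul (int k) x"
      by (simp add: frag_cmul_distrib)
    then show ?case using Suc additive_plus add assms by (simp add: algebra_simps)
  qed
  show ?thesis
  proof (cases n)
    case (nonneg k)
    then show ?thesis using nat[of k] by simp
  next
    case (neg k)
    then have "frag_cmul n x = - frag_cmul (int (Suc k)) x" by simp
    then show ?thesis using nat[of "Suc k"] additive_uminus[of "frag_cmul (int (Suc k)) x"] neg
      by (metis minus_mult_left of_int_minus of_int_of_nat_eq)
  qed
qed

lemma additive_sum:
  assumes "\<And>i. i \<in> I \<Longrightarrow> f i \<in> B"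
  shows "(\<Sum>i\<in>I. f i) \<in> B \<and> \<phi> (\<Sum>i\<in>I. f i) = (\<Sum>i\<in>I. \<phi> (f i))"
  using assms zero add[OF zero zero]
  by (induction I rule: infinite_finite_induct) (auto simp: additive_plus add)

end

text \<open>\<open>\<rat>\<close> is an injective abelian group.\<close>

lemma additive_extends_to_pairing:
  fixes B :: "('b \<Rightarrow>\<^sub>0 int) set" and \<phi> :: "('b \<Rightarrow>\<^sub>0 int) \<Rightarrow> rat"
  assumes zero: "0 \<in> B" and diff: "\<And>x y. x \<in> B \<Longrightarrow> y \<in> B \<Longrightarrow> x - y \<in> B"
    and add: "\<And>x y. x \<in> B \<Longrightarrow> y \<in> B \<Longrightarrow> \<phi> (x + y) = \<phi> x + \<phi> y"
  obtains c where "\<And>x. x \<in> B \<Longrightarrow> pairing c x = \<phi> x"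
proof -
  \<comment> \<open>Integral chains are embedded by e into a rational vector space, where linear
    maps extend from independent sets.\<close>
  define sc :: "rat \<Rightarrow> ('b \<Rightarrow>\<^sub>0 rat) \<Rightarrow> ('b \<Rightarrow>\<^sub>0 rat)" where "sc r x = Poly_Mapping.map ((*) r) x" for r x
  define e :: "('b \<Rightarrow>\<^sub>0 int) \<Rightarrow> ('b \<Rightarrow>\<^sub>0 rat)" where "e = Poly_Mapping.map rat_of_int"
  have lsc: "Poly_Mapping.lookup (sc r x) k = r * Poly_Mapping.lookup x k" for r x k
    by (simp add: sc_def Poly_Mapping.map.rep_eq when_def)
  have le: "Poly_Mapping.lookup (e x) k = of_int (Poly_Mapping.lookup x k)" for x k
    by (simp add: e_def Poly_Mapping.map.rep_eq when_def)
  interpret V: vector_space sc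
    by unfold_locales (auto intro!: poly_mapping_eqI simp: lsc lookup_add algebra_simps)
  interpret VP: vector_space_pair sc "(*) :: rat \<Rightarrow> rat \<Rightarrow> rat"
    by unfold_locales (auto simp: algebra_simps)
  have e_add: "e (x + y) = e x + e y" for x y
    by (intro poly_mapping_eqI) (simp add: le lookup_add)
  have e_cmul: "e (frag_cmul n x) = sc (of_int n) (e x)" for n x
    by (intro poly_mapping_eqI) (simp add: le lsc)
  have e_0: "e 0 = 0" by (intro poly_mapping_eqI) (simp add: le)
  have e_sum: "e (\<Sum>i\<in>I. f i) = (\<Sum>i\<in>I. e (f i))" for I :: "('b \<Rightarrow>\<^sub>0 rat) set" and f
    by (induction I rule: infinite_finite_induct) (auto simp: e_add e_0)
  have e_inj: "e x = e y \<Longrightarrow> x = y" for x y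
    by (intro poly_mapping_eqI) (metis le of_int_eq_iff)
  have cmul: "frag_cmul n x \<in> B \<and> \<phi> (frag_cmul n x) = of_int n * \<phi> x" if "x \<in> B" for n x
    using zero diff add that by (rule additive_frag_cmul)
  have sum_in: "(\<Sum>i\<in>I. f i) \<in> B \<and> \<phi> (\<Sum>i\<in>I. f i) = (\<Sum>i\<in>I. \<phi> (f i))"
    if "\<And>i. i \<in> I \<Longrightarrow> f i \<in> B" for I :: "('b \<Rightarrow>\<^sub>0 rat) set" and f
    using zero diff add that by (rule additive_sum)
  \<comment> \<open>J is a rational basis of the span of B that consists of elements of B, so \<phi>
    prescribes values on it.\<close>
  obtain J where J: "J \<subseteq> e ` B" "V.independent J" "e ` B \<subseteq> V.span J"
    using V.maximal_independent_subset by blast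
  define inve where "inve v = (THE b. e b = v)" for v
  have inve: "inve (e b) = b" for b
    unfolding inve_def using e_inj by blast
  obtain g where g: "Vector_Spaces.linear sc (*) g" and gJ: "\<And>v. v \<in> J \<Longrightarrow> g v = \<phi> (inve v)"
    using VP.linear_independent_extend[OF J(2), of "\<lambda>v. \<phi> (inve v)"] by blast
  interpret g: Vector_Spaces.linear sc "(*)" g by (rule g)
  have gB: "g (e b) = \<phi> b" if b: "b \<in> B" for b
  proof -
    have "e b \<in> V.span J" using J(3) b by blast
    then obtain T u where T: "finite T" "T \<subseteq> J" and eb: "e b = (\<Sum>v\<in>T. sc (u v) v)"
      unfolding V.span_explicit by auto
    \<comment> \<open>Multiplication by all denominators turns the rational relation into one
      between integral chains, where additivity of \<phi> applies; N is cancelled again at the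
      end.\<close>
    define N :: int where "N = (\<Prod>v\<in>T. snd (quotient_of (u v)))"
    have Npos: "N > 0" unfolding N_def by (intro prod_pos) (auto intro: quotient_of_denom_pos')
    have "\<exists>n. of_int N * u v = of_int n" if v: "v \<in> T" for v
    proof -
      let ?q = "snd (quotient_of (u v))" and ?R = "\<Prod>w\<in>T-{v}. snd (quotient_of (u w))"
      have "N = ?q * ?R" unfolding N_def using T(1) v by (rule prod.remove)
      moreover have "u v = of_int (fst (quotient_of (u v))) / of_int ?q"
        by (rule quotient_of_div) simp
      then have "of_int ?q * u v = of_int (fst (quotient_of (u v)))"
        using quotient_of_denom_pos'[of "u v"] by (simp add: field_simps)
      ultimately have "of_int N * u v = of_int (?R * fst (quotient_of (u v)))"
        by (simp add: mult.commute mult.left_commute)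
      then show ?thesis by blast
    qed
    then obtain k where k: "\<And>v. v \<in> T \<Longrightarrow> of_int N * u v = of_int (k v)" by metis
    have TB: "inve v \<in> B \<and> e (inve v) = v" if "v \<in> T" for v
      using that T(2) J(1) inve by fastforce
    have "e (frag_cmul N b) = (\<Sum>v\<in>T. sc (of_int N * u v) v)"
      by (simp add: e_cmul eb V.scale_sum_right)
    also have "\<dots> = (\<Sum>v\<in>T. sc (of_int (k v)) v)"
      by (intro sum.cong) (auto simp: k)
    also have "\<dots> = e (\<Sum>v\<in>T. frag_cmul (k v) (inve v))"
      by (simp add: e_sum e_cmul TB)
    finally have Nb: "frag_cmul N b = (\<Sum>v\<in>T. frag_cmul (k v) (inve v))" by (rule e_inj)
    have "of_int N * \<phi> b = \<phi> (frag_cmul N b)" using cmul[OF b] by simp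
    also have "\<dots> = (\<Sum>v\<in>T. of_int (k v) * \<phi> (inve v))"
      unfolding Nb using sum_in[of T "\<lambda>v. frag_cmul (k v) (inve v)"] cmul TB by simp
    also have "\<dots> = (\<Sum>v\<in>T. of_int N * (u v * g v))"
      using T(2) gJ k by (intro sum.cong) (auto simp flip: k mult.assoc)
    also have "\<dots> = of_int N * g (e b)"
      by (simp add: eb g.sum g.scale sum_distrib_left)
    finally show ?thesis using Npos by simp
  qed
  define c where "c \<sigma> = g (Poly_Mapping.single \<sigma> 1)" for \<sigma>
  have "pairing c x = \<phi> x" if x: "x \<in> B" for x
  proof -
    have "e x = (\<Sum>\<sigma>\<in>Poly_Mapping.keys x. sc (of_int (Poly_Mapping.lookup x \<sigma>)) (Poly_Mapping.single \<sigma> 1))"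
      by (intro poly_mapping_eqI)
        (simp add: le lookup_sum lsc lookup_single when_def in_keys_iff
          if_distrib[where f = "\<lambda>u. _ * u"] cong: if_cong)
    then have "g (e x) = pairing c x"
      by (simp add: g.sum g.scale pairing_def c_def)
    with gB[OF x] show ?thesis by simp
  qed
  then show ?thesis using that by blast
qed

text \<open>The discrete Stokes formula, through which statements about cochains are reduced to
  statements about chains.\<close>

lemma pairing_coboundary:
  assumes "singular_chain (Suc p) X x"
  shows "pairing (coboundary p X c) x = pairing c (chain_boundary (Suc p) x)"
proof -
  have "singular_simplex (Suc p) X \<sigma>" if "\<sigma> \<in> Poly_Mapping.keys x" for \<sigma>
    using assms that by (auto simp: singular_chain_def)
  then have "pairing (coboundary p X c) x = pairing (\<lambda>\<sigma>. \<Sum>k\<le>Suc p. (-1) ^ k * c (singular_face (Suc p) k \<sigma>)) x"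
    by (intro pairing_cong) (simp add: coboundary_def)
  also have "\<dots> = pairing c (chain_boundary (Suc p) x)"
    unfolding chain_boundary_def frag_extend_def pairing_sum pairing_frag_cmul
    by (simp add: pairing_def[of _ x] pairing_sum pairing_frag_cmul del: sum.atMost_Suc)
  finally show ?thesis .
qed

section \<open>Cocycles and coboundaries\<close>

lemma coboundary_in_singular_cochains: "coboundary p X c \<in> singular_cochains (Suc p) X"
  by (simp add: coboundary_def singular_cochains_def)

lemma singular_cochain_zeroI:
  assumes "c \<in> singular_cochains p X" and "\<And>x. singular_chain p X x \<Longrightarrow> pairing c x = 0"
  shows "c = (\<lambda>_. 0)"
proof
  fix \<sigma>
  show "c \<sigma> = 0"
    using assms(1) assms(2)[of "frag_of \<sigma>"]
    by (cases "singular_simplex p X \<sigma>") (auto simp: singular_cochains_def singular_chain_of)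
qed

lemma coboundaries_subset_cocycles: "coboundaries p X \<subseteq> cocycles p X"
proof (cases p)
  case 0
  have "coboundary 0 X (\<lambda>_. 0) = (\<lambda>_. 0)" by (auto simp: coboundary_def)
  then show ?thesis by (simp add: 0 coboundaries_def cocycles_def singular_cochains_def)
next
  case (Suc q)
  have "coboundary (Suc q) X (coboundary q X c) = (\<lambda>_. 0)" for c
  proof (rule singular_cochain_zeroI[OF coboundary_in_singular_cochains])
    fix x assume x: "singular_chain (Suc (Suc q)) X x"
    then show "pairing (coboundary (Suc q) X (coboundary q X c)) x = 0"
      using singular_chain_boundary_alt[OF x] chain_boundary_boundary_alt[OF x]
      by (simp add: pairing_coboundary)
  qed
  then show ?thesis
    by (auto simp: Suc coboundaries_def cocycles_def coboundary_in_singular_cochains)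
qed

lemma cocycles_lin:
  assumes "a \<in> cocycles p X" "b \<in> cocycles p X"
  shows "(\<lambda>\<sigma>. r * a \<sigma> + s * b \<sigma>) \<in> cocycles p X"
proof -
  have "coboundary p X (\<lambda>\<sigma>. r * a \<sigma> + s * b \<sigma>) =
     (\<lambda>\<sigma>. r * coboundary p X a \<sigma> + s * coboundary p X b \<sigma>)"
    by (auto simp: coboundary_def algebra_simps sum.distrib sum_distrib_left)
  then show ?thesis using assms by (auto simp: cocycles_def singular_cochains_def)
qed

lemma coboundaries_lin:
  assumes "a \<in> coboundaries p X" "b \<in> coboundaries p X"
  shows "(\<lambda>\<sigma>. r * a \<sigma> + s * b \<sigma>) \<in> coboundaries p X"
proof (cases p)
  case 0
  then show ?thesis using assms by (auto simp: coboundaries_def)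
next
  case (Suc q)
  then obtain c d where cd: "c \<in> singular_cochains q X" "d \<in> singular_cochains q X"
    "a = coboundary q X c" "b = coboundary q X d"
    using assms by (auto simp: coboundaries_def)
  have "coboundary q X (\<lambda>\<sigma>. r * c \<sigma> + s * d \<sigma>) = (\<lambda>\<sigma>. r * a \<sigma> + s * b \<sigma>)"
    by (auto simp: cd coboundary_def algebra_simps sum.distrib sum_distrib_left)
  moreover have "(\<lambda>\<sigma>. r * c \<sigma> + s * d \<sigma>) \<in> singular_cochains q X"
    using cd by (auto simp: singular_cochains_def)
  ultimately show ?thesis unfolding Suc coboundaries_def by (simp add: image_iff) metis
qed

lemma zero_in_coboundaries: "(\<lambda>_. 0) \<in> coboundaries p X"
proof (cases p)
  case (Suc q)
  have "coboundary q X (\<lambda>_. 0) = (\<lambda>_. 0)" by (auto simp: coboundary_def)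
  then show ?thesis unfolding Suc coboundaries_def
    by (auto simp: singular_cochains_def image_iff intro!: exI[of _ "\<lambda>_. 0"])
qed (simp add: coboundaries_def)

section \<open>Cohomology classes as a rational vector space\<close>

definition cohomology_class :: "nat \<Rightarrow> 'a topology \<Rightarrow> 'a cochain \<Rightarrow> 'a cochain set" where
  "cohomology_class p X c = {(\<lambda>\<sigma>. h \<sigma> + c \<sigma>) | h. h \<in> coboundaries p X}"

lemma in_cohomology_class: "z \<in> cohomology_class p X c \<longleftrightarrow> (\<lambda>\<sigma>. z \<sigma> - c \<sigma>) \<in> coboundaries p X"
proof -
  have "z = (\<lambda>\<sigma>. h \<sigma> + c \<sigma>) \<longleftrightarrow> h = (\<lambda>\<sigma>. z \<sigma> - c \<sigma>)" for h
    by (auto simp: fun_eq_iff)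
  then show ?thesis by (simp add: cohomology_class_def)
qed

lemma cohomology_class_eq_iff:
  "cohomology_class p X c = cohomology_class p X d \<longleftrightarrow> (\<lambda>\<sigma>. c \<sigma> - d \<sigma>) \<in> coboundaries p X"
proof
  assume "cohomology_class p X c = cohomology_class p X d"
  moreover have "c \<in> cohomology_class p X c"
    by (simp add: in_cohomology_class zero_in_coboundaries)
  ultimately show "(\<lambda>\<sigma>. c \<sigma> - d \<sigma>) \<in> coboundaries p X" by (simp add: in_cohomology_class)
next
  assume *: "(\<lambda>\<sigma>. c \<sigma> - d \<sigma>) \<in> coboundaries p X"
  have "(\<lambda>\<sigma>. z \<sigma> - c \<sigma>) \<in> coboundaries p X \<longleftrightarrow> (\<lambda>\<sigma>. z \<sigma> - d \<sigma>) \<in> coboundaries p X" for z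
    using coboundaries_lin[OF _ *, of "\<lambda>\<sigma>. z \<sigma> - c \<sigma>" 1 1]
      coboundaries_lin[OF _ *, of "\<lambda>\<sigma>. z \<sigma> - d \<sigma>" 1 "-1"] by auto
  then show "cohomology_class p X c = cohomology_class p X d"
    by (auto simp: in_cohomology_class)
qed

text \<open>Replaces cosets, sums of sets and unions of cosets by operations on
  representatives.\<close>

lemma singular_cohomology_simps:
  "carrier (singular_cohomology p X) = cohomology_class p X ` cocycles p X"
  "zero (singular_cohomology p X) = cohomology_class p X (\<lambda>_. 0)"
  "add (singular_cohomology p X) (cohomology_class p X a) (cohomology_class p X b) =
    cohomology_class p X (\<lambda>\<sigma>. a \<sigma> + b \<sigma>)"
  "Module.smult (singular_cohomology p X) r (cohomology_class p X a) = cohomology_class p X (\<lambda>\<sigma>. r * a \<sigma>)"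
proof -
  have coset: "coboundaries p X +>\<^bsub>cocycle_module p X\<^esub> c = cohomology_class p X c" for c
    by (auto simp: a_r_coset_def' cohomology_class_def cocycle_module_def)
  show "carrier (singular_cohomology p X) = cohomology_class p X ` cocycles p X"
    by (auto simp: singular_cohomology_def quotient_module_def A_RCOSETS_def' coset)
       (auto simp: cocycle_module_def)
  show "zero (singular_cohomology p X) = cohomology_class p X (\<lambda>_. 0)"
    by (simp add: singular_cohomology_def quotient_module_def cohomology_class_def)
  show "add (singular_cohomology p X) (cohomology_class p X a) (cohomology_class p X b) =
    cohomology_class p X (\<lambda>\<sigma>. a \<sigma> + b \<sigma>)"
  proof -
    have "(\<Union>x\<in>cohomology_class p X a. \<Union>y\<in>cohomology_class p X b. {\<lambda>\<sigma>. x \<sigma> + y \<sigma>}) =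
        cohomology_class p X (\<lambda>\<sigma>. a \<sigma> + b \<sigma>)" (is "?L = ?R")
    proof (intro equalityI subsetI)
      fix z assume "z \<in> ?L"
      then obtain x y where "x \<in> cohomology_class p X a" "y \<in> cohomology_class p X b"
        "z = (\<lambda>\<sigma>. x \<sigma> + y \<sigma>)" by auto
      then show "z \<in> ?R"
        using coboundaries_lin[of "\<lambda>\<sigma>. x \<sigma> - a \<sigma>" p X "\<lambda>\<sigma>. y \<sigma> - b \<sigma>" 1 1]
        by (simp add: in_cohomology_class algebra_simps)
    next
      fix z assume "z \<in> ?R"
      then have "(\<lambda>\<sigma>. z \<sigma> - b \<sigma>) \<in> cohomology_class p X a" "b \<in> cohomology_class p X b"
        by (simp_all add: in_cohomology_class zero_in_coboundaries algebra_simps)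
      moreover have "z = (\<lambda>\<sigma>. (z \<sigma> - b \<sigma>) + b \<sigma>)" by simp
      ultimately show "z \<in> ?L" by blast
    qed
    then show ?thesis
      by (simp add: singular_cohomology_def quotient_module_def set_add_def' cocycle_module_def)
  qed
  show "Module.smult (singular_cohomology p X) r (cohomology_class p X a) = cohomology_class p X (\<lambda>\<sigma>. r * a \<sigma>)"
  proof -
    have "cohomology_class p X (\<lambda>\<sigma>. r * b \<sigma>) = cohomology_class p X (\<lambda>\<sigma>. r * a \<sigma>)"
      if "b \<in> cohomology_class p X a" for b
      unfolding cohomology_class_eq_iff
      using that coboundaries_lin[of "\<lambda>\<sigma>. b \<sigma> - a \<sigma>" p X "\<lambda>\<sigma>. b \<sigma> - a \<sigma>" r 0]
      by (simp add: in_cohomology_class algebra_simps)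
    moreover have "a \<in> cohomology_class p X a" by (simp add: in_cohomology_class zero_in_coboundaries)
    ultimately have "(\<Union>b\<in>cohomology_class p X a. cohomology_class p X (\<lambda>\<sigma>. r * b \<sigma>)) = cohomology_class p X (\<lambda>\<sigma>. r * a \<sigma>)"
      by blast
    then show ?thesis
      by (simp add: singular_cohomology_def quotient_module_def coset)
        (simp add: cocycle_module_def)
  qed
qed

lemma vectorspace_singular_cohomology:
  "vectorspace (class_ring :: rat ring) (singular_cohomology p X)"
proof -
  let ?M = "singular_cohomology p X" and ?cl = "cohomology_class p X"
  have lin: "(\<lambda>\<sigma>. a \<sigma> + b \<sigma>) \<in> cocycles p X" if "a \<in> cocycles p X" "b \<in> cocycles p X" for a b
    using cocycles_lin[OF that, of 1 1] by simp
  have smu: "(\<lambda>\<sigma>. r * a \<sigma>) \<in> cocycles p X" if "a \<in> cocycles p X" for a r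
    using cocycles_lin[OF that that, of r 0] by simp
  have z: "(\<lambda>_. 0) \<in> cocycles p X" using zero_in_coboundaries coboundaries_subset_cocycles by blast
  have grp: "abelian_group ?M"
  proof (rule abelian_groupI)
    fix x assume "x \<in> carrier ?M"
    then obtain a where a: "a \<in> cocycles p X" "x = ?cl a" by (auto simp: singular_cohomology_simps)
    have "?cl (\<lambda>\<sigma>. (-1) * a \<sigma>) \<in> carrier ?M" using smu[OF a(1)] by (simp only: singular_cohomology_simps) blast
    moreover have "?cl (\<lambda>\<sigma>. (-1) * a \<sigma>) \<oplus>\<^bsub>?M\<^esub> x = \<zero>\<^bsub>?M\<^esub>"
      unfolding a singular_cohomology_simps by simp
    ultimately show "\<exists>y\<in>carrier ?M. y \<oplus>\<^bsub>?M\<^esub> x = \<zero>\<^bsub>?M\<^esub>" by blast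
  qed (auto simp: singular_cohomology_simps z lin algebra_simps)
  have "Module.module (class_ring :: rat ring) ?M"
    by (intro Module.module.intro grp Module.module_axioms.intro)
      (auto simp: singular_cohomology_simps smu lin algebra_simps fieldE(1)[OF class_field])
  then show ?thesis using class_field by (intro vectorspace.intro)
qed

text \<open>A dual-basis criterion: applying e j to a relation isolates its j-th coefficient, so b
  is independent, and the separation of points by e shows that every vector equals the combination
  of b with its own coordinates.\<close>

lemma dim_eq_card_coordinates:
  fixes M :: "(rat, 'v) module" and e :: "nat \<Rightarrow> 'v \<Rightarrow> rat"
  assumes vs: "vectorspace (class_ring :: rat ring) M"
    and add: "\<And>j x y. j < r \<Longrightarrow> x \<in> carrier M \<Longrightarrow> y \<in> carrier M \<Longrightarrow> e j (x \<oplus>\<^bsub>M\<^esub> y) = e j x + e j y"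
    and smult: "\<And>j s x. j < r \<Longrightarrow> x \<in> carrier M \<Longrightarrow> e j (s \<odot>\<^bsub>M\<^esub> x) = s * e j x"
    and inj: "\<And>x y. x \<in> carrier M \<Longrightarrow> y \<in> carrier M \<Longrightarrow> (\<And>j. j < r \<Longrightarrow> e j x = e j y) \<Longrightarrow> x = y"
    and b: "\<And>i. i < r \<Longrightarrow> b i \<in> carrier M"
    and dual: "\<And>i j. i < r \<Longrightarrow> j < r \<Longrightarrow> e j (b i) = (if i = j then 1 else 0)"
  shows "vectorspace.dim (class_ring :: rat ring) M = r"
proof -
  interpret vectorspace "class_ring :: rat ring" M by (rule vs)
  have K: "carrier (class_ring :: rat ring) = UNIV" "\<zero>\<^bsub>(class_ring :: rat ring)\<^esub> = 0"
    by simp_all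
  have e0: "e j \<zero>\<^bsub>M\<^esub> = 0" if "j < r" for j
    using add[OF that, of "\<zero>\<^bsub>M\<^esub>" "\<zero>\<^bsub>M\<^esub>"] by simp
  have elin: "e j (lincomb a A) = (\<Sum>v\<in>A. a v * e j v)" if "finite A" "A \<subseteq> carrier M" "j < r" for a A j
    using that(1,2)
  proof (induction A rule: finite_induct)
    case empty
    then show ?case by (simp add: lincomb_def e0 that(3))
  next
    case (insert v A)
    have m: "a w \<odot>\<^bsub>M\<^esub> w \<in> carrier M" if "w \<in> insert v A" for w
      using insert.prems that by (intro smult_closed) (auto simp: K)
    have "lincomb a (insert v A) = (a v \<odot>\<^bsub>M\<^esub> v) \<oplus>\<^bsub>M\<^esub> lincomb a A"
      unfolding lincomb_def using insert m by (intro M.finsum_insert) auto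
    moreover have "lincomb a A \<in> carrier M"
      unfolding lincomb_def using m by (intro M.finsum_closed) auto
    ultimately show ?case using insert m that(3) by (simp add: add smult)
  qed
  let ?B = "b ` {..<r}"
  have injb: "inj_on b {..<r}"
  proof (rule inj_onI)
    fix i j assume *: "i \<in> {..<r}" "j \<in> {..<r}" "b i = b j"
    then show "i = j" using dual[of i j] dual[of j j] by (auto split: if_splits)
  qed
  have BC: "?B \<subseteq> carrier M" using b by auto
  have coef: "(\<Sum>v\<in>?B. a v * e j v) = a (b j)" if "j < r" for a j
  proof -
    have "(\<Sum>v\<in>?B. a v * e j v) = (\<Sum>i<r. a (b i) * e j (b i))" by (simp add: sum.reindex[OF injb])
    also have "\<dots> = (\<Sum>i<r. if i = j then a (b j) else 0)"
      using that by (intro sum.cong) (auto simp: dual)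
    finally show ?thesis using that by simp
  qed
  have "basis ?B"
    unfolding basis_def
  proof (intro conjI)
    show "\<not> lin_dep ?B"
    proof
      assume "lin_dep ?B"
      then obtain a v where av: "lincomb a ?B = \<zero>\<^bsub>M\<^esub>" "v \<in> ?B" "a v \<noteq> \<zero>\<^bsub>(class_ring :: rat ring)\<^esub>"
        using finite_lin_dep[of ?B] BC by auto
      from av(2) obtain j where j: "j < r" "v = b j" by auto
      have "a (b j) = e j (lincomb a ?B)" using elin[of ?B j a] BC coef j by simp
      with av j show False by (simp add: e0 K)
    qed
    show "gen_set ?B"
    proof -
      have "x \<in> span ?B" if x: "x \<in> carrier M" for x
      proof -
        define a where "a v = e (THE i. i < r \<and> b i = v) x" for v
        have ab: "a (b j) = e j x" if "j < r" for j
        proof -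
          have "(THE i. i < r \<and> b i = b j) = j"
            using that injb by (intro the_equality) (auto simp: inj_on_def)
          then show ?thesis by (simp add: a_def)
        qed
        have "lincomb a ?B \<in> carrier M" using BC by (intro lincomb_closed) (auto simp: K)
        then have "x = lincomb a ?B"
          using x elin[of ?B _ a] BC coef ab by (intro inj) auto
        then show ?thesis unfolding span_def by (auto simp: K)
      qed
      moreover have "span ?B \<subseteq> carrier M" using BC by (rule span_is_subset2)
      ultimately show ?thesis by blast
    qed
    show "?B \<subseteq> carrier M" by (rule BC)
  qed
  then have "dim = card ?B" by (intro dim_basis) auto
  then show ?thesis by (simp add: card_image injb)
qed


section \<open>Duality of cocycles and cycles\<close>

lemma cocycle_pairing_boundary:
  assumes "c \<in> cocycles p X" "singular_relboundary p X {} z"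
  shows "pairing c z = 0"
proof -
  obtain x where x: "singular_chain (Suc p) X x" "chain_boundary (Suc p) x = z"
    using assms(2) by (auto simp: singular_boundary)
  have "coboundary p X c = (\<lambda>_. 0)" using assms(1) by (simp add: cocycles_def)
  then show ?thesis using pairing_coboundary[OF x(1), of c] by (simp add: x(2))
qed

lemma coboundary_pairing_cycle:
  assumes "c \<in> coboundaries p X" "singular_relcycle p X {} z"
  shows "pairing c z = 0"
proof (cases p)
  case 0
  then show ?thesis using assms by (simp add: coboundaries_def)
next
  case (Suc q)
  then obtain b where "c = coboundary q X b" using assms by (auto simp: coboundaries_def)
  with assms(2) show ?thesis by (simp add: Suc singular_cycle pairing_coboundary)
qed

text \<open>Functions obtained by extension along divisibility may be nonzero off the singular
  simplices, where a cochain has to vanish.\<close>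

definition restrict_cochain :: "nat \<Rightarrow> 'a topology \<Rightarrow> 'a cochain \<Rightarrow> 'a cochain" where
  "restrict_cochain p X c = (\<lambda>\<sigma>. if singular_simplex p X \<sigma> then c \<sigma> else 0)"

lemma restrict_cochain_in: "restrict_cochain p X c \<in> singular_cochains p X"
  by (simp add: restrict_cochain_def singular_cochains_def)

lemma pairing_restrict_cochain:
  "singular_chain p X x \<Longrightarrow> pairing (restrict_cochain p X c) x = pairing c x"
  by (intro pairing_cong) (auto simp: restrict_cochain_def singular_chain_def)

text \<open>A cocycle vanishing on all cycles factors through the boundary map, and the induced function
  on boundaries extends to all chains by divisibility of \<open>\<rat>\<close>.\<close>

lemma cocycle_in_coboundariesI:
  assumes c: "c \<in> cocycles p X" and 0: "\<And>z. singular_relcycle p X {} z \<Longrightarrow> pairing c z = 0"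
  shows "c \<in> coboundaries p X"
proof (cases p)
  case 0
  have "c = (\<lambda>_. 0)"
    using c 0 assms(2) by (intro singular_cochain_zeroI[of _ 0 X])
      (auto simp: cocycles_def singular_cycle chain_boundary_def)
  then show ?thesis by (simp add: zero_in_coboundaries)
next
  case (Suc q)
  define B where "B = chain_boundary (Suc q) ` {x. singular_chain (Suc q) X x}"
  \<comment> \<open>The choice of a preimage is harmless: two preimages differ by a cycle, on which
    c vanishes.\<close>
  define \<phi> where "\<phi> b = pairing c (SOME x. singular_chain (Suc q) X x \<and> chain_boundary (Suc q) x = b)" for b
  have phi: "\<phi> (chain_boundary (Suc q) x) = pairing c x" if x: "singular_chain (Suc q) X x" for x
  proof -
    define y where "y = (SOME y. singular_chain (Suc q) X y \<and> chain_boundary (Suc q) y = chain_boundary (Suc q) x)"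
    have y: "singular_chain (Suc q) X y \<and> chain_boundary (Suc q) y = chain_boundary (Suc q) x"
      unfolding y_def by (rule someI[of _ x]) (simp add: x)
    then have "singular_relcycle p X {} (y - x)"
      using x by (simp add: singular_cycle Suc singular_chain_diff chain_boundary_diff)
    then have "pairing c (y - x) = 0" by (rule assms(2))
    then show ?thesis unfolding \<phi>_def y_def[symmetric] by (simp add: pairing_diff)
  qed
  obtain d where d: "\<And>b. b \<in> B \<Longrightarrow> pairing d b = \<phi> b"
  proof (rule additive_extends_to_pairing[of B \<phi>])
    show "0 \<in> B" unfolding B_def by (rule image_eqI[of _ _ 0]) auto
    show "x - y \<in> B" if "x \<in> B" "y \<in> B" for x y
      using that unfolding B_def
      by (auto simp flip: chain_boundary_diff intro!: imageI singular_chain_diff)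
    show "\<phi> (x + y) = \<phi> x + \<phi> y" if "x \<in> B" "y \<in> B" for x y
      using that unfolding B_def
      by (auto simp: phi pairing_add singular_chain_add simp flip: chain_boundary_add)
  qed blast
  let ?d = "restrict_cochain q X d"
  have "(\<lambda>\<sigma>. c \<sigma> - coboundary q X ?d \<sigma>) = (\<lambda>_. 0)"
  proof (rule singular_cochain_zeroI[of _ p X])
    show "(\<lambda>\<sigma>. c \<sigma> - coboundary q X ?d \<sigma>) \<in> singular_cochains p X"
      using c coboundary_in_singular_cochains[of q X ?d]
      by (simp add: Suc cocycles_def singular_cochains_def)
    fix x assume "singular_chain p X x"
    then have x: "singular_chain (Suc q) X x" by (simp add: Suc)
    then have "pairing (coboundary q X ?d) x = pairing d (chain_boundary (Suc q) x)"
      using singular_chain_boundary_alt[OF x] by (simp add: pairing_coboundary pairing_restrict_cochain)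
    also have "\<dots> = pairing c x" using x by (subst d) (auto simp: B_def phi)
    finally show "pairing (\<lambda>\<sigma>. c \<sigma> - coboundary q X ?d \<sigma>) x = 0"
      by (simp add: pairing_diff_left)
  qed
  then have "c = coboundary q X ?d" by (simp add: fun_eq_iff)
  then show ?thesis by (auto simp: Suc coboundaries_def restrict_cochain_in)
qed

text \<open>The universal coefficient theorem, in the only case needed here.\<close>

theorem betti_number_free_homology:
  assumes "homology_group (int p) X \<cong> free_Abelian_group {..<r::nat}"
  shows "betti_number (int p) X = r"
proof -
  obtain f where f: "f \<in> iso (homology_group (int p) X) (free_Abelian_group {..<r})"
    using assms by (auto simp: is_iso_def)
  let ?Z = "singular_relcycle_set p X {}"
  \<comment> \<open>F gives the integral coordinates of the homology class of a cycle.\<close>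
  define F where "F z = f (homologous_rel_set p X {} z)" for z
  have cls: "(\<lambda>z. homologous_rel_set p X {} z) \<in> hom (relcycle_group p X {}) (homology_group (int p) X)"
    using normal.r_coset_hom_Mod[OF normal_subgroup_singular_relboundary_relcycle[of p X "{}"]]
    by (simp add: right_coset_singular_relboundary relative_homology_group_def)
  have Fhom: "F \<in> hom (relcycle_group p X {}) (free_Abelian_group {..<r})"
  proof -
    have "f \<in> hom (homology_group (int p) X) (free_Abelian_group {..<r})" using f by (simp add: iso_def)
    from hom_compose[OF cls this] show ?thesis by (simp add: F_def[abs_def] comp_def)
  qed
  have F_add: "F (x + y) = F x + F y" if "x \<in> ?Z" "y \<in> ?Z" for x y
    using hom_mult[OF Fhom, of x y] that by simp
  have F_keys: "Poly_Mapping.keys (F x) \<subseteq> {..<r}" if "x \<in> ?Z" for x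
    using Fhom that by (auto simp: hom_def Pi_iff)
  have carr: "carrier (homology_group (int p) X) = homologous_rel_set p X {} ` ?Z"
    by (rule carrier_relative_homology_group)
  have bij: "bij_betw f (carrier (homology_group (int p) X)) (carrier (free_Abelian_group {..<r}))"
    using f by (simp add: iso_def)
  have F_boundary: "F x = 0 \<longleftrightarrow> singular_relboundary p X {} x" if x: "x \<in> ?Z" for x
  proof -
    have one: "f (singular_relboundary_set p X {}) = 0"
      using hom_one[of f "homology_group (int p) X" "free_Abelian_group {..<r}"] f by (simp add: iso_def)
    have "singular_relboundary_set p X {} \<in> carrier (homology_group (int p) X)"
      using group.is_monoid[OF group_relative_homology_group, THEN monoid.one_closed, of "int p" X "{}"]
      by simp
    then have "F x = 0 \<longleftrightarrow> homologous_rel_set p X {} x = singular_relboundary_set p X {}"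
      unfolding F_def using one bij x carr by (metis (no_types, lifting) bij_betw_imp_inj_on imageI inj_onD)
    then show ?thesis by (simp add: homologous_rel_set_eq_relboundary)
  qed
  have Z0: "0 \<in> ?Z" and Zdiff: "\<And>x y. x \<in> ?Z \<Longrightarrow> y \<in> ?Z \<Longrightarrow> x - y \<in> ?Z"
    by (auto simp: singular_relcycle_diff)
  have "\<exists>z\<in>?Z. F z = frag_of i" if "i < r" for i
  proof -
    have "frag_of i \<in> carrier (free_Abelian_group {..<r})" using that by simp
    then have "frag_of i \<in> f ` carrier (homology_group (int p) X)"
      by (simp only: bij_betw_imp_surj_on[OF bij])
    then obtain C where "C \<in> carrier (homology_group (int p) X)" "f C = frag_of i" by force
    then show ?thesis unfolding carr F_def by blast
  qed
  then obtain z where z: "\<And>i. i < r \<Longrightarrow> z i \<in> ?Z" "\<And>i. i < r \<Longrightarrow> F (z i) = frag_of i" by metis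
  define \<kappa> where "\<kappa> i x = Poly_Mapping.lookup (F x) i" for i x
  have k_add: "\<kappa> i (x + y) = \<kappa> i x + \<kappa> i y" if "x \<in> ?Z" "y \<in> ?Z" for i x y
    using F_add[OF that] by (simp add: \<kappa>_def lookup_add)
  have kz: "\<kappa> i (z j) = (if i = j then 1 else 0)" if "j < r" for i j
    using z(2)[OF that] by (simp add: \<kappa>_def)
  \<comment> \<open>Every cycle is an integral combination of the z i up to a boundary, and cocycles
    vanish on boundaries.\<close>
  have vanish: "pairing c x = 0"
    if c: "c \<in> cocycles p X" "\<And>i. i < r \<Longrightarrow> pairing c (z i) = 0" and x: "x \<in> ?Z" for c x
  proof -
    define y where "y = (\<Sum>i<r. frag_cmul (\<kappa> i x) (z i))"
    have cm: "frag_cmul (\<kappa> i x) (z i) \<in> ?Z" "\<kappa> j (frag_cmul (\<kappa> i x) (z i)) = \<kappa> i x * \<kappa> j (z i)"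
      if "i < r" for i j
      using additive_frag_cmul[of ?Z "\<kappa> j" "z i" "\<kappa> i x", OF Z0 Zdiff k_add z(1)[OF that]] by auto
    have y: "y \<in> ?Z" and ky: "\<kappa> j y = (\<Sum>i<r. \<kappa> j (frag_cmul (\<kappa> i x) (z i)))" for j
      using additive_sum[of ?Z "\<kappa> j" "{..<r}" "\<lambda>i. frag_cmul (\<kappa> i x) (z i)", OF Z0 Zdiff k_add] cm(1)
      by (auto simp: y_def)
    have "\<kappa> j y = \<kappa> j x" for j
    proof (cases "j < r")
      case True
      have "\<kappa> j y = (\<Sum>i<r. if j = i then \<kappa> i x else 0)"
        unfolding ky by (intro sum.cong) (auto simp: cm kz)
      then show ?thesis using True by simp
    next
      case False
      then have "Poly_Mapping.lookup (F w) j = 0" if "w \<in> ?Z" for w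
        using F_keys[OF that] by (auto simp: in_keys_iff)
      then show ?thesis using x y by (simp add: \<kappa>_def)
    qed
    then have "F y = F x" by (intro poly_mapping_eqI) (simp add: \<kappa>_def)
    moreover have "F (x - y) + F y = F x" using F_add[OF Zdiff[OF x y] y] by simp
    ultimately have "F (x - y) = 0" by simp
    then have "singular_relboundary p X {} (x - y)" using F_boundary[OF Zdiff[OF x y]] by blast
    then have "pairing c (x - y) = 0" by (rule cocycle_pairing_boundary[OF c(1)])
    moreover have "pairing c y = 0"
      unfolding y_def pairing_sum pairing_frag_cmul using c(2) by simp
    ultimately show ?thesis by (simp add: pairing_diff)
  qed
  \<comment> \<open>The i-th coordinate is additive on cycles and extends to all chains by
    divisibility; it is a cocycle because boundaries have coordinates zero.\<close>
  have "\<exists>c\<in>cocycles p X. \<forall>x\<in>?Z. pairing c x = of_int (\<kappa> i x)" for i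
  proof -
    obtain c where c: "\<And>x. x \<in> ?Z \<Longrightarrow> pairing c x = of_int (\<kappa> i x)"
    proof (rule additive_extends_to_pairing[of ?Z "\<lambda>x. of_int (\<kappa> i x)"])
      show "0 \<in> ?Z" by (rule Z0)
      show "x - y \<in> ?Z" if "x \<in> ?Z" "y \<in> ?Z" for x y by (rule Zdiff[OF that])
      show "rat_of_int (\<kappa> i (x + y)) = of_int (\<kappa> i x) + of_int (\<kappa> i y)" if "x \<in> ?Z" "y \<in> ?Z" for x y
        by (simp add: k_add[OF that])
    qed (rule that, blast)
    let ?c = "restrict_cochain p X c"
    have pc: "pairing ?c x = of_int (\<kappa> i x)" if "x \<in> ?Z" for x
      using that c by (simp add: pairing_restrict_cochain singular_cycle)
    have "coboundary p X ?c = (\<lambda>_. 0)"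
    proof (rule singular_cochain_zeroI[OF coboundary_in_singular_cochains])
      fix x assume x: "singular_chain (Suc p) X x"
      then have b: "singular_relboundary p X {} (chain_boundary (Suc p) x)"
        by (auto simp: singular_boundary)
      then have "chain_boundary (Suc p) x \<in> ?Z" by (simp add: singular_relboundary_imp_relcycle)
      moreover from this have "F (chain_boundary (Suc p) x) = 0" using b F_boundary by blast
      ultimately show "pairing (coboundary p X ?c) x = 0"
        using x by (simp add: pairing_coboundary pc \<kappa>_def)
    qed
    then show ?thesis using pc by (intro bexI[of _ ?c]) (auto simp: cocycles_def restrict_cochain_in)
  qed
  then obtain b where b: "\<And>i. b i \<in> cocycles p X" "\<And>i x. x \<in> ?Z \<Longrightarrow> pairing (b i) x = of_int (\<kappa> i x)"
    by metis
  let ?M = "singular_cohomology p X"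
  \<comment> \<open>Independent of the chosen representative, since coboundaries vanish on
    cycles.\<close>
  define e where "e j A = pairing (SOME c. c \<in> A) (z j)" for j and A :: "'a cochain set"
  have e: "e j (cohomology_class p X c) = pairing c (z j)" if "j < r" for j c
  proof -
    have "(SOME c'. c' \<in> cohomology_class p X c) \<in> cohomology_class p X c"
      by (rule someI[of _ c]) (simp add: in_cohomology_class zero_in_coboundaries)
    then have "pairing (\<lambda>\<sigma>. (SOME c'. c' \<in> cohomology_class p X c) \<sigma> - c \<sigma>) (z j) = 0"
      using z(1)[OF that] by (intro coboundary_pairing_cycle[of _ p X]) (auto simp: in_cohomology_class)
    then show ?thesis by (simp add: e_def pairing_diff_left)
  qed
  have bz: "pairing (b i) (z j) = (if i = j then 1 else 0)" if "j < r" for i j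
    using b(2)[OF z(1)[OF that]] kz[OF that] by simp
  have "vectorspace.dim (class_ring :: rat ring) ?M = r"
  proof (rule dim_eq_card_coordinates[OF vectorspace_singular_cohomology, of r p X e "\<lambda>i. cohomology_class p X (b i)"])
    fix x y assume xy: "x \<in> carrier ?M" "y \<in> carrier ?M" and eq: "\<And>j. j < r \<Longrightarrow> e j x = e j y"
    obtain c d where cd: "c \<in> cocycles p X" "d \<in> cocycles p X" "x = cohomology_class p X c" "y = cohomology_class p X d"
      using xy by (auto simp: singular_cohomology_simps)
    have cdc: "(\<lambda>\<sigma>. c \<sigma> - d \<sigma>) \<in> cocycles p X" using cocycles_lin[OF cd(1,2), of 1 "-1"] by simp
    moreover have "pairing (\<lambda>\<sigma>. c \<sigma> - d \<sigma>) w = 0" if "w \<in> ?Z" for w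
      using vanish[OF cdc _ that] eq cd e by (simp add: pairing_diff_left)
    ultimately have "(\<lambda>\<sigma>. c \<sigma> - d \<sigma>) \<in> coboundaries p X"
      by (intro cocycle_in_coboundariesI) auto
    then show "x = y" by (simp add: cd cohomology_class_eq_iff)
  qed (auto simp: singular_cohomology_simps e pairing_add_left pairing_mult_left b bz)
  then show ?thesis by (simp add: betti_number_def)
qed

section \<open>Homology of spaces with an affine paving\<close>

text \<open>An extension by the integers splits: a preimage w of the generator spans a complement of
  the image of A.\<close>

lemma iso_free_Abelian_group_extension:
  assumes AB: "i \<in> hom A B" "inj_on i (carrier A)" and BC: "q \<in> hom B C" "q ` carrier B = carrier C"
    and ex: "\<And>b. b \<in> carrier B \<Longrightarrow> q b = \<one>\<^bsub>C\<^esub> \<longleftrightarrow> b \<in> i ` carrier A"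
    and grp: "comm_group B" "group A" "group C"
    and A: "A \<cong> free_Abelian_group {..<n::nat}" and C: "C \<cong> integer_group"
  shows "B \<cong> free_Abelian_group {..<Suc n}"
proof -
  interpret B: comm_group B by fact
  let ?F = "free_Abelian_group {..<n}" and ?G = "free_Abelian_group {..<Suc n}"
  obtain a where a: "a \<in> iso ?F A"
    using group.iso_sym[OF grp(2) A] by (auto simp: is_iso_def)
  obtain c where c: "c \<in> iso C integer_group" using C by (auto simp: is_iso_def)
  define k where "k b = c (q b)" for b
  have khom: "k \<in> hom B integer_group"
    using hom_compose[OF BC(1), of c integer_group] c by (simp add: iso_def k_def[abs_def] comp_def)
  have k_mult: "k (x \<otimes>\<^bsub>B\<^esub> y) = k x + k y" if "x \<in> carrier B" "y \<in> carrier B" for x y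
    using hom_mult[OF khom that] by simp
  have c1: "c \<one>\<^bsub>C\<^esub> = 0"
    using hom_one[of c C integer_group] c grp(3) by (simp add: iso_def)
  have k0: "k b = 0 \<longleftrightarrow> b \<in> i ` carrier A" if b: "b \<in> carrier B" for b
  proof -
    have "q b \<in> carrier C" "\<one>\<^bsub>C\<^esub> \<in> carrier C"
      using BC b grp(3) by (auto intro: group.is_monoid monoid.one_closed)
    moreover have "inj_on c (carrier C)" using c by (simp add: iso_def bij_betw_def)
    ultimately have "k b = 0 \<longleftrightarrow> q b = \<one>\<^bsub>C\<^esub>"
      using c1 unfolding k_def by (metis inj_onD)
    then show ?thesis using ex[OF b] by simp
  qed
  have "1 \<in> c ` carrier C" using c by (simp add: iso_def bij_betw_def)
  then have "1 \<in> c ` q ` carrier B" by (simp only: BC(2))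
  then obtain w where w: "w \<in> carrier B" "k w = 1" unfolding k_def by fastforce
  have kw: "k (w [^]\<^bsub>B\<^esub> (j::int)) = j" for j
    using hom_int_pow[OF khom _ B.group_axioms, of w j] w by simp
  define u where "u x = i (a x)" for x
  have uhom: "u \<in> hom ?F B" using hom_compose[of a ?F A i B] a AB by (simp add: iso_def u_def[abs_def] comp_def)
  have a_bij: "inj_on a (carrier ?F)" "a ` carrier ?F = carrier A"
    using a by (simp_all add: iso_def bij_betw_def)
  have u_inj: "inj_on u (carrier ?F)"
    using comp_inj_on[of a "carrier ?F" i] a_bij AB(2) by (simp add: u_def[abs_def] comp_def)
  have u_im: "u ` carrier ?F = i ` carrier A"
    unfolding a_bij(2)[symmetric] image_image u_def ..
  have u_mult: "u (x + y) = u x \<otimes>\<^bsub>B\<^esub> u y" if "x \<in> carrier ?F" "y \<in> carrier ?F" for x y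
    using hom_mult[OF uhom that] by simp
  have u_closed: "u x \<in> carrier B" if "x \<in> carrier ?F" for x
    using uhom that by (auto simp: hom_def)
  have ku: "k (u x) = 0" if "x \<in> carrier ?F" for x
    using k0[OF u_closed[OF that]] u_im that by blast
  \<comment> \<open>The free group on n + 1 generators is split into its part on the first n
    generators, sent to the image of A, and its last coordinate, sent to a power of w.\<close>
  define r where "r x = x - frag_cmul (Poly_Mapping.lookup x n) (frag_of n)" for x :: "nat \<Rightarrow>\<^sub>0 int"
  have r_add: "r (x + y) = r x + r y" for x y
    by (simp add: r_def lookup_add frag_cmul_distrib)
  have r_closed: "r x \<in> carrier ?F" if "x \<in> carrier ?G" for x
  proof -
    have "Poly_Mapping.lookup (r x) j = 0" if "\<not> j < n" for j
      using that \<open>x \<in> carrier ?G\<close>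
      by (cases "j = n") (auto simp: r_def lookup_minus in_keys_iff subset_iff)
    then show ?thesis by (auto simp: in_keys_iff)
  qed
  define \<Phi> where "\<Phi> x = u (r x) \<otimes>\<^bsub>B\<^esub> w [^]\<^bsub>B\<^esub> Poly_Mapping.lookup x n" for x
  have Phi_hom: "\<Phi> \<in> hom ?G B"
  proof (rule homI)
    show "\<Phi> x \<in> carrier B" if "x \<in> carrier ?G" for x
      unfolding \<Phi>_def using u_closed[OF r_closed[OF that]] w by simp
    show "\<Phi> (x \<otimes>\<^bsub>?G\<^esub> y) = \<Phi> x \<otimes>\<^bsub>B\<^esub> \<Phi> y" if "x \<in> carrier ?G" "y \<in> carrier ?G" for x y
      using u_closed[OF r_closed[OF that(1)]] u_closed[OF r_closed[OF that(2)]] w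
        u_mult[OF r_closed[OF that(1)] r_closed[OF that(2)]]
      by (simp add: \<Phi>_def r_add lookup_add B.int_pow_mult B.m_ac)
  qed
  have kPhi: "k (\<Phi> x) = Poly_Mapping.lookup x n" if "x \<in> carrier ?G" for x
    using u_closed[OF r_closed[OF that]] w ku[OF r_closed[OF that]] by (simp add: \<Phi>_def k_mult kw)
  have "inj_on \<Phi> (carrier ?G)"
  proof (rule inj_onI)
    fix x y assume xy: "x \<in> carrier ?G" "y \<in> carrier ?G" "\<Phi> x = \<Phi> y"
    then have l: "Poly_Mapping.lookup x n = Poly_Mapping.lookup y n"
      using kPhi by metis
    then have "u (r x) = u (r y)"
      using xy u_closed r_closed w by (simp add: \<Phi>_def)
    then have "r x = r y" using u_inj r_closed xy by (auto dest: inj_onD)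
    then show "x = y" using l by (simp add: r_def)
  qed
  moreover have "\<Phi> ` carrier ?G = carrier B"
  proof
    show "\<Phi> ` carrier ?G \<subseteq> carrier B" using Phi_hom by (auto simp: hom_def)
    show "carrier B \<subseteq> \<Phi> ` carrier ?G"
    proof
      fix b assume b: "b \<in> carrier B"
      let ?b = "b \<otimes>\<^bsub>B\<^esub> w [^]\<^bsub>B\<^esub> (- k b)"
      have "k ?b = 0" using b w by (simp add: k_mult kw)
      then have "?b \<in> u ` carrier ?F" unfolding u_im using k0[of ?b] b w by simp
      then obtain x where x: "x \<in> carrier ?F" "u x = ?b" by force
      then have ln: "Poly_Mapping.lookup x n = 0" by (auto simp: in_keys_iff subset_iff)
      let ?x = "x + frag_cmul (k b) (frag_of n)"
      have "?x \<in> carrier ?G"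
        using x by (auto simp: in_keys_iff lookup_add subset_iff)
      moreover have "\<Phi> ?x = b"
      proof -
        have "r ?x = x" using ln by (simp add: r_def lookup_add)
        then show ?thesis using b w
          by (simp add: \<Phi>_def x(2) lookup_add ln B.m_assoc flip: B.int_pow_mult)
      qed
      ultimately show "b \<in> \<Phi> ` carrier ?G" by (intro image_eqI[of b \<Phi> ?x]) simp_all
    qed
  qed
  ultimately have "\<Phi> \<in> iso ?G B" using Phi_hom by (simp add: iso_def bij_betw_def)
  then have "?G \<cong> B" by (auto simp: is_iso_def)
  then show ?thesis by (rule group.iso_sym[OF group_free_Abelian_group])
qed

lemma trivial_group_free_Abelian_group_0: "G \<cong> free_Abelian_group {..<0::nat} \<Longrightarrow> group G \<Longrightarrow> trivial_group G"
proof -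
  assume *: "G \<cong> free_Abelian_group {..<0::nat}" "group G"
  have "trivial_group (free_Abelian_group {..<0::nat})"
    by (auto simp: trivial_group_def)
  then show ?thesis using isomorphic_group_triviality[OF *(1)] * by simp
qed

text \<open>A Thom isomorphism: passing from the contractible subspace to the pair shifts degrees by
  the codimension k.\<close>

lemma relative_homology_group_Euclidean_pair:
  fixes p :: int and a k :: nat
  defines "G \<equiv> relative_homology_group p (Euclidean_space (a + k)) (topspace (Euclidean_space (a + k)) - topspace (Euclidean_space a))"
  shows "p = int k \<Longrightarrow> G \<cong> integer_group" "p \<noteq> int k \<Longrightarrow> trivial_group G"
proof -
  \<comment> \<open>The closed set is taken to be the whole subspace, so its complement on the left
    is empty and the relative group is an absolute one.\<close>
  have "relative_homology_group (p - int k) (Euclidean_space a) (topspace (Euclidean_space a) - topspace (Euclidean_space a)) \<cong> G"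
    using relative_homology_group_Euclidean_complement_step[of a "topspace (Euclidean_space a)" "p - int k" k]
    by (simp add: G_def)
  then have iso: "homology_group (p - int k) (Euclidean_space a) \<cong> G" by simp
  then have iso': "G \<cong> homology_group (p - int k) (Euclidean_space a)"
    by (rule group.iso_sym[OF group_relative_homology_group])
  {
    assume p: "p = int k"
    have "homology_group 0 (Euclidean_space a) \<cong> integer_group"
      by (intro isomorphic_integer_zeroth_homology_group path_connected_Euclidean_space)
        (use nontrivial_Euclidean_space in auto)
    with iso' show "G \<cong> integer_group" using p iso_trans by force
  }
  {
    assume p: "p \<noteq> int k"
    have "trivial_group (reduced_homology_group (p - int k) (Euclidean_space a))"
      by (rule trivial_reduced_homology_group_contractible_space) simp
    then have "trivial_group (homology_group (p - int k) (Euclidean_space a))"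
      using p by (simp add: un_reduced_homology_group)
    with iso' show "trivial_group G"
      using isomorphic_group_triviality[OF iso'] G_def by simp
  }
qed

text \<open>Excision of U - V, which is closed in the union of U and V, leaves the pair of V and its
  intersection with U; h identifies this with a Euclidean space and the complement of a linear
  subspace of codimension k.\<close>

lemma relative_homology_group_cell:
  fixes X :: "'a topology" and p :: int and a k :: nat
  assumes V: "openin X V" and U: "openin X U"
    and h: "homeomorphic_map (Euclidean_space (a + k)) (subtopology X V) h"
    and cell: "h ` topspace (Euclidean_space a) = V - U"
  defines "G \<equiv> relative_homology_group p (subtopology X (U \<union> V)) U"
  shows "p = int k \<Longrightarrow> G \<cong> integer_group" "p \<noteq> int k \<Longrightarrow> trivial_group G"
proof -
  let ?Y = "subtopology X (U \<union> V)" and ?E = "Euclidean_space (a + k)"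
  have top: "topspace ?Y = U \<union> V" using openin_subset[OF U] openin_subset[OF V] by auto
  have UY: "openin ?Y U" "openin ?Y V" using U V by (auto intro: openin_subtopology_Int2 simp: openin_open_subtopology openin_Un)
  have "closedin ?Y (U - V)"
  proof -
    have "U - V = topspace ?Y - V" using top by auto
    then show ?thesis using UY(2) by (metis closedin_diff closedin_topspace)
  qed
  then have "?Y closure_of (U - V) \<subseteq> ?Y interior_of U"
    using UY(1) by (auto simp: closure_of_closedin interior_of_openin)
  from homology_excision_axiom[OF this, of "U \<union> V" p]
  have "relative_homology_group p (subtopology ?Y (U \<union> V - (U - V))) (U - (U - V)) \<cong>
      relative_homology_group p (subtopology ?Y (U \<union> V)) U"
    by (auto simp: is_iso_def)
  moreover have "subtopology ?Y (U \<union> V - (U - V)) = subtopology X V"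
  proof -
    have "(U \<union> V) \<inter> (U \<union> V - (U - V)) = V" by blast
    then show ?thesis by (simp only: subtopology_subtopology)
  qed
  moreover have "U - (U - V) = U \<inter> V" by blast
  ultimately have "relative_homology_group p (subtopology X V) (U \<inter> V) \<cong> G"
    by (simp add: G_def subtopology_subtopology del: relative_homology_group_restrict)
  moreover have "relative_homology_group p ?E (topspace ?E - topspace (Euclidean_space a)) \<cong>
      relative_homology_group p (subtopology X V) (U \<inter> V)"
  proof -
    have hV: "h ` topspace ?E = V" "inj_on h (topspace ?E)"
      using homeomorphic_imp_surjective_map[OF h] homeomorphic_imp_injective_map[OF h] openin_subset[OF V]
      by (auto simp: inf_absorb2)
    have "topspace (Euclidean_space a) \<subseteq> topspace ?E" by (auto simp: topspace_Euclidean_space)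
    then have "h ` (topspace ?E - topspace (Euclidean_space a)) = h ` topspace ?E - h ` topspace (Euclidean_space a)"
      using hV by (intro inj_on_image_set_diff[of h "topspace ?E"]) auto
    also have "\<dots> = U \<inter> V" unfolding hV cell by blast
    finally show ?thesis
      using homeomorphic_map_relative_homology_iso[OF h, of "topspace ?E - topspace (Euclidean_space a)" "U \<inter> V" p]
      by (auto simp: is_iso_def)
  qed
  ultimately have iso: "relative_homology_group p ?E (topspace ?E - topspace (Euclidean_space a)) \<cong> G"
    using iso_trans by blast
  then have iso': "G \<cong> relative_homology_group p ?E (topspace ?E - topspace (Euclidean_space a))"
    by (rule group.iso_sym[OF group_relative_homology_group])
  show "p = int k \<Longrightarrow> G \<cong> integer_group"
    using relative_homology_group_Euclidean_pair(1) iso' iso_trans by blast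
  show "p \<noteq> int k \<Longrightarrow> trivial_group G"
    using relative_homology_group_Euclidean_pair(2)[of p k a] isomorphic_group_triviality[OF iso'] G_def by simp
qed

text \<open>All cells have even dimension, so the long exact sequences of the filtration break up into
  short ones.\<close>

lemma homology_group_affine_paving:
  fixes X :: "'a topology" and V :: "nat \<Rightarrow> 'a set" and a k :: "nat \<Rightarrow> nat" and p :: int
  assumes V: "\<And>i. i < n \<Longrightarrow> openin X (V i)" and even: "\<And>i. i < n \<Longrightarrow> even (k i)"
    and h: "\<And>i. i < n \<Longrightarrow> homeomorphic_map (Euclidean_space (a i + k i)) (subtopology X (V i)) (h i)"
    and cell: "\<And>i. i < n \<Longrightarrow> h i ` topspace (Euclidean_space (a i)) = V i - (\<Union>j<i. V j)"
  shows "homology_group p (subtopology X (\<Union>i<n. V i)) \<cong> free_Abelian_group {..<card {i. i < n \<and> int (k i) = p}}"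
  using assms
proof (induction n arbitrary: p)
  case 0
  have "carrier (homology_group p (subtopology X {})) = {\<one>\<^bsub>homology_group p (subtopology X {})\<^esub>}"
    using trivial_homology_group_empty[of "subtopology X {}" p] by (simp add: trivial_group_def)
  moreover have "\<one>\<^bsub>homology_group p (subtopology X {})\<^esub> \<otimes>\<^bsub>homology_group p (subtopology X {})\<^esub> \<one>\<^bsub>homology_group p (subtopology X {})\<^esub>
      = \<one>\<^bsub>homology_group p (subtopology X {})\<^esub>"
    by (simp add: group.is_monoid monoid.l_one monoid.one_closed)
  ultimately have "(\<lambda>_. 0) \<in> iso (homology_group p (subtopology X {})) (free_Abelian_group {..<0::nat})"
    by (auto simp: iso_def hom_def bij_betw_def)
  then show ?case by (auto simp: is_iso_def)
next
  case (Suc n)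
  let ?U = "\<Union>i<n. V i" and ?N = "\<lambda>p. card {i. i < n \<and> int (k i) = p}"
  define Y where "Y = subtopology X (?U \<union> V n)"
  have Un: "(\<Union>i<Suc n. V i) = ?U \<union> V n" by (auto simp: less_Suc_eq)
  have U: "openin X ?U" using Suc.prems(1) by (intro openin_Union) auto
  have YU: "subtopology Y ?U = subtopology X ?U"
    by (simp add: Y_def subtopology_subtopology inf_absorb2)
  have IH: "homology_group p (subtopology Y ?U) \<cong> free_Abelian_group {..<?N p}" for p
    unfolding YU using Suc.prems by (intro Suc.IH) auto
  note rel = relative_homology_group_cell[OF Suc.prems(1)[of n] U Suc.prems(3)[of n] Suc.prems(4)[of n], simplified,
      folded Y_def]
  have odd: "trivial_group (homology_group p (subtopology Y ?U))" if "odd p" for p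
  proof -
    have e: "{i. i < n \<and> int (k i) = p} = {}" using Suc.prems(2) that
      by (metis (mono_tags, lifting) Collect_empty_eq even_of_nat less_SucI)
    show ?thesis using IH[of p] unfolding e by (intro trivial_group_free_Abelian_group_0) simp_all
  qed
  let ?i = "\<lambda>p. hom_induced p (subtopology Y ?U) {} Y {} id" and ?j = "\<lambda>p. hom_induced p Y {} Y ?U id"
    and ?d = "\<lambda>p. hom_boundary p Y ?U"
  have ex1: "?j p ` carrier (homology_group p Y) = kernel (relative_homology_group p Y ?U) (homology_group (p - 1) (subtopology Y ?U)) (?d p)" for p
    using homology_exactness_axiom_1[of p Y ?U] by simp
  have ex2: "?d p ` carrier (relative_homology_group p Y ?U) = kernel (homology_group (p - 1) (subtopology Y ?U)) (homology_group (p - 1) Y) (?i (p - 1))" for p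
    using homology_exactness_axiom_2[of p Y ?U] by simp
  have ex3: "?i p ` carrier (homology_group p (subtopology Y ?U)) = kernel (homology_group p Y) (relative_homology_group p Y ?U) (?j p)" for p
    using homology_exactness_axiom_3[of p Y ?U] by simp
  have ghi: "group_hom (homology_group p (subtopology Y ?U)) (homology_group p Y) (?i p)" for p
    by (simp add: group_hom_def group_hom_axioms_def hom_induced_hom)
  have ghd: "group_hom (relative_homology_group p Y ?U) (homology_group (p - 1) (subtopology Y ?U)) (?d p)" for p
    by (simp add: group_hom_def group_hom_axioms_def hom_boundary_hom)
  have ghj: "group_hom (homology_group p Y) (relative_homology_group p Y ?U) (?j p)" for p
    by (simp add: group_hom_def group_hom_axioms_def hom_induced_hom)
  \<comment> \<open>The kernel is the image of the boundary map from degree p + 1. If the relative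
    group there is nontrivial, then p + 1 is the even number k n, so p is odd and the source of the
    inclusion map is trivial.\<close>
  have inj: "inj_on (?i p) (carrier (homology_group p (subtopology Y ?U)))"
  proof -
    have "kernel (homology_group p (subtopology Y ?U)) (homology_group p Y) (?i p) = {\<one>\<^bsub>homology_group p (subtopology Y ?U)\<^esub>}"
    proof (cases "p + 1 = int (k n)")
      case True
      then have "odd p" using Suc.prems(2)[of n] by (metis even_of_nat even_plus_one_iff lessI)
      from odd[OF this] show ?thesis
        by (auto simp: kernel_def trivial_group_def group_hom.hom_one[OF ghi])
    next
      case False
      then have "trivial_group (relative_homology_group (p + 1) Y ?U)" by (rule rel(2))
      then show ?thesis using ex2[of "p + 1"] group_hom.hom_one[OF ghd[of "p + 1"]]
        by (simp add: trivial_group_def)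
    qed
    then show ?thesis by (rule group_hom.trivial_ker_imp_inj[OF ghi])
  qed
  show ?case unfolding Un Y_def[symmetric]
  proof (cases "p = int (k n)")
    case True
    \<comment> \<open>The boundary map out of degree p lands in a trivial group, so the map to the
      relative group is onto.\<close>
    have "odd (p - 1)" using True Suc.prems(2)[of n] by simp
    from odd[OF this] have surj: "?j p ` carrier (homology_group p Y) = carrier (relative_homology_group p Y ?U)"
      using group_hom.hom_closed[OF ghd[of p]] unfolding ex1
      by (auto simp: kernel_def trivial_group_def)
    have "homology_group p Y \<cong> free_Abelian_group {..<Suc (?N p)}"
    proof (rule iso_free_Abelian_group_extension[where i = "?i p" and q = "?j p"])
      show "?i p \<in> hom (homology_group p (subtopology Y ?U)) (homology_group p Y)" "?j p \<in> hom (homology_group p Y) (relative_homology_group p Y ?U)"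
        using ghi ghj by (simp_all add: group_hom_def group_hom_axioms_def)
      show "?j p b = \<one>\<^bsub>relative_homology_group p Y ?U\<^esub> \<longleftrightarrow> b \<in> ?i p ` carrier (homology_group p (subtopology Y ?U))"
        if "b \<in> carrier (homology_group p Y)" for b
        using that unfolding ex3 by (simp add: kernel_def)
      show "relative_homology_group p Y ?U \<cong> integer_group" using rel(1) True by blast
    qed (use inj surj IH in \<open>simp_all add: abelian_homology_group\<close>)
    moreover have "{i. i < Suc n \<and> int (k i) = p} = insert n {i. i < n \<and> int (k i) = p}"
      using True by (auto simp: less_Suc_eq)
    ultimately show "homology_group p Y \<cong> free_Abelian_group {..<card {i. i < Suc n \<and> int (k i) = p}}"
      by simp
  next
    case False
    then have "trivial_group (relative_homology_group p Y ?U)" by (rule rel(2))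
    then have "?i p ` carrier (homology_group p (subtopology Y ?U)) = carrier (homology_group p Y)"
      using group_hom.hom_closed[OF ghj[of p]] unfolding ex3
      by (auto simp: kernel_def trivial_group_def)
    then have "?i p \<in> iso (homology_group p (subtopology Y ?U)) (homology_group p Y)"
      using inj ghi by (auto simp: iso_def bij_betw_def group_hom_def group_hom_axioms_def)
    then have "homology_group p Y \<cong> homology_group p (subtopology Y ?U)"
      by (metis group.iso_sym group_relative_homology_group is_iso_def empty_iff)
    then have "homology_group p Y \<cong> free_Abelian_group {..<?N p}" using IH iso_trans by blast
    moreover have "{i. i < Suc n \<and> int (k i) = p} = {i. i < n \<and> int (k i) = p}"
      using False by (auto simp: less_Suc_eq)
    ultimately show "homology_group p Y \<cong> free_Abelian_group {..<card {i. i < Suc n \<and> int (k i) = p}}"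
      by simp
  qed
qed

section \<open>Trees of words\<close>

definition prefix_closed :: "nat \<Rightarrow> nat list set \<Rightarrow> bool" where
  "prefix_closed m S \<longleftrightarrow> S \<subseteq> lists {..<m} \<and> finite S \<and> (\<forall>w i. w @ [i] \<in> S \<longrightarrow> w \<in> S)"

definition word_trees :: "nat \<Rightarrow> nat \<Rightarrow> nat list set set" where
  "word_trees m d = {S. prefix_closed m S \<and> card S = d}"

text \<open>The leaves when S is read as the set of inner nodes of a full m-ary tree; for empty S
  the root is the only leaf.\<close>

definition boundary :: "nat \<Rightarrow> nat list set \<Rightarrow> nat list set" where
  "boundary m S = {w \<in> lists {..<m}. w \<notin> S \<and> (w = [] \<or> butlast w \<in> S)}"

text \<open>Each pair is a complex coordinate of the chart of S that vanishes on the cell of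
  S.\<close>

definition cell_codim :: "nat \<Rightarrow> nat list set \<Rightarrow> nat" where
  "cell_codim m S = card {(w, w'). w \<in> boundary m S \<and> w' \<in> S \<and> w < w'}"

section \<open>Prefix-closed sets and the comparison of trees\<close>

lemma less_append_left_iff: "xs @ ys < xs @ zs \<longleftrightarrow> ys < (zs :: 'a::linorder list)"
  by (induction xs) auto

lemma less_snoc: "w < w @ [i]" for w :: "'a::linorder list"
  using less_append_left_iff[of w "[]" "[i]"] by simp

lemma prefix_closed_append: "prefix_closed m S \<Longrightarrow> u @ v \<in> S \<Longrightarrow> u \<in> S"
proof (induction v rule: rev_induct)
  case (snoc i v)
  then have "(u @ v) @ [i] \<in> S" by simp
  then have "u @ v \<in> S" using snoc.prems(1) unfolding prefix_closed_def by blast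
  then show ?case using snoc by blast
qed simp

lemma prefix_closed_length: "prefix_closed m S \<Longrightarrow> w \<in> S \<Longrightarrow> length w < card S"
proof -
  assume S: "prefix_closed m S" and w: "w \<in> S"
  have "inj_on (\<lambda>k. take k w) {..length w}"
    by (intro inj_onI) (metis atMost_iff length_take min.absorb2)
  moreover have "(\<lambda>k. take k w) ` {..length w} \<subseteq> S"
    using prefix_closed_append[OF S] w by (metis append_take_drop_id image_subsetI)
  ultimately have "card {..length w} \<le> card S"
    using S by (metis card_image card_mono prefix_closed_def)
  then show ?thesis by simp
qed

lemma finite_word_trees: "finite (word_trees m d)"
proof -
  have "word_trees m d \<subseteq> Pow {w. set w \<subseteq> {..<m} \<and> length w \<le> d}"
  proof
    fix S assume "S \<in> word_trees m d"
    then have S: "prefix_closed m S" "card S = d" by (simp_all add: word_trees_def)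
    then have "S \<subseteq> lists {..<m}" by (simp add: prefix_closed_def)
    then have "set w \<subseteq> {..<m} \<and> length w \<le> d" if "w \<in> S" for w
      using prefix_closed_length[OF S(1) that] S(2) that by (auto simp: lists_eq_set)
    then show "S \<in> Pow {w. set w \<subseteq> {..<m} \<and> length w \<le> d}" by blast
  qed
  moreover have "finite {w. set w \<subseteq> {..<m} \<and> length w \<le> d}"
    by (rule finite_lists_length_le) simp
  ultimately show ?thesis by (meson finite_Pow_iff finite_subset)
qed

lemma finite_boundary: "finite S \<Longrightarrow> finite (boundary m S)"
proof -
  assume S: "finite S"
  have "boundary m S \<subseteq> insert [] ((\<lambda>(w, i). w @ [i]) ` (S \<times> {..<m}))"
  proof
    fix w assume "w \<in> boundary m S"
    then show "w \<in> insert [] ((\<lambda>(w, i). w @ [i]) ` (S \<times> {..<m}))"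
      by (cases w rule: rev_cases) (auto simp: boundary_def image_iff)
  qed
  then show ?thesis using S by (meson finite.insertI finite_SigmaI finite_imageI finite_lessThan finite_subset)
qed

lemma snoc_in_tree_or_boundary:
  "prefix_closed m S \<Longrightarrow> u \<in> S \<Longrightarrow> i < m \<Longrightarrow> u @ [i] \<in> S \<union> boundary m S"
  by (auto simp: prefix_closed_def boundary_def)

lemma Nil_in_tree_or_boundary: "[] \<in> S \<union> boundary m S"
  by (auto simp: boundary_def)

lemma prefix_closed_insert_boundary:
  "prefix_closed m S \<Longrightarrow> w \<in> boundary m S \<Longrightarrow> prefix_closed m (insert w S)"
  by (auto simp: prefix_closed_def boundary_def)

text \<open>The lists share the part below z, and then A continues with z. Equal cardinality ensures
  that B still has an element beyond z; otherwise its list would be a proper prefix of that of A and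
  would come first.\<close>

lemma sorted_list_of_set_less:
  fixes A B :: "'a::linorder set"
  assumes fin: "finite A" "finite B" and card: "card A = card B"
    and z: "z \<in> A" "z \<notin> B" and eq: "\<And>u. u < z \<Longrightarrow> u \<in> A \<longleftrightarrow> u \<in> B"
  shows "sorted_list_of_set A < sorted_list_of_set B"
proof -
  let ?P = "{u \<in> A. u < z}"
  have PB: "?P = {u \<in> B. u < z}" using eq by blast
  have split: "sorted_list_of_set C = sorted_list_of_set {u \<in> C. u < z} @ sorted_list_of_set {u \<in> C. z \<le> u}"
    if "finite C" for C :: "'a set"
  proof -
    have C: "finite {u \<in> C. u < z}" "finite {u \<in> C. z \<le> u}" using that by simp_all
    have "sorted (sorted_list_of_set {u \<in> C. u < z} @ sorted_list_of_set {u \<in> C. z \<le> u})"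
      by (simp add: sorted_append C) (meson less_imp_le order_trans)
    moreover have "{u \<in> C. u < z} \<inter> {u \<in> C. z \<le> u} = {}" "{u \<in> C. u < z} \<union> {u \<in> C. z \<le> u} = C"
      using linorder_not_less by blast+
    then have "distinct (sorted_list_of_set {u \<in> C. u < z} @ sorted_list_of_set {u \<in> C. z \<le> u})"
      "set (sorted_list_of_set {u \<in> C. u < z} @ sorted_list_of_set {u \<in> C. z \<le> u}) = C"
      unfolding distinct_append set_append set_sorted_list_of_set[OF C(1)] set_sorted_list_of_set[OF C(2)]
      using distinct_sorted_list_of_set by blast+
    ultimately show ?thesis using that
      by (intro sorted_distinct_set_unique) simp_all
  qed
  have A': "sorted_list_of_set {u \<in> A. z \<le> u} = z # sorted_list_of_set {u \<in> A. z < u}"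
  proof -
    have f: "finite {u \<in> A. z < u}" "finite {u \<in> A. z \<le> u}" using fin by simp_all
    have e: "insert z {u \<in> A. z < u} = {u \<in> A. z \<le> u}"
      using z by (auto simp: le_less)
    show ?thesis
    proof (rule sorted_distinct_set_unique)
      show "sorted (z # sorted_list_of_set {u \<in> A. z < u})" "distinct (z # sorted_list_of_set {u \<in> A. z < u})"
        using set_sorted_list_of_set[OF f(1)] by (simp_all add: less_imp_le)
      show "set (sorted_list_of_set {u \<in> A. z \<le> u}) = set (z # sorted_list_of_set {u \<in> A. z < u})"
        by (simp only: list.set set_sorted_list_of_set[OF f(1)] set_sorted_list_of_set[OF f(2)] e)
    qed (rule sorted_sorted_list_of_set distinct_sorted_list_of_set)+
  qed
  have "card ?P < card A"
    using fin z by (intro psubset_card_mono) auto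
  have "{u \<in> B. z \<le> u} \<noteq> {}"
  proof
    assume "{u \<in> B. z \<le> u} = {}"
    then have "B = {u \<in> B. u < z}" using linorder_not_less by blast
    then show False using \<open>card ?P < card A\<close> card PB by simp
  qed
  moreover have fB: "finite {u \<in> B. z \<le> u}" using fin by simp
  ultimately have "sorted_list_of_set {u \<in> B. z \<le> u} \<noteq> []"
    using sorted_list_of_set_eq_Nil_iff by blast
  then obtain y ys where y: "sorted_list_of_set {u \<in> B. z \<le> u} = y # ys"
    by (meson neq_Nil_conv)
  then have "y \<in> {u \<in> B. z \<le> u}" using set_sorted_list_of_set[OF fB] by (metis list.set_intros(1))
  then have "z < y" using z by (auto simp: le_less)
  then show ?thesis
    unfolding split[OF fin(1)] split[OF fin(2)] A' y PB[symmetric] less_append_left_iff by simp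
qed

lemma symmetric_difference_minimum:
  fixes A B :: "'a::linorder set"
  assumes "finite A" "finite B" "A \<noteq> B"
  obtains z where "z \<in> A \<longleftrightarrow> z \<notin> B" "\<And>u. u < z \<Longrightarrow> u \<in> A \<longleftrightarrow> u \<in> B"
proof -
  let ?D = "(A - B) \<union> (B - A)"
  have D: "finite ?D" "?D \<noteq> {}" using assms by auto
  have "Min ?D \<in> ?D" using D by (rule Min_in)
  moreover have "u \<notin> ?D" if "u < Min ?D" for u
    using D that by (meson Min_le linorder_not_less)
  ultimately show ?thesis using that[of "Min ?D"] by blast
qed

section \<open>Vectors attached to words\<close>

definition word_eval :: "complex vec \<times> complex mat list \<Rightarrow> nat list \<Rightarrow> complex vec" where
  "word_eval x w = foldl (\<lambda>v i. (snd x ! i) *\<^sub>v v) (fst x) w"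

lemma word_eval_Nil [simp]: "word_eval x [] = fst x"
  by (simp add: word_eval_def)

text \<open>Letters act from left to right, so appending a letter applies one more matrix.
  Prefix-closed sets are thus the families of vectors that can be built step by step from f.\<close>

lemma word_eval_snoc [simp]: "word_eval x (w @ [i]) = (snd x ! i) *\<^sub>v word_eval x w"
  by (simp add: word_eval_def)

lemma rep_space_iff:
  "x \<in> rep_space m d \<longleftrightarrow> fst x \<in> carrier_vec d \<and> length (snd x) = m \<and> (\<forall>i<m. snd x ! i \<in> carrier_mat d d)"
  by (cases x) (auto simp: rep_space_def set_conv_nth)

lemma word_eval_carrier:
  assumes "x \<in> rep_space m d" "w \<in> lists {..<m}"
  shows "word_eval x w \<in> carrier_vec d"
  using assms(2)
proof (induction w rule: rev_induct)
  case Nil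
  then show ?case using assms(1) by (simp add: rep_space_iff)
next
  case (snoc i w)
  then have "snd x ! i \<in> carrier_mat d d" "word_eval x w \<in> carrier_vec d" using assms(1) by (auto simp: rep_space_iff)
  then show ?case by simp
qed

definition frame :: "nat list set \<Rightarrow> complex vec \<times> complex mat list \<Rightarrow> complex mat" where
  "frame S x = (let d = card S in mat d d (\<lambda>(i, j). vec_index (word_eval x (sorted_list_of_set S ! j)) i))"

definition chart_domain :: "nat \<Rightarrow> nat list set \<Rightarrow> (complex vec \<times> complex mat list) set" where
  "chart_domain m S = {x \<in> rep_space m (card S). det (frame S x) \<noteq> 0}"

text \<open>Indexed by words instead of vectors, so that two words with the same vector count as
  dependent.\<close>

definition free_family :: "nat \<Rightarrow> complex vec \<times> complex mat list \<Rightarrow> nat list set \<Rightarrow> bool" where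
  "free_family d x S \<longleftrightarrow> (\<forall>c. (\<forall>i<d. (\<Sum>w\<in>S. c w * vec_index (word_eval x w) i) = 0) \<longrightarrow> (\<forall>w\<in>S. c w = 0))"

lemma frame_carrier [simp]: "frame S x \<in> carrier_mat (card S) (card S)"
  by (simp add: frame_def Let_def)

lemma sum_nth_sorted_list_of_set:
  fixes S :: "'a::linorder set"
  assumes "finite S"
  shows "(\<Sum>w\<in>S. g w) = (\<Sum>j<card S. g (sorted_list_of_set S ! j))"
proof -
  have "bij_betw (\<lambda>j. sorted_list_of_set S ! j) {..<card S} S"
    using bij_betw_nth[of "sorted_list_of_set S" "{..<card S}" S] assms by simp
  then show ?thesis by (intro sum.reindex_bij_betw[symmetric])
qed

lemma frame_mult_vec:
  assumes "finite S" "i < card S" "v \<in> carrier_vec (card S)"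
  shows "vec_index (frame S x *\<^sub>v v) i = (\<Sum>j<card S. vec_index v j * vec_index (word_eval x (sorted_list_of_set S ! j)) i)"
  using assms by (simp add: frame_def Let_def scalar_prod_def atLeast0LessThan mult.commute)

lemma free_family_iff_det:
  assumes S: "finite S" "card S = d"
  shows "free_family d x S \<longleftrightarrow> det (frame S x) \<noteq> 0"
proof -
  define ws where "ws = sorted_list_of_set S"
  have ws: "distinct ws" "set ws = S" "length ws = d" using S by (simp_all add: ws_def)
  have "(\<exists>v. v \<in> carrier_vec d \<and> v \<noteq> 0\<^sub>v d \<and> frame S x *\<^sub>v v = 0\<^sub>v d) \<longleftrightarrow> \<not> free_family d x S"
  proof
    assume "\<exists>v. v \<in> carrier_vec d \<and> v \<noteq> 0\<^sub>v d \<and> frame S x *\<^sub>v v = 0\<^sub>v d"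
    then obtain v where v: "v \<in> carrier_vec d" "v \<noteq> 0\<^sub>v d" "frame S x *\<^sub>v v = 0\<^sub>v d" by blast
    define c where "c w = vec_index v (THE j. j < d \<and> ws ! j = w)" for w
    have c: "c (ws ! j) = vec_index v j" if "j < d" for j
    proof -
      have "(THE k. k < d \<and> ws ! k = ws ! j) = j"
        using that ws by (intro the_equality) (auto simp: nth_eq_iff_index_eq)
      then show ?thesis by (simp add: c_def)
    qed
    have "(\<Sum>w\<in>S. c w * vec_index (word_eval x w) i) = 0" if "i < d" for i
    proof -
      have "(\<Sum>w\<in>S. c w * vec_index (word_eval x w) i) = vec_index (frame S x *\<^sub>v v) i"
        using S v(1) that unfolding sum_nth_sorted_list_of_set[OF S(1)]
        by (simp add: frame_mult_vec c[unfolded ws_def])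
      then show ?thesis using v(3) that by simp
    qed
    moreover obtain j where "j < d" "vec_index v j \<noteq> 0"
      using v(1,2) by (metis carrier_vecD eq_vecI index_zero_vec(1) index_zero_vec(2))
    then have "\<exists>w\<in>S. c w \<noteq> 0" using c ws by (metis nth_mem)
    ultimately show "\<not> free_family d x S" unfolding free_family_def by blast
  next
    assume "\<not> free_family d x S"
    then obtain c w where c: "\<And>i. i < d \<Longrightarrow> (\<Sum>w\<in>S. c w * vec_index (word_eval x w) i) = 0" and w: "w \<in> S" "c w \<noteq> 0"
      unfolding free_family_def by blast
    define v where "v = vec d (\<lambda>j. c (ws ! j))"
    have "frame S x *\<^sub>v v = 0\<^sub>v d"
    proof (rule eq_vecI)
      fix i assume "i < dim_vec (0\<^sub>v d :: complex vec)"
      then have i: "i < d" by simp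
      have "vec_index (frame S x *\<^sub>v v) i = (\<Sum>w\<in>S. c w * vec_index (word_eval x w) i)"
        unfolding sum_nth_sorted_list_of_set[OF S(1)] using S i
        by (simp add: frame_mult_vec v_def ws_def)
      then show "vec_index (frame S x *\<^sub>v v) i = vec_index (0\<^sub>v d) i" using c i by simp
    qed (use S in \<open>simp add: frame_def Let_def\<close>)
    moreover have "v \<noteq> 0\<^sub>v d"
    proof -
      obtain j where "j < d" "ws ! j = w" using w ws by (metis in_set_conv_nth)
      then have "vec_index v j \<noteq> 0" using w by (simp add: v_def)
      then show ?thesis using \<open>j < d\<close> by auto
    qed
    moreover have "v \<in> carrier_vec d" by (simp add: v_def)
    ultimately show "\<exists>v. v \<in> carrier_vec d \<and> v \<noteq> 0\<^sub>v d \<and> frame S x *\<^sub>v v = 0\<^sub>v d" by blast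
  qed
  then show ?thesis
    using det_0_iff_vec_prod_zero_field[of "frame S x" d] S by auto
qed

lemma card_free_family_le:
  assumes S: "finite S" and free: "free_family d x S"
  shows "card S \<le> d"
proof (rule ccontr)
  assume "\<not> card S \<le> d"
  define n where "n = card S"
  have n: "d < n" using \<open>\<not> card S \<le> d\<close> by (simp add: n_def)
  \<comment> \<open>Padding by zero rows gives a square matrix; row d exists because d < n, and it
    vanishes, so A is singular.\<close>
  define A where "A = mat n n (\<lambda>(i, j). if i < d then vec_index (word_eval x (sorted_list_of_set S ! j)) i else 0)"
  have A: "A \<in> carrier_mat n n" by (simp add: A_def)
  have "transpose_mat A *\<^sub>v unit_vec n d = 0\<^sub>v n"
    using n by (intro eq_vecI) (auto simp: A_def scalar_prod_def unit_vec_def intro!: sum.neutral)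
  then have "\<exists>v. v \<in> carrier_vec n \<and> v \<noteq> 0\<^sub>v n \<and> transpose_mat A *\<^sub>v v = 0\<^sub>v n"
    using n by (intro exI[of _ "unit_vec n d"]) simp
  then have "det (transpose_mat A) = 0"
    using det_0_iff_vec_prod_zero_field[of "transpose_mat A" n] A by simp
  then have "det A = 0" using det_transpose[OF A] by simp
  then obtain v where v: "v \<in> carrier_vec n" "v \<noteq> 0\<^sub>v n" "A *\<^sub>v v = 0\<^sub>v n"
    using det_0_iff_vec_prod_zero_field[OF A] by blast
  define ws where "ws = sorted_list_of_set S"
  have ws: "distinct ws" "set ws = S" "length ws = n" using S by (simp_all add: ws_def n_def)
  define c where "c w = vec_index v (THE j. j < n \<and> ws ! j = w)" for w
  have c: "c (ws ! j) = vec_index v j" if "j < n" for j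
  proof -
    have "(THE k. k < n \<and> ws ! k = ws ! j) = j"
      using that ws by (intro the_equality) (auto simp: nth_eq_iff_index_eq)
    then show ?thesis by (simp add: c_def)
  qed
  have "(\<Sum>w\<in>S. c w * vec_index (word_eval x w) i) = 0" if "i < d" for i
  proof -
    have "(\<Sum>w\<in>S. c w * vec_index (word_eval x w) i) = vec_index (A *\<^sub>v v) i"
      unfolding sum_nth_sorted_list_of_set[OF S] using v(1) that n
      by (simp add: A_def scalar_prod_def c[unfolded ws_def] n_def[symmetric] atLeast0LessThan mult.commute)
    then show ?thesis using v(3) that n by simp
  qed
  then have "\<forall>w\<in>S. c w = 0" using free unfolding free_family_def by blast
  then have "vec_index v j = 0" if "j < n" for j using c[OF that] ws that by (metis nth_mem)
  then show False using v(1,2) by (metis carrier_vecD eq_vecI index_zero_vec(1) index_zero_vec(2))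
qed

definition word_span :: "nat \<Rightarrow> complex vec \<times> complex mat list \<Rightarrow> nat list set \<Rightarrow> complex vec set" where
  "word_span d x S = {v \<in> carrier_vec d. \<exists>c. \<forall>i<d. vec_index v i = (\<Sum>w\<in>S. c w * vec_index (word_eval x w) i)}"

lemma word_eval_in_span_if_not_free:
  assumes S: "finite S" and free: "free_family d x S" and nfree: "\<not> free_family d x (insert w S)"
    and w: "w \<notin> S" "word_eval x w \<in> carrier_vec d"
  shows "word_eval x w \<in> word_span d x S"
proof -
  obtain c u where c: "\<And>i. i < d \<Longrightarrow> (\<Sum>w\<in>insert w S. c w * vec_index (word_eval x w) i) = 0"
    and u: "u \<in> insert w S" "c u \<noteq> 0"
    using nfree unfolding free_family_def by blast
  have c': "c w * vec_index (word_eval x w) i + (\<Sum>w\<in>S. c w * vec_index (word_eval x w) i) = 0" if "i < d" for i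
    using c[OF that] S w by simp
  have "c w \<noteq> 0"
  proof
    assume "c w = 0"
    then have "\<forall>w\<in>S. c w = 0" using c' free unfolding free_family_def by simp
    then show False using u \<open>c w = 0\<close> by auto
  qed
  have "vec_index (word_eval x w) i = (\<Sum>u\<in>S. (- c u / c w) * vec_index (word_eval x u) i)" if "i < d" for i
  proof -
    have "(\<Sum>u\<in>S. (- c u / c w) * vec_index (word_eval x u) i) = (\<Sum>u\<in>S. c u * vec_index (word_eval x u) i) * (- 1 / c w)"
      unfolding sum_distrib_right by (intro sum.cong) auto
    also have "\<dots> = vec_index (word_eval x w) i"
      using c'[OF that] \<open>c w \<noteq> 0\<close> by (simp add: field_simps) (metis add.commute add_eq_0_iff)
    finally show ?thesis by simp
  qed
  then show ?thesis
    using w(2) unfolding word_span_def by (intro CollectI conjI exI[of _ "\<lambda>u. - c u / c w"]) simp_all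
qed

lemma subspace_module_vec_iff:
  "VectorSpace.subspace (class_ring :: complex ring) U (module_vec TYPE(complex) d) \<longleftrightarrow>
     U \<subseteq> carrier_vec d \<and> 0\<^sub>v d \<in> U \<and> (\<forall>u\<in>U. \<forall>v\<in>U. u + v \<in> U) \<and> (\<forall>c. \<forall>u\<in>U. c \<cdot>\<^sub>v u \<in> U)"
proof -
  interpret vec_space "TYPE(complex)" d .
  have "subspace class_ring U V \<longleftrightarrow> submodule class_ring U V"
    using vectorspace_axioms by (auto simp: subspace_def)
  then show ?thesis
    using module_axioms by (auto simp: submodule_def module_vec_def)
qed

text \<open>A matrix sends the vector of a word of S to that of a word of S or of its boundary,
  hence back into the span. The span is therefore one of the subspaces intersected in the definition
  of stability.\<close>

lemma stable_span_eq_carrier: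
  assumes x: "x \<in> stable_tuples m d" and S: "prefix_closed m S"
    and bd: "\<And>w. w \<in> boundary m S \<Longrightarrow> word_eval x w \<in> word_span d x S"
  shows "word_span d x S = carrier_vec d"
proof -
  have xr: "x \<in> rep_space m d" using x by (auto simp: stable_tuples_def)
  have fin: "finite S" and Sm: "S \<subseteq> lists {..<m}" using S by (simp_all add: prefix_closed_def)
  have ev: "word_eval x w \<in> carrier_vec d" if "w \<in> S" for w
    using word_eval_carrier[OF xr] that Sm by blast
  have base: "word_eval x w \<in> word_span d x S" if "w \<in> S" for w
  proof -
    have "(\<Sum>u\<in>S. (if u = w then 1 else 0) * vec_index (word_eval x u) i) = vec_index (word_eval x w) i" for i
      using that fin by (simp add: if_distrib[where f = "\<lambda>a. a * _"] cong: if_cong)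
    then show ?thesis using ev[OF that] unfolding word_span_def by (auto intro!: exI[of _ "\<lambda>u. if u = w then 1 else 0"])
  qed
  have zero: "0\<^sub>v d \<in> word_span d x S"
    unfolding word_span_def by (auto intro!: exI[of _ "\<lambda>_. 0"])
  have add: "u + v \<in> word_span d x S" if "u \<in> word_span d x S" "v \<in> word_span d x S" for u v
  proof -
    obtain a b where ab: "\<And>i. i < d \<Longrightarrow> vec_index u i = (\<Sum>w\<in>S. a w * vec_index (word_eval x w) i)"
       "\<And>i. i < d \<Longrightarrow> vec_index v i = (\<Sum>w\<in>S. b w * vec_index (word_eval x w) i)"
      "u \<in> carrier_vec d" "v \<in> carrier_vec d"
      using \<open>u \<in> word_span d x S\<close> \<open>v \<in> word_span d x S\<close> unfolding word_span_def by blast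
    then have "\<forall>i<d. vec_index (u + v) i = (\<Sum>w\<in>S. (a w + b w) * vec_index (word_eval x w) i)"
      by (simp add: algebra_simps sum.distrib)
    then show ?thesis using ab(3,4) unfolding word_span_def by (auto intro!: exI[of _ "\<lambda>w. a w + b w"])
  qed
  have smult: "a \<cdot>\<^sub>v u \<in> word_span d x S" if u: "u \<in> word_span d x S" for u a
  proof -
    obtain c where c: "\<And>i. i < d \<Longrightarrow> vec_index u i = (\<Sum>w\<in>S. c w * vec_index (word_eval x w) i)" "u \<in> carrier_vec d"
      using u unfolding word_span_def by blast
    then have "\<forall>i<d. vec_index (a \<cdot>\<^sub>v u) i = (\<Sum>w\<in>S. (a * c w) * vec_index (word_eval x w) i)"
      by (simp add: algebra_simps sum_distrib_left)
    then show ?thesis using c(2) unfolding word_span_def by (auto intro!: exI[of _ "\<lambda>w. a * c w"])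
  qed
  have all: "word_eval x w \<in> word_span d x S" if "w \<in> S \<union> boundary m S" for w
    using that base bd by blast
  have inv: "snd x ! l *\<^sub>v u \<in> word_span d x S" if l: "l < m" and u: "u \<in> word_span d x S" for l u
  proof -
    let ?\<phi> = "snd x ! l"
    have \<phi>: "?\<phi> \<in> carrier_mat d d" using xr l by (simp add: rep_space_iff)
    obtain c where c: "\<And>i. i < d \<Longrightarrow> vec_index u i = (\<Sum>w\<in>S. c w * vec_index (word_eval x w) i)" "u \<in> carrier_vec d"
      using u unfolding word_span_def by blast
    have part: "T \<subseteq> S \<Longrightarrow> vec d (\<lambda>i. \<Sum>w\<in>T. c w * vec_index (word_eval x (w @ [l])) i) \<in> word_span d x S" if "finite T" for T
      using that
    proof (induction T rule: finite_induct)
      case empty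
      have "vec d (\<lambda>i. \<Sum>w\<in>{}. c w * vec_index (word_eval x (w @ [l])) i) = 0\<^sub>v d" by auto
      then show ?case using zero by simp
    next
      case (insert w T)
      have "w @ [l] \<in> lists {..<m}" using insert.prems Sm l by auto
      then have "word_eval x (w @ [l]) \<in> carrier_vec d" by (rule word_eval_carrier[OF xr])
      then have "vec d (\<lambda>i. \<Sum>w\<in>insert w T. c w * vec_index (word_eval x (w @ [l])) i) =
         c w \<cdot>\<^sub>v word_eval x (w @ [l]) + vec d (\<lambda>i. \<Sum>w\<in>T. c w * vec_index (word_eval x (w @ [l])) i)"
        using insert.hyps by (intro eq_vecI) (auto simp del: word_eval_snoc)
      moreover have "word_eval x (w @ [l]) \<in> word_span d x S"
        using insert.prems snoc_in_tree_or_boundary[OF S _ l] by (intro all) auto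
      ultimately show ?case using insert by (simp add: add smult del: word_eval_snoc)
    qed
    have "?\<phi> *\<^sub>v u = vec d (\<lambda>i. \<Sum>w\<in>S. c w * vec_index (word_eval x (w @ [l])) i)"
    proof (rule eq_vecI)
      fix i assume "i < dim_vec (vec d (\<lambda>i. \<Sum>w\<in>S. c w * vec_index (word_eval x (w @ [l])) i))"
      then have i: "i < d" by simp
      have e: "vec_index (word_eval x (w @ [l])) i = (\<Sum>j<d. ?\<phi> $$ (i, j) * vec_index (word_eval x w) j)" if "w \<in> S" for w
        using \<phi> ev[OF that] i by (simp add: scalar_prod_def atLeast0LessThan)
      have "vec_index (?\<phi> *\<^sub>v u) i = (\<Sum>j<d. ?\<phi> $$ (i, j) * (\<Sum>w\<in>S. c w * vec_index (word_eval x w) j))"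
        using \<phi> c i by (simp add: scalar_prod_def atLeast0LessThan)
      also have "\<dots> = (\<Sum>w\<in>S. c w * (\<Sum>j<d. ?\<phi> $$ (i, j) * vec_index (word_eval x w) j))"
        unfolding sum_distrib_left by (subst sum.swap) (intro sum.cong refl, simp)
      also have "\<dots> = (\<Sum>w\<in>S. c w * vec_index (word_eval x (w @ [l])) i)"
        by (intro sum.cong refl) (simp only: e)
      finally show "vec_index (?\<phi> *\<^sub>v u) i = vec_index (vec d (\<lambda>i. \<Sum>w\<in>S. c w * vec_index (word_eval x (w @ [l])) i)) i"
        using i by simp
    qed (use \<phi> in simp)
    then show ?thesis using part[OF fin] by simp
  qed
  have "VectorSpace.subspace class_ring (word_span d x S) (module_vec TYPE(complex) d)"
    unfolding subspace_module_vec_iff using zero add smult by (auto simp: word_span_def)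
  moreover have "fst x \<in> word_span d x S" using all[OF Nil_in_tree_or_boundary] by simp
  moreover have "\<forall>\<phi>\<in>set (snd x). \<forall>u\<in>word_span d x S. \<phi> *\<^sub>v u \<in> word_span d x S"
    using inv xr by (auto simp: rep_space_iff in_set_conv_nth)
  ultimately have "\<Inter>{U. VectorSpace.subspace class_ring U (module_vec TYPE(complex) d) \<and> fst x \<in> U \<and>
          (\<forall>\<phi>\<in>set (snd x). \<forall>u\<in>U. \<phi> *\<^sub>v u \<in> U)} \<subseteq> word_span d x S" by (intro Inter_lower) auto
  moreover have "\<Inter>{U. VectorSpace.subspace class_ring U (module_vec TYPE(complex) d) \<and> fst x \<in> U \<and>
          (\<forall>\<phi>\<in>set (snd x). \<forall>u\<in>U. \<phi> *\<^sub>v u \<in> U)} = carrier_vec d"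
    using x by (auto simp: stable_tuples_def split: prod.splits)
  ultimately show ?thesis by (auto simp: word_span_def)
qed

text \<open>With fewer than d vectors, padding by zero columns gives a singular square matrix,
  whereas expanding the unit vectors in the word vectors would give it a right inverse.\<close>

lemma card_eq_if_spanning:
  assumes S: "finite S" and le: "card S \<le> d" and span: "word_span d x S = carrier_vec d"
  shows "card S = d"
proof (rule ccontr)
  assume "card S \<noteq> d"
  define n where "n = card S"
  have n: "n < d" using le \<open>card S \<noteq> d\<close> by (simp add: n_def)
  define ws where "ws = sorted_list_of_set S"
  define A where "A = mat d d (\<lambda>(i, j). if j < n then vec_index (word_eval x (ws ! j)) i else 0)"
  have A: "A \<in> carrier_mat d d" by (simp add: A_def)
  have "\<exists>c. \<forall>i<d. vec_index (unit_vec d k) i = (\<Sum>w\<in>S. c w * vec_index (word_eval x w) i)" for k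
  proof -
    have "unit_vec d k \<in> word_span d x S" unfolding span by simp
    then show ?thesis unfolding word_span_def by (elim CollectE conjE)
  qed
  then have "\<forall>k. \<exists>c. \<forall>i<d. vec_index (unit_vec d k) i = (\<Sum>w\<in>S. c w * vec_index (word_eval x w) i)" by (intro allI)
  from choice[OF this] obtain c where
    c: "\<And>k i. i < d \<Longrightarrow> vec_index (unit_vec d k) i = (\<Sum>w\<in>S. c k w * vec_index (word_eval x w) i)"
    by auto
  define C where "C = mat d d (\<lambda>(j, k). if j < n then c k (ws ! j) else 0)"
  have C: "C \<in> carrier_mat d d" by (simp add: C_def)
  have "A * C = 1\<^sub>m d"
  proof (rule eq_matI)
    fix i k assume "i < dim_row (1\<^sub>m d :: complex mat)" "k < dim_col (1\<^sub>m d :: complex mat)"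
    then have ik: "i < d" "k < d" by simp_all
    have "(A * C) $$ (i, k) = (\<Sum>j<d. if j < n then vec_index (word_eval x (ws ! j)) i * c k (ws ! j) else 0)"
      using ik unfolding A_def C_def by (simp add: scalar_prod_def atLeast0LessThan if_distrib cong: if_cong)
    also have "\<dots> = (\<Sum>j<n. c k (ws ! j) * vec_index (word_eval x (ws ! j)) i)"
      using n by (intro sum.mono_neutral_cong_right) auto
    also have "\<dots> = vec_index (unit_vec d k) i"
      unfolding c[OF ik(1)] sum_nth_sorted_list_of_set[OF S] by (simp add: n_def ws_def)
    finally show "(A * C) $$ (i, k) = 1\<^sub>m d $$ (i, k)" using ik by (auto simp: unit_vec_def)
  qed (simp_all add: A_def C_def)
  then have "det A * det C = 1" using det_mult[OF A C] by simp
  then have "det A \<noteq> 0" by auto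
  moreover have "A *\<^sub>v unit_vec d n = 0\<^sub>v d"
    using n by (intro eq_vecI) (auto simp: A_def scalar_prod_def unit_vec_def intro!: sum.neutral)
  then have "\<exists>v. v \<in> carrier_vec d \<and> v \<noteq> 0\<^sub>v d \<and> A *\<^sub>v v = 0\<^sub>v d"
    using n by (intro exI[of _ "unit_vec d n"]) simp
  ultimately show False using det_0_iff_vec_prod_zero_field[OF A] by simp
qed

text \<open>A linearly independent tree of maximal size spans an invariant subspace containing \<open>f\<close>.\<close>

lemma extend_free_tree:
  assumes x: "x \<in> stable_tuples m d" and S: "prefix_closed m S" and free: "free_family d x S"
  obtains T where "S \<subseteq> T" "T \<in> word_trees m d" "x \<in> chart_domain m T"
proof -
  have xr: "x \<in> rep_space m d" using x by (auto simp: stable_tuples_def)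
  let ?P = "\<lambda>T. S \<subseteq> T \<and> prefix_closed m T \<and> free_family d x T"
  have bound: "\<forall>T. ?P T \<longrightarrow> card T < Suc d"
    using card_free_family_le[of _ d x] by (simp add: prefix_closed_def less_Suc_eq_le)
  obtain T where T: "?P T" and max: "\<And>T'. ?P T' \<Longrightarrow> card T' \<le> card T"
    using ex_has_greatest_nat[of ?P S card "Suc d"] S free bound by blast
  have fin: "finite T" using T by (simp add: prefix_closed_def)
  have "word_eval x w \<in> word_span d x T" if w: "w \<in> boundary m T" for w
  proof (rule word_eval_in_span_if_not_free)
    have wT: "w \<notin> T" using w by (simp add: boundary_def)
    then show "w \<notin> T" .
    have "prefix_closed m (insert w T)" using T w prefix_closed_insert_boundary by blast
    moreover have "\<not> card (insert w T) \<le> card T" using fin wT by simp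
    ultimately show "\<not> free_family d x (insert w T)" using max[of "insert w T"] T by blast
    show "word_eval x w \<in> carrier_vec d"
      using w by (intro word_eval_carrier[OF xr]) (simp add: boundary_def)
  qed (use T fin in auto)
  then have "word_span d x T = carrier_vec d"
    using T by (intro stable_span_eq_carrier[OF x]) auto
  then have "card T = d" using T fin by (intro card_eq_if_spanning[of T d x] card_free_family_le) auto
  moreover from this have "det (frame T x) \<noteq> 0" using free_family_iff_det[OF fin, of d x] T by blast
  ultimately show ?thesis using that[of T] T xr by (auto simp: word_trees_def chart_domain_def)
qed

section \<open>Charts on the stable locus\<close>

lemma continuous_map_mult_field:
  fixes f g :: "'a \<Rightarrow> 'b::real_normed_field"
  shows "continuous_map X euclidean f \<Longrightarrow> continuous_map X euclidean g \<Longrightarrow> continuous_map X euclidean (\<lambda>x. f x * g x)"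
  by (simp add: continuous_map_atin tendsto_mult)

lemma continuous_map_prod_field:
  fixes f :: "'a \<Rightarrow> 'i \<Rightarrow> 'b::real_normed_field"
  shows "(\<And>i. i \<in> I \<Longrightarrow> continuous_map X euclidean (\<lambda>x. f x i)) \<Longrightarrow> continuous_map X euclidean (\<lambda>x. prod (f x) I)"
  by (simp add: continuous_map_atin tendsto_prod)

lemma continuous_map_divide_field:
  fixes f g :: "'a \<Rightarrow> 'b::real_normed_field"
  shows "continuous_map X euclidean f \<Longrightarrow> continuous_map X euclidean g \<Longrightarrow>
    (\<And>x. x \<in> topspace X \<Longrightarrow> g x \<noteq> 0) \<Longrightarrow> continuous_map X euclidean (\<lambda>x. f x / g x)"
  by (simp add: continuous_map_atin tendsto_divide)

lemma continuous_map_det: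
  fixes A :: "'a \<Rightarrow> complex mat"
  assumes A: "\<And>x. x \<in> topspace X \<Longrightarrow> A x \<in> carrier_mat n n"
    and cont: "\<And>i j. i < n \<Longrightarrow> j < n \<Longrightarrow> continuous_map X euclidean (\<lambda>x. A x $$ (i, j))"
  shows "continuous_map X euclidean (\<lambda>x. det (A x))"
proof -
  have "continuous_map X euclidean (\<lambda>x. \<Sum>p\<in>{p. p permutes {0..<n}}. signof p * (\<Prod>i = 0..<n. A x $$ (i, p i)))"
  proof (intro continuous_map_sum continuous_map_mult_field continuous_map_prod_field)
    show "finite {p. p permutes {0..<n}}" by (rule finite_permutations) simp
    show "continuous_map X euclidean (\<lambda>x. A x $$ (i, p i))" if "p \<in> {p. p permutes {0..<n}}" "i \<in> {0..<n}" for p i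
      using that permutes_in_image[of p "{0..<n}" i] by (intro cont) auto
  qed simp
  then show ?thesis
    by (rule continuous_map_eq) (simp add: det_def'[OF A])
qed

lemma continuous_map_adj_mat:
  fixes A :: "'a \<Rightarrow> complex mat"
  assumes A: "\<And>x. x \<in> topspace X \<Longrightarrow> A x \<in> carrier_mat n n"
    and cont: "\<And>i j. i < n \<Longrightarrow> j < n \<Longrightarrow> continuous_map X euclidean (\<lambda>x. A x $$ (i, j))"
    and ij: "i < n" "j < n"
  shows "continuous_map X euclidean (\<lambda>x. adj_mat (A x) $$ (i, j))"
proof -
  have "continuous_map X euclidean (\<lambda>x. det (mat_delete (A x) j i))"
  proof (rule continuous_map_det[where n = "n - 1"])
    show "mat_delete (A x) j i \<in> carrier_mat (n - 1) (n - 1)" if "x \<in> topspace X" for x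
      using A[OF that] by (rule mat_delete_carrier)
    fix i' j' assume "i' < n - 1" "j' < n - 1"
    then have "continuous_map X euclidean (\<lambda>x. A x $$ (if i' < j then i' else Suc i', if j' < i then j' else Suc j'))"
      by (intro cont) auto
    then show "continuous_map X euclidean (\<lambda>x. mat_delete (A x) j i $$ (i', j'))"
    proof (rule continuous_map_eq)
      fix x assume "x \<in> topspace X"
      then have "dim_row (A x) = n" "dim_col (A x) = n" using A by auto
      then show "A x $$ (if i' < j then i' else Suc i', if j' < i then j' else Suc j') = mat_delete (A x) j i $$ (i', j')"
        using \<open>i' < n - 1\<close> \<open>j' < n - 1\<close> by (simp add: mat_delete_def)
    qed
  qed
  then have "continuous_map X euclidean (\<lambda>x. (-1) ^ (j + i) * det (mat_delete (A x) j i))"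
    by (intro continuous_map_mult_field) auto
  then show ?thesis
  proof (rule continuous_map_eq)
    fix x assume "x \<in> topspace X"
    then have "dim_row (A x) = n" "dim_col (A x) = n" using A by auto
    then show "(-1) ^ (j + i) * det (mat_delete (A x) j i) = adj_mat (A x) $$ (i, j)"
      using ij by (simp add: adj_mat_def cofactor_def)
  qed
qed

text \<open>Cramer's formula, which makes the entries visibly continuous where the determinant is
  nonzero.\<close>

definition inverse_mat :: "complex mat \<Rightarrow> complex mat" where
  "inverse_mat A = (1 / det A) \<cdot>\<^sub>m adj_mat A"

lemma inverse_mat:
  assumes A: "A \<in> carrier_mat n n" and "det A \<noteq> 0"
  shows "inverse_mat A \<in> carrier_mat n n" "A * inverse_mat A = 1\<^sub>m n" "inverse_mat A * A = 1\<^sub>m n"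
proof -
  note adj = adj_mat[OF A]
  show "inverse_mat A \<in> carrier_mat n n" using adj by (simp add: inverse_mat_def)
  show "A * inverse_mat A = 1\<^sub>m n" "inverse_mat A * A = 1\<^sub>m n"
    using adj A assms(2) by (auto simp: inverse_mat_def mult_smult_distrib[OF A adj(1)] mult_smult_assoc_mat[OF adj(1) A] intro!: eq_matI)
qed

section \<open>The topology of the representation space\<close>

lemma topspace_rep_topology [simp]: "topspace (rep_topology m d) = rep_space m d"
  by (simp add: rep_topology_def topspace_pullback_topology)

lemma continuous_map_rep_coords: "continuous_map (rep_topology m d) euclidean (rep_coords m d)"
  using continuous_map_pullback[of euclidean euclidean id "rep_space m d" "rep_coords m d"]
  by (simp add: rep_topology_def)

lemma continuous_map_rep_vec:
  assumes "i < d"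
  shows "continuous_map (rep_topology m d) euclidean (\<lambda>x. vec_index (fst x) i)"
proof -
  have "continuous_on UNIV (\<lambda>p :: (nat \<Rightarrow> complex) \<times> (nat \<Rightarrow> nat \<Rightarrow> nat \<Rightarrow> complex). fst p i)"
    by (intro continuous_intros continuous_on_product_then_coordinatewise)
  then have "continuous_map euclidean euclidean (\<lambda>p :: (nat \<Rightarrow> complex) \<times> (nat \<Rightarrow> nat \<Rightarrow> nat \<Rightarrow> complex). fst p i)" by simp
  from continuous_map_compose[OF continuous_map_rep_coords this] show ?thesis
    by (rule continuous_map_eq) (use assms in \<open>auto simp: rep_coords_def split: prod.splits\<close>)
qed

lemma continuous_map_rep_mat:
  assumes "l < m" "i < d" "j < d"
  shows "continuous_map (rep_topology m d) euclidean (\<lambda>x. (snd x ! l) $$ (i, j))"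
proof -
  have "continuous_on UNIV (\<lambda>p :: (nat \<Rightarrow> complex) \<times> (nat \<Rightarrow> nat \<Rightarrow> nat \<Rightarrow> complex). snd p l i j)"
    by (rule continuous_on_product_then_coordinatewise[OF continuous_on_product_then_coordinatewise[OF
          continuous_on_product_then_coordinatewise[OF continuous_on_snd[OF continuous_on_id]]]])
  then have "continuous_map euclidean euclidean (\<lambda>p :: (nat \<Rightarrow> complex) \<times> (nat \<Rightarrow> nat \<Rightarrow> nat \<Rightarrow> complex). snd p l i j)" by simp
  from continuous_map_compose[OF continuous_map_rep_coords this] show ?thesis
    by (rule continuous_map_eq) (use assms in \<open>auto simp: rep_coords_def split: prod.splits\<close>)
qed

lemma continuous_map_into_rep_topology:
  assumes g: "\<And>x. x \<in> topspace X \<Longrightarrow> g x \<in> rep_space m d"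
    and v: "\<And>i. i < d \<Longrightarrow> continuous_map X euclidean (\<lambda>x. vec_index (fst (g x)) i)"
    and M: "\<And>l i j. l < m \<Longrightarrow> i < d \<Longrightarrow> j < d \<Longrightarrow> continuous_map X euclidean (\<lambda>x. (snd (g x) ! l) $$ (i, j))"
  shows "continuous_map X (rep_topology m d) g"
  unfolding rep_topology_def
proof (rule continuous_map_pullback')
  have 1: "continuous_map X euclidean (\<lambda>x i. if i < d then vec_index (fst (g x)) i else 0)"
    unfolding euclidean_product_topology[symmetric] continuous_map_componentwise_UNIV
    by (auto intro: v continuous_map_eq)
  have 2: "continuous_map X euclidean (\<lambda>x l i j. if l < m \<and> i < d \<and> j < d then (snd (g x) ! l) $$ (i, j) else 0)"
    unfolding euclidean_product_topology[symmetric] continuous_map_componentwise_UNIV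
    by (auto intro: M continuous_map_eq)
  have "rep_coords m d \<circ> g = (\<lambda>x. (\<lambda>i. if i < d then vec_index (fst (g x)) i else 0, \<lambda>l i j. if l < m \<and> i < d \<and> j < d then (snd (g x) ! l) $$ (i, j) else 0))"
    by (simp add: rep_coords_def fun_eq_iff case_prod_beta)
  then show "continuous_map X euclidean (rep_coords m d \<circ> g)"
    using continuous_map_pairedI[OF 1 2] by simp
qed (use g in auto)

lemma continuous_map_word_eval:
  assumes "w \<in> lists {..<m}" "i < d"
  shows "continuous_map (rep_topology m d) euclidean (\<lambda>x. vec_index (word_eval x w) i)"
  using assms
proof (induction w arbitrary: i rule: rev_induct)
  case Nil
  then show ?case by (simp add: continuous_map_rep_vec)
next
  case (snoc l w)
  then have "continuous_map (rep_topology m d) euclidean (\<lambda>x. \<Sum>j<d. (snd x ! l) $$ (i, j) * vec_index (word_eval x w) j)"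
    by (intro continuous_map_sum continuous_map_mult_field continuous_map_rep_mat snoc.IH) auto
  then show ?case
  proof (rule continuous_map_eq)
    fix x assume x: "x \<in> topspace (rep_topology m d)"
    then have "snd x ! l \<in> carrier_mat d d" "word_eval x w \<in> carrier_vec d"
      using snoc.prems word_eval_carrier[of x m d w] by (auto simp: rep_space_iff)
    then show "(\<Sum>j<d. (snd x ! l) $$ (i, j) * vec_index (word_eval x w) j) = vec_index (word_eval x (w @ [l])) i"
      using snoc.prems by (simp add: scalar_prod_def atLeast0LessThan)
  qed
qed

text \<open>The coordinates of the vector of w in the basis given by the words of S; they are
  meaningful on \<open>chart_domain m S\<close>.\<close>

definition chart_vec :: "nat list set \<Rightarrow> complex vec \<times> complex mat list \<Rightarrow> nat list \<Rightarrow> complex vec" where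
  "chart_vec S x w = inverse_mat (frame S x) *\<^sub>v word_eval x w"

definition tree_list :: "nat list set \<Rightarrow> nat list list" where
  "tree_list S = sorted_list_of_set S"

section \<open>Coordinates with respect to a tree\<close>

context
  fixes m d :: nat and S :: "nat list set"
  assumes S: "S \<in> word_trees m d"
begin

lemma tree_facts: "prefix_closed m S" "finite S" "card S = d" "S \<subseteq> lists {..<m}"
  using S by (auto simp: word_trees_def prefix_closed_def)

lemma tree_list: "distinct (tree_list S)" "set (tree_list S) = S" "length (tree_list S) = d"
  using tree_facts by (simp_all add: tree_list_def)

lemma tree_list_in: "j < d \<Longrightarrow> tree_list S ! j \<in> S" using tree_list by (metis nth_mem)

lemma frame_index: "i < d \<Longrightarrow> j < d \<Longrightarrow> frame S x $$ (i, j) = vec_index (word_eval x (tree_list S ! j)) i"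
  using tree_facts by (simp add: frame_def tree_list_def Let_def)

lemma frame_carrier_d: "frame S x \<in> carrier_mat d d"
  using frame_carrier[of S x] tree_facts by simp

lemma tree_list_word: "j < d \<Longrightarrow> tree_list S ! j \<in> lists {..<m}"
  using tree_list_in tree_facts(4) by blast

lemma frame_col:
  assumes x: "x \<in> rep_space m d" and j: "j < d"
  shows "col (frame S x) j = word_eval x (tree_list S ! j)"
proof -
  have F: "dim_row (frame S x) = d" "dim_col (frame S x) = d" using frame_carrier_d[of x] by auto
  have "dim_vec (word_eval x (tree_list S ! j)) = d"
    using word_eval_carrier[OF x tree_list_word[OF j]] by simp
  then show ?thesis using j F by (intro eq_vecI) (simp_all add: frame_index)
qed

lemma chart_domain_rep: "x \<in> chart_domain m S \<Longrightarrow> x \<in> rep_space m d"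
  using tree_facts by (simp add: chart_domain_def)

lemma chart_vec_carrier: "x \<in> chart_domain m S \<Longrightarrow> w \<in> lists {..<m} \<Longrightarrow> chart_vec S x w \<in> carrier_vec d"
  using inverse_mat(1)[OF frame_carrier_d, of x] word_eval_carrier[OF chart_domain_rep]
  by (auto simp: chart_vec_def chart_domain_def)

lemma frame_chart_vec:
  assumes x: "x \<in> chart_domain m S" and w: "w \<in> lists {..<m}"
  shows "frame S x *\<^sub>v chart_vec S x w = word_eval x w"
proof -
  have nz: "det (frame S x) \<noteq> 0" using x by (simp add: chart_domain_def)
  note inv = inverse_mat[OF frame_carrier_d nz]
  have e: "word_eval x w \<in> carrier_vec d" using word_eval_carrier[OF chart_domain_rep[OF x] w] .
  show ?thesis unfolding chart_vec_def
    using e by (simp add: inv(2) flip: assoc_mult_mat_vec[OF frame_carrier_d[of x] inv(1) e])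
qed

lemma chart_vec_unique:
  assumes x: "x \<in> chart_domain m S" and u: "u \<in> carrier_vec d" "frame S x *\<^sub>v u = word_eval x w"
  shows "chart_vec S x w = u"
proof -
  have nz: "det (frame S x) \<noteq> 0" using x by (simp add: chart_domain_def)
  note inv = inverse_mat[OF frame_carrier_d nz]
  show ?thesis unfolding chart_vec_def u(2)[symmetric]
    using u(1) by (simp add: inv(3) flip: assoc_mult_mat_vec[OF inv(1) frame_carrier_d[of x] u(1)])
qed

text \<open>The columns of an invertible frame span the whole space, and they lie in every invariant
  subspace that contains f.\<close>

lemma chart_domain_stable: "chart_domain m S \<subseteq> stable_tuples m d"
proof
  fix x assume x: "x \<in> chart_domain m S"
  note xr = chart_domain_rep[OF x]
  have "v \<in> U" if U: "VectorSpace.subspace class_ring U (module_vec TYPE(complex) d)" "fst x \<in> U"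
      "\<forall>\<phi>\<in>set (snd x). \<forall>u\<in>U. \<phi> *\<^sub>v u \<in> U" and v: "v \<in> carrier_vec d" for U v
  proof -
    note U1 = U(1)[unfolded subspace_module_vec_iff]
    have ev: "word_eval x w \<in> U" if "w \<in> lists {..<m}" for w
      using that
    proof (induction w rule: rev_induct)
      case (snoc i w)
      then have "snd x ! i \<in> set (snd x)" using xr by (auto simp: rep_space_iff)
      then show ?case using snoc U(3) by simp
    qed (simp add: U(2))
    have nz: "det (frame S x) \<noteq> 0" using x by (simp add: chart_domain_def)
    note inv = inverse_mat[OF frame_carrier_d nz]
    define u where "u = inverse_mat (frame S x) *\<^sub>v v"
    have u: "u \<in> carrier_vec d" using inv(1) v by (simp add: u_def)
    have fu: "frame S x *\<^sub>v u = v"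
      using v by (simp add: u_def inv(2) flip: assoc_mult_mat_vec[OF frame_carrier_d[of x] inv(1) v])
    have part: "J \<subseteq> {..<d} \<Longrightarrow> vec d (\<lambda>i. \<Sum>j\<in>J. vec_index u j * vec_index (word_eval x (tree_list S ! j)) i) \<in> U" if "finite J" for J
      using that
    proof (induction J rule: finite_induct)
      case empty
      have "vec d (\<lambda>i. \<Sum>j\<in>{}. vec_index u j * vec_index (word_eval x (tree_list S ! j)) i) = 0\<^sub>v d" by auto
      then show ?case using U1 by simp
    next
      case (insert k J)
      have k: "tree_list S ! k \<in> lists {..<m}" using insert.prems tree_list_in tree_facts by auto
      have "vec d (\<lambda>i. \<Sum>j\<in>insert k J. vec_index u j * vec_index (word_eval x (tree_list S ! j)) i) =
        vec_index u k \<cdot>\<^sub>v word_eval x (tree_list S ! k) + vec d (\<lambda>i. \<Sum>j\<in>J. vec_index u j * vec_index (word_eval x (tree_list S ! j)) i)"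
        using insert.hyps word_eval_carrier[OF xr k] by (intro eq_vecI) auto
      then show ?case using U1 insert ev[OF k] by simp
    qed
    have "v = vec d (\<lambda>i. \<Sum>j<d. vec_index u j * vec_index (word_eval x (tree_list S ! j)) i)"
    proof (rule eq_vecI)
      fix i assume "i < dim_vec (vec d (\<lambda>i. \<Sum>j<d. vec_index u j * vec_index (word_eval x (tree_list S ! j)) i))"
      then have i: "i < d" by simp
      have "vec_index (frame S x *\<^sub>v u) i = (\<Sum>j<d. vec_index u j * vec_index (word_eval x (tree_list S ! j)) i)"
        using frame_mult_vec[of S i u x] tree_facts i u by (simp add: tree_list_def)
      then show "vec_index v i = vec_index (vec d (\<lambda>i. \<Sum>j<d. vec_index u j * vec_index (word_eval x (tree_list S ! j)) i)) i"
        using i fu by simp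
    qed (use v in simp)
    then show ?thesis using part[of "{..<d}"] by simp
  qed
  moreover have "VectorSpace.subspace class_ring (carrier_vec d) (module_vec TYPE(complex) d)"
    unfolding subspace_module_vec_iff by auto
  moreover have "fst x \<in> carrier_vec d" using xr by (simp add: rep_space_iff)
  moreover have "\<forall>\<phi>\<in>set (snd x). \<forall>u\<in>carrier_vec d. \<phi> *\<^sub>v u \<in> carrier_vec d"
  proof (intro ballI)
    fix \<phi> :: "complex mat" and u :: "complex vec" assume "\<phi> \<in> set (snd x)" "u \<in> carrier_vec d"
    moreover from this have "\<phi> \<in> carrier_mat d d" using xr by (auto simp: rep_space_iff in_set_conv_nth)
    ultimately show "\<phi> *\<^sub>v u \<in> carrier_vec d" by simp
  qed
  ultimately have "\<Inter>{U. VectorSpace.subspace class_ring U (module_vec TYPE(complex) d) \<and> fst x \<in> U \<and>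
          (\<forall>\<phi>\<in>set (snd x). \<forall>u\<in>U. \<phi> *\<^sub>v u \<in> U)} = carrier_vec d"
    by (intro equalityI subsetI InterI; blast)
  then show "x \<in> stable_tuples m d" using xr by (auto simp: stable_tuples_def case_prod_beta)
qed

lemma continuous_map_frame:
  assumes "i < d" "j < d"
  shows "continuous_map (rep_topology m d) euclidean (\<lambda>x. frame S x $$ (i, j))"
proof -
  have "tree_list S ! j \<in> lists {..<m}" using tree_list_in assms tree_facts by auto
  from continuous_map_word_eval[OF this assms(1)] show ?thesis by (simp add: frame_index assms)
qed

lemma continuous_map_det_frame: "continuous_map (rep_topology m d) euclidean (\<lambda>x. det (frame S x))"
  by (rule continuous_map_det[where n = d]) (auto simp: frame_carrier_d continuous_map_frame)

lemma openin_chart_domain: "openin (rep_topology m d) (chart_domain m S)"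
proof -
  have "openin (rep_topology m d) {x \<in> topspace (rep_topology m d). det (frame S x) \<in> - {0}}"
    by (rule openin_continuous_map_preimage[OF continuous_map_det_frame]) auto
  then show ?thesis by (simp add: chart_domain_def tree_facts)
qed

text \<open>By Cramer's formula the coordinates are quotients of continuous functions whose
  denominator, the determinant of the frame, does not vanish on the chart.\<close>

lemma continuous_map_chart_vec:
  assumes w: "w \<in> lists {..<m}" and i: "i < d"
  shows "continuous_map (subtopology (rep_topology m d) (chart_domain m S)) euclidean (\<lambda>x. vec_index (chart_vec S x w) i)"
proof -
  let ?X = "subtopology (rep_topology m d) (chart_domain m S)"
  have "continuous_map ?X euclidean (\<lambda>x. (\<Sum>j<d. adj_mat (frame S x) $$ (i, j) * vec_index (word_eval x w) j) / det (frame S x))"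
    using i by (intro continuous_map_divide_field continuous_map_sum continuous_map_mult_field
      continuous_map_from_subtopology continuous_map_adj_mat[where n = d] continuous_map_word_eval
      continuous_map_det_frame continuous_map_frame w)
      (auto simp: chart_domain_def frame_carrier_d)
  then show ?thesis
  proof (rule continuous_map_eq)
    fix x assume "x \<in> topspace ?X"
    then have x: "x \<in> rep_space m d" by auto
    have "word_eval x w \<in> carrier_vec d" using x w by (rule word_eval_carrier)
    moreover have "adj_mat (frame S x) \<in> carrier_mat d d" using adj_mat(1)[OF frame_carrier_d] .
    ultimately show "(\<Sum>j<d. adj_mat (frame S x) $$ (i, j) * vec_index (word_eval x w) j) / det (frame S x) = vec_index (chart_vec S x w) i"
      using i by (simp add: chart_vec_def inverse_mat_def scalar_prod_def atLeast0LessThan sum_divide_distrib)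
  qed
qed

end

section \<open>Orbits of the general linear group\<close>

lemma GL_orbitI:
  "g \<in> carrier_mat d d \<Longrightarrow> h \<in> carrier_mat d d \<Longrightarrow> g * h = 1\<^sub>m d \<Longrightarrow> h * g = 1\<^sub>m d \<Longrightarrow>
    (g *\<^sub>v fst x, map (\<lambda>\<phi>. g * \<phi> * h) (snd x)) \<in> GL_orbit d x"
  unfolding GL_orbit_def by (auto simp: case_prod_beta)

lemma GL_orbitE:
  assumes "y \<in> GL_orbit d x"
  obtains g h where "g \<in> carrier_mat d d" "h \<in> carrier_mat d d" "g * h = 1\<^sub>m d" "h * g = 1\<^sub>m d"
    "y = (g *\<^sub>v fst x, map (\<lambda>\<phi>. g * \<phi> * h) (snd x))"
  using assms unfolding GL_orbit_def by (auto simp: case_prod_beta)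

lemma GL_orbit_rep_space: "x \<in> rep_space m d \<Longrightarrow> y \<in> GL_orbit d x \<Longrightarrow> y \<in> rep_space m d"
  by (auto elim!: GL_orbitE simp: rep_space_iff)

lemma GL_orbit_self: "x \<in> rep_space m d \<Longrightarrow> x \<in> GL_orbit d x"
proof -
  assume x: "x \<in> rep_space m d"
  have "(1\<^sub>m d *\<^sub>v fst x, map (\<lambda>\<phi>. 1\<^sub>m d * \<phi> * 1\<^sub>m d) (snd x)) = x"
  proof (rule prod_eqI)
    show "snd (1\<^sub>m d *\<^sub>v fst x, map (\<lambda>\<phi>. 1\<^sub>m d * \<phi> * 1\<^sub>m d) (snd x)) = snd x"
      using x by (auto simp: rep_space_iff intro!: nth_equalityI)
  qed (use x in \<open>simp add: rep_space_iff\<close>)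
  then show ?thesis using GL_orbitI[of "1\<^sub>m d" d "1\<^sub>m d" x] by simp
qed

lemma GL_orbit_subset: 
  assumes x: "x \<in> rep_space m d" and y: "y \<in> GL_orbit d x"
  shows "GL_orbit d y \<subseteq> GL_orbit d x"
proof
  obtain g h where gh: "g \<in> carrier_mat d d" "h \<in> carrier_mat d d" "g * h = 1\<^sub>m d" "h * g = 1\<^sub>m d"
    "y = (g *\<^sub>v fst x, map (\<lambda>\<phi>. g * \<phi> * h) (snd x))" using y by (rule GL_orbitE)
  fix z assume "z \<in> GL_orbit d y"
  then obtain g' h' where gh': "g' \<in> carrier_mat d d" "h' \<in> carrier_mat d d" "g' * h' = 1\<^sub>m d" "h' * g' = 1\<^sub>m d"
    "z = (g' *\<^sub>v fst y, map (\<lambda>\<phi>. g' * \<phi> * h') (snd y))" by (rule GL_orbitE)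
  note assoc = assoc_mult_mat[where n\<^sub>1 = d and n\<^sub>2 = d and n\<^sub>3 = d and n\<^sub>4 = d]
  have "(g' * g) * (h * h') = g' * ((g * h) * h')" using gh(1,2) gh'(1,2) by (simp add: assoc)
  then have 1: "(g' * g) * (h * h') = 1\<^sub>m d" using gh' by (simp add: gh(3))
  have "(h * h') * (g' * g) = h * ((h' * g') * g)" using gh(1,2) gh'(1,2) by (simp add: assoc)
  then have 2: "(h * h') * (g' * g) = 1\<^sub>m d" using gh by (simp add: gh'(4))
  have "z = ((g' * g) *\<^sub>v fst x, map (\<lambda>\<phi>. (g' * g) * \<phi> * (h * h')) (snd x))"
  proof (rule prod_eqI)
    show "fst z = fst ((g' * g) *\<^sub>v fst x, map (\<lambda>\<phi>. (g' * g) * \<phi> * (h * h')) (snd x))"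
      using gh gh' x by (simp add: rep_space_iff assoc_mult_mat_vec)
    show "snd z = snd ((g' * g) *\<^sub>v fst x, map (\<lambda>\<phi>. (g' * g) * \<phi> * (h * h')) (snd x))"
    proof (rule nth_equalityI)
      fix i assume "i < length (snd z)"
      then have i: "i < length (snd x)" by (simp add: gh' gh)
      define \<phi> where "\<phi> = snd x ! i"
      have \<phi>: "\<phi> \<in> carrier_mat d d" using i x by (simp add: rep_space_iff \<phi>_def)
      have "g' * (g * \<phi> * h) * h' = (g' * g) * \<phi> * (h * h')"
        using gh(1,2) gh'(1,2) \<phi> by (simp add: assoc_mult_mat[where n\<^sub>1 = d and n\<^sub>2 = d and n\<^sub>3 = d and n\<^sub>4 = d])
      then show "snd z ! i = snd ((g' * g) *\<^sub>v fst x, map (\<lambda>\<phi>. (g' * g) * \<phi> * (h * h')) (snd x)) ! i"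
        using i by (simp add: gh gh' \<phi>_def)
    qed (simp add: gh gh')
  qed
  moreover have "g' * g \<in> carrier_mat d d" "h * h' \<in> carrier_mat d d" using gh gh' by simp_all
  ultimately show "z \<in> GL_orbit d x" using GL_orbitI[OF _ _ 1 2, of x] by simp
qed

lemma GL_orbit_sym:
  assumes x: "x \<in> rep_space m d" and y: "y \<in> GL_orbit d x"
  shows "x \<in> GL_orbit d y"
proof -
  obtain g h where gh: "g \<in> carrier_mat d d" "h \<in> carrier_mat d d" "g * h = 1\<^sub>m d" "h * g = 1\<^sub>m d"
    "y = (g *\<^sub>v fst x, map (\<lambda>\<phi>. g * \<phi> * h) (snd x))" using y by (rule GL_orbitE)
  have "(h *\<^sub>v fst y, map (\<lambda>\<phi>. h * \<phi> * g) (snd y)) = x"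
  proof (rule prod_eqI)
    show "fst (h *\<^sub>v fst y, map (\<lambda>\<phi>. h * \<phi> * g) (snd y)) = fst x"
      using gh x by (simp add: rep_space_iff flip: assoc_mult_mat_vec)
    show "snd (h *\<^sub>v fst y, map (\<lambda>\<phi>. h * \<phi> * g) (snd y)) = snd x"
    proof (rule nth_equalityI)
      fix i assume "i < length (snd (h *\<^sub>v fst y, map (\<lambda>\<phi>. h * \<phi> * g) (snd y)))"
      then have i: "i < length (snd x)" by (simp add: gh)
      define \<phi> where "\<phi> = snd x ! i"
      have \<phi>: "\<phi> \<in> carrier_mat d d" using i x by (simp add: rep_space_iff \<phi>_def)
      have "h * (g * \<phi> * h) * g = (h * g) * \<phi> * (h * g)"
        using gh(1,2) \<phi> by (simp add: assoc_mult_mat[where n\<^sub>1 = d and n\<^sub>2 = d and n\<^sub>3 = d and n\<^sub>4 = d])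
      then show "snd (h *\<^sub>v fst y, map (\<lambda>\<phi>. h * \<phi> * g) (snd y)) ! i = snd x ! i"
        using i \<phi> by (simp add: gh flip: \<phi>_def)
    qed (simp add: gh)
  qed
  then show ?thesis using GL_orbitI[OF gh(2,1,4,3), of y] by simp
qed

lemma GL_orbit_eq:
  assumes x: "x \<in> rep_space m d" and y: "y \<in> GL_orbit d x"
  shows "GL_orbit d y = GL_orbit d x"
  using GL_orbit_subset[OF x y] GL_orbit_subset[OF GL_orbit_rep_space[OF x y] GL_orbit_sym[OF x y]] by blast

lemma word_eval_GL:
  assumes x: "x \<in> rep_space m d" and gh: "g \<in> carrier_mat d d" "h \<in> carrier_mat d d" "h * g = 1\<^sub>m d"
    and y: "y = (g *\<^sub>v fst x, map (\<lambda>\<phi>. g * \<phi> * h) (snd x))" and w: "w \<in> lists {..<m}"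
  shows "word_eval y w = g *\<^sub>v word_eval x w"
  using w
proof (induction w rule: rev_induct)
  case Nil
  then show ?case by (simp add: y)
next
  case (snoc i w)
  then have i: "i < m" and w: "w \<in> lists {..<m}" by auto
  define \<phi> where "\<phi> = snd x ! i"
  have \<phi>: "\<phi> \<in> carrier_mat d d" using i x by (simp add: rep_space_iff \<phi>_def)
  have v: "word_eval x w \<in> carrier_vec d" using x w by (rule word_eval_carrier)
  have "(g * \<phi> * h) *\<^sub>v (g *\<^sub>v word_eval x w) = (g * \<phi>) *\<^sub>v ((h * g) *\<^sub>v word_eval x w)"
    using gh(1,2) \<phi> v by (simp add: assoc_mult_mat_vec[where n\<^sub>1 = d and n\<^sub>2 = d and n\<^sub>3 = d])
  also have "\<dots> = g *\<^sub>v (\<phi> *\<^sub>v word_eval x w)" using gh \<phi> v by (simp add: assoc_mult_mat_vec)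
  finally show ?case using snoc w i x by (simp add: y \<phi>_def rep_space_iff)
qed

text \<open>The group element g multiplies the frame and all word vectors from the left, so it
  cancels in the coordinates.\<close>

lemma chart_GL:
  assumes S: "S \<in> word_trees m d" and x: "x \<in> chart_domain m S" and y: "y \<in> GL_orbit d x"
  shows "y \<in> chart_domain m S" "w \<in> lists {..<m} \<Longrightarrow> chart_vec S y w = chart_vec S x w"
proof -
  note xr = chart_domain_rep[OF S x]
  obtain g h where gh: "g \<in> carrier_mat d d" "h \<in> carrier_mat d d" "g * h = 1\<^sub>m d" "h * g = 1\<^sub>m d"
    "y = (g *\<^sub>v fst x, map (\<lambda>\<phi>. g * \<phi> * h) (snd x))" using y by (rule GL_orbitE)
  note ev = word_eval_GL[OF xr gh(1,2,4,5)]
  note yr = GL_orbit_rep_space[OF xr y]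
  have fr: "frame S y = g * frame S x"
  proof (rule mat_col_eqI)
    fix j assume "j < dim_col (g * frame S x)"
    then have j: "j < d" using frame_carrier_d[OF S, of x] by simp
    note wj = tree_list_word[OF S j]
    show "col (frame S y) j = col (g * frame S x) j"
      using frame_col[OF S yr j] frame_col[OF S xr j] ev[OF wj]
      by (simp add: col_mult2[OF gh(1) frame_carrier_d[OF S] j])
  qed (use gh(1) frame_carrier_d[OF S, of x] frame_carrier_d[OF S, of y] in auto)
  have "det g * det h = 1" using det_mult[OF gh(1,2)] gh(3) by simp
  then have "det (frame S y) \<noteq> 0"
    using det_mult[OF gh(1) frame_carrier_d[OF S, of x]] x unfolding fr by (auto simp: chart_domain_def)
  then show yc: "y \<in> chart_domain m S" using yr tree_facts[OF S] by (simp add: chart_domain_def)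
  assume w: "w \<in> lists {..<m}"
  have cv: "chart_vec S x w \<in> carrier_vec d" using chart_vec_carrier[OF S x w] .
  show "chart_vec S y w = chart_vec S x w"
  proof (rule chart_vec_unique[OF S yc cv])
    show "frame S y *\<^sub>v chart_vec S x w = word_eval y w"
      unfolding fr ev[OF w] using frame_chart_vec[OF S x w]
      by (simp add: assoc_mult_mat_vec[OF gh(1) frame_carrier_d[OF S] cv])
  qed
qed

section \<open>The affine paving of the noncommutative Hilbert scheme\<close>

text \<open>The vector prescribed for w in normal form: a basis vector for a word of the tree, free
  parameters for a boundary word.\<close>

definition section_vec :: "nat list set \<Rightarrow> (nat list \<times> nat list \<Rightarrow> complex) \<Rightarrow> nat list \<Rightarrow> complex vec" where
  "section_vec S c w = vec (card S) (\<lambda>j. if w \<in> S then (if tree_list S ! j = w then 1 else 0) else c (w, tree_list S ! j))"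

text \<open>The normal form whose frame is the identity. Column j of the l-th matrix has to be the
  vector of the j-th tree word extended by l; this extension lies in the tree or its boundary, so
  the parameters are subject to no condition.\<close>

definition chart_section :: "nat \<Rightarrow> nat list set \<Rightarrow> (nat list \<times> nat list \<Rightarrow> complex) \<Rightarrow> complex vec \<times> complex mat list" where
  "chart_section m S c = (section_vec S c [],
     map (\<lambda>l. mat (card S) (card S) (\<lambda>(i, j). vec_index (section_vec S c (tree_list S ! j @ [l])) i)) [0..<m])"

text \<open>The coefficient of the tree word w' in the expansion of the vector of w, see
  \<open>chart_coord_expansion\<close>; the description finds the position of w' in
  \<open>tree_list S\<close>.\<close>

definition chart_coord :: "nat list set \<Rightarrow> complex vec \<times> complex mat list \<Rightarrow> nat list \<times> nat list \<Rightarrow> complex" where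
  "chart_coord S x = (\<lambda>(w, w'). vec_index (chart_vec S x w) (THE j. j < card S \<and> tree_list S ! j = w'))"

lemma stable_rep: "stable_tuples m d \<subseteq> rep_space m d"
  by (auto simp: stable_tuples_def)

section \<open>Normal forms and the chart of a tree\<close>

context
  fixes m d :: nat and S :: "nat list set"
  assumes S: "S \<in> word_trees m d"
begin

lemma the_index: "j < d \<Longrightarrow> (THE k. k < card S \<and> tree_list S ! k = tree_list S ! j) = j"
  using tree_list[OF S] tree_facts[OF S] by (intro the_equality) (auto simp: nth_eq_iff_index_eq)

lemma chart_coord_index: "j < d \<Longrightarrow> chart_coord S x (w, tree_list S ! j) = vec_index (chart_vec S x w) j"
  by (simp add: chart_coord_def the_index)

lemma chart_section_rep: "chart_section m S c \<in> rep_space m d"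
  using tree_facts[OF S] by (simp add: chart_section_def rep_space_iff section_vec_def)

lemma section_vec_carrier: "section_vec S c w \<in> carrier_vec d"
  using tree_facts[OF S] by (simp add: section_vec_def)

text \<open>For a word u of the tree the prescribed vector is a unit vector, so the product is a
  column of the matrix.\<close>

lemma section_mat_mult:
  assumes l: "l < m" and u: "u \<in> S"
  shows "snd (chart_section m S c) ! l *\<^sub>v section_vec S c u = section_vec S c (u @ [l])"
proof (rule eq_vecI)
  fix i assume "i < dim_vec (section_vec S c (u @ [l]))"
  then have i: "i < d" using section_vec_carrier[of c "u @ [l]"] by simp
  obtain k where k: "k < d" "tree_list S ! k = u" using u tree_list[OF S] by (metis in_set_conv_nth)
  have eq: "tree_list S ! j = u \<longleftrightarrow> j = k" if "j < d" for j
    using that k tree_list[OF S] by (metis nth_eq_iff_index_eq)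
  have "vec_index (snd (chart_section m S c) ! l *\<^sub>v section_vec S c u) i =
    (\<Sum>j<d. vec_index (section_vec S c (tree_list S ! j @ [l])) i * (if tree_list S ! j = u then 1 else 0))"
    using l i u tree_facts[OF S]
    by (simp add: chart_section_def scalar_prod_def atLeast0LessThan) (simp add: section_vec_def)
  also have "\<dots> = (\<Sum>j<d. if j = k then vec_index (section_vec S c (u @ [l])) i else 0)"
    by (intro sum.cong) (auto simp: eq k)
  also have "\<dots> = vec_index (section_vec S c (u @ [l])) i" using k by simp
  finally show "vec_index (snd (chart_section m S c) ! l *\<^sub>v section_vec S c u) i = vec_index (section_vec S c (u @ [l])) i" .
qed (use l tree_facts[OF S] section_vec_carrier[of c "u @ [l]"] in \<open>auto simp: chart_section_def\<close>)

lemma word_eval_section: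
  assumes "w \<in> S \<union> boundary m S"
  shows "word_eval (chart_section m S c) w = section_vec S c w"
proof -
  have inS: "w \<in> S \<Longrightarrow> word_eval (chart_section m S c) w = section_vec S c w" for w
  proof (induction w rule: rev_induct)
    case Nil
    then show ?case by (simp add: chart_section_def)
  next
    case (snoc l w)
    then have "w \<in> S" "l < m" using tree_facts[OF S] by (auto simp: prefix_closed_def)
    then show ?case using snoc.IH section_mat_mult by simp
  qed
  show ?thesis
  proof (cases "w \<in> S")
    case False
    then have b: "w \<in> boundary m S" using assms by blast
    show ?thesis
    proof (cases w rule: rev_cases)
      case (snoc u l)
      then have "u \<in> S" "l < m" using b by (auto simp: boundary_def)
      then show ?thesis using inS section_mat_mult by (simp add: snoc)
    qed (simp add: chart_section_def)
  qed (rule inS)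
qed

lemma frame_section: "frame S (chart_section m S c) = 1\<^sub>m d"
proof (rule eq_matI)
  fix i j assume "i < dim_row (1\<^sub>m d :: complex mat)" "j < dim_col (1\<^sub>m d :: complex mat)"
  then have ij: "i < d" "j < d" by simp_all
  have "tree_list S ! i = tree_list S ! j \<longleftrightarrow> i = j"
    using ij tree_list[OF S] by (simp add: nth_eq_iff_index_eq)
  then show "frame S (chart_section m S c) $$ (i, j) = 1\<^sub>m d $$ (i, j)"
    using ij tree_list_in[OF S ij(2)] tree_facts[OF S]
    by (simp add: frame_index[OF S] word_eval_section section_vec_def)
qed (use frame_carrier_d[OF S, of "chart_section m S c"] in auto)

lemma chart_section_domain: "chart_section m S c \<in> chart_domain m S"
  using chart_section_rep tree_facts[OF S] by (simp add: chart_domain_def frame_section)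

lemma chart_vec_section:
  assumes "w \<in> S \<union> boundary m S"
  shows "chart_vec S (chart_section m S c) w = section_vec S c w"
  using section_vec_carrier[of c w]
  by (intro chart_vec_unique[OF S chart_section_domain]) (simp_all add: frame_section word_eval_section[OF assms])

lemma chart_coord_section:
  assumes "w \<in> boundary m S" "w' \<in> S"
  shows "chart_coord S (chart_section m S c) (w, w') = c (w, w')"
proof -
  obtain k where k: "k < d" "tree_list S ! k = w'" using assms tree_list[OF S] by (metis in_set_conv_nth)
  have "w \<notin> S" using assms by (simp add: boundary_def)
  then show ?thesis
    using chart_coord_index[OF k(1), of "chart_section m S c" w] k tree_facts[OF S] assms
    by (simp add: chart_vec_section section_vec_def)
qed

text \<open>The frame of x is itself the group element that carries the normal form with the
  coordinates of x to x.\<close>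

lemma orbit_section_chart_coord:
  assumes x: "x \<in> chart_domain m S" and c: "\<And>w w'. w \<in> boundary m S \<Longrightarrow> w' \<in> S \<Longrightarrow> c (w, w') = chart_coord S x (w, w')"
  shows "GL_orbit d (chart_section m S c) = GL_orbit d x"
proof -
  note xr = chart_domain_rep[OF S x]
  define g where "g = frame S x"
  define h where "h = inverse_mat g"
  have nz: "det (frame S x) \<noteq> 0" using x by (simp add: chart_domain_def)
  have g: "g \<in> carrier_mat d d" and h: "h \<in> carrier_mat d d" and gh: "g * h = 1\<^sub>m d" "h * g = 1\<^sub>m d"
    using inverse_mat[OF frame_carrier_d[OF S] nz] frame_carrier_d[OF S] by (simp_all add: g_def h_def)
  have gs: "g *\<^sub>v section_vec S c w = word_eval x w" if w: "w \<in> S \<union> boundary m S" for w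
  proof (cases "w \<in> S")
    case False
    then have b: "w \<in> boundary m S" and wl: "w \<in> lists {..<m}" using w by (auto simp: boundary_def)
    have "section_vec S c w = chart_vec S x w"
    proof (rule eq_vecI)
      fix j assume "j < dim_vec (chart_vec S x w)"
      then have j: "j < d" using chart_vec_carrier[OF S x wl] by simp
      then show "vec_index (section_vec S c w) j = vec_index (chart_vec S x w) j"
        using False tree_facts[OF S] c[OF b tree_list_in[OF S j]] chart_coord_index[OF j]
        by (simp add: section_vec_def)
    qed (use chart_vec_carrier[OF S x wl] section_vec_carrier in auto)
    then show ?thesis using frame_chart_vec[OF S x wl] by (simp add: g_def)
  next
    case True
    then have wl: "w \<in> lists {..<m}" using tree_facts[OF S] by blast
    obtain k where k: "k < d" "tree_list S ! k = w" using True tree_list[OF S] by (metis in_set_conv_nth)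
    have eq: "tree_list S ! j = w \<longleftrightarrow> j = k" if "j < d" for j
      using that k tree_list[OF S] by (metis nth_eq_iff_index_eq)
    have "section_vec S c w = unit_vec d k"
      using True tree_facts[OF S] eq by (intro eq_vecI) (auto simp: section_vec_def unit_vec_def)
    moreover have "g *\<^sub>v unit_vec d k = col g k" using g k by (intro eq_vecI) auto
    ultimately show ?thesis using frame_col[OF S xr k(1)] k by (simp add: g_def)
  qed
  have "x = (g *\<^sub>v fst (chart_section m S c), map (\<lambda>\<phi>. g * \<phi> * h) (snd (chart_section m S c)))"
  proof (rule prod_eqI)
    show "fst x = fst (g *\<^sub>v fst (chart_section m S c), map (\<lambda>\<phi>. g * \<phi> * h) (snd (chart_section m S c)))"
      using gs[OF Nil_in_tree_or_boundary] by (simp add: chart_section_def)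
    show "snd x = snd (g *\<^sub>v fst (chart_section m S c), map (\<lambda>\<phi>. g * \<phi> * h) (snd (chart_section m S c)))"
    proof (rule nth_equalityI)
      fix l assume "l < length (snd x)"
      then have l: "l < m" using xr by (simp add: rep_space_iff)
      define \<phi> where "\<phi> = snd x ! l"
      define \<psi> where "\<psi> = snd (chart_section m S c) ! l"
      have \<phi>: "\<phi> \<in> carrier_mat d d" and \<psi>: "\<psi> \<in> carrier_mat d d"
        using l xr chart_section_rep[of c] by (simp_all add: rep_space_iff \<phi>_def \<psi>_def)
      \<comment> \<open>Compared column by column: both sides give the vector of the j-th tree word
        extended by l.\<close>
      have "g * \<psi> = \<phi> * g"
      proof (rule mat_col_eqI)
        fix j assume "j < dim_col (\<phi> * g)"
        then have j: "j < d" using g by simp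
        have "col \<psi> j = section_vec S c (tree_list S ! j @ [l])"
          using l j tree_facts[OF S] section_vec_carrier[of c "tree_list S ! j @ [l]"]
          by (intro eq_vecI) (auto simp: \<psi>_def chart_section_def)
        then have "col (g * \<psi>) j = word_eval x (tree_list S ! j @ [l])"
          using gs[OF snoc_in_tree_or_boundary[OF tree_facts(1)[OF S] tree_list_in[OF S j] l]]
          by (simp add: col_mult2[OF g \<psi> j] del: word_eval_snoc)
        also have "\<dots> = col (\<phi> * g) j"
          using frame_col[OF S xr j] col_mult2[OF \<phi> g j] by (simp add: \<phi>_def g_def)
        finally show "col (g * \<psi>) j = col (\<phi> * g) j" .
      qed (use g \<phi> \<psi> in auto)
      then have "g * \<psi> * h = \<phi> * (g * h)" using assoc_mult_mat[OF \<phi> g h] by simp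
      then have "\<phi> = g * \<psi> * h" using \<phi> gh by simp
      then show "snd x ! l = snd (g *\<^sub>v fst (chart_section m S c), map (\<lambda>\<phi>. g * \<phi> * h) (snd (chart_section m S c))) ! l"
        using l by (simp add: \<phi>_def \<psi>_def chart_section_def)
    qed (use xr in \<open>simp add: chart_section_def rep_space_iff\<close>)
  qed
  then have "x \<in> GL_orbit d (chart_section m S c)" using GL_orbitI[OF g h gh] by metis
  then show ?thesis using GL_orbit_eq[OF chart_section_rep] by metis
qed

text \<open>Chart domains are saturated by \<open>chart_GL\<close>, so membership can be tested on
  any point of the orbit.\<close>

lemma orbit_in_chart_iff:
  assumes "x \<in> rep_space m d"
  shows "GL_orbit d x \<in> GL_orbit d ` chart_domain m S \<longleftrightarrow> x \<in> chart_domain m S"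
proof
  assume "GL_orbit d x \<in> GL_orbit d ` chart_domain m S"
  then obtain y where y: "y \<in> chart_domain m S" "GL_orbit d x = GL_orbit d y" by blast
  then have "x \<in> GL_orbit d y" using GL_orbit_self[OF assms] by simp
  then show "x \<in> chart_domain m S" using chart_GL(1)[OF S y(1)] by blast
qed blast

lemma openin_chart:
  shows "openin (nc_hilbert m d) (GL_orbit d ` chart_domain m S)"
proof -
  let ?T = "subtopology (rep_topology m d) (stable_tuples m d)"
  have top: "topspace ?T = stable_tuples m d" using stable_rep[of m d] by auto
  have "{x \<in> topspace ?T. GL_orbit d x \<in> GL_orbit d ` chart_domain m S} = chart_domain m S"
    unfolding top using orbit_in_chart_iff chart_domain_stable[OF S] stable_rep[of m d] by auto
  moreover have "openin ?T (chart_domain m S)"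
    using openin_chart_domain[OF S] chart_domain_stable[OF S] by (metis inf.absorb1 openin_subtopology)
  ultimately show ?thesis
    unfolding nc_hilbert_def openin_quotient_topology top using chart_domain_stable[OF S] by auto
qed

text \<open>A quotient map restricts to a quotient map over an open set; hence continuity on the
  chart can be tested before passing to orbits.\<close>

lemma quotient_map_chart:
  "quotient_map (subtopology (rep_topology m d) (chart_domain m S))
     (subtopology (nc_hilbert m d) (GL_orbit d ` chart_domain m S)) (GL_orbit d)"
proof -
  let ?T = "subtopology (rep_topology m d) (stable_tuples m d)"
  have top: "topspace ?T = stable_tuples m d" using stable_rep[of m d] by auto
  have "{x \<in> topspace ?T. GL_orbit d x \<in> GL_orbit d ` chart_domain m S} = chart_domain m S"
    unfolding top using orbit_in_chart_iff chart_domain_stable[OF S] stable_rep[of m d] by auto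
  from quotient_map_restriction[OF quotient_map_quotient_topology[of ?T "GL_orbit d"] this]
  show ?thesis
    using openin_chart chart_domain_stable[OF S] by (simp add: nc_hilbert_def subtopology_subtopology inf_absorb2)
qed

text \<open>Normal forms give a continuous parametrisation by all coordinates, and the coordinates
  of an orbit give its inverse. The cell is cut out by some of the coordinates, that is, by a linear
  subspace.\<close>

lemma nc_hilbert_chart:
  obtains a h where
    "homeomorphic_map (Euclidean_space (a + 2 * cell_codim m S)) (subtopology (nc_hilbert m d) (GL_orbit d ` chart_domain m S)) h"
    "h ` topspace (Euclidean_space a) =
      GL_orbit d ` {x \<in> chart_domain m S. \<forall>w\<in>boundary m S. \<forall>w'\<in>S. w < w' \<longrightarrow> chart_coord S x (w, w') = 0}"
proof -
  let ?V = "GL_orbit d ` chart_domain m S"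
  let ?Q = "subtopology (nc_hilbert m d) ?V"
  have finS: "finite S" using tree_facts[OF S] by simp
  define I0 where "I0 = {(w, w'). w \<in> boundary m S \<and> w' \<in> S \<and> \<not> w < w'}"
  define I1 where "I1 = {(w, w'). w \<in> boundary m S \<and> w' \<in> S \<and> w < w'}"
  have I: "I0 \<union> I1 = boundary m S \<times> S" "I0 \<inter> I1 = {}" by (auto simp: I0_def I1_def)
  have "finite (boundary m S \<times> S)" using finS finite_boundary by blast
  then have "finite I0" "finite I1" using I(1) by (metis finite_Un)+
  then obtain l0 l1 where l0: "set l0 = I0" "distinct l0" and l1: "set l1 = I1" "distinct l1"
    by (meson finite_distinct_list)
  have len1: "length l1 = cell_codim m S" using l1 distinct_card[OF l1(2)] by (simp add: cell_codim_def I1_def)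
  \<comment> \<open>The coordinates that vanish on the cell come last, because the points of
    \<open>Euclidean_space a\<close> are those whose entries from a on are zero.\<close>
  define ps where "ps = l0 @ l1"
  have ps: "distinct ps" "set ps = boundary m S \<times> S" using l0 l1 I by (simp_all add: ps_def)
  define n where "n = length ps"
  define a where "a = 2 * length l0"
  have an: "a + 2 * cell_codim m S = 2 * n" by (simp add: a_def n_def ps_def len1)
  define pos where "pos p = (THE k. k < n \<and> ps ! k = p)" for p
  have pos: "pos (ps ! k) = k" if "k < n" for k
    unfolding pos_def using that ps(1) by (intro the_equality) (auto simp: n_def nth_eq_iff_index_eq)
  have pos': "pos p < n \<and> ps ! pos p = p" if "p \<in> boundary m S \<times> S" for p
    using that pos unfolding ps(2)[symmetric] n_def by (metis in_set_conv_nth)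
  \<comment> \<open>Real and imaginary part of the k-th coordinate occupy the positions 2k and 2k +
    1.\<close>
  define enc where "enc q = (\<lambda>i. if i < 2 * n then (if even i then Re (q (ps ! (i div 2))) else Im (q (ps ! (i div 2)))) else 0)"
    for q :: "nat list \<times> nat list \<Rightarrow> complex"
  define dec where "dec v p = Complex (v (2 * pos p)) (v (2 * pos p + 1))" for v :: "nat \<Rightarrow> real" and p
  let ?E = "Euclidean_space (2 * n)"
  have enc_top: "enc q \<in> topspace ?E" for q by (simp add: enc_def topspace_Euclidean_space)
  have dec_enc: "dec (enc q) p = q p" if "p \<in> boundary m S \<times> S" for q p
    using pos'[OF that] by (simp add: dec_def enc_def complex_eq_iff)
  have enc_dec: "enc q = v" if v: "v \<in> topspace ?E" and q: "\<And>p. p \<in> boundary m S \<times> S \<Longrightarrow> q p = dec v p" for q v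
  proof
    fix i
    show "enc q i = v i"
    proof (cases "i < 2 * n")
      case True
      then have k: "i div 2 < n" by simp
      then have "ps ! (i div 2) \<in> boundary m S \<times> S" using ps(2) by (metis n_def nth_mem)
      then have "q (ps ! (i div 2)) = Complex (v (2 * (i div 2))) (v (2 * (i div 2) + 1))"
        by (simp add: q dec_def pos k)
      then show ?thesis using True by (auto simp: enc_def odd_two_times_div_two_succ)
    next
      case False
      then show ?thesis using v by (simp add: enc_def topspace_Euclidean_space)
    qed
  qed
  define h where "h v = GL_orbit d (chart_section m S (dec v))" for v
  \<comment> \<open>Any representative of the orbit gives the same value, because coordinates are
    invariant.\<close>
  define k where "k U = enc (chart_coord S (SOME x. x \<in> U))" for U
  have inv: "chart_coord S y p = chart_coord S x p"
    if "x \<in> chart_domain m S" "y \<in> GL_orbit d x" "p \<in> boundary m S \<times> S" for x y p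
  proof -
    obtain w w' where p: "p = (w, w')" "w \<in> boundary m S" using \<open>p \<in> boundary m S \<times> S\<close> by blast
    then have "w \<in> lists {..<m}" unfolding boundary_def by blast
    from chart_GL(2)[OF S \<open>x \<in> chart_domain m S\<close> \<open>y \<in> GL_orbit d x\<close> this] show ?thesis by (simp add: chart_coord_def p)
  qed
  have enc_cong: "enc q = enc q'" if "\<And>p. p \<in> boundary m S \<times> S \<Longrightarrow> q p = q' p" for q q'
    using enc_dec[OF enc_top[of q'], of q] dec_enc that by simp
  have k: "k (GL_orbit d x) = enc (chart_coord S x)" if x: "x \<in> chart_domain m S" for x
  proof -
    have "(SOME y. y \<in> GL_orbit d x) \<in> GL_orbit d x"
      by (rule someI[of _ x]) (rule GL_orbit_self[OF chart_domain_rep[OF S x]])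
    then show ?thesis unfolding k_def using inv[OF x] by (intro enc_cong) blast
  qed
  have conth: "continuous_map ?E ?Q h"
  proof -
    have "continuous_map ?E (subtopology (rep_topology m d) (chart_domain m S)) (\<lambda>v. chart_section m S (dec v))"
    proof (rule continuous_map_into_subtopology[OF continuous_map_into_rep_topology])
      have proj: "continuous_map ?E euclideanreal (\<lambda>v. v i)" for i
        unfolding Euclidean_space_def
        by (intro continuous_map_from_subtopology continuous_map_product_projection) simp
      have cdec: "continuous_map ?E euclidean (\<lambda>v. dec v p)" for p
      proof -
        have "continuous_map ?E euclidean (\<lambda>v. complex_of_real (v (2 * pos p)) + \<i> * complex_of_real (v (2 * pos p + 1)))"
          using proj by (intro continuous_map_add continuous_map_mult_field)
            (auto simp: continuous_map_atin tendsto_of_real)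
        then show ?thesis by (simp add: dec_def Complex_eq)
      qed
      have cvec: "continuous_map ?E euclidean (\<lambda>v. vec_index (section_vec S (dec v) w) i)" if "i < d" for w i
        using that tree_facts[OF S] cdec by (cases "w \<in> S") (auto simp: section_vec_def)
      show "continuous_map ?E euclidean (\<lambda>v. vec_index (fst (chart_section m S (dec v))) i)" if "i < d" for i
        using cvec[OF that] by (simp add: chart_section_def)
      show "continuous_map ?E euclidean (\<lambda>v. (snd (chart_section m S (dec v)) ! l) $$ (i, j))" if "l < m" "i < d" "j < d" for l i j
        using cvec[OF that(2)] that tree_facts[OF S] by (simp add: chart_section_def)
    qed (auto simp: chart_section_rep chart_section_domain)
    from continuous_map_compose[OF this quotient_imp_continuous_map[OF quotient_map_chart]]
    show ?thesis by (simp add: h_def[abs_def] comp_def)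
  qed
  \<comment> \<open>Continuity of the inverse is checked on representatives, where the coordinates
    are known to be continuous.\<close>
  have contk: "continuous_map ?Q ?E k"
  proof (rule continuous_compose_quotient_map[OF quotient_map_chart])
    let ?X = "subtopology (rep_topology m d) (chart_domain m S)"
    have comp: "continuous_map ?X euclideanreal (\<lambda>x. if even i then Re (chart_coord S x (ps ! (i div 2))) else Im (chart_coord S x (ps ! (i div 2))))"
      if i: "i < 2 * n" for i
    proof -
      obtain w w' where w: "ps ! (i div 2) = (w, w')" by fastforce
      have "i div 2 < n" using i by simp
      then have "(w, w') \<in> boundary m S \<times> S" using ps(2) w by (metis n_def nth_mem)
      then have b: "w \<in> lists {..<m}" "w' \<in> S" by (auto simp: boundary_def)
      obtain j where j: "j < d" "tree_list S ! j = w'" using b tree_list[OF S] by (metis in_set_conv_nth)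
      have "continuous_map ?X euclidean (\<lambda>x. chart_coord S x (w, w'))"
        using continuous_map_chart_vec[OF S b(1) j(1)] chart_coord_index[OF j(1)] by (simp add: j)
      then show ?thesis unfolding w
        by (cases "even i") (auto simp: continuous_map_atin tendsto_Re tendsto_Im)
    qed
    have "continuous_map ?X ?E (\<lambda>x. enc (chart_coord S x))"
      unfolding enc_def continuous_map_componentwise_Euclidean_space by (intro allI impI comp)
    then show "continuous_map ?X ?E (k \<circ> GL_orbit d)"
      by (rule continuous_map_eq) (auto simp: k)
  qed
  have kh: "k (h v) = v" if v: "v \<in> topspace ?E" for v
    unfolding h_def k[OF chart_section_domain]
    using chart_coord_section by (intro enc_dec[OF v]) auto
  have hk: "h (k U) = U" if U: "U \<in> ?V" for U
  proof -
    obtain x where x: "x \<in> chart_domain m S" "U = GL_orbit d x" using U by blast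
    show ?thesis unfolding x(2) k[OF x(1)] h_def
      using dec_enc by (intro orbit_section_chart_coord[OF x(1)]) auto
  qed
  have top: "topspace ?Q = ?V" using openin_subset[OF openin_chart] by auto
  have "homeomorphic_maps ?E ?Q h k"
    unfolding homeomorphic_maps_def using conth contk kh hk top by auto
  then have homeo: "homeomorphic_map ?E ?Q h" using homeomorphic_map_maps by blast
  have free: "v \<in> topspace (Euclidean_space a) \<longleftrightarrow> (\<forall>p\<in>I1. dec v p = 0)" if v: "v \<in> topspace ?E" for v
  proof
    assume "v \<in> topspace (Euclidean_space a)"
    then have v0: "v i = 0" if "i \<ge> a" for i using that by (simp add: topspace_Euclidean_space)
    show "\<forall>p\<in>I1. dec v p = 0"
    proof
      fix p assume p: "p \<in> I1"
      then obtain j where j: "j < length l1" "p = l1 ! j" using l1 by (metis in_set_conv_nth)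
      then have "p = ps ! (length l0 + j)" "length l0 + j < n" by (simp_all add: ps_def n_def)
      then have "pos p = length l0 + j" using pos by simp
      then show "dec v p = 0" using v0 by (simp add: dec_def a_def complex_eq_iff)
    qed
  next
    assume *: "\<forall>p\<in>I1. dec v p = 0"
    have "v i = 0" if i: "i \<ge> a" for i
    proof (cases "i < 2 * n")
      case True
      define j where "j = i div 2"
      have j: "length l0 \<le> j" "j < n" using i True by (auto simp: j_def a_def)
      then have "ps ! j \<in> I1" using l1 by (auto simp: ps_def nth_append n_def)
      then have "dec v (ps ! j) = 0" using * by blast
      then have "v (2 * j) = 0" "v (2 * j + 1) = 0" using pos[OF j(2)] by (simp_all add: dec_def complex_eq_iff)
      then show ?thesis by (cases "even i") (simp_all add: j_def odd_two_times_div_two_succ)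
    next
      case False
      then show ?thesis using v by (simp add: topspace_Euclidean_space)
    qed
    then show "v \<in> topspace (Euclidean_space a)" by (simp add: topspace_Euclidean_space)
  qed
  have sub: "topspace (Euclidean_space a) \<subseteq> topspace ?E"
    using an by (auto simp: topspace_Euclidean_space)
  have "h ` topspace (Euclidean_space a) =
      GL_orbit d ` {x \<in> chart_domain m S. \<forall>w\<in>boundary m S. \<forall>w'\<in>S. w < w' \<longrightarrow> chart_coord S x (w, w') = 0}" (is "?L = ?R")
  proof (intro equalityI subsetI)
    fix U assume "U \<in> ?L"
    then obtain v where v: "v \<in> topspace (Euclidean_space a)" "U = h v" by blast
    have "chart_coord S (chart_section m S (dec v)) (w, w') = 0" if "w \<in> boundary m S" "w' \<in> S" "w < w'" for w w'
    proof -
      have "(w, w') \<in> I1" using that by (simp add: I1_def)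
      then have "dec v (w, w') = 0" using free[of v] v(1) sub by blast
      then show ?thesis using chart_coord_section[OF that(1,2)] by simp
    qed
    then show "U \<in> ?R" unfolding v(2) h_def using chart_section_domain by blast
  next
    fix U assume "U \<in> ?R"
    then obtain x where x: "x \<in> chart_domain m S" "U = GL_orbit d x"
      "\<And>w w'. w \<in> boundary m S \<Longrightarrow> w' \<in> S \<Longrightarrow> w < w' \<Longrightarrow> chart_coord S x (w, w') = 0" by blast
    have "enc (chart_coord S x) \<in> topspace (Euclidean_space a)"
      using free[OF enc_top] dec_enc x(3) by (auto simp: I1_def)
    moreover have "h (enc (chart_coord S x)) = U" using hk[of U] k[OF x(1)] x by auto
    ultimately show "U \<in> ?L" by blast
  qed
  then show ?thesis using that[of a h] homeo an by simp
qed

end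

section \<open>Comparison of the cells of different trees\<close>

lemma chart_coord_expansion:
  assumes S: "S \<in> word_trees m d" and x: "x \<in> chart_domain m S" and w: "w \<in> lists {..<m}" and i: "i < d"
  shows "vec_index (word_eval x w) i = (\<Sum>w'\<in>S. chart_coord S x (w, w') * vec_index (word_eval x w') i)"
proof -
  have "vec_index (word_eval x w) i = vec_index (frame S x *\<^sub>v chart_vec S x w) i"
    using frame_chart_vec[OF S x w] by simp
  also have "\<dots> = (\<Sum>j<card S. vec_index (chart_vec S x w) j * vec_index (word_eval x (sorted_list_of_set S ! j)) i)"
    using frame_mult_vec[of S i "chart_vec S x w" x] chart_vec_carrier[OF S x w] tree_facts[OF S] i by simp
  also have "\<dots> = (\<Sum>w'\<in>S. chart_coord S x (w, w') * vec_index (word_eval x w') i)"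
    unfolding sum_nth_sorted_list_of_set[OF tree_facts(2)[OF S]]
    using chart_coord_index[OF S] tree_facts(3)[OF S] by (simp add: tree_list_def)
  finally show ?thesis .
qed

text \<open>The cell of \<open>S\<close> consists of the points whose lexicographically first basis of words is \<open>S\<close>.\<close>

lemma cell_eq_diff:
  assumes S: "S \<in> word_trees m d"
  shows "{x \<in> chart_domain m S. \<forall>w\<in>boundary m S. \<forall>w'\<in>S. w < w' \<longrightarrow> chart_coord S x (w, w') = 0} =
    chart_domain m S - (\<Union>T\<in>{T \<in> word_trees m d. sorted_list_of_set T < sorted_list_of_set S}. chart_domain m T)"
    (is "?L = ?R")
proof (intro equalityI subsetI)
  fix x assume x: "x \<in> ?L"
  then have xS: "x \<in> chart_domain m S" by simp
  have "x \<notin> chart_domain m T" if T: "T \<in> word_trees m d" "sorted_list_of_set T < sorted_list_of_set S" for T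
  proof
    assume xT: "x \<in> chart_domain m T"
    have fin: "finite S" "finite T" and card: "card T = card S" using tree_facts[OF S] tree_facts[OF T(1)] by simp_all
    have "S \<noteq> T" using T(2) by auto
    \<comment> \<open>z is the first word at which the trees differ. As T precedes S it belongs to
      T, and its parent lies in S because the trees agree below z; so z is a boundary word of
      S.\<close>
    then obtain z where z: "z \<in> S \<longleftrightarrow> z \<notin> T" and eq: "\<And>u. u < z \<Longrightarrow> u \<in> S \<longleftrightarrow> u \<in> T"
      using symmetric_difference_minimum[OF fin] by metis
    have "z \<notin> S"
    proof
      assume "z \<in> S"
      then have "sorted_list_of_set S < sorted_list_of_set T"
        using z eq fin card by (intro sorted_list_of_set_less[of S T z]) auto
      then show False using T(2) by simp
    qed
    then have zT: "z \<in> T" using z by blast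
    have zl: "z \<in> lists {..<m}" using zT tree_facts[OF T(1)] by blast
    have "z = [] \<or> butlast z \<in> S"
    proof (cases z rule: rev_cases)
      case (snoc u i)
      then have "u \<in> T" using zT tree_facts(1)[OF T(1)] by (auto simp: prefix_closed_def)
      moreover have "u < z" unfolding snoc by (rule less_snoc)
      ultimately show ?thesis using eq snoc by simp
    qed simp
    then have zb: "z \<in> boundary m S" using \<open>z \<notin> S\<close> zl by (simp add: boundary_def)
    have "free_family d x T"
      using xT free_family_iff_det[OF fin(2), of d x] tree_facts(3)[OF T(1)] by (simp add: chart_domain_def)
    \<comment> \<open>On the cell the vector of z involves only tree words before z. These belong to
      T as well, which gives a linear relation in T with coefficient -1 at z.\<close>
    define c where "c w = (if w = z then -1 else if w < z then chart_coord S x (z, w) else 0)" for w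
    have "(\<Sum>w\<in>T. c w * vec_index (word_eval x w) i) = 0" if i: "i < d" for i
    proof -
      have "(\<Sum>w\<in>T. c w * vec_index (word_eval x w) i) = - vec_index (word_eval x z) i + (\<Sum>w\<in>T-{z}. c w * vec_index (word_eval x w) i)"
        using fin zT by (subst sum.remove[of T z]) (auto simp: c_def)
      also have "(\<Sum>w\<in>T-{z}. c w * vec_index (word_eval x w) i) = (\<Sum>w\<in>{w\<in>T. w < z}. chart_coord S x (z, w) * vec_index (word_eval x w) i)"
        using fin by (intro sum.mono_neutral_cong_right) (auto simp: c_def)
      also have "{w\<in>T. w < z} = {w\<in>S. w < z}" using eq by blast
      also have "(\<Sum>w\<in>{w\<in>S. w < z}. chart_coord S x (z, w) * vec_index (word_eval x w) i) = (\<Sum>w\<in>S. chart_coord S x (z, w) * vec_index (word_eval x w) i)"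
      proof (rule sum.mono_neutral_left)
        show "\<forall>w\<in>S - {w \<in> S. w < z}. chart_coord S x (z, w) * vec_index (word_eval x w) i = 0"
        proof
          fix w assume "w \<in> S - {w \<in> S. w < z}"
          then have "w \<in> S" "z < w" using \<open>z \<notin> S\<close> by (auto simp: not_less le_less)
          then have "chart_coord S x (z, w) = 0" using x zb by blast
          then show "chart_coord S x (z, w) * vec_index (word_eval x w) i = 0" by simp
        qed
      qed (use fin in auto)
      also have "\<dots> = vec_index (word_eval x z) i" using chart_coord_expansion[OF S xS zl i] by simp
      finally show ?thesis by simp
    qed
    then have "c z = 0" using \<open>free_family d x T\<close> zT unfolding free_family_def by blast
    then show False by (simp add: c_def)
  qed
  then show "x \<in> ?R" using xS by blast
next
  fix x assume x: "x \<in> ?R"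
  then have xS: "x \<in> chart_domain m S" by simp
  have fin: "finite S" using tree_facts[OF S] by simp
  have "chart_coord S x (w, w') = 0" if w: "w \<in> boundary m S" "w' \<in> S" "w < w'" for w w'
  proof (rule ccontr)
    assume nz: "chart_coord S x (w, w') \<noteq> 0"
    have wS: "w \<notin> S" and wl: "w \<in> lists {..<m}" using w by (simp_all add: boundary_def)
    \<comment> \<open>Since the coordinate at some w' > w is nonzero, w could replace w' in the
      basis, but this exchange might destroy prefix closure. So only the words of S before w are
      kept together with w, and \<open>extend_free_tree\<close> completes them to a tree.\<close>
    define T where "T = insert w {u \<in> S. u < w}"
    have finT: "finite T" using fin by (simp add: T_def)
    have "prefix_closed m T"
    proof -
      have "u \<in> T" if "u @ [i] \<in> T" for u i
      proof -
        have lt: "u < u @ [i]" by (rule less_snoc)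
        from that consider "u @ [i] = w" | "u @ [i] \<in> S" "u @ [i] < w" by (auto simp: T_def)
        then show ?thesis
        proof cases
          case 1
          then have "u \<in> S" using w(1) by (auto simp: boundary_def)
          then show ?thesis using lt 1 by (simp add: T_def)
        next
          case 2
          then have "u \<in> S" using tree_facts(1)[OF S] by (auto simp: prefix_closed_def)
          then show ?thesis using lt 2(2) by (auto simp: T_def)
        qed
      qed
      then show ?thesis using finT tree_facts(4)[OF S] wl by (auto simp: prefix_closed_def T_def)
    qed
    have freeS: "free_family d x S"
      using xS free_family_iff_det[OF fin, of d x] tree_facts(3)[OF S] by (simp add: chart_domain_def)
    have "free_family d x T"
      unfolding free_family_def
    proof (intro allI impI ballI)
      fix c u assume c: "\<forall>i<d. (\<Sum>w\<in>T. c w * vec_index (word_eval x w) i) = 0" and u: "u \<in> T"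
      \<comment> \<open>The relation c on T rewritten in the basis S. Its coefficient at w' comes
        from w alone, because w' is not before w, and this forces c w = 0.\<close>
      define b where "b v = c w * chart_coord S x (w, v) + (if v < w then c v else 0)" for v
      have "(\<Sum>v\<in>S. b v * vec_index (word_eval x v) i) = 0" if i: "i < d" for i
      proof -
        have "(\<Sum>v\<in>S. b v * vec_index (word_eval x v) i) =
          c w * (\<Sum>v\<in>S. chart_coord S x (w, v) * vec_index (word_eval x v) i) + (\<Sum>v\<in>S. (if v < w then c v else 0) * vec_index (word_eval x v) i)"
          by (simp add: b_def algebra_simps sum.distrib sum_distrib_left)
        also have "(\<Sum>v\<in>S. (if v < w then c v else 0) * vec_index (word_eval x v) i) = (\<Sum>v\<in>{u\<in>S. u < w}. c v * vec_index (word_eval x v) i)"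
          using fin by (intro sum.mono_neutral_cong_right) auto
        also have "c w * (\<Sum>v\<in>S. chart_coord S x (w, v) * vec_index (word_eval x v) i) + \<dots> = (\<Sum>v\<in>T. c v * vec_index (word_eval x v) i)"
          using fin chart_coord_expansion[OF S xS wl i] by (simp add: T_def)
        finally show ?thesis using c i by simp
      qed
      then have b0: "b v = 0" if "v \<in> S" for v using freeS that unfolding free_family_def by blast
      have "b w' = c w * chart_coord S x (w, w')" using w(3) by (simp add: b_def)
      then have cw: "c w = 0" using b0[OF w(2)] nz by simp
      show "c u = 0"
      proof (cases "u = w")
        case False
        then have "u \<in> S" "u < w" using u by (auto simp: T_def)
        then show ?thesis using b0[of u] cw by (simp add: b_def)
      qed (simp add: cw)
    qed
    then obtain T' where T': "T \<subseteq> T'" "T' \<in> word_trees m d" "x \<in> chart_domain m T'"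
      using extend_free_tree[OF _ \<open>prefix_closed m T\<close>] xS chart_domain_stable[OF S] by blast
    have fin': "finite T'" and card: "card T' = card S" using tree_facts[OF S] tree_facts[OF T'(2)] by simp_all
    have "S \<noteq> T'" using T' wS by (auto simp: T_def)
    then obtain z where z: "z \<in> S \<longleftrightarrow> z \<notin> T'" and eq: "\<And>u. u < z \<Longrightarrow> u \<in> S \<longleftrightarrow> u \<in> T'"
      using symmetric_difference_minimum[OF fin fin'] by metis
    \<comment> \<open>The word w lies in T' but not in S, so the first difference is at w or
      earlier; all words of S before w are in T', so the difference cannot be a word of S.\<close>
    have "z \<le> w" using eq[of w] wS T'(1) by (force simp: T_def)
    have "z \<notin> S"
    proof
      assume "z \<in> S"
      then have "z < w" using \<open>z \<le> w\<close> wS by (auto simp: le_less)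
      then have "z \<in> T'" using \<open>z \<in> S\<close> T'(1) by (auto simp: T_def)
      then show False using z \<open>z \<in> S\<close> by blast
    qed
    then have "sorted_list_of_set T' < sorted_list_of_set S"
      using z eq fin fin' card by (intro sorted_list_of_set_less[of T' S z]) auto
    then show False using x T' by blast
  qed
  then show "x \<in> ?L" using xS by blast
qed

section \<open>Homology, Betti numbers and Euler characteristic\<close>

lemma stable_covered_by_charts:
  assumes "x \<in> stable_tuples m d"
  obtains S where "S \<in> word_trees m d" "x \<in> chart_domain m S"
proof -
  have "prefix_closed m {}" by (simp add: prefix_closed_def)
  moreover have "free_family d x {}" by (simp add: free_family_def)
  ultimately show ?thesis using extend_free_tree[OF assms] that by metis
qed

text \<open>Enumerating the trees by increasing sorted lists of words turns
  \<open>cell_eq_diff\<close> into the filtration hypothesis of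
  \<open>homology_group_affine_paving\<close>.\<close>

theorem homology_group_nc_hilbert:
  "homology_group p (nc_hilbert m d) \<cong> free_Abelian_group {..<card {S \<in> word_trees m d. int (2 * cell_codim m S) = p}}"
proof -
  define L where "L = sorted_list_of_set (sorted_list_of_set ` word_trees m d)"
  define n where "n = length L"
  have finL: "finite (sorted_list_of_set ` word_trees m d)" using finite_word_trees by simp
  have L: "set L = sorted_list_of_set ` word_trees m d" "sorted L" "distinct L" using finL by (simp_all add: L_def)
  define T where "T i = set (L ! i)" for i
  have T: "T i \<in> word_trees m d \<and> sorted_list_of_set (T i) = L ! i" if "i < n" for i
  proof -
    have "L ! i \<in> sorted_list_of_set ` word_trees m d" using that L(1) by (metis n_def nth_mem)
    then obtain S where "S \<in> word_trees m d" "L ! i = sorted_list_of_set S" by blast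
    then show ?thesis using tree_facts[of S m d] by (simp add: T_def)
  qed
  have T_ex: "\<exists>i<n. T i = S" if "S \<in> word_trees m d" for S
  proof -
    have "sorted_list_of_set S \<in> set L" using that L(1) by blast
    then obtain i where "i < n" "L ! i = sorted_list_of_set S" by (metis in_set_conv_nth n_def)
    then show ?thesis using tree_facts[OF that] by (auto simp: T_def)
  qed
  have less: "L ! i < L ! j \<longleftrightarrow> i < j" if "i < n" "j < n" for i j
    using that L(2,3) unfolding n_def
    by (metis linorder_neqE_nat nth_eq_iff_index_eq order_less_asym sorted_wrt_nth_less strict_sorted_iff)
  define V where "V i = GL_orbit d ` chart_domain m (T i)" for i
  have "\<exists>a h. homeomorphic_map (Euclidean_space (a + 2 * cell_codim m (T i))) (subtopology (nc_hilbert m d) (V i)) h \<and>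
     h ` topspace (Euclidean_space a) = V i - (\<Union>j<i. V j)" if i: "i < n" for i
  proof -
    have Ti: "T i \<in> word_trees m d" using T[OF i] by simp
    have lower: "{S \<in> word_trees m d. sorted_list_of_set S < sorted_list_of_set (T i)} = T ` {..<i}"
    proof (intro equalityI subsetI)
      fix S assume S: "S \<in> {S \<in> word_trees m d. sorted_list_of_set S < sorted_list_of_set (T i)}"
      then obtain j where j: "j < n" "T j = S" using T_ex by blast
      then have "L ! j < L ! i" using S T[OF i] T[OF j(1)] by auto
      then show "S \<in> T ` {..<i}" using less[OF j(1) i] j by auto
    next
      fix S assume "S \<in> T ` {..<i}"
      then obtain j where j: "j < i" "S = T j" by auto
      then have "L ! j < L ! i" using less[of j i] i by simp
      then show "S \<in> {S \<in> word_trees m d. sorted_list_of_set S < sorted_list_of_set (T i)}"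
        using j T[of j] T[OF i] i by simp
    qed
    \<comment> \<open>Passing to orbits commutes with this difference because the removed sets are
      saturated.\<close>
    have "GL_orbit d ` (chart_domain m (T i) - (\<Union>j<i. chart_domain m (T j))) = V i - (\<Union>j<i. V j)"
    proof -
      have "GL_orbit d x \<in> V j \<longleftrightarrow> x \<in> chart_domain m (T j)" if "j < i" "x \<in> chart_domain m (T i)" for x j
        unfolding V_def using that i T[of j] chart_domain_rep[OF Ti] by (intro orbit_in_chart_iff) auto
      then have "chart_domain m (T i) - (\<Union>j<i. chart_domain m (T j)) =
          {x \<in> chart_domain m (T i). GL_orbit d x \<notin> (\<Union>j<i. V j)}" by blast
      moreover have "GL_orbit d ` {x \<in> A. GL_orbit d x \<notin> W} = GL_orbit d ` A - W" for A W by blast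
      ultimately show ?thesis by (simp only: V_def[of i])
    qed
    moreover have "(\<Union>S\<in>T ` {..<i}. chart_domain m S) = (\<Union>j<i. chart_domain m (T j))" by simp
    moreover obtain a h where
      "homeomorphic_map (Euclidean_space (a + 2 * cell_codim m (T i))) (subtopology (nc_hilbert m d) (V i)) h"
      "h ` topspace (Euclidean_space a) = GL_orbit d ` (chart_domain m (T i) - (\<Union>S\<in>T ` {..<i}. chart_domain m S))"
      using nc_hilbert_chart[OF Ti] unfolding cell_eq_diff[OF Ti] lower V_def .
    ultimately show ?thesis by (intro exI[of _ a] exI[of _ h]) simp
  qed
  then obtain a h where ah: "\<And>i. i < n \<Longrightarrow> homeomorphic_map (Euclidean_space (a i + 2 * cell_codim m (T i))) (subtopology (nc_hilbert m d) (V i)) (h i)"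
     "\<And>i. i < n \<Longrightarrow> h i ` topspace (Euclidean_space (a i)) = V i - (\<Union>j<i. V j)" by metis
  have op: "openin (nc_hilbert m d) (V i)" if "i < n" for i
    unfolding V_def using T[OF that] by (intro openin_chart) simp
  have "homology_group p (subtopology (nc_hilbert m d) (\<Union>i<n. V i)) \<cong>
      free_Abelian_group {..<card {i. i < n \<and> int (2 * cell_codim m (T i)) = p}}"
    using op ah by (intro homology_group_affine_paving[of n _ V "\<lambda>i. 2 * cell_codim m (T i)" a h]) auto
  moreover have "(\<Union>i<n. V i) = topspace (nc_hilbert m d)"
  proof
    show "(\<Union>i<n. V i) \<subseteq> topspace (nc_hilbert m d)" using openin_subset[OF op] by blast
    have "topspace (nc_hilbert m d) = GL_orbit d ` stable_tuples m d"
      using quotient_imp_surjective_map[OF quotient_map_quotient_topology[of "subtopology (rep_topology m d) (stable_tuples m d)" "GL_orbit d"]]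
      by (simp add: nc_hilbert_def inf_absorb2 stable_rep)
    moreover have "GL_orbit d x \<in> (\<Union>i<n. V i)" if x: "x \<in> stable_tuples m d" for x
    proof -
      obtain S where S: "S \<in> word_trees m d" "x \<in> chart_domain m S" using stable_covered_by_charts[OF x] .
      then obtain i where "i < n" "T i = S" using T_ex by blast
      then show ?thesis using S by (auto simp: V_def)
    qed
    ultimately show "topspace (nc_hilbert m d) \<subseteq> (\<Union>i<n. V i)" by auto
  qed
  moreover have "card {i. i < n \<and> int (2 * cell_codim m (T i)) = p} = card {S \<in> word_trees m d. int (2 * cell_codim m S) = p}"
  proof (rule bij_betw_same_card)
    have "inj_on T {..<n}"
      using T L(3) by (intro inj_onI) (metis lessThan_iff n_def nth_eq_iff_index_eq)
    then have "inj_on T {i. i < n \<and> int (2 * cell_codim m (T i)) = p}" by (rule inj_on_subset) auto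
    moreover have im: "T ` {i. i < n \<and> P (T i)} = {S \<in> word_trees m d. P S}" for P
    proof (intro equalityI subsetI)
      fix S assume "S \<in> {S \<in> word_trees m d. P S}"
      then show "S \<in> T ` {i. i < n \<and> P (T i)}" using T_ex[of S] by blast
    qed (use T in auto)
    ultimately show "bij_betw T {i. i < n \<and> int (2 * cell_codim m (T i)) = p} {S \<in> word_trees m d. int (2 * cell_codim m S) = p}"
      unfolding bij_betw_def using im[of "\<lambda>S. int (2 * cell_codim m S) = p"] by (intro conjI)
  qed
  ultimately show ?thesis by simp
qed

corollary betti_number_nc_hilbert:
  "betti_number p (nc_hilbert m d) = card {S \<in> word_trees m d. int (2 * cell_codim m S) = p}"
proof (cases "p < 0")
  case True
  then have "{S \<in> word_trees m d. int (2 * cell_codim m S) = p} = {}" by auto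
  with True show ?thesis unfolding betti_number_def by simp
next
  case False
  then have "p = int (nat p)" by simp
  then show ?thesis using betti_number_free_homology[OF homology_group_nc_hilbert[of "int (nat p)" m d]] by simp
qed

text \<open>Only even degrees occur, so all signs are positive and the sum counts each tree
  once.\<close>

corollary euler_characteristic_nc_hilbert:
  "euler_characteristic (nc_hilbert m d) = int (card (word_trees m d))"
proof -
  let ?W = "word_trees m d"
  let ?b = "\<lambda>i. card {S \<in> ?W. 2 * cell_codim m S = i}"
  have b: "betti_number (int i) (nc_hilbert m d) = ?b i" for i
    by (simp only: betti_number_nc_hilbert of_nat_eq_iff)
  have odd: "?b i = 0" if "odd i" for i
    using that by (metis (mono_tags, lifting) Collect_empty_eq card.empty dvd_triv_left)
  have "{i. ?b i \<noteq> 0} = (\<lambda>S. 2 * cell_codim m S) ` ?W"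
    using finite_word_trees[of m d] by (auto simp: card_eq_0_iff)
  then have "euler_characteristic (nc_hilbert m d) = (\<Sum>i\<in>(\<lambda>S. 2 * cell_codim m S) ` ?W. (-1) ^ i * int (?b i))"
    by (simp add: euler_characteristic_def b)
  also have "\<dots> = (\<Sum>i\<in>(\<lambda>S. 2 * cell_codim m S) ` ?W. int (?b i))"
    by (intro sum.cong) auto
  also have "\<dots> = int (\<Sum>i\<in>(\<lambda>S. 2 * cell_codim m S) ` ?W. ?b i)" by simp
  also have "(\<Sum>i\<in>(\<lambda>S. 2 * cell_codim m S) ` ?W. ?b i) = card ?W"
    using sum.image_gen[OF finite_word_trees[of m d], of "\<lambda>_. 1::nat" "\<lambda>S. 2 * cell_codim m S"] by simp
  finally show ?thesis .
qed

section \<open>Area of trees\<close>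

text \<open>Letter l counts its m - 1 - l later siblings, so the weight is the number of branches to
  the right of the path; the letter m - 1 is free.\<close>

definition path_weight :: "nat \<Rightarrow> nat list \<Rightarrow> nat" where
  "path_weight m u = (\<Sum>l\<leftarrow>u. m - 1 - l)"

definition area :: "nat \<Rightarrow> nat list set \<Rightarrow> nat" where
  "area m S = (\<Sum>u\<in>S. path_weight m u)"

definition graft :: "nat \<Rightarrow> (nat \<Rightarrow> nat list set) \<Rightarrow> nat list set" where
  "graft m g = insert [] (\<Union>i<m. (#) i ` g i)"

text \<open>\<open>restrict\<close> yields extensional functions, among which the family of branches
  of a tree is unique.\<close>

definition branch :: "nat \<Rightarrow> nat list set \<Rightarrow> nat \<Rightarrow> nat list set" where
  "branch m S = restrict (\<lambda>i. {u. i # u \<in> S}) {..<m}"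

definition all_trees :: "nat \<Rightarrow> nat list set set" where
  "all_trees m = {S. prefix_closed m S}"

lemma word_trees_eq: "word_trees m d = {S \<in> all_trees m. card S = d}"
  by (simp add: word_trees_def all_trees_def)

lemma finite_all_trees: "S \<in> all_trees m \<Longrightarrow> finite S"
  by (simp add: all_trees_def prefix_closed_def)

section \<open>Decomposition of a tree at its root\<close>

lemma sum_graft:
  assumes "\<And>i. i < m \<Longrightarrow> finite (g i)"
  shows "(\<Sum>u\<in>graft m g. f u) = f [] + (\<Sum>i<m. \<Sum>u\<in>g i. f (i # u))"
proof -
  have "(\<Sum>u\<in>(\<Union>i<m. (#) i ` g i). f u) = (\<Sum>i<m. \<Sum>u\<in>(#) i ` g i. f u)"
    using assms by (intro sum.UNION_disjoint) auto
  also have "\<dots> = (\<Sum>i<m. \<Sum>u\<in>g i. f (i # u))"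
    by (rule sum.cong[OF refl], subst sum.reindex) auto
  finally show ?thesis using assms by (simp add: graft_def) (subst sum.insert; auto)
qed

lemma prefix_closed_Cons_iff:
  "i < m \<Longrightarrow> prefix_closed m S \<Longrightarrow> prefix_closed m {u. i # u \<in> S}"
proof -
  assume i: "i < m" and S: "prefix_closed m S"
  have "finite {u. i # u \<in> S}"
    using S by (intro finite_vimageI[of S "(#) i", unfolded vimage_def]) (auto simp: prefix_closed_def)
  then show ?thesis using S by (auto simp: prefix_closed_def)
qed

lemma graft_in_all_trees:
  assumes "\<And>i. i < m \<Longrightarrow> g i \<in> all_trees m"
  shows "graft m g \<in> all_trees m"
proof -
  have g: "prefix_closed m (g i)" if "i < m" for i using assms that by (simp add: all_trees_def)
  have "w \<in> graft m g" if "w @ [l] \<in> graft m g" for w l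
  proof (cases w)
    case (Cons i u)
    then have "i < m" "u @ [l] \<in> g i" using that by (auto simp: graft_def)
    moreover from this have "u \<in> g i" using g[of i] unfolding prefix_closed_def by blast
    ultimately show ?thesis using Cons by (auto simp: graft_def)
  qed (simp add: graft_def)
  moreover have gi: "finite (g i)" "g i \<subseteq> lists {..<m}" if "i < m" for i
    using g[OF that] by (simp_all add: prefix_closed_def)
  then have "finite (graft m g)" by (simp add: graft_def)
  moreover have "graft m g \<subseteq> lists {..<m}"
  proof
    fix w assume w: "w \<in> graft m g"
    show "w \<in> lists {..<m}"
    proof (cases w)
      case (Cons i u)
      then have "i < m" "u \<in> g i" using w by (auto simp: graft_def)
      then show ?thesis using gi(2)[of i] Cons by auto
    qed simp
  qed
  ultimately show ?thesis unfolding all_trees_def prefix_closed_def by blast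
qed

lemma bij_betw_graft:
  "bij_betw (graft m) ({..<m} \<rightarrow>\<^sub>E all_trees m) (all_trees m - {{}})"
proof (rule bij_betw_byWitness[where f' = "branch m"])
  show "\<forall>g\<in>{..<m} \<rightarrow>\<^sub>E all_trees m. branch m (graft m g) = g"
    by (auto simp: branch_def graft_def fun_eq_iff PiE_iff extensional_def)
  show "\<forall>S\<in>all_trees m - {{}}. graft m (branch m S) = S"
  proof
    fix S assume S: "S \<in> all_trees m - {{}}"
    then obtain w where "w \<in> S" by blast
    then have "[] \<in> S" using S prefix_closed_append[of m S "[]" w] by (simp add: all_trees_def)
    moreover have "S \<subseteq> lists {..<m}" using S by (simp add: all_trees_def prefix_closed_def)
    moreover have "i # v \<in> graft m (branch m S) \<longleftrightarrow> i < m \<and> i # v \<in> S" for i v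
      by (auto simp: graft_def branch_def)
    moreover have "[] \<in> graft m (branch m S)" by (simp add: graft_def)
    ultimately have "u \<in> graft m (branch m S) \<longleftrightarrow> u \<in> S" for u
      by (cases u) auto
    then show "graft m (branch m S) = S" by blast
  qed
  show "graft m ` ({..<m} \<rightarrow>\<^sub>E all_trees m) \<subseteq> all_trees m - {{}}"
    using graft_in_all_trees by (auto simp: PiE_iff graft_def)
  show "branch m ` (all_trees m - {{}}) \<subseteq> {..<m} \<rightarrow>\<^sub>E all_trees m"
    using prefix_closed_Cons_iff by (auto simp: branch_def all_trees_def)
qed

lemma all_trees_cases:
  assumes "S \<in> all_trees m"
  obtains "S = {}" | g where "g \<in> {..<m} \<rightarrow>\<^sub>E all_trees m" "S = graft m g"
  using assms bij_betw_imp_surj_on[OF bij_betw_graft[of m]] by blast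

lemma card_graft:
  assumes "\<And>i. i < m \<Longrightarrow> finite (g i)"
  shows "card (graft m g) = Suc (\<Sum>i<m. card (g i))"
  using sum_graft[of m g "\<lambda>_. 1::nat", OF assms] by simp

lemma all_trees_induct [consumes 1, case_names empty graft]:
  assumes "S \<in> all_trees m" and "P {}"
    and step: "\<And>g. g \<in> {..<m} \<rightarrow>\<^sub>E all_trees m \<Longrightarrow> (\<And>i. i < m \<Longrightarrow> P (g i)) \<Longrightarrow> P (graft m g)"
  shows "P S"
  using assms(1)
proof (induction "card S" arbitrary: S rule: less_induct)
  case less
  from less.prems show ?case
  proof (cases rule: all_trees_cases)
    case (2 g)
    have g: "g i \<in> all_trees m" if "i < m" for i using 2(1) that by (auto simp: PiE_iff)
    have "card (g i) < card S" if "i < m" for i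
    proof -
      have "card (g i) \<le> (\<Sum>i<m. card (g i))" using that by (intro member_le_sum) auto
      moreover have "card (graft m g) = Suc (\<Sum>i<m. card (g i))"
        using g finite_all_trees by (intro card_graft) blast
      ultimately show ?thesis by (simp add: 2(2))
    qed
    then show ?thesis unfolding 2(2) using step[OF 2(1)] less.hyps g 2(2) by blast
  qed (use assms(2) in simp)
qed

lemma boundary_empty: "boundary m {} = {[]}"
  by (auto simp: boundary_def)

lemma boundary_graft:
  assumes "g \<in> {..<m} \<rightarrow>\<^sub>E all_trees m"
  shows "boundary m (graft m g) = (\<Union>i<m. (#) i ` boundary m (g i))"
proof (rule Set.set_eqI)
  fix w
  show "w \<in> boundary m (graft m g) \<longleftrightarrow> w \<in> (\<Union>i<m. (#) i ` boundary m (g i))"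
  proof (cases w)
    case Nil
    then show ?thesis by (auto simp: boundary_def graft_def)
  next
    case (Cons i u)
    have "butlast (i # u) \<in> graft m g \<longleftrightarrow> u = [] \<or> butlast u \<in> g i" if "i < m"
      using that by (cases u rule: rev_cases) (auto simp: graft_def butlast_append)
    moreover have "i # u \<in> graft m g \<longleftrightarrow> i < m \<and> u \<in> g i" by (auto simp: graft_def)
    moreover have "i # u \<in> (\<Union>i<m. (#) i ` boundary m (g i)) \<longleftrightarrow> i < m \<and> u \<in> boundary m (g i)" by auto
    ultimately show ?thesis unfolding Cons by (auto simp: boundary_def)
  qed
qed

text \<open>Grafting adds up the leaves of the m branches and creates one inner node, so each node
  accounts for m - 1 further leaves.\<close>

lemma card_boundary:
  assumes "S \<in> all_trees m" "m > 0"
  shows "card (boundary m S) = (m - 1) * card S + 1"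
  using assms(1)
proof (induction S rule: all_trees_induct)
  case empty
  then show ?case by (simp add: boundary_empty)
next
  case (graft g)
  have fin: "finite (g i)" if "i < m" for i using graft(1) that finite_all_trees by (auto simp: PiE_iff)
  have "card (boundary m (graft m g)) = (\<Sum>i<m. card ((#) i ` boundary m (g i)))"
    unfolding boundary_graft[OF graft(1)] using fin finite_boundary
    by (intro card_UN_disjoint) auto
  also have "\<dots> = (\<Sum>i<m. (m - 1) * card (g i) + 1)"
    by (intro sum.cong refl) (simp add: card_image graft(2))
  also have "\<dots> = (m - 1) * (\<Sum>i<m. card (g i)) + m" by (simp add: sum_Suc sum_distrib_left)
  also have "\<dots> = (m - 1) * card (graft m g) + 1"
  proof -
    have "(m - 1) * k + m = (m - 1) * Suc k + 1" for k using assms(2) by (simp only: mult_Suc_right)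
    then show ?thesis by (simp only: card_graft[of m g, OF fin])
  qed
  finally show ?case .
qed

lemma area_graft:
  assumes "g \<in> {..<m} \<rightarrow>\<^sub>E all_trees m"
  shows "area m (graft m g) = (\<Sum>i<m. area m (g i) + (m - 1 - i) * card (g i))"
proof -
  have "finite (g i)" if "i < m" for i using assms that finite_all_trees by (auto simp: PiE_iff)
  then have "area m (graft m g) = path_weight m [] + (\<Sum>i<m. \<Sum>u\<in>g i. path_weight m (i # u))"
    unfolding area_def by (rule sum_graft)
  also have "\<dots> = (\<Sum>i<m. (\<Sum>u\<in>g i. path_weight m u + (m - 1 - i)))"
    by (simp add: path_weight_def add.commute)
  also have "\<dots> = (\<Sum>i<m. area m (g i) + (m - 1 - i) * card (g i))"
    unfolding sum.distrib area_def by (simp add: mult.commute)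
  finally show ?thesis .
qed

text \<open>A boundary word precedes a node either inside a common branch or because its branch
  comes earlier, and in the latter case every pair counts. The root precedes all boundary words and
  contributes nothing.\<close>

lemma cell_codim_graft:
  assumes g: "g \<in> {..<m} \<rightarrow>\<^sub>E all_trees m" and m: "m > 0"
  shows "cell_codim m (graft m g) =
    (\<Sum>j<m. cell_codim m (g j)) + (\<Sum>j<m. \<Sum>i<j. ((m - 1) * card (g i) + 1) * card (g j))"
proof -
  have gT: "g i \<in> all_trees m" if "i < m" for i using g that by (auto simp: PiE_iff)
  have fin: "finite (g i)" "finite (boundary m (g i))" if "i < m" for i
    using gT[OF that] finite_all_trees finite_boundary by auto
  define D where "D j = {(w, w'). w \<in> boundary m (g j) \<and> w' \<in> g j \<and> w < w'}" for j
  define A where "A j = map_prod ((#) j) ((#) j) ` D j" for j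
  define B where "B j i = map_prod ((#) i) ((#) j) ` (boundary m (g i) \<times> g j)" for j i
  have "{(w, w'). w \<in> boundary m (graft m g) \<and> w' \<in> graft m g \<and> w < w'} = (\<Union>j<m. A j \<union> (\<Union>i<j. B j i))" (is "?L = ?R")
  proof (rule Set.set_eqI)
    fix p :: "nat list \<times> nat list"
    obtain w w' where p: "p = (w, w')" by fastforce
    show "p \<in> ?L \<longleftrightarrow> p \<in> ?R"
    proof
      assume "p \<in> ?L"
      then have h: "w \<in> boundary m (graft m g)" "w' \<in> graft m g" "w < w'" by (auto simp: p)
      obtain i u where w: "w = i # u" "i < m" "u \<in> boundary m (g i)" using h(1) boundary_graft[OF g] by auto
      obtain j u' where w': "w' = j # u'" "j < m" "u' \<in> g j" using h(2,3) w by (auto simp: graft_def)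
      consider "i < j" | "i = j" "u < u'" using h(3) w w' by auto
      then show "p \<in> ?R"
      proof cases
        case 1
        then have "p \<in> B j i" using w w' by (auto simp: B_def p)
        then show ?thesis using 1 w'(2) by blast
      next
        case 2
        then have "p \<in> A j" using w w' by (auto simp: A_def D_def p)
        then show ?thesis using w'(2) by blast
      qed
    next
      assume "p \<in> ?R"
      then obtain j where j: "j < m" "p \<in> A j \<or> (\<exists>i<j. p \<in> B j i)" by blast
      then show "p \<in> ?L"
      proof (elim conjE disjE exE)
        assume "p \<in> A j"
        then show ?thesis using j(1) boundary_graft[OF g] by (auto simp: A_def D_def graft_def)
      next
        fix i assume "i < j" "p \<in> B j i"
        then show ?thesis using j(1) boundary_graft[OF g] by (fastforce simp: B_def graft_def)
      qed
    qed
  qed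
  then have "cell_codim m (graft m g) = card (\<Union>j<m. A j \<union> (\<Union>i<j. B j i))" by (simp add: cell_codim_def)
  also have "\<dots> = (\<Sum>j<m. card (A j \<union> (\<Union>i<j. B j i)))"
  proof (rule card_UN_disjoint)
    have "finite (A j)" if "j < m" for j
    proof -
      have "D j \<subseteq> boundary m (g j) \<times> g j" by (auto simp: D_def)
      then show ?thesis unfolding A_def using fin[OF that] by (meson finite_SigmaI finite_imageI finite_subset)
    qed
    moreover have "finite (B j i)" if "i < j" "j < m" for i j
      unfolding B_def using fin[of i] fin[of j] that by (intro finite_imageI finite_cartesian_product) auto
    ultimately show "\<forall>j\<in>{..<m}. finite (A j \<union> (\<Union>i<j. B j i))" by auto
    show "\<forall>j\<in>{..<m}. \<forall>k\<in>{..<m}. j \<noteq> k \<longrightarrow> (A j \<union> (\<Union>i<j. B j i)) \<inter> (A k \<union> (\<Union>i<k. B k i)) = {}"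
      by (auto simp: A_def B_def)
  qed simp
  also have "\<dots> = (\<Sum>j<m. cell_codim m (g j) + (\<Sum>i<j. ((m - 1) * card (g i) + 1) * card (g j)))"
  proof (rule sum.cong[OF refl])
    fix j assume "j \<in> {..<m}"
    then have j: "j < m" by simp
    have finD: "finite (D j)"
      using fin[OF j] by (rule_tac finite_subset[of _ "boundary m (g j) \<times> g j"]) (auto simp: D_def)
    have inj: "inj_on (map_prod ((#) i) ((#) j')) X" for i j' :: nat and X
      by (auto simp: inj_on_def)
    have cA: "card (A j) = cell_codim m (g j)" unfolding A_def cell_codim_def D_def by (rule card_image[OF inj])
    have cB: "card (B j i) = ((m - 1) * card (g i) + 1) * card (g j)" if "i < j" for i
      unfolding B_def using card_boundary[OF gT, of i] that j m
      by (simp add: card_image[OF inj] card_cartesian_product)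
    have finB: "finite (B j i)" if "i < j" for i
      unfolding B_def using fin[of i] fin[of j] that j by (intro finite_imageI finite_cartesian_product) auto
    have "card (A j \<union> (\<Union>i<j. B j i)) = card (A j) + card (\<Union>i<j. B j i)"
      using finD finB by (intro card_Un_disjoint) (auto simp: A_def B_def)
    also have "card (\<Union>i<j. B j i) = (\<Sum>i<j. card (B j i))"
      using finB by (intro card_UN_disjoint) (auto simp: B_def)
    finally show "card (A j \<union> (\<Union>i<j. B j i)) = cell_codim m (g j) + (\<Sum>i<j. ((m - 1) * card (g i) + 1) * card (g j))"
      using cA cB by simp
  qed
  finally show ?thesis by (simp add: sum.distrib)
qed

lemma square_sum_eq:
  fixes x :: "nat \<Rightarrow> int"
  shows "(\<Sum>i<m. x i)\<^sup>2 = (\<Sum>i<m. (x i)\<^sup>2) + 2 * (\<Sum>j<m. \<Sum>i<j. x i * x j)"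
  by (induction m) (simp_all add: power2_eq_square algebra_simps sum_distrib_left sum_distrib_right)

text \<open>Let x i be the sizes of the branches. The mixed products in
  \<open>cell_codim_graft\<close> complete the squares from the induction hypothesis to the square
  of the total size, and its linear terms j x j complement the weights m - 1 - j of
  \<open>area_graft\<close>.\<close>

lemma area_plus_codim:
  assumes "S \<in> all_trees m" and m: "m > 0"
  shows "2 * (int (area m S) + int (cell_codim m S)) = (int m - 1) * int (card S) * (int (card S) - 1)"
  using assms(1)
proof (induction S rule: all_trees_induct)
  case empty
  then show ?case by (simp add: area_def cell_codim_def)
next
  case (graft g)
  have fin: "finite (g i)" if "i < m" for i using graft(1) that finite_all_trees by (auto simp: PiE_iff)
  define x where "x i = int (card (g i))" for i
  define M where "M = int m - 1"
  define N where "N = (\<Sum>i<m. x i)"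
  have IH: "2 * (int (area m (g i)) + int (cell_codim m (g i))) = M * x i * (x i - 1)" if "i < m" for i
    using graft(2)[OF that] by (simp add: x_def M_def)
  have card: "int (card (graft m g)) = N + 1"
    using card_graft[of m g] fin by (simp add: N_def x_def)
  have ar: "int (area m (graft m g)) = (\<Sum>i<m. int (area m (g i))) + (\<Sum>i<m. (M - int i) * x i)"
  proof -
    have "int (m - 1 - i) = M - int i" if "i < m" for i using that by (simp add: M_def of_nat_diff)
    then have "(\<Sum>i<m. int (m - 1 - i) * x i) = (\<Sum>i<m. (M - int i) * x i)" by (intro sum.cong) auto
    then show ?thesis
      unfolding area_graft[OF graft(1)] of_nat_sum of_nat_add of_nat_mult sum.distrib x_def by simp
  qed
  have co: "int (cell_codim m (graft m g)) = (\<Sum>i<m. int (cell_codim m (g i))) + (\<Sum>j<m. \<Sum>i<j. (M * x i + 1) * x j)"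
  proof -
    have "int (m - 1) = M" using m by (simp add: M_def of_nat_diff)
    then show ?thesis
      unfolding cell_codim_graft[OF graft(1) m] by (simp only: of_nat_sum of_nat_add of_nat_mult of_nat_1 x_def)
  qed
  have "(\<Sum>j<m. \<Sum>i<j. (M * x i + 1) * x j) = M * (\<Sum>j<m. \<Sum>i<j. x i * x j) + (\<Sum>j<m. int j * x j)"
    by (simp add: algebra_simps sum.distrib sum_distrib_left)
  moreover have "(\<Sum>i<m. (M - int i) * x i) = M * N - (\<Sum>j<m. int j * x j)"
    by (simp add: algebra_simps sum_subtractf sum_distrib_left N_def)
  moreover have "2 * (\<Sum>i<m. int (area m (g i))) + 2 * (\<Sum>i<m. int (cell_codim m (g i))) = M * (\<Sum>i<m. (x i)\<^sup>2) - M * N"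
  proof -
    have "2 * (\<Sum>i<m. int (area m (g i))) + 2 * (\<Sum>i<m. int (cell_codim m (g i))) = (\<Sum>i<m. 2 * (int (area m (g i)) + int (cell_codim m (g i))))"
      by (simp add: sum.distrib sum_distrib_left)
    also have "\<dots> = (\<Sum>i<m. M * x i * (x i - 1))" using IH by (intro sum.cong) auto
    finally show ?thesis by (simp add: N_def algebra_simps power2_eq_square sum_subtractf sum_distrib_left)
  qed
  moreover have "N\<^sup>2 = (\<Sum>i<m. (x i)\<^sup>2) + 2 * (\<Sum>j<m. \<Sum>i<j. x i * x j)"
    unfolding N_def by (rule square_sum_eq)
  then have "M * N\<^sup>2 = M * (\<Sum>i<m. (x i)\<^sup>2) + 2 * (M * (\<Sum>j<m. \<Sum>i<j. x i * x j))"
    by (simp add: algebra_simps)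
  ultimately have "2 * (int (area m (graft m g)) + int (cell_codim m (graft m g))) = M * N\<^sup>2 + M * N"
    unfolding ar co by (simp add: algebra_simps)
  then show ?case unfolding card M_def[symmetric] by (simp add: power2_eq_square algebra_simps)
qed

section \<open>Products of generating functions\<close>

text \<open>The weight may depend on the index, as the branches at a root enter the area with
  different factors.\<close>

lemma fps_nth_prod_generating_functions:
  fixes w :: "'i \<Rightarrow> 'b \<Rightarrow> 'r::comm_ring_1" and sz :: "'b \<Rightarrow> nat"
  assumes fin: "\<And>n. finite {t \<in> T. sz t = n}" and I: "finite I"
  shows "fps_nth (\<Prod>i\<in>I. Abs_fps (\<lambda>n. \<Sum>t\<in>{t \<in> T. sz t = n}. w i t)) n =
    (\<Sum>g\<in>{g \<in> I \<rightarrow>\<^sub>E T. (\<Sum>i\<in>I. sz (g i)) = n}. \<Prod>i\<in>I. w i (g i))"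
  and "finite {g \<in> I \<rightarrow>\<^sub>E T. (\<Sum>i\<in>I. sz (g i)) = n}"
proof -
  define G where "G I n = {g \<in> I \<rightarrow>\<^sub>E T. (\<Sum>i\<in>I. sz (g i)) = n}" for I :: "'i set" and n
  have "finite (G I n) \<and> fps_nth (\<Prod>i\<in>I. Abs_fps (\<lambda>n. \<Sum>t\<in>{t \<in> T. sz t = n}. w i t)) n = (\<Sum>g\<in>G I n. \<Prod>i\<in>I. w i (g i))"
    using I
  proof (induction I arbitrary: n rule: finite_induct)
    case empty
    have "G {} n = (if n = 0 then {\<lambda>_. undefined} else {})" by (auto simp: G_def)
    then show ?case by simp
  next
    case (insert a I)
    \<comment> \<open>A tuple on \<open>insert a I\<close> is coded by the size and value of its
      component at a and by its restriction to I, in accordance with the Cauchy product.\<close>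
    define P where "P = (SIGMA k:{0..n}. {t \<in> T. sz t = k} \<times> G I (n - k))"
    define \<Psi> where "\<Psi> = (\<lambda>(k :: nat, t, g). g(a := t) :: 'i \<Rightarrow> 'b)"
    have finP: "finite P" unfolding P_def using fin insert.IH by auto
    have upd: "(\<Sum>i\<in>I. sz ((g(a := t)) i)) = (\<Sum>i\<in>I. sz (g i))" for g t
      using insert.hyps by (intro sum.cong) auto
    have bij: "bij_betw \<Psi> P (G (insert a I) n)"
    proof (rule bij_betw_byWitness[where f' = "\<lambda>g. (sz (g a), g a, restrict g I)"])
      show "\<forall>p\<in>P. (\<lambda>g. (sz (g a), g a, restrict g I)) (\<Psi> p) = p"
        using insert.hyps by (auto simp: P_def \<Psi>_def G_def PiE_iff fun_eq_iff extensional_def)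
      show "\<forall>g\<in>G (insert a I) n. \<Psi> (sz (g a), g a, restrict g I) = g"
        by (auto simp: \<Psi>_def G_def PiE_iff fun_eq_iff extensional_def)
      show "\<Psi> ` P \<subseteq> G (insert a I) n"
        using insert.hyps upd by (auto simp: P_def \<Psi>_def G_def PiE_iff extensional_def)
      show "(\<lambda>g. (sz (g a), g a, restrict g I)) ` G (insert a I) n \<subseteq> P"
        using insert.hyps by (auto simp: P_def G_def PiE_iff)
    qed
    have "(\<Sum>g\<in>G (insert a I) n. \<Prod>i\<in>insert a I. w i (g i)) = (\<Sum>p\<in>P. \<Prod>i\<in>insert a I. w i (\<Psi> p i))"
      by (rule sum.reindex_bij_betw[OF bij, symmetric])
    also have "\<dots> = (\<Sum>(k, t, g)\<in>P. w a t * (\<Prod>i\<in>I. w i (g i)))"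
    proof (intro sum.cong refl)
      fix p assume "p \<in> P"
      obtain k t g where p: "p = (k, t, g)" by (metis prod_cases3)
      have "(\<Prod>i\<in>I. w i ((g(a := t)) i)) = (\<Prod>i\<in>I. w i (g i))" using insert.hyps by (intro prod.cong) auto
      then show "(\<Prod>i\<in>insert a I. w i (\<Psi> p i)) = (case p of (k, t, g) \<Rightarrow> w a t * (\<Prod>i\<in>I. w i (g i)))"
        using insert.hyps by (simp add: p \<Psi>_def)
    qed
    also have "\<dots> = (\<Sum>k=0..n. \<Sum>(t, g)\<in>{t \<in> T. sz t = k} \<times> G I (n - k). w a t * (\<Prod>i\<in>I. w i (g i)))"
      unfolding P_def using fin insert.IH by (subst sum.Sigma[symmetric]) auto
    also have "\<dots> = (\<Sum>k=0..n. (\<Sum>t\<in>{t \<in> T. sz t = k}. w a t) * (\<Sum>g\<in>G I (n - k). \<Prod>i\<in>I. w i (g i)))"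
      by (simp add: sum_product sum.cartesian_product)
    also have "\<dots> = fps_nth (\<Prod>i\<in>insert a I. Abs_fps (\<lambda>n. \<Sum>t\<in>{t \<in> T. sz t = n}. w i t)) n"
      using insert by (simp add: fps_mult_nth)
    finally show ?case using bij finP bij_betw_finite by metis
  qed
  then show "fps_nth (\<Prod>i\<in>I. Abs_fps (\<lambda>n. \<Sum>t\<in>{t \<in> T. sz t = n}. w i t)) n =
    (\<Sum>g\<in>{g \<in> I \<rightarrow>\<^sub>E T. (\<Sum>i\<in>I. sz (g i)) = n}. \<Prod>i\<in>I. w i (g i))"
   and "finite {g \<in> I \<rightarrow>\<^sub>E T. (\<Sum>i\<in>I. sz (g i)) = n}" by (simp_all add: G_def)
qed

section \<open>Sums over trees of given size\<close>

lemma word_trees_0: "word_trees m 0 = {{}}"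
  by (auto simp: word_trees_def prefix_closed_def)

lemma word_trees_Suc:
  "bij_betw (graft m) {g \<in> {..<m} \<rightarrow>\<^sub>E all_trees m. (\<Sum>i<m. card (g i)) = n} (word_trees m (Suc n))"
proof -
  have "card (graft m g) = Suc (\<Sum>i<m. card (g i))" if "g \<in> {..<m} \<rightarrow>\<^sub>E all_trees m" for g
    using that finite_all_trees by (intro card_graft) (auto simp: PiE_iff)
  then have "graft m ` {g \<in> {..<m} \<rightarrow>\<^sub>E all_trees m. (\<Sum>i<m. card (g i)) = n} = {S \<in> all_trees m - {{}}. card S = Suc n}"
    unfolding bij_betw_imp_surj_on[OF bij_betw_graft[of m], symmetric] by auto
  moreover have "{S \<in> all_trees m - {{}}. card S = Suc n} = word_trees m (Suc n)" by (auto simp: word_trees_eq)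
  moreover have "inj_on (graft m) {g \<in> {..<m} \<rightarrow>\<^sub>E all_trees m. (\<Sum>i<m. card (g i)) = n}"
    using bij_betw_imp_inj_on[OF bij_betw_graft[of m]] by (rule inj_on_subset) auto
  ultimately show ?thesis by (simp add: bij_betw_def)
qed

text \<open>The weight is multiplicative over the branches, and the root accounts for the shift from
  \<open>Suc n\<close> to n.\<close>

lemma sum_word_trees_Suc:
  fixes w :: "nat \<Rightarrow> nat list set \<Rightarrow> 'r::comm_ring_1"
  assumes "\<And>g. g \<in> {..<m} \<rightarrow>\<^sub>E all_trees m \<Longrightarrow> f (graft m g) = (\<Prod>i<m. w i (g i))"
  shows "(\<Sum>S\<in>word_trees m (Suc n). f S) = fps_nth (\<Prod>i<m. Abs_fps (\<lambda>n. \<Sum>S\<in>word_trees m n. w i S)) n"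
proof -
  have fin: "finite {S \<in> all_trees m. card S = n}" for n using finite_word_trees by (simp add: word_trees_eq)
  have "(\<Sum>S\<in>word_trees m (Suc n). f S) = (\<Sum>g\<in>{g \<in> {..<m} \<rightarrow>\<^sub>E all_trees m. (\<Sum>i<m. card (g i)) = n}. f (graft m g))"
    by (rule sum.reindex_bij_betw[OF word_trees_Suc, symmetric])
  also have "\<dots> = (\<Sum>g\<in>{g \<in> {..<m} \<rightarrow>\<^sub>E all_trees m. (\<Sum>i<m. card (g i)) = n}. \<Prod>i<m. w i (g i))"
    using assms by (intro sum.cong) auto
  also have "\<dots> = fps_nth (\<Prod>i<m. Abs_fps (\<lambda>n. \<Sum>S\<in>word_trees m n. w i S)) n"
    unfolding word_trees_eq by (rule fps_nth_prod_generating_functions(1)[OF fin, symmetric]) simp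
  finally show ?thesis .
qed

section \<open>Central binomial coefficients\<close>

text \<open>Consecutive values differ by O(1/n^2), which is summable. The value of the limit is
  determined implicitly in \<open>binomial_asymptotics\<close>.\<close>

lemma stirling_constant_exists:
  "\<exists>L. (\<lambda>n. ln (fact n) - (real n + 1/2) * ln (real n) + real n) \<longlonglongrightarrow> L"
proof -
  define s where "s n = ln (fact (Suc n)) - (real (Suc n) + 1/2) * ln (real (Suc n)) + real (Suc n)" for n
  have diff: "s (Suc n) - s n = 1 - (real n + 3/2) * ln (1 + 1 / (real n + 1))" for n
  proof -
    have e1: "ln (fact (Suc (Suc n)) :: real) = ln (real n + 2) + ln (fact (Suc n))"
    proof -
      have "(fact (Suc (Suc n)) :: real) = (real n + 2) * fact (Suc n)" by (simp add: algebra_simps)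
      then show ?thesis by (simp add: ln_mult del: fact_Suc)
    qed
    have e2: "ln (1 + 1 / (real n + 1)) = ln (real n + 2) - ln (real n + 1)"
    proof -
      have "1 + 1 / (real n + 1) = (real n + 2) / (real n + 1)" by (simp add: field_simps)
      then show ?thesis by (simp add: ln_div)
    qed
    have r: "real (Suc (Suc n)) = real n + 2" "real (Suc n) = real n + 1" by simp_all
    show ?thesis unfolding s_def e1 e2 r by (simp add: algebra_simps)
  qed
  have "(\<lambda>n. 1 - (real n + 3/2) * ln (1 + 1 / (real n + 1))) \<in> O(\<lambda>n. 1 / real n ^ 2)"
    by real_asymp
  then have "summable (\<lambda>n. s (Suc n) - s n)"
    unfolding diff by (rule summable_comparison_test_bigo[rotated])
      (use inverse_power_summable[of 2, where 'a = real] in \<open>simp add: inverse_eq_divide\<close>)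
  then have "convergent (\<lambda>n. \<Sum>k<n. s (Suc k) - s k)"
    by (simp add: summable_iff_convergent)
  then have "convergent (\<lambda>n. s n - s 0)" by (simp add: sum_lessThan_telescope)
  then obtain l where "(\<lambda>n. s n - s 0) \<longlonglongrightarrow> l" by (auto simp: convergent_def)
  then have "(\<lambda>n. (s n - s 0) + s 0) \<longlonglongrightarrow> l + s 0" by (intro tendsto_add tendsto_const)
  then have "s \<longlonglongrightarrow> l + s 0" by simp
  then have "(\<lambda>n. ln (fact n) - (real n + 1/2) * ln (real n) + real n) \<longlonglongrightarrow> l + s 0"
    unfolding s_def[abs_def] by (rule filterlim_sequentially_Suc[THEN iffD1])
  then show ?thesis by blast
qed

text \<open>Three Stirling approximations leave the single constant exp (- L). It is the same for
  all m, so it can be calibrated at m = 2.\<close>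

lemma binomial_growth:
  obtains c where "\<And>m::nat. m \<ge> 2 \<Longrightarrow>
    (\<lambda>n. real (m * n choose n) * ((real m - 1) ^ (m - 1) / real m ^ m) ^ n * sqrt (real n)) \<longlonglongrightarrow> c * sqrt (real m / (real m - 1))"
proof -
  obtain L where L: "(\<lambda>n. ln (fact n) - (real n + 1/2) * ln (real n) + real n) \<longlonglongrightarrow> L"
    using stirling_constant_exists by blast
  define s where "s n = ln (fact n) - (real n + 1/2) * ln (real n) + real n" for n
  have sL: "s \<longlonglongrightarrow> L" using L by (simp add: s_def[abs_def])
  show ?thesis
  proof (rule that[of "exp (- L)"])
    fix m :: nat assume m: "m \<ge> 2"
    have sm: "(\<lambda>n. s (m * n)) \<longlonglongrightarrow> L"
      using m by (intro filterlim_compose[OF sL] mult_nat_left_at_top) simp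
    have sm1: "(\<lambda>n. s ((m - 1) * n)) \<longlonglongrightarrow> L"
      using m by (intro filterlim_compose[OF sL] mult_nat_left_at_top) simp
    have lim: "(\<lambda>n. exp (s (m * n) - s n - s ((m - 1) * n)) * sqrt (real m / (real m - 1))) \<longlonglongrightarrow> exp (L - L - L) * sqrt (real m / (real m - 1))"
      by (intro tendsto_intros sm sm1 sL)
    have "\<forall>\<^sub>F n in sequentially. exp (s (m * n) - s n - s ((m - 1) * n)) * sqrt (real m / (real m - 1)) =
       real (m * n choose n) * ((real m - 1) ^ (m - 1) / real m ^ m) ^ n * sqrt (real n)"
      using eventually_gt_at_top[of 0]
    proof eventually_elim
      case (elim n)
      define M where "M = real m"
      define N where "N = real n"
      have M: "M > 1" and N: "N > 0" using m elim by (simp_all add: M_def N_def)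
      have r: "real (m * n) = M * N" "real ((m - 1) * n) = (M - 1) * N" "real n = N"
        using m by (simp_all add: M_def N_def of_nat_diff)
      have lnM: "ln (M * N) = ln M + ln N" "ln ((M - 1) * N) = ln (M - 1) + ln N"
        using M N by (simp_all add: ln_mult)
      have bin: "real (m * n choose n) = fact (m * n) / (fact n * fact ((m - 1) * n))"
      proof -
        have "m * n - n = (m - 1) * n" "n \<le> m * n" using m by (simp_all add: diff_mult_distrib)
        then show ?thesis using binomial_fact[of n "m * n", where 'a = real] by simp
      qed
      have "ln (real (m * n choose n)) = ln (fact (m * n)) - ln (fact n) - ln (fact ((m - 1) * n))"
        unfolding bin by (simp add: ln_div ln_mult)
      moreover have "s (m * n) = ln (fact (m * n)) - (M * N + 1/2) * ln (M * N) + M * N"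
        "s n = ln (fact n) - (N + 1/2) * ln N + N"
        "s ((m - 1) * n) = ln (fact ((m - 1) * n)) - ((M - 1) * N + 1/2) * ln ((M - 1) * N) + (M - 1) * N"
        unfolding s_def r by simp_all
      ultimately have "s (m * n) - s n - s ((m - 1) * n) =
          ln (real (m * n choose n)) + N * ((M - 1) * ln (M - 1) - M * ln M) + (ln N + ln (M - 1) - ln M) / 2"
        unfolding lnM by (simp add: algebra_simps add_divide_distrib diff_divide_distrib)
      moreover have "((real m - 1) ^ (m - 1) / real m ^ m) ^ n = exp (N * ((M - 1) * ln (M - 1) - M * ln M))"
      proof -
        have "(M - 1) ^ (m - 1) = exp ((M - 1) * ln (M - 1))"
          using M m by (simp add: powr_realpow[symmetric] powr_def M_def of_nat_diff)
        moreover have "M ^ m = exp (M * ln M)"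
          using M by (simp add: powr_realpow[symmetric] powr_def M_def)
        ultimately have "(M - 1) ^ (m - 1) / M ^ m = exp ((M - 1) * ln (M - 1) - M * ln M)"
          by (simp add: exp_diff)
        then show ?thesis unfolding M_def[symmetric] by (simp add: N_def exp_of_nat_mult[symmetric])
      qed
      moreover have "exp ((ln N + ln (M - 1) - ln M) / 2) = sqrt N * sqrt (M - 1) / sqrt M"
      proof -
        have "(ln N + ln (M - 1) - ln M) / 2 = ln (sqrt N) + ln (sqrt (M - 1)) - ln (sqrt M)"
          using M N by (simp add: ln_sqrt field_simps)
        then show ?thesis unfolding \<open>(ln N + ln (M - 1) - ln M) / 2 = _\<close> exp_diff exp_add using M N by simp
      qed
      moreover have "real (m * n choose n) > 0" using m by (simp add: zero_less_binomial_iff)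
      ultimately show ?case using M N
        unfolding r M_def[symmetric] by (simp add: exp_add real_sqrt_divide)
    qed
    with lim have "(\<lambda>n. real (m * n choose n) * ((real m - 1) ^ (m - 1) / real m ^ m) ^ n * sqrt (real n)) \<longlonglongrightarrow> exp (L - L - L) * sqrt (real m / (real m - 1))"
      by (rule Lim_transform_eventually)
    then show "(\<lambda>n. real (m * n choose n) * ((real m - 1) ^ (m - 1) / real m ^ m) ^ n * sqrt (real n)) \<longlonglongrightarrow> exp (- L) * sqrt (real m / (real m - 1))"
      by simp
  qed
qed

text \<open>The coefficients of (1 - x)^(-1/2), the comparison sequence for a simple pole in a
  square-root uniformiser.\<close>

definition central_binomial :: "nat \<Rightarrow> real" where
  "central_binomial n = real (2 * n choose n) / 4 ^ n"

lemma central_binomial_eq_gbinomial: "central_binomial n = (-1) ^ n * ((-1/2) gchoose n)"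
proof (induction n)
  case (Suc n)
  have "real (Suc n) * real (2 * Suc n choose Suc n) = 2 * (2 * real n + 1) * real (2 * n choose n)"
  proof -
    have a: "fact (2 * Suc n) = (2 * real n + 2) * (2 * real n + 1) * fact (2 * n)"
      by (simp add: algebra_simps)
    have b: "real (2 * Suc n choose Suc n) = fact (2 * Suc n) / (fact (Suc n) * fact (Suc n))"
      using binomial_fact[of "Suc n" "2 * Suc n", where 'a = real] by simp
    have c: "real (2 * n choose n) = fact (2 * n) / (fact n * fact n)"
      using binomial_fact[of n "2 * n", where 'a = real] by (simp add: mult_2)
    have f: "(fact (Suc n) :: real) = (real n + 1) * fact n" by simp
    show ?thesis unfolding b a c f by (simp add: divide_simps) (simp add: algebra_simps)
  qed
  then have "real (2 * Suc n choose Suc n) = 2 * (2 * real n + 1) * real (2 * n choose n) / real (Suc n)"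
    by (simp add: field_simps del: binomial_Suc_Suc)
  note B = this
  have A: "central_binomial (Suc n) = central_binomial n * (2 * real n + 1) / (2 * (real n + 1))"
    unfolding central_binomial_def B by (simp add: divide_simps) (simp add: algebra_simps)
  have G: "((-1/2 :: real) gchoose Suc n) = ((-1/2) gchoose n) * (-1/2 - real n) / (real n + 1)"
    by (simp add: gbinomial_absorption[symmetric] gbinomial_Suc_rec field_simps gbinomial_mult_1)
  show ?case unfolding A G Suc.IH by (simp add: divide_simps) (simp add: algebra_simps)
qed (simp add: central_binomial_def)

text \<open>Vandermonde's identity with both upper indices -1/2; in terms of series, the square of
  (1 - x)^(-1/2) is 1/(1 - x).\<close>

lemma central_binomial_convolution: "(\<Sum>k\<le>n. central_binomial k * central_binomial (n - k)) = 1"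
proof -
  have "(\<Sum>k\<le>n. central_binomial k * central_binomial (n - k)) =
     (-1) ^ n * (\<Sum>k\<le>n. ((-1/2) gchoose k) * ((-1/2) gchoose (n - k)))"
    unfolding sum_distrib_left
  proof (intro sum.cong refl)
    fix k assume "k \<in> {..n}"
    then have "(-1 :: real) ^ n = (-1) ^ k * (-1) ^ (n - k)" by (simp flip: power_add)
    then show "central_binomial k * central_binomial (n - k) = (-1) ^ n * (((-1/2) gchoose k) * ((-1/2) gchoose (n - k)))"
      by (simp add: central_binomial_eq_gbinomial)
  qed
  also have "(\<Sum>k\<le>n. ((-1/2 :: real) gchoose k) * ((-1/2) gchoose (n - k))) = (-1) gchoose n"
    using gbinomial_Vandermonde[of "-1/2 :: real" "-1/2" n] by (simp add: atMost_atLeast0)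
  also have "(-1) ^ n * ((-1 :: real) gchoose n) = 1"
    using gbinomial_minus[of "1 :: real" n] binomial_gbinomial[of n n, where 'a = real]
    by (simp flip: power_mult_distrib mult.assoc)
  finally show ?thesis .
qed

text \<open>\<open>central_binomial n\<close> is pochhammer (1/2) n / n!, which differs by an
  elementary factor from the sequence converging to 1/Gamma(1/2) = 1/sqrt pi.\<close>

lemma central_binomial_asymptotics: "(\<lambda>n. central_binomial n * sqrt (real n)) \<longlonglongrightarrow> 1 / sqrt pi"
proof -
  have cb: "central_binomial n = pochhammer (1/2) n / fact n" for n
    by (simp add: central_binomial_eq_gbinomial gbinomial_pochhammer flip: power_mult_distrib mult.assoc)
  have "rGamma_series (1/2 :: real) \<longlonglongrightarrow> rGamma (1/2)" by (rule rGamma_series_LIMSEQ)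
  moreover have "rGamma (1/2 :: real) = 1 / sqrt pi"
    by (simp add: rGamma_inverse_Gamma Gamma_one_half_real field_simps)
  ultimately have lim: "rGamma_series (1/2 :: real) \<longlonglongrightarrow> 1 / sqrt pi" by simp
  have "(\<lambda>n. real n / (real n + 1/2)) \<longlonglongrightarrow> 1" by real_asymp
  from tendsto_mult[OF lim this]
  have "(\<lambda>n. rGamma_series (1/2) n * (real n / (real n + 1/2))) \<longlonglongrightarrow> 1 / sqrt pi" by simp
  moreover have "\<forall>\<^sub>F n in sequentially. rGamma_series (1/2) n * (real n / (real n + 1/2)) = central_binomial n * sqrt (real n)"
    using eventually_gt_at_top[of 0]
  proof eventually_elim
    case (elim n)
    have "exp (1/2 * ln (real n)) = sqrt (real n)" using elim by (simp add: powr_half_sqrt[symmetric] powr_def)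
    then have "rGamma_series (1/2) n = (pochhammer (1/2) n / fact n) * (real n + 1/2) / sqrt (real n)"
      by (simp add: rGamma_series_def pochhammer_Suc add.commute)
    moreover have "real n + 1/2 \<noteq> 0" by (simp add: add_nonneg_eq_0_iff)
    ultimately have "rGamma_series (1/2) n * (real n / (real n + 1/2)) = central_binomial n * (real n / sqrt (real n))"
      by (simp only: cb) (simp add: divide_simps)
    then show ?case by (simp add: real_div_sqrt)
  qed
  ultimately show ?thesis by (rule Lim_transform_eventually)
qed

lemma central_binomial_pos: "central_binomial n > 0"
  by (simp add: central_binomial_def zero_less_binomial_iff)

lemma central_binomial_tendsto_0: "central_binomial \<longlonglongrightarrow> 0"
proof -
  have "(\<lambda>n. (1 / sqrt (real n))) \<longlonglongrightarrow> 0" by real_asymp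
  from tendsto_mult[OF central_binomial_asymptotics this]
  have "(\<lambda>n. central_binomial n * sqrt (real n) * (1 / sqrt (real n))) \<longlonglongrightarrow> 0" by simp
  moreover have "\<forall>\<^sub>F n in sequentially. central_binomial n * sqrt (real n) * (1 / sqrt (real n)) = central_binomial n"
    using eventually_gt_at_top[of 0] by eventually_elim simp
  ultimately show ?thesis by (rule Lim_transform_eventually)
qed

text \<open>At m = 2 the growth rate concerns the central binomial coefficients, and comparison with
  their known asymptotics gives c * sqrt 2 = 1 / sqrt pi.\<close>

theorem binomial_asymptotics:
  fixes m :: nat
  assumes m: "m \<ge> 2"
  shows "(\<lambda>n. real (m * n choose n) * ((real m - 1) ^ (m - 1) / real m ^ m) ^ n / central_binomial n)
    \<longlonglongrightarrow> sqrt (real m / (2 * (real m - 1)))"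
proof -
  obtain c where c: "\<And>m::nat. m \<ge> 2 \<Longrightarrow>
    (\<lambda>n. real (m * n choose n) * ((real m - 1) ^ (m - 1) / real m ^ m) ^ n * sqrt (real n)) \<longlonglongrightarrow> c * sqrt (real m / (real m - 1))"
    by (rule binomial_growth) blast
  have "(\<lambda>n. central_binomial n * sqrt (real n)) \<longlonglongrightarrow> c * sqrt 2"
    using c[of 2] by (simp add: central_binomial_def power_divide)
  then have cs: "c * sqrt 2 = 1 / sqrt pi" using central_binomial_asymptotics LIMSEQ_unique by blast
  have "(\<lambda>n. (real (m * n choose n) * ((real m - 1) ^ (m - 1) / real m ^ m) ^ n * sqrt (real n)) / (central_binomial n * sqrt (real n)))
     \<longlonglongrightarrow> (c * sqrt (real m / (real m - 1))) / (1 / sqrt pi)"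
    by (intro tendsto_divide c[OF m] central_binomial_asymptotics) simp
  moreover have "(c * sqrt (real m / (real m - 1))) / (1 / sqrt pi) = sqrt (real m / (2 * (real m - 1)))"
  proof -
    have "c \<noteq> 0" using cs by auto
    moreover have "real m / (2 * (real m - 1)) = (real m / (real m - 1)) / 2" by simp
    then have "sqrt (real m / (2 * (real m - 1))) = sqrt (real m / (real m - 1)) / sqrt 2"
      by (simp only: real_sqrt_divide)
    ultimately show ?thesis unfolding cs[symmetric] by simp
  qed
  moreover have "\<forall>\<^sub>F n in sequentially. (real (m * n choose n) * ((real m - 1) ^ (m - 1) / real m ^ m) ^ n * sqrt (real n)) / (central_binomial n * sqrt (real n))
     = real (m * n choose n) * ((real m - 1) ^ (m - 1) / real m ^ m) ^ n / central_binomial n"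
    using eventually_gt_at_top[of 0] by eventually_elim simp
  ultimately show ?thesis using Lim_transform_eventually by fastforce
qed

text \<open>The kernel e tends to 0 and has self-convolution 1. For fixed N the first N terms vanish
  in the limit with e, and the others are at most a small multiple of the self-convolution.\<close>

lemma convolution_tendsto_0:
  fixes e v w :: "nat \<Rightarrow> real"
  assumes pos: "\<And>n. e n > 0" and e0: "e \<longlonglongrightarrow> 0" and conv: "\<And>n. (\<Sum>k\<le>n. e k * e (n - k)) = 1"
    and v: "(\<lambda>n. v n / e n) \<longlonglongrightarrow> 0" and w: "\<And>n. \<bar>w n\<bar> \<le> M * e n"
  shows "(\<lambda>n. \<Sum>k\<le>n. v k * w (n - k)) \<longlonglongrightarrow> 0"
proof (rule LIMSEQ_I)
  fix r :: real assume r: "r > 0"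
  have M0: "M \<ge> 0" using order.trans[OF abs_ge_zero w[of 0]] pos[of 0] by (simp add: zero_le_mult_iff)
  define M' where "M' = M + 1"
  have M': "M' > 0" "\<bar>w n\<bar> \<le> M' * e n" for n
  proof -
    show "M' > 0" using M0 by (simp add: M'_def)
    have "\<bar>w n\<bar> \<le> M * e n" by (rule w)
    also have "\<dots> \<le> M' * e n" using pos[of n] by (simp add: M'_def)
    finally show "\<bar>w n\<bar> \<le> M' * e n" .
  qed
  define \<epsilon> where "\<epsilon> = r / (2 * M')"
  have eps: "\<epsilon> > 0" using r M' by (simp add: \<epsilon>_def)
  obtain N where N: "\<And>n. n \<ge> N \<Longrightarrow> \<bar>v n / e n\<bar> < \<epsilon>"
    using LIMSEQ_D[OF v eps] by auto
  have vN: "\<bar>v n\<bar> \<le> \<epsilon> * e n" if "n \<ge> N" for n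
    using N[OF that] pos[of n] by (simp add: abs_divide field_simps)
  have "(\<lambda>n. \<Sum>k<N. \<bar>v k\<bar> * (M' * e (n - k))) \<longlonglongrightarrow> (\<Sum>k<N. \<bar>v k\<bar> * (M' * 0))"
  proof (intro tendsto_sum tendsto_mult tendsto_const)
    fix k show "(\<lambda>n. e (n - k)) \<longlonglongrightarrow> 0"
      by (rule LIMSEQ_offset[of _ k]) (use e0 in simp)
  qed
  then have "(\<lambda>n. \<Sum>k<N. \<bar>v k\<bar> * (M' * e (n - k))) \<longlonglongrightarrow> 0" by simp
  from LIMSEQ_D[OF this, of "r / 2"] obtain N' where N': "\<And>n. n \<ge> N' \<Longrightarrow> \<bar>\<Sum>k<N. \<bar>v k\<bar> * (M' * e (n - k))\<bar> < r / 2"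
    using r by auto
  show "\<exists>no. \<forall>n\<ge>no. norm ((\<Sum>k\<le>n. v k * w (n - k)) - 0) < r"
  proof (intro exI allI impI)
    fix n assume n: "n \<ge> max N N'"
    have "\<bar>\<Sum>k\<le>n. v k * w (n - k)\<bar> \<le> (\<Sum>k\<le>n. \<bar>v k\<bar> * (M' * e (n - k)))"
      by (rule order.trans[OF sum_abs]) (auto simp: abs_mult intro!: sum_mono mult_left_mono M'(2))
    also have "\<dots> = (\<Sum>k<N. \<bar>v k\<bar> * (M' * e (n - k))) + (\<Sum>k\<in>{N..n}. \<bar>v k\<bar> * (M' * e (n - k)))"
      using n by (subst sum.union_disjoint[symmetric]) (auto intro!: sum.cong)
    also have "(\<Sum>k\<in>{N..n}. \<bar>v k\<bar> * (M' * e (n - k))) \<le> (\<Sum>k\<in>{N..n}. (\<epsilon> * M') * (e k * e (n - k)))"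
    proof (rule sum_mono)
      fix k assume "k \<in> {N..n}"
      then have "\<bar>v k\<bar> * (M' * e (n - k)) \<le> (\<epsilon> * e k) * (M' * e (n - k))"
        using vN[of k] M' pos[of "n - k"] by (intro mult_right_mono) auto
      then show "\<bar>v k\<bar> * (M' * e (n - k)) \<le> (\<epsilon> * M') * (e k * e (n - k))" by (simp add: algebra_simps)
    qed
    also have "\<dots> \<le> (\<Sum>k\<le>n. (\<epsilon> * M') * (e k * e (n - k)))"
      using eps M' pos by (intro sum_mono2) (auto intro!: mult_nonneg_nonneg less_imp_le)
    also have "\<dots> = \<epsilon> * M'" using conv[of n] by (simp flip: sum_distrib_left)
    also have "\<epsilon> * M' = r / 2" using M' by (simp add: \<epsilon>_def)
    finally have "\<bar>\<Sum>k\<le>n. v k * w (n - k)\<bar> \<le> (\<Sum>k<N. \<bar>v k\<bar> * (M' * e (n - k))) + r / 2" by simp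
    moreover have "(\<Sum>k<N. \<bar>v k\<bar> * (M' * e (n - k))) < r / 2" using N'[of n] n by auto
    ultimately show "norm ((\<Sum>k\<le>n. v k * w (n - k)) - 0) < r" by simp
  qed
qed

text \<open>With u = c e + v, where v is negligible against e, bilinearity leaves c^2 times the
  self-convolution of e and two terms covered by \<open>convolution_tendsto_0\<close>.\<close>

lemma convolution_square_tendsto:
  fixes e u :: "nat \<Rightarrow> real"
  assumes pos: "\<And>n. e n > 0" and e0: "e \<longlonglongrightarrow> 0" and conv: "\<And>n. (\<Sum>k\<le>n. e k * e (n - k)) = 1"
    and u: "(\<lambda>n. u n / e n) \<longlonglongrightarrow> c"
  shows "(\<lambda>n. \<Sum>k\<le>n. u k * u (n - k)) \<longlonglongrightarrow> c\<^sup>2"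
proof -
  define v where "v n = u n - c * e n" for n
  have "(\<lambda>n. u n / e n - c) \<longlonglongrightarrow> 0" using u LIM_zero by blast
  moreover have "u n / e n - c = v n / e n" for n using pos[of n] by (simp add: v_def field_simps)
  ultimately have v: "(\<lambda>n. v n / e n) \<longlonglongrightarrow> 0" by simp
  have "Bseq (\<lambda>n. u n / e n)" using u by (intro convergent_imp_Bseq) (auto simp: convergent_def)
  then obtain M where M: "\<And>n. norm (u n / e n) \<le> M" unfolding Bseq_def by blast
  have uM: "\<bar>u n\<bar> \<le> M * e n" for n using M[of n] pos[of n] by (simp add: abs_divide field_simps)
  have eM: "\<bar>c * e n\<bar> \<le> \<bar>c\<bar> * e n" for n using pos[of n] by (simp add: abs_mult)
  have "(\<lambda>n. (\<Sum>k\<le>n. v k * u (n - k)) + (\<Sum>k\<le>n. v k * (c * e (n - k))) + c\<^sup>2) \<longlonglongrightarrow> 0 + 0 + c\<^sup>2"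
    by (intro tendsto_add tendsto_const convolution_tendsto_0[OF pos e0 conv v uM] convolution_tendsto_0[OF pos e0 conv v eM])
  moreover have "(\<Sum>k\<le>n. v k * u (n - k)) + (\<Sum>k\<le>n. v k * (c * e (n - k))) + c\<^sup>2 = (\<Sum>k\<le>n. u k * u (n - k))" for n
  proof -
    have flip: "(\<Sum>k\<le>n. u k * e (n - k)) = (\<Sum>k\<le>n. e k * u (n - k))"
      by (subst sum.atLeastAtMost_rev[of _ 0 n, unfolded atLeast0AtMost add_0_left]) (auto intro!: sum.cong)
    have "(\<Sum>k\<le>n. v k * u (n - k)) + (\<Sum>k\<le>n. v k * (c * e (n - k))) =
      (\<Sum>k\<le>n. u k * u (n - k)) - c * (\<Sum>k\<le>n. e k * u (n - k)) + c * (\<Sum>k\<le>n. u k * e (n - k)) - c\<^sup>2 * (\<Sum>k\<le>n. e k * e (n - k))"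
      by (simp add: v_def sum_distrib_left sum.distrib sum_subtractf algebra_simps power2_eq_square)
    then show ?thesis by (simp add: flip conv)
  qed
  ultimately show ?thesis by simp
qed

section \<open>Generating functions of trees\<close>

definition tree_count :: "nat \<Rightarrow> nat \<Rightarrow> real" where
  "tree_count m n = real (card (word_trees m n))"

definition tree_fps :: "nat \<Rightarrow> real fps" where
  "tree_fps m = Abs_fps (tree_count m)"

lemma tree_fps_eq: "tree_fps m = 1 + fps_X * tree_fps m ^ m"
proof (rule fps_ext)
  fix n
  show "fps_nth (tree_fps m) n = fps_nth (1 + fps_X * tree_fps m ^ m) n"
  proof (cases n)
    case 0
    then show ?thesis by (simp add: tree_fps_def tree_count_def word_trees_0)
  next
    case (Suc k)
    have "(\<Sum>S\<in>word_trees m (Suc k). 1 :: real) = fps_nth (\<Prod>i<m. Abs_fps (\<lambda>n. \<Sum>S\<in>word_trees m n. 1)) k"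
      by (rule sum_word_trees_Suc) simp
    then show ?thesis by (simp add: Suc tree_fps_def tree_count_def[abs_def])
  qed
qed

text \<open>Raney numbers, the coefficients of the x-th power of the tree series, see
  \<open>fps_nth_tree_fps_power\<close>. The case n = 0 is separate because for x = 0 the fraction
  would be 0/0, that is 0 instead of 1.\<close>

definition raney :: "nat \<Rightarrow> nat \<Rightarrow> nat \<Rightarrow> real" where
  "raney m n x = (if n = 0 then 1 else real x / real (m * n + x) * real (m * n + x choose n))"

section \<open>Powers of the tree series\<close>

lemma raney_Suc_aux:
  assumes "n > 0" "m > 0"
  shows "raney m n x = real x / real n * real (m * n + x - 1 choose (n - 1))"
proof -
  obtain k where k: "n = Suc k" using assms by (cases n) auto
  obtain N where N: "m * n + x = Suc N" using assms by (cases "m * n + x") auto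
  have "real (Suc k) * real (Suc N choose Suc k) = real (Suc N) * real (N choose k)"
    using Suc_times_binomial_eq[of N k] by (metis mult.commute of_nat_mult)
  then have "real (Suc N choose Suc k) / real (Suc N) = real (N choose k) / real (Suc k)"
    by (simp add: field_simps del: binomial_Suc_Suc)
  moreover have "raney m n x = real x * (real (Suc N choose Suc k) / real (Suc N))"
    unfolding raney_def N using k by (simp del: binomial_Suc_Suc)
  ultimately show ?thesis unfolding N using k by simp
qed

text \<open>The coefficients of T^(x+1) = T^x + X T^(x+m). Absorption identities reduce the three
  terms to one common binomial coefficient.\<close>

lemma raney_rec:
  assumes n: "n > 0" and m: "m > 0"
  shows "raney m n (Suc x) = raney m n x + raney m (n - 1) (x + m)"
proof -
  obtain k where k: "n = Suc k" using n by (cases n) auto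
  define N where "N = m * n + x"
  have N: "N > 0" using n m by (simp add: N_def)
  have a: "raney m n (Suc x) = real (Suc x) / real n * real (N choose k)"
    using raney_Suc_aux[OF n m, of "Suc x"] by (simp add: N_def k)
  have b: "raney m n x = real x / real n * real (N - 1 choose k)"
    using raney_Suc_aux[OF n m, of x] by (simp add: N_def k)
  show ?thesis
  proof (cases k)
    case 0
    then show ?thesis using a b k by (simp add: raney_def)
  next
    case (Suc j)
    have Nk: "m * k + (x + m) = N" by (simp add: N_def k)
    have c: "raney m k (x + m) = real (x + m) / real k * real (N - 1 choose j)"
      using raney_Suc_aux[of k m "x + m"] m Suc Nk by simp
    obtain M where M: "N = Suc M" using N by (cases N) auto
    have "real (N choose k) = real (M choose k) + real (M choose j)" unfolding M Suc by simp
    moreover have "real k * real (M choose k) = (real M - real j) * real (M choose j)"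
    proof (cases "j \<le> M")
      case True
      have "Suc j * (M choose Suc j) = (M - j) * (M choose j)"
        using binomial_absorb_comp[of M j] binomial_absorption[of j M] by (metis mult.commute times_binomial_minus1_eq binomial_absorption)
      then have "real (Suc j * (M choose Suc j)) = real ((M - j) * (M choose j))" by simp
      then show ?thesis using True Suc by (simp add: of_nat_diff algebra_simps del: binomial_Suc_Suc)
    qed (use Suc in \<open>simp add: binomial_eq_0\<close>)
    ultimately have d: "real (N choose k) = real (M choose k) + real (M choose j)"
      and e: "real (M choose k) = (real M - real j) / real k * real (M choose j)"
      using Suc by (simp_all add: field_simps)
    have "real N = real m * (real k + 1) + real x" by (simp add: N_def k algebra_simps)
    then have Mx: "real M = real m * (real k + 1) + real x - 1" using M by simp
    \<comment> \<open>After this all terms are rational multiples of q, and the claim is an identity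
      of rational functions.\<close>
    define K q X where "K = real k" and "q = real (M choose j)" and "X = real x"
    have K: "K > 0" "K + 1 \<noteq> 0" using Suc by (simp_all add: K_def)
    have e': "real (M choose k) = (real m * (K + 1) + X - K) / K * q"
      unfolding e Mx by (simp add: K_def q_def X_def Suc)
    have "raney m n (Suc x) = (X + 1) / (K + 1) * ((real m * (K + 1) + X - K) / K * q + q)"
      unfolding a d e' by (simp add: k K_def X_def q_def add.commute)
    moreover have "raney m n x = X / (K + 1) * ((real m * (K + 1) + X - K) / K * q)"
      unfolding b using e' by (simp add: M k K_def X_def add.commute)
    moreover have "raney m (n - 1) (x + m) = (X + real m) / K * q"
      using c by (simp add: k M K_def q_def X_def add.commute)
    moreover have "(X + 1) / (K + 1) * ((real m * (K + 1) + X - K) / K * q + q) =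
        X / (K + 1) * ((real m * (K + 1) + X - K) / K * q) + (X + real m) / K * q"
      using K by (simp add: divide_simps) (simp add: algebra_simps)
    ultimately show ?thesis by simp
  qed
qed

text \<open>In \<open>raney_rec\<close> the second term has a smaller n but a larger x; hence an
  outer induction on n for all x, and an inner one on x.\<close>

lemma fps_nth_tree_fps_power:
  assumes "m > 0"
  shows "fps_nth (tree_fps m ^ x) n = raney m n x"
proof (induction n arbitrary: x rule: less_induct)
  case (less n)
  show ?case
  proof (cases "n = 0")
    case True
    then show ?thesis by (simp add: raney_def tree_fps_def tree_count_def word_trees_0 fps_power_zeroth)
  next
    case False
    show ?thesis
    proof (induction x)
      case 0
      then show ?case using False by (simp add: raney_def)
    next
      case (Suc x)
      have "tree_fps m ^ Suc x = tree_fps m ^ x * (1 + fps_X * tree_fps m ^ m)"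
        using tree_fps_eq[of m] by simp
      also have "\<dots> = tree_fps m ^ x + fps_X * tree_fps m ^ (x + m)" by (simp add: algebra_simps power_add)
      finally have "fps_nth (tree_fps m ^ Suc x) n = fps_nth (tree_fps m ^ x) n + fps_nth (tree_fps m ^ (x + m)) (n - 1)"
        using False by simp
      also have "\<dots> = raney m n x + raney m (n - 1) (x + m)" using Suc less.IH[of "n - 1" "x + m"] False by simp
      finally show ?case using raney_rec[of n m x] False assms by simp
    qed
  qed
qed

lemma tree_count_eq_raney: "m > 0 \<Longrightarrow> tree_count m n = raney m n 1"
  using fps_nth_tree_fps_power[of m 1 n] by (simp add: tree_fps_def)

lemma tree_count_eq:
  assumes "m > 0"
  shows "tree_count m n = real (m * n choose n) / (real (m - 1) * real n + 1)"
proof -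
  have "real (m * n + 1 choose n) * real (m * n + 1 - n) = real (m * n + 1) * real (m * n choose n)"
    using binomial_absorb_comp[of "m * n + 1" n] by (metis add_diff_cancel_right' mult.commute of_nat_mult)
  moreover have "m * n + 1 - n = (m - 1) * n + 1" using assms by (cases m) auto
  ultimately have *: "real (m * n + 1 choose n) * (real (m - 1) * real n + 1) = real (m * n + 1) * real (m * n choose n)"
    by (metis of_nat_1 of_nat_add of_nat_mult)
  have pos: "real (m - 1) * real n + 1 > 0" by (simp add: add_nonneg_pos)
  have "tree_count m n = real (m * n + 1 choose n) / real (m * n + 1)"
    using tree_count_eq_raney[OF assms] by (cases "n = 0") (simp_all add: raney_def)
  also have "\<dots> = real (m * n choose n) / (real (m - 1) * real n + 1)"
  proof -
    have "real (m * n + 1) \<noteq> 0" by (subst of_nat_eq_0_iff) simp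
    moreover have "real (m - 1) * real n + 1 \<noteq> 0" using pos by simp
    moreover have "real (m * n + 1 choose n) * (real (m - 1) * real n + 1) = real (m * n choose n) * real (m * n + 1)"
      using * by (simp only: mult.commute[of "real (m * n choose n)"])
    ultimately show ?thesis by (rule iffD2[OF frac_eq_eq])
  qed
  finally show ?thesis .
qed

lemma tree_count_pos: "m > 0 \<Longrightarrow> tree_count m n > 0"
  unfolding tree_count_eq by (intro divide_pos_pos) (simp_all add: zero_less_binomial_iff add_nonneg_pos)

lemma binomial_ratio_le:
  assumes m: "m \<ge> 2" and N: "N \<ge> m * n"
  shows "real (Suc N choose n) \<le> 2 * real (N choose n)"
proof -
  have "2 * n \<le> N" using N m by (meson mult_le_mono1 order.trans)
  define A B D where "A = real (Suc N choose n)" and "B = real (N choose n)" and "D = real (Suc N - n)"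
  have "A * D = real (Suc N) * B"
    unfolding A_def B_def D_def using binomial_absorb_comp[of "Suc N" n]
    by (metis diff_Suc_1 mult.commute of_nat_mult)
  moreover have "real (Suc N) \<le> 2 * D" "D > 0" using \<open>2 * n \<le> N\<close> by (simp_all add: of_nat_diff D_def)
  moreover from this have "real (Suc N) * B \<le> 2 * D * B" by (intro mult_right_mono) (simp_all add: B_def)
  ultimately have "A * D \<le> (2 * B) * D" by (simp add: ac_simps)
  then have "A \<le> 2 * B" using \<open>D > 0\<close> by (rule mult_right_le_imp_le)
  then show ?thesis by (simp only: A_def B_def)
qed

text \<open>Raising the upper index of these binomial coefficients by one at most doubles them, so
  every power of T has coefficients of the order of those of T. Polynomials in Y therefore do not
  affect leading asymptotics.\<close>

lemma tree_fps_power_bound: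
  assumes m: "m \<ge> 2" and n: "n > 0"
  shows "\<bar>fps_nth (tree_fps m ^ x) n\<bar> \<le> real x * 2 ^ x * tree_count m n"
proof -
  have le: "real (m * n + x choose n) \<le> 2 ^ x * real (m * n choose n)" for x
  proof (induction x)
    case (Suc x)
    have "real (m * n + Suc x choose n) \<le> 2 * real (m * n + x choose n)"
      using binomial_ratio_le[OF m, of n "m * n + x"] by simp
    with Suc show ?case by simp
  qed simp
  have "fps_nth (tree_fps m ^ x) n = real x / real (m * n + x) * real (m * n + x choose n)"
    using m n by (simp add: fps_nth_tree_fps_power raney_def)
  also have "\<dots> \<le> real x / (real (m - 1) * real n + 1) * (2 ^ x * real (m * n choose n))"
  proof -
    have D: "real (m - 1) * real n + 1 > 0" by (simp add: add_nonneg_pos)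
    show ?thesis
    proof (cases "x = 0")
      case False
      have "(m - 1) * n + 1 \<le> m * n + x" using m False by (simp add: diff_mult_distrib)
      then have "real (m - 1) * real n + 1 \<le> real (m * n + x)" by (metis of_nat_1 of_nat_add of_nat_le_iff of_nat_mult)
      then have "real x / real (m * n + x) \<le> real x / (real (m - 1) * real n + 1)"
        using D by (intro divide_left_mono mult_pos_pos) auto
      then show ?thesis using le[of x] D by (intro mult_mono) auto
    qed simp
  qed
  also have "\<dots> = real x * 2 ^ x * tree_count m n" using m by (simp add: tree_count_eq)
  finally show ?thesis
    using m n by (simp add: fps_nth_tree_fps_power raney_def)
qed

text \<open>The operator X d/dX, which inserts a factor equal to the tree size.\<close>

definition euler_op :: "real fps \<Rightarrow> real fps" where "euler_op f = fps_X * fps_deriv f"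

lemma fps_nth_euler_op [simp]: "fps_nth (euler_op f) n = real n * fps_nth f n"
  by (cases n) (simp_all add: euler_op_def)

lemma euler_op_mult: "euler_op (f * g) = euler_op f * g + f * euler_op g"
  by (simp add: euler_op_def algebra_simps)

lemma euler_op_add: "euler_op (f + g) = euler_op f + euler_op g"
  by (simp add: euler_op_def algebra_simps)

lemma euler_op_const [simp]: "euler_op (fps_const c) = 0" "euler_op 1 = 0" "euler_op 0 = 0"
  by (simp_all add: euler_op_def)

lemma euler_op_power: "euler_op (f ^ n) = fps_const (real n) * f ^ (n - 1) * euler_op f"
  by (simp add: euler_op_def fps_deriv_power algebra_simps fps_of_nat)

section \<open>Singular expansions\<close>

text \<open>\<open>Y\<close> is the local uniformiser \<open>m - (m - 1) T\<close> at the dominant (square root) singularity of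
  the tree series \<open>T\<close>.\<close>

definition ser_Y :: "nat \<Rightarrow> real fps" where
  "ser_Y m = fps_const (real m) - fps_const (real m - 1) * tree_fps m"

definition ser_Z :: "nat \<Rightarrow> real fps" where
  "ser_Z m = inverse (ser_Y m)"

text \<open>Real polynomials in Y, generated by monomials so that rule induction gives the closure
  properties.\<close>

inductive_set Y_polys :: "nat \<Rightarrow> real fps set" for m where
  zero: "0 \<in> Y_polys m"
| step: "p \<in> Y_polys m \<Longrightarrow> fps_const a * ser_Y m ^ i + p \<in> Y_polys m"

text \<open>Laurent polynomials in Y with pole order at most r; c is the coefficient of Y^(-r) and
  may be zero, so contributions of lower order are expressed by c = 0.\<close>

definition has_lead :: "nat \<Rightarrow> nat \<Rightarrow> real \<Rightarrow> real fps \<Rightarrow> bool" where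
  "has_lead m r c g \<longleftrightarrow> (\<exists>p\<in>Y_polys m. g = ser_Z m ^ r * (fps_const c + ser_Y m * p))"

section \<open>Calculus of Laurent polynomials in Y\<close>

context
  fixes m :: nat
  assumes m: "m \<ge> 2"
begin

private abbreviation "Y \<equiv> ser_Y m"
private abbreviation "Z \<equiv> ser_Z m"
private abbreviation "T \<equiv> tree_fps m"
private abbreviation "P \<equiv> Y_polys m"

lemma m1: "real m - 1 > 0" "real m > 0" "real m - 1 \<noteq> 0" "real m \<noteq> 0" using m by auto

lemma Y_mult_Z: "Y * Z = 1"
proof -
  have "fps_nth Y 0 = 1" by (simp add: ser_Y_def tree_fps_def tree_count_def word_trees_0)
  then show ?thesis unfolding ser_Z_def by (intro inverse_mult_eq_1') simp
qed

lemma tree_fps_eq_Y: "T = fps_const (real m / (real m - 1)) + Y * fps_const (- 1 / (real m - 1))"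
  by (rule fps_ext) (use m1 in \<open>simp add: ser_Y_def fps_mult_right_const_nth field_simps\<close>)

lemma Y_polys_add: "p \<in> P \<Longrightarrow> q \<in> P \<Longrightarrow> p + q \<in> P"
  by (induction p rule: Y_polys.induct) (auto simp: add.assoc intro: Y_polys.intros)

lemma Y_polys_monom: "fps_const a * Y ^ i \<in> P"
  using Y_polys.step[OF Y_polys.zero, of a m i] by simp

lemma Y_polys_const: "fps_const a \<in> P" using Y_polys_monom[of a 0] by simp

lemma Y_polys_Y: "Y \<in> P" using Y_polys_monom[of 1 1] by simp

lemma Y_polys_monom_mult: "q \<in> P \<Longrightarrow> (fps_const a * Y ^ i) * q \<in> P"
proof (induction q rule: Y_polys.induct)
  case (step p b j)
  have "(fps_const a * Y ^ i) * (fps_const b * Y ^ j + p) = fps_const (a * b) * Y ^ (i + j) + (fps_const a * Y ^ i) * p"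
    by (simp add: algebra_simps power_add flip: fps_const_mult)
  then show ?case using step Y_polys.step by simp
qed (simp add: Y_polys.zero)

lemma Y_polys_mult: "p \<in> P \<Longrightarrow> q \<in> P \<Longrightarrow> p * q \<in> P"
  by (induction p rule: Y_polys.induct) (auto simp: distrib_right intro: Y_polys_add Y_polys_monom_mult Y_polys.zero)

lemma Y_polys_uminus: "p \<in> P \<Longrightarrow> - p \<in> P"
  using Y_polys_mult[OF Y_polys_const[of "-1"], of p] by (simp flip: fps_const_neg)

lemma Y_polys_diff: "p \<in> P \<Longrightarrow> q \<in> P \<Longrightarrow> p - q \<in> P"
  using Y_polys_add[OF _ Y_polys_uminus, of p q] by simp

lemma has_leadI: "p \<in> P \<Longrightarrow> g = Z ^ r * (fps_const c + Y * p) \<Longrightarrow> has_lead m r c g"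
  by (auto simp: has_lead_def)

lemma has_lead_add:
  assumes "has_lead m r c g" "has_lead m r c' g'"
  shows "has_lead m r (c + c') (g + g')"
proof -
  obtain p p' where p: "p \<in> P" "g = Z ^ r * (fps_const c + Y * p)" "p' \<in> P" "g' = Z ^ r * (fps_const c' + Y * p')"
    using assms by (auto simp: has_lead_def)
  show ?thesis by (rule has_leadI[OF Y_polys_add[OF p(1,3)]]) (simp add: p algebra_simps flip: fps_const_add)
qed

lemma has_lead_mult:
  assumes "has_lead m r c g" "has_lead m r' c' g'"
  shows "has_lead m (r + r') (c * c') (g * g')"
proof -
  obtain p p' where p: "p \<in> P" "g = Z ^ r * (fps_const c + Y * p)" "p' \<in> P" "g' = Z ^ r' * (fps_const c' + Y * p')"
    using assms by (auto simp: has_lead_def)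
  have "fps_const c * p' + p * fps_const c' + Y * (p * p') \<in> P"
    using p by (intro Y_polys_add Y_polys_mult Y_polys_const Y_polys_Y)
  then show ?thesis by (rule has_leadI) (simp add: p algebra_simps power_add flip: fps_const_mult)
qed

lemma has_lead_weaken: "has_lead m r c g \<Longrightarrow> has_lead m (Suc r) 0 g"
proof -
  assume "has_lead m r c g"
  then obtain p where p: "p \<in> P" "g = Z ^ r * (fps_const c + Y * p)" by (auto simp: has_lead_def)
  have "g = Z ^ r * (Y * Z) * (fps_const c + Y * p)" by (simp add: p Y_mult_Z)
  then have "g = Z ^ Suc r * (fps_const 0 + Y * (fps_const c + Y * p))" by (simp add: algebra_simps)
  then show ?thesis by (rule has_leadI[rotated]) (intro Y_polys_add Y_polys_mult Y_polys_Y Y_polys_const p)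
qed

lemma has_lead_weaken_le: "has_lead m r c g \<Longrightarrow> r < r' \<Longrightarrow> has_lead m r' 0 g"
proof (induction r' rule: less_induct)
  case (less r')
  show ?case
  proof (cases "r' = Suc r")
    case False
    then have "has_lead m (r' - 1) 0 g" using less by simp
    then have "has_lead m (Suc (r' - 1)) 0 g" by (rule has_lead_weaken)
    then show ?thesis using less.prems by simp
  qed (use less has_lead_weaken in simp)
qed

lemma has_lead_P: "fps_const c + Y * p = g \<Longrightarrow> p \<in> P \<Longrightarrow> has_lead m 0 c g"
  by (rule has_leadI) auto

lemma has_lead_const: "has_lead m 0 c (fps_const c)"
  by (rule has_leadI[OF Y_polys.zero]) simp

lemma has_lead_zero: "has_lead m r 0 0"
  by (rule has_leadI[OF Y_polys.zero]) simp

lemma has_lead_cmult: "has_lead m r c g \<Longrightarrow> has_lead m r (a * c) (fps_const a * g)"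
  using has_lead_mult[OF has_lead_const[of a]] by simp

lemma has_lead_uminus: "has_lead m r c g \<Longrightarrow> has_lead m r (- c) (- g)"
  using has_lead_cmult[of r c g "-1"] by (simp flip: fps_const_neg)

lemma has_lead_diff: "has_lead m r c g \<Longrightarrow> has_lead m r c' g' \<Longrightarrow> has_lead m r (c - c') (g - g')"
  using has_lead_add[OF _ has_lead_uminus, of r c g c' g'] by simp

lemma has_lead_sum:
  "(\<And>i. i \<in> I \<Longrightarrow> has_lead m r (c i) (g i)) \<Longrightarrow> has_lead m r (\<Sum>i\<in>I. c i) (\<Sum>i\<in>I. g i)"
  by (induction I rule: infinite_finite_induct) (auto simp: has_lead_zero has_lead_add)

lemma has_lead_T: "has_lead m 0 (real m / (real m - 1)) T"
  by (rule has_lead_P[OF tree_fps_eq_Y[symmetric] Y_polys_const])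

lemma has_lead_T1: "has_lead m 0 (1 / (real m - 1)) (T - 1)"
proof -
  have "real m / (real m - 1) - 1 = 1 / (real m - 1)" using m1 by (simp add: field_simps)
  then show ?thesis using has_lead_diff[OF has_lead_T has_lead_const[of 1]] by simp
qed

lemma has_lead_Z_mult: "has_lead m r c g \<Longrightarrow> has_lead m (Suc r) c (Z * g)"
  by (auto simp: has_lead_def mult.assoc)

text \<open>Implicit differentiation of T = 1 + X T^m gives the factor T - m (T - 1) in front of the
  derivative, and this is Y.\<close>

lemma euler_op_T: "euler_op T = T * (T - 1) * Z"
proof -
  define F where "F = fps_X * T ^ m"
  have F: "T = 1 + F" unfolding F_def by (rule tree_fps_eq)
  have "euler_op F = F + fps_X * (fps_const (real m) * T ^ (m - 1) * euler_op T)"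
    unfolding F_def euler_op_mult euler_op_power by (simp add: euler_op_def)
  then have e: "euler_op T = F + fps_X * (fps_const (real m) * T ^ (m - 1) * euler_op T)"
    by (subst F, subst euler_op_add) simp
  have Tm: "T ^ m = T ^ (m - 1) * T" using m by (cases m) auto
  have "T * euler_op T = T * F + fps_const (real m) * (fps_X * (T ^ (m - 1) * T)) * euler_op T"
    by (subst e) (simp add: algebra_simps)
  also have "fps_X * (T ^ (m - 1) * T) = F" by (simp only: F_def Tm)
  also have F1: "F = T - 1" using F by (metis add_diff_cancel_left')
  finally have "euler_op T * (T - fps_const (real m) * (T - 1)) = T * (T - 1)" by (simp add: algebra_simps)
  moreover have "T - fps_const (real m) * (T - 1) = Y"
    by (simp add: ser_Y_def algebra_simps fps_const_sub[symmetric])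
  ultimately have "euler_op T * (Y * Z) = T * (T - 1) * Z" by (simp add: mult.assoc[symmetric])
  then show ?thesis by (simp add: Y_mult_Z)
qed

text \<open>The polynomial (m - Y) (1 - Y) / (m - 1), that is, (m - 1) T (T - 1) in terms of
  Y.\<close>

definition ser_W :: "real fps" where
  "ser_W = fps_const (1 / (real m - 1)) * (fps_const (real m) - fps_const (real m + 1) * Y + Y ^ 2)"

lemma Y_polys_W: "ser_W \<in> P"
proof -
  have "Y ^ 2 \<in> P" using Y_polys_monom[of 1 2] by simp
  then show ?thesis unfolding ser_W_def by (intro Y_polys_mult Y_polys_add Y_polys_diff Y_polys_const Y_polys_Y)
qed

lemma euler_op_Y: "euler_op Y = - ser_W * Z"
proof -
  define b where "b = real m - 1"
  have b: "b \<noteq> 0" "real m = b + 1" using m1 by (simp_all add: b_def)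
  have bT: "fps_const b * T = fps_const (real m) - Y" unfolding ser_Y_def b_def by simp
  have bT1: "fps_const b * (T - 1) = 1 - Y"
    using bT by (simp add: right_diff_distrib b flip: fps_const_add)
  have bb: "fps_const (1 / b) * fps_const b = 1" using b by simp
  have "euler_op Y = - (fps_const b * euler_op T)"
    unfolding ser_Y_def by (rule fps_ext) (simp add: b_def)
  also have "fps_const b * euler_op T = (fps_const (1 / b) * fps_const b) * (fps_const b * (T * (T - 1) * Z))"
    by (simp only: bb euler_op_T mult_1)
  also have "\<dots> = fps_const (1 / b) * ((fps_const b * T) * (fps_const b * (T - 1))) * Z"
    by (simp only: ac_simps)
  also have "(fps_const b * T) * (fps_const b * (T - 1)) = fps_const (real m) - fps_const (real m + 1) * Y + Y ^ 2"
    unfolding bT bT1 by (simp add: algebra_simps power2_eq_square flip: fps_const_add)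
  finally show ?thesis by (simp add: ser_W_def b_def)
qed

lemma euler_op_Z: "euler_op Z = ser_W * Z ^ 3"
proof -
  have "euler_op (Y * Z) = 0" by (simp add: Y_mult_Z)
  then have "Y * euler_op Z = ser_W * Z * Z" unfolding euler_op_mult euler_op_Y by (simp add: algebra_simps eq_neg_iff_add_eq_0)
  then have "(Y * Z) * euler_op Z = ser_W * Z ^ 3" by (simp add: algebra_simps power3_eq_cube)
  then show ?thesis by (simp add: Y_mult_Z)
qed

lemma euler_op_Z_power: "euler_op (Z ^ r) = fps_const (real r) * ser_W * Z ^ (r + 2)"
proof (cases r)
  case (Suc k)
  have "Z ^ (r + 2) = Z ^ (r - 1) * Z ^ 3" unfolding Suc by (simp flip: power_add add: numeral_3_eq_3)
  then show ?thesis unfolding euler_op_power euler_op_Z by (simp add: algebra_simps)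
qed simp

lemma euler_op_P: "p \<in> P \<Longrightarrow> \<exists>q\<in>P. euler_op p = Z * q"
proof (induction p rule: Y_polys.induct)
  case zero
  then show ?case using Y_polys.zero by (intro bexI[of _ 0]) simp_all
next
  case (step p a i)
  then obtain q where q: "q \<in> P" "euler_op p = Z * q" by blast
  have "fps_const a * (fps_const (real i) * Y ^ (i - 1) * (- ser_W)) + q \<in> P"
    using Y_polys_mult[OF Y_polys_const Y_polys_mult[OF Y_polys_monom Y_polys_uminus[OF Y_polys_W]], of a "real i" "i - 1"] q(1) by (intro Y_polys_add) (simp_all add: mult.assoc)
  moreover have "euler_op (fps_const a * Y ^ i + p) = Z * (fps_const a * (fps_const (real i) * Y ^ (i - 1) * (- ser_W)) + q)"
    unfolding euler_op_add euler_op_mult euler_op_power euler_op_Y q(2) by (simp add: algebra_simps)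
  ultimately show ?case by blast
qed

text \<open>The conjugate of \<open>euler_op\<close> by multiplication with T, see
  \<open>euler_op_T_mult\<close>.\<close>

definition D1 :: "real fps \<Rightarrow> real fps" where
  "D1 g = (T - 1) * Z * g + euler_op g"

lemma euler_op_T_mult: "euler_op (T * g) = T * D1 g"
  unfolding euler_op_mult euler_op_T D1_def by (simp add: algebra_simps)

text \<open>The derivative of Z^r is r W Z^(r+2), and W has constant term m / (m - 1) in Y, so two
  pole orders are gained. Differentiating the polynomial factor gains only one, which leaves a spare
  factor Y.\<close>

lemma has_lead_euler_op:
  assumes "has_lead m r c g"
  shows "has_lead m (r + 2) (real r * c * (real m / (real m - 1))) (euler_op g)"
proof -
  obtain p where p: "p \<in> P" "g = Z ^ r * (fps_const c + Y * p)" using assms by (auto simp: has_lead_def)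
  define h where "h = fps_const c + Y * p"
  have h: "h \<in> P" unfolding h_def by (intro Y_polys_add Y_polys_mult Y_polys_const Y_polys_Y p)
  obtain q where q: "q \<in> P" "euler_op h = Z * q" using euler_op_P[OF h] by blast
  have W: "ser_W = fps_const (real m / (real m - 1)) + Y * (fps_const (1 / (real m - 1)) * (Y - fps_const (real m + 1)))"
    by (simp add: ser_W_def algebra_simps power2_eq_square flip: fps_const_mult)
  define w where "w = fps_const (1 / (real m - 1)) * (Y - fps_const (real m + 1))"
  have w: "w \<in> P" unfolding w_def by (intro Y_polys_mult Y_polys_diff Y_polys_const Y_polys_Y)
  have "euler_op g = Z ^ (r + 2) * (fps_const (real r) * ser_W * h) + Z ^ r * (Z * q)"
    unfolding p(2) h_def[symmetric] euler_op_mult euler_op_Z_power q(2) by (simp add: algebra_simps)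
  also have "Z ^ r * (Z * q) = Z ^ r * (Y * Z) * (Z * q)" by (simp add: Y_mult_Z)
  finally have "euler_op g = Z ^ (r + 2) * (fps_const (real r) * ser_W * h + Y * q)"
    by (simp add: algebra_simps power2_eq_square)
  also have "fps_const (real r) * ser_W * h + Y * q = fps_const (real r * c * (real m / (real m - 1))) +
      Y * (fps_const (real r) * (w * h + fps_const (real m / (real m - 1)) * p) + q)"
  proof -
    have "fps_const (real r) * ser_W * h = fps_const (real r) * (fps_const (real m / (real m - 1)) * h + Y * (w * h))"
      unfolding W w_def[symmetric] by (simp add: algebra_simps)
    also have "fps_const (real m / (real m - 1)) * h = fps_const (real m / (real m - 1) * c) + Y * (fps_const (real m / (real m - 1)) * p)"
      unfolding h_def by (simp add: algebra_simps flip: fps_const_mult)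
    finally show ?thesis by (simp add: algebra_simps flip: fps_const_mult)
  qed
  finally show ?thesis
    by (rule has_leadI[rotated]) (intro Y_polys_add Y_polys_mult Y_polys_const w h p q)
qed

lemma has_lead_D1:
  assumes "has_lead m r c g"
  shows "has_lead m (r + 2) (real r * c * (real m / (real m - 1))) (D1 g)"
proof -
  have "has_lead m (Suc (0 + r)) (1 / (real m - 1) * c) (Z * ((T - 1) * g))"
    by (intro has_lead_Z_mult has_lead_mult has_lead_T1 assms)
  then have "has_lead m (r + 2) 0 (Z * ((T - 1) * g))" by (rule has_lead_weaken_le) simp
  from has_lead_add[OF this has_lead_euler_op[OF assms]] show ?thesis by (simp add: D1_def algebra_simps)
qed

text \<open>The derivative of 1 vanishes, so the other term of \<open>D1\<close> takes over and
  gives a simple pole. This is the start of the whole recursion.\<close>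

lemma has_lead_D1_one: "has_lead m 1 (1 / (real m - 1)) (D1 1)"
  using has_lead_Z_mult[OF has_lead_T1] by (simp add: D1_def mult.commute)

lemma has_lead_D1_funpow: "has_lead m r c g \<Longrightarrow> \<exists>c'. has_lead m (r + 2 * j) c' ((D1 ^^ j) g)"
proof (induction j)
  case (Suc j)
  then obtain c' where "has_lead m (r + 2 * j) c' ((D1 ^^ j) g)" by blast
  from has_lead_D1[OF this] show ?case by (auto simp: algebra_simps)
qed auto

lemma has_lead_D1_funpow_one: "j > 0 \<Longrightarrow> \<exists>c'. has_lead m (2 * j - 1) c' ((D1 ^^ j) 1)"
proof -
  assume "j > 0"
  then obtain k where k: "j = Suc k" by (cases j) auto
  have "\<exists>c'. has_lead m (1 + 2 * k) c' ((D1 ^^ k) (D1 1))"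
    by (rule has_lead_D1_funpow[OF has_lead_D1_one])
  then show ?thesis unfolding k funpow_Suc_right by simp
qed

end

section \<open>Moment generating functions\<close>

text \<open>Division by k! makes this the coefficient of t^k in the sum of exp (t area), so that
  adding areas means multiplying series in t.\<close>

definition moment_fps :: "nat \<Rightarrow> nat \<Rightarrow> real fps" where
  "moment_fps m k = Abs_fps (\<lambda>n. \<Sum>S\<in>word_trees m n. real (area m S) ^ k / fact k)"

text \<open>In a series whose outer variable marks size and whose inner one marks the moment order,
  this exchanges the two roles; it is multiplicative, so products over branches are
  preserved.\<close>

definition swap_fps :: "'a::comm_ring_1 fps fps \<Rightarrow> 'a fps fps" where
  "swap_fps A = Abs_fps (\<lambda>k. Abs_fps (\<lambda>n. fps_nth (fps_nth A n) k))"

lemma fps_nth_swap [simp]: "fps_nth (fps_nth (swap_fps A) k) n = fps_nth (fps_nth A n) k"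
  by (simp add: swap_fps_def)

lemma swap_fps_mult: "swap_fps (A * B) = swap_fps A * swap_fps B"
proof (rule fps_ext, rule fps_ext)
  fix k n
  have "fps_nth (fps_nth (swap_fps (A * B)) k) n =
     (\<Sum>i=0..n. \<Sum>j=0..k. fps_nth (fps_nth A i) j * fps_nth (fps_nth B (n - i)) (k - j))"
    by (simp add: fps_mult_nth fps_sum_nth)
  also have "\<dots> = (\<Sum>j=0..k. \<Sum>i=0..n. fps_nth (fps_nth A i) j * fps_nth (fps_nth B (n - i)) (k - j))"
    by (rule sum.swap)
  also have "\<dots> = fps_nth (fps_nth (swap_fps A * swap_fps B) k) n"
    by (simp add: fps_mult_nth fps_sum_nth)
  finally show "fps_nth (fps_nth (swap_fps (A * B)) k) n = fps_nth (fps_nth (swap_fps A * swap_fps B) k) n" .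
qed

lemma swap_fps_1: "swap_fps 1 = 1"
  by (rule fps_ext, rule fps_ext) (simp add: fps_one_nth)

lemma swap_fps_prod: "finite I \<Longrightarrow> swap_fps (\<Prod>i\<in>I. A i) = (\<Prod>i\<in>I. swap_fps (A i))"
  by (induction I rule: finite_induct) (simp_all add: swap_fps_1 swap_fps_mult)

lemma prod_fps_exp: "(\<Prod>i\<in>I. fps_exp (c i :: real)) = fps_exp (\<Sum>i\<in>I. c i)"
  by (induction I rule: infinite_finite_induct) (simp_all add: fps_exp_add_mult)

lemma fps_nth_euler_op_funpow: "fps_nth ((euler_op ^^ j) f) n = real n ^ j * fps_nth f n"
  by (induction j) simp_all

text \<open>The number c stands for the weight m - 1 - i that the i-th branch at the root adds to
  each of its nodes.\<close>

definition shifted_fps :: "nat \<Rightarrow> nat \<Rightarrow> real fps fps" where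
  "shifted_fps m c = Abs_fps (\<lambda>n. \<Sum>S\<in>word_trees m n. fps_exp (real (area m S + c * card S)))"

text \<open>exp (t (area + c n)) factors as exp (t c n) exp (t area), and a factor n^j amounts to j
  applications of \<open>euler_op\<close>.\<close>

lemma swap_shifted_fps:
  "fps_nth (swap_fps (shifted_fps m c)) k = (\<Sum>j=0..k. fps_const (real c ^ j / fact j) * (euler_op ^^ j) (moment_fps m (k - j)))"
proof (rule fps_ext)
  fix n
  have "fps_nth (fps_nth (swap_fps (shifted_fps m c)) k) n = (\<Sum>S\<in>word_trees m n. fps_nth (fps_exp (real c * real n) * fps_exp (real (area m S))) k)"
    unfolding fps_nth_swap shifted_fps_def fps_exp_add_mult[symmetric]
    by (simp add: fps_sum_nth add.commute word_trees_def)
  also have "\<dots> = (\<Sum>S\<in>word_trees m n. \<Sum>j=0..k. (real c ^ j / fact j) * real n ^ j * (real (area m S) ^ (k - j) / fact (k - j)))"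
    by (simp add: fps_mult_nth power_mult_distrib)
  also have "\<dots> = (\<Sum>j=0..k. \<Sum>S\<in>word_trees m n. (real c ^ j / fact j) * real n ^ j * (real (area m S) ^ (k - j) / fact (k - j)))"
    by (rule sum.swap)
  also have "\<dots> = fps_nth (\<Sum>j=0..k. fps_const (real c ^ j / fact j) * (euler_op ^^ j) (moment_fps m (k - j))) n"
    by (simp add: fps_sum_nth fps_nth_euler_op_funpow moment_fps_def sum_distrib_left mult.assoc)
  finally show "fps_nth (fps_nth (swap_fps (shifted_fps m c)) k) n = fps_nth (\<Sum>j=0..k. fps_const (real c ^ j / fact j) * (euler_op ^^ j) (moment_fps m (k - j))) n" .
qed

text \<open>\<open>area_graft\<close> in exponential form. For k > 0 the empty tree contributes
  nothing, so no constant term appears.\<close>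

lemma moment_fps_rec:
  assumes k: "k > 0"
  shows "moment_fps m k = fps_X * fps_nth (\<Prod>i<m. swap_fps (shifted_fps m (m - 1 - i))) k"
proof (rule fps_ext)
  fix n
  show "fps_nth (moment_fps m k) n = fps_nth (fps_X * fps_nth (\<Prod>i<m. swap_fps (shifted_fps m (m - 1 - i))) k) n"
  proof (cases n)
    case 0
    then show ?thesis using k by (simp add: moment_fps_def word_trees_0 area_def)
  next
    case (Suc l)
    have "(\<Sum>S\<in>word_trees m (Suc l). fps_exp (real (area m S))) = fps_nth (\<Prod>i<m. shifted_fps m (m - 1 - i)) l"
      unfolding shifted_fps_def
      by (rule sum_word_trees_Suc) (simp only: area_graft prod_fps_exp of_nat_sum)
    then have "fps_nth (\<Sum>S\<in>word_trees m (Suc l). fps_exp (real (area m S))) k = fps_nth (fps_nth (swap_fps (\<Prod>i<m. shifted_fps m (m - 1 - i))) k) l"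
      by simp
    then show ?thesis unfolding swap_fps_prod[OF finite_lessThan]
      by (simp add: Suc moment_fps_def fps_sum_nth)
  qed
qed

lemma moment_fps_0: "moment_fps m 0 = tree_fps m"
  by (simp add: moment_fps_def tree_fps_def tree_count_def[abs_def])

text \<open>Normalised so that order 0 gives 1; products over the branches then have constant term 1
  in t.\<close>

definition reduced_moment :: "nat \<Rightarrow> nat \<Rightarrow> real fps" where
  "reduced_moment m k = moment_fps m k * inverse (tree_fps m)"

text \<open>The rescaling that turns the recursion of \<open>airy_Omega\<close> into that of the
  leading coefficients: 1/m adjusts the convolution, m^2 / (m - 1) the linear term.\<close>

definition airy_phi :: "nat \<Rightarrow> nat \<Rightarrow> real" where
  "airy_phi m k = (1 / real m) * ((real m)\<^sup>2 / (real m - 1)) ^ k * airy_Omega k / fact k"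

section \<open>Leading coefficients of the reduced moments\<close>

context
  fixes m :: nat
  assumes m: "m \<ge> 2"
begin

private abbreviation "f \<equiv> reduced_moment m"
private abbreviation "lead \<equiv> has_lead m"
private abbreviation "\<phi> \<equiv> airy_phi m"

lemma tree_fps_inverse: "tree_fps m * inverse (tree_fps m) = 1"
  by (rule inverse_mult_eq_1') (simp add: tree_fps_def tree_count_def word_trees_0)

lemma moment_eq: "moment_fps m k = tree_fps m * f k"
proof -
  have "tree_fps m * f k = moment_fps m k * (tree_fps m * inverse (tree_fps m))" by (simp add: reduced_moment_def ac_simps)
  then show ?thesis by (simp add: tree_fps_inverse)
qed

lemma reduced_moment_0: "f 0 = 1" by (simp add: reduced_moment_def moment_fps_0 tree_fps_inverse)

text \<open>The series of \<open>swap_shifted_fps\<close> after a factor T is split off, which turns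
  \<open>euler_op\<close> into its conjugate \<open>D1\<close>.\<close>

definition shifted_reduced :: "nat \<Rightarrow> real fps fps" where
  "shifted_reduced c = Abs_fps (\<lambda>k. \<Sum>j=0..k. fps_const (real c ^ j / fact j) * (D1 m ^^ j) (f (k - j)))"

lemma euler_op_funpow_T_mult: "(euler_op ^^ j) (tree_fps m * g) = tree_fps m * (D1 m ^^ j) g"
  by (induction j) (simp_all add: euler_op_T_mult[OF m])

lemma swap_shifted_eq: "swap_fps (shifted_fps m c) = fps_const (tree_fps m) * shifted_reduced c"
  by (rule fps_ext) (simp add: swap_shifted_fps shifted_reduced_def moment_eq euler_op_funpow_T_mult sum_distrib_left algebra_simps)

text \<open>The factors T split off from the m branches combine with X to X T^m = T - 1.\<close>

lemma reduced_rec: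
  assumes "k > 0"
  shows "tree_fps m * f k = (tree_fps m - 1) * fps_nth (\<Prod>i<m. shifted_reduced (m - 1 - i)) k"
proof -
  have "(\<Prod>i<m. swap_fps (shifted_fps m (m - 1 - i))) = fps_const (tree_fps m ^ m) * (\<Prod>i<m. shifted_reduced (m - 1 - i))"
    unfolding swap_shifted_eq prod.distrib by (simp add: fps_const_power)
  then have "moment_fps m k = fps_X * tree_fps m ^ m * fps_nth (\<Prod>i<m. shifted_reduced (m - 1 - i)) k"
    using moment_fps_rec[OF assms, of m] by (simp add: mult.assoc)
  moreover have "fps_X * tree_fps m ^ m = tree_fps m - 1" using tree_fps_eq[of m] by (metis add_diff_cancel_left')
  ultimately show ?thesis by (simp add: moment_eq)
qed

lemma airy_phi_rec:
  assumes k: "k \<ge> 1"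
  shows "airy_phi m k = (real m / 2) * ((3 * real k - 4) * \<phi> (k - 1) * (real m / (real m - 1)) + (\<Sum>j=1..k-1. \<phi> j * \<phi> (k - j)))"
proof -
  define M where "M = real m"
  have M: "M > 1" using m by (simp add: M_def)
  define l where "l = M\<^sup>2 / (M - 1)"
  have l: "l \<noteq> 0" "M / (M - 1) = l / M" using M by (auto simp: l_def power2_eq_square)
  obtain j where j: "k = Suc j" using k by (cases k) auto
  have "\<phi> i * \<phi> (k - i) = l ^ k / (M\<^sup>2 * fact k) * (real (k choose i) * airy_Omega i * airy_Omega (k - i))" if "i \<in> {1..k-1}" for i
  proof -
    have "real (k choose i) = fact k / (fact i * fact (k - i))" using that by (intro binomial_fact) auto
    moreover have "k = i + (k - i)" using that by auto
    then have "l ^ k = l ^ i * l ^ (k - i)" by (metis power_add)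
    moreover have "\<phi> i = (1 / M) * l ^ i * airy_Omega i / fact i" "\<phi> (k - i) = (1 / M) * l ^ (k - i) * airy_Omega (k - i) / fact (k - i)"
      by (simp_all add: airy_phi_def M_def l_def)
    ultimately show ?thesis using M by (simp add: power2_eq_square ac_simps)
  qed
  then have Q: "(\<Sum>i=1..k-1. \<phi> i * \<phi> (k - i)) = l ^ k / (M\<^sup>2 * fact k) * (\<Sum>i=1..k-1. real (k choose i) * airy_Omega i * airy_Omega (k - i))"
    unfolding sum_distrib_left by (intro sum.cong) auto
  have E: "(3 * real k - 4) * \<phi> (k - 1) * (M / (M - 1)) = l ^ k / (M\<^sup>2 * fact k) * ((3 * real k - 4) * real k * airy_Omega (k - 1))"
  proof -
    have f: "fact k = real k * fact j" by (simp add: j)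
    have kk: "real k > 0" using k by simp
    have p: "\<phi> (k - 1) = (1 / M) * l ^ j * airy_Omega j / fact j" by (simp add: airy_phi_def M_def l_def j)
    have "(3 * real k - 4) * ((1 / M) * l ^ j * airy_Omega j / fact j) * (l / M) =
       (l * l ^ j) / (M\<^sup>2 * (real k * fact j)) * ((3 * real k - 4) * real k * airy_Omega j)"
      using M kk by (simp add: power2_eq_square ac_simps)
    then show ?thesis unfolding p l(2) f by (simp add: j)
  qed
  have O: "2 * airy_Omega k = (3 * real k - 4) * real k * airy_Omega (k - 1) + (\<Sum>i=1..k-1. real (k choose i) * airy_Omega i * airy_Omega (k - i))"
    using k by (subst airy_Omega.simps) simp
  have "(real m / 2) * ((3 * real k - 4) * \<phi> (k - 1) * (real m / (real m - 1)) + (\<Sum>j=1..k-1. \<phi> j * \<phi> (k - j)))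
    = (M / 2) * (l ^ k / (M\<^sup>2 * fact k) * (2 * airy_Omega k))"
    unfolding Q E[unfolded M_def] O M_def by (simp add: algebra_simps)
  also have "\<dots> = \<phi> k"
  proof -
    have "\<phi> k = (1 / M) * l ^ k * airy_Omega k / fact k" by (simp add: airy_phi_def M_def l_def)
    then show ?thesis using M by (simp add: power2_eq_square)
  qed
  finally show ?thesis by simp
qed

lemma shifted_reduced_nth: "fps_nth (shifted_reduced c) k = (\<Sum>j=0..k. fps_const (real c ^ j / fact j) * (D1 m ^^ j) (f (k - j)))"
  by (simp add: shifted_reduced_def)

text \<open>Each \<open>D1\<close> costs two pole orders, while lowering the moment index by one
  saves three. The j-th term thus has order 3 k - j - 1 for j < k and 2 k - 1 for j = k, which is
  below 3 k - a.\<close>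

lemma shifted_tail:
  assumes IH: "\<And>j. 1 \<le> j \<Longrightarrow> j < k \<Longrightarrow> lead (3 * j - 1) (\<phi> j) (f j)" and a: "a \<ge> 1" "a \<le> 2" and k: "k \<ge> 1"
  shows "lead (3 * k - a) 0 (\<Sum>j=a..k. fps_const (real c ^ j / fact j) * (D1 m ^^ j) (f (k - j)))"
proof -
  have *: "lead (3 * k - a) 0 (fps_const (real c ^ j / fact j) * (D1 m ^^ j) (f (k - j)))" if j: "j \<in> {a..k}" for j
  proof -
    have "lead (3 * k - a) 0 ((D1 m ^^ j) (f (k - j)))"
    proof (cases "j = k")
      case True
      then obtain c' where "lead (2 * j - 1) c' ((D1 m ^^ j) 1)" using has_lead_D1_funpow_one[OF m, of j] k by auto
      then show ?thesis
        using True j a k reduced_moment_0 by (intro has_lead_weaken_le[OF m, of "2 * j - 1" c']) auto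
    next
      case False
      then have "lead (3 * (k - j) - 1) (\<phi> (k - j)) (f (k - j))" using j a by (intro IH) auto
      from has_lead_D1_funpow[OF m this, of j] obtain c' where "lead (3 * (k - j) - 1 + 2 * j) c' ((D1 m ^^ j) (f (k - j)))" by blast
      then show ?thesis using j a False by (elim has_lead_weaken_le[OF m]) auto
    qed
    from has_lead_cmult[OF m this, of "real c ^ j / fact j"] show ?thesis by simp
  qed
  have "lead (3 * k - a) (\<Sum>j=a..k. 0) (\<Sum>j=a..k. fps_const (real c ^ j / fact j) * (D1 m ^^ j) (f (k - j)))"
    by (rule has_lead_sum[OF m]) (rule *)
  then show ?thesis by simp
qed

lemma shifted_lead:
  assumes IH: "\<And>j. 1 \<le> j \<Longrightarrow> j < k \<Longrightarrow> lead (3 * j - 1) (\<phi> j) (f j)" and j: "1 \<le> j" "j < k"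
  shows "lead (3 * j - 1) (\<phi> j) (fps_nth (shifted_reduced c) j)"
proof -
  have "fps_nth (shifted_reduced c) j = f j + (\<Sum>i=1..j. fps_const (real c ^ i / fact i) * (D1 m ^^ i) (f (j - i)))"
    by (simp add: shifted_reduced_nth sum.atLeast_Suc_atMost)
  moreover have "lead (3 * j - 1) 0 (\<Sum>i=1..j. fps_const (real c ^ i / fact i) * (D1 m ^^ i) (f (j - i)))"
    using IH j by (intro shifted_tail) auto
  ultimately show ?thesis using has_lead_add[OF m IH[OF j]] by fastforce
qed

text \<open>Once f k is removed, the term j = 1 dominates: one application of \<open>D1\<close> to
  the preceding moment, which becomes the linear term of the Airy recursion.\<close>

lemma shifted_second_order:
  assumes IH: "\<And>j. 1 \<le> j \<Longrightarrow> j < k \<Longrightarrow> lead (3 * j - 1) (\<phi> j) (f j)" and k: "k \<ge> 1"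
  shows "lead (3 * k - 2) (real c * ((3 * real k - 4) * \<phi> (k - 1) * (real m / (real m - 1)))) (fps_nth (shifted_reduced c) k - f k)"
proof -
  have "fps_nth (shifted_reduced c) k - f k = fps_const (real c) * D1 m (f (k - 1)) + (\<Sum>i=2..k. fps_const (real c ^ i / fact i) * (D1 m ^^ i) (f (k - i)))"
    using k by (simp add: shifted_reduced_nth sum.atLeast_Suc_atMost numeral_2_eq_2)
  moreover have "lead (3 * k - 2) 0 (\<Sum>i=2..k. fps_const (real c ^ i / fact i) * (D1 m ^^ i) (f (k - i)))"
    using IH k by (intro shifted_tail) auto
  moreover have "lead (3 * k - 2) ((3 * real k - 4) * \<phi> (k - 1) * (real m / (real m - 1))) (D1 m (f (k - 1)))"
  proof (cases "k = 1")
    \<comment> \<open>Here f 0 = 1 has no pole and \<open>has_lead_D1_one\<close> takes the place of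
      \<open>has_lead_D1\<close>. The value still fits the formula because 3 k - 4 = -1 meets
      \<open>airy_Omega 0\<close> = -1.\<close>
    case True
    have "\<phi> 0 = - 1 / real m" by (simp add: airy_phi_def airy_Omega.simps)
    then have "(3 * real k - 4) * \<phi> (k - 1) * (real m / (real m - 1)) = 1 / (real m - 1)" using True m by simp
    then show ?thesis using has_lead_D1_one[OF m] True reduced_moment_0 by simp
  next
    case False
    then have "lead (3 * (k - 1) - 1) (\<phi> (k - 1)) (f (k - 1))" using k by (intro IH) auto
    from has_lead_D1[OF m this]
    have "lead (3 * (k - 1) - 1 + 2) (real (3 * (k - 1) - 1) * \<phi> (k - 1) * (real m / (real m - 1))) (D1 m (f (k - 1)))" .
    moreover have "3 * (k - 1) - 1 + 2 = 3 * k - 2" "real (3 * (k - 1) - 1) = 3 * real k - 4" using False k by (auto simp: of_nat_diff)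
    ultimately show ?thesis by simp
  qed
  ultimately show ?thesis using has_lead_add[OF m has_lead_cmult[OF m]] by fastforce
qed

lemma fps_mult_nth_split:
  fixes A B :: "real fps fps"
  assumes "fps_nth A 0 = 1" "fps_nth B 0 = 1" "k \<ge> 1"
  shows "fps_nth (A * B) k = fps_nth A k + fps_nth B k + (\<Sum>j=1..k-1. fps_nth A j * fps_nth B (k - j))"
proof -
  obtain l where k: "k = Suc l" using assms(3) by (cases k) auto
  have "fps_nth (A * B) k = fps_nth A 0 * fps_nth B k + (\<Sum>j=Suc 0..k. fps_nth A j * fps_nth B (k - j))"
    unfolding fps_mult_nth by (simp add: sum.atLeast_Suc_atMost)
  also have "(\<Sum>j=Suc 0..k. fps_nth A j * fps_nth B (k - j)) = (\<Sum>j=1..k-1. fps_nth A j * fps_nth B (k - j)) + fps_nth A k * fps_nth B 0"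
    unfolding k by simp
  finally show ?thesis using assms by (simp add: add.commute add.left_commute)
qed

text \<open>In the root decomposition f k occurs on the right once for each branch, with factor T -
  1. Collecting it on the left produces T - m (T - 1) = Y, and dividing by Y raises the pole order
  of the remainder R from 3 k - 2 to 3 k - 1.\<close>

lemma reduced_moment_lead: "k \<ge> 1 \<Longrightarrow> lead (3 * k - 1) (\<phi> k) (f k)"
proof (induction k rule: less_induct)
  case (less k)
  have IH: "lead (3 * j - 1) (\<phi> j) (f j)" if "1 \<le> j" "j < k" for j using less that by blast
  note k = less.prems
  define b where "b i = shifted_reduced (m - 1 - i)" for i
  define P where "P n = (\<Prod>i<n. b i)" for n
  define e where "e = (3 * real k - 4) * \<phi> (k - 1) * (real m / (real m - 1))"
  define Q where "Q = (\<Sum>j=1..k-1. \<phi> j * \<phi> (k - j))"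
  have b0: "fps_nth (b i) 0 = 1" for i by (simp add: b_def shifted_reduced_nth reduced_moment_0)
  have bl: "lead (3 * j - 1) (\<phi> j) (fps_nth (b i) j)" if "1 \<le> j" "j < k" for i j
    unfolding b_def using shifted_lead[OF IH] that by blast
  have b2: "lead (3 * k - 2) (real (m - 1 - i) * e) (fps_nth (b i) k - f k)" for i
    unfolding b_def e_def using shifted_second_order[OF IH k] by blast
  have P0: "fps_nth (P n) 0 = 1" for n
    by (induction n) (simp_all add: P_def b0)
  have P1: "\<forall>j. 1 \<le> j \<and> j < k \<longrightarrow> lead (3 * j - 1) (real n * \<phi> j) (fps_nth (P n) j)" for n
  proof (induction n)
    case 0
    have "fps_nth (P 0) j = 0" if "1 \<le> j" for j using that by (simp add: P_def)
    then show ?case by (auto simp: has_lead_zero[OF m])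
  next
    case (Suc n)
    show ?case
    proof (intro allI impI)
      fix j assume j: "1 \<le> j \<and> j < k"
      have "lead (3 * j - 1) 0 (\<Sum>i=1..j-1. fps_nth (P n) i * fps_nth (b n) (j - i))"
      proof -
        have *: "lead (3 * j - 1) 0 (fps_nth (P n) i * fps_nth (b n) (j - i))" if i: "i \<in> {1..j-1}" for i
        proof -
          have "lead ((3 * i - 1) + (3 * (j - i) - 1)) (real n * \<phi> i * \<phi> (j - i)) (fps_nth (P n) i * fps_nth (b n) (j - i))"
            using Suc i j bl[of "j - i" n] by (intro has_lead_mult[OF m]) auto
          then show ?thesis using i by (elim has_lead_weaken_le[OF m]) auto
        qed
        have "lead (3 * j - 1) (\<Sum>i=1..j-1. 0) (\<Sum>i=1..j-1. fps_nth (P n) i * fps_nth (b n) (j - i))"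
          by (rule has_lead_sum[OF m]) (rule *)
        then show ?thesis by simp
      qed
      moreover have "lead (3 * j - 1) (real n * \<phi> j + \<phi> j) (fps_nth (P n) j + fps_nth (b n) j)"
        using Suc j bl by (intro has_lead_add[OF m]) auto
      ultimately have "lead (3 * j - 1) (real n * \<phi> j + \<phi> j + 0) (fps_nth (P n) j + fps_nth (b n) j + (\<Sum>i=1..j-1. fps_nth (P n) i * fps_nth (b n) (j - i)))"
        by - (rule has_lead_add[OF m])
      moreover have "fps_nth (P (Suc n)) j = fps_nth (P n) j + fps_nth (b n) j + (\<Sum>i=1..j-1. fps_nth (P n) i * fps_nth (b n) (j - i))"
        using fps_mult_nth_split[OF P0 b0, of j n n] j by (simp add: P_def)
      ultimately show "lead (3 * j - 1) (real (Suc n) * \<phi> j) (fps_nth (P (Suc n)) j)"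
        by (simp add: algebra_simps)
    qed
  qed
  \<comment> \<open>For n = m both coefficients are m (m - 1) / 2: the sum of the weights m - 1 - i,
    and the number of pairs of branches. This coincidence is what reproduces the recursion of the
    \<Omega>.\<close>
  have P2: "lead (3 * k - 2) ((\<Sum>i<n. real (m - 1 - i)) * e + (real n * (real n - 1) / 2) * Q) (fps_nth (P n) k - fps_const (real n) * f k)" for n
  proof (induction n)
    case 0
    have "fps_nth (P 0) k = 0" using k by (simp add: P_def)
    then show ?case by (simp add: has_lead_zero[OF m])
  next
    case (Suc n)
    have "lead (3 * k - 2) (\<Sum>j=1..k-1. real n * \<phi> j * \<phi> (k - j)) (\<Sum>j=1..k-1. fps_nth (P n) j * fps_nth (b n) (k - j))"
    proof (rule has_lead_sum[OF m])
      fix j assume j: "j \<in> {1..k-1}"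
      have "lead ((3 * j - 1) + (3 * (k - j) - 1)) (real n * \<phi> j * \<phi> (k - j)) (fps_nth (P n) j * fps_nth (b n) (k - j))"
        using P1 j bl[of "k - j" n] by (intro has_lead_mult[OF m]) auto
      moreover have "(3 * j - 1) + (3 * (k - j) - 1) = 3 * k - 2" using j by auto
      ultimately show "lead (3 * k - 2) (real n * \<phi> j * \<phi> (k - j)) (fps_nth (P n) j * fps_nth (b n) (k - j))" by simp
    qed
    from has_lead_add[OF m has_lead_add[OF m Suc b2[of n]] this]
    have "lead (3 * k - 2) ((\<Sum>i<n. real (m - 1 - i)) * e + (real n * (real n - 1) / 2) * Q + real (m - 1 - n) * e + (\<Sum>j=1..k-1. real n * \<phi> j * \<phi> (k - j)))
      ((fps_nth (P n) k - fps_const (real n) * f k) + (fps_nth (b n) k - f k) + (\<Sum>j=1..k-1. fps_nth (P n) j * fps_nth (b n) (k - j)))" .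
    moreover have "fps_nth (P (Suc n)) k = fps_nth (P n) k + fps_nth (b n) k + (\<Sum>i=1..k-1. fps_nth (P n) i * fps_nth (b n) (k - i))"
      using fps_mult_nth_split[OF P0 b0 k, of n n] by (simp add: P_def)
    then have "(fps_nth (P n) k - fps_const (real n) * f k) + (fps_nth (b n) k - f k) + (\<Sum>j=1..k-1. fps_nth (P n) j * fps_nth (b n) (k - j))
        = fps_nth (P (Suc n)) k - fps_const (real (Suc n)) * f k"
      by (simp add: algebra_simps flip: fps_const_add)
    moreover have "(\<Sum>j=1..k-1. real n * \<phi> j * \<phi> (k - j)) = real n * Q" by (simp add: Q_def sum_distrib_left mult.assoc)
    then have "(\<Sum>i<n. real (m - 1 - i)) * e + (real n * (real n - 1) / 2) * Q + real (m - 1 - n) * e + (\<Sum>j=1..k-1. real n * \<phi> j * \<phi> (k - j))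
       = (\<Sum>i<Suc n. real (m - 1 - i)) * e + (real (Suc n) * (real (Suc n) - 1) / 2) * Q"
      by (simp add: field_simps)
    ultimately show ?case by simp
  qed
  have s: "(\<Sum>i<m. real (m - 1 - i)) = real m * (real m - 1) / 2"
  proof -
    have "(\<Sum>i<m. real (m - 1 - i)) = (\<Sum>i<m. real i)" using sum.nat_diff_reindex[of real m] by simp
    also have "\<dots> = real m * (real m - 1) / 2" by (induction m) (auto simp: field_simps)
    finally show ?thesis .
  qed
  define R where "R = fps_nth (P m) k - fps_const (real m) * f k"
  have R: "lead (3 * k - 2) (real m * (real m - 1) / 2 * (e + Q)) R"
    using P2[of m] unfolding R_def s by (simp add: algebra_simps add_divide_distrib diff_divide_distrib)
  have "tree_fps m * f k = (tree_fps m - 1) * (fps_const (real m) * f k + R)"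
    using reduced_rec[of k] k by (simp add: R_def P_def b_def)
  then have "f k * (tree_fps m - fps_const (real m) * (tree_fps m - 1)) = (tree_fps m - 1) * R" by (simp add: algebra_simps)
  moreover have "tree_fps m - fps_const (real m) * (tree_fps m - 1) = ser_Y m"
    by (simp add: ser_Y_def algebra_simps fps_const_sub[symmetric])
  ultimately have "f k * ser_Y m = (tree_fps m - 1) * R" by simp
  then have "f k * ser_Y m * ser_Z m = (tree_fps m - 1) * R * ser_Z m" by (rule arg_cong)
  then have "f k * (ser_Y m * ser_Z m) = ser_Z m * ((tree_fps m - 1) * R)" unfolding mult.assoc[of "f k" "ser_Y m" "ser_Z m"] by (simp only: mult.commute)
  then have "f k = ser_Z m * ((tree_fps m - 1) * R)" by (simp add: Y_mult_Z[OF m])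
  moreover have "lead (Suc (0 + (3 * k - 2))) (1 / (real m - 1) * (real m * (real m - 1) / 2 * (e + Q))) (ser_Z m * ((tree_fps m - 1) * R))"
    by (intro has_lead_Z_mult[OF m] has_lead_mult[OF m] has_lead_T1[OF m] R)
  moreover have "1 / (real m - 1) * (real m * (real m - 1) / 2 * (e + Q)) = \<phi> k"
    unfolding airy_phi_rec[OF k] e_def Q_def using m by simp
  moreover have "Suc (0 + (3 * k - 2)) = 3 * k - 1" using k by simp
  ultimately show ?case by simp
qed

theorem moment_fps_lead: "k \<ge> 1 \<Longrightarrow> lead (3 * k - 1) (real m / (real m - 1) * \<phi> k) (moment_fps m k)"
  using has_lead_mult[OF m has_lead_T[OF m] reduced_moment_lead, of k] by (simp add: moment_eq)

end

section \<open>Asymptotics of the moments\<close>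

text \<open>The constant predicted by singularity analysis. Near the radius of convergence \<rho>, Y
  behaves like sqrt (2 m / (m - 1)) (1 - X / \<rho>)^(1/2), so Z^r contributes n^(r/2 - 1) / Gamma
  (r / 2); the remaining constants come from the division by the tree numbers.\<close>

definition kappa :: "nat \<Rightarrow> nat \<Rightarrow> real" where
  "kappa m r = 2 * sqrt pi * (real m - 1) * sqrt ((real m - 1) / (2 * real m)) ^ (r + 1) / Gamma (real r / 2)"

text \<open>The exponent (r + 1) / 2 of n is the difference between r / 2 - 1 for a pole of order r
  and -3/2 for the tree numbers.\<close>

definition scaled_coeff :: "nat \<Rightarrow> nat \<Rightarrow> real fps \<Rightarrow> nat \<Rightarrow> real" where
  "scaled_coeff m r g n = fps_nth g n / (tree_count m n * sqrt (real n) ^ (r + 1))"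

definition airy_moment :: "nat \<Rightarrow> real" where
  "airy_moment k = 2 * sqrt pi / Gamma ((3 * real k - 1) / 2) * airy_Omega k"

text \<open>The negative value Gamma (-1/2) = -2 sqrt pi compensates for \<open>airy_Omega 0\<close>
  = -1.\<close>

lemma airy_moment_0: "airy_moment 0 = 1"
proof -
  have "(-1/2 :: real) \<noteq> - real n" for n
  proof
    assume "(-1/2 :: real) = - real n"
    then have "real (2 * n) = real 1" by simp
    then have "2 * n = 1" unfolding of_nat_eq_iff .
    then show False by presburger
  qed
  then have "(-1/2 :: real) \<notin> \<int>\<^sub>\<le>\<^sub>0" by (auto elim!: nonpos_Ints_cases')
  then have "Gamma (1/2 :: real) = (-1/2) * Gamma (-1/2)"
    using Gamma_plus1[of "-1/2 :: real"] by simp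
  then have "Gamma (-1/2 :: real) = - 2 * sqrt pi" by (simp add: Gamma_one_half_real)
  then show ?thesis by (simp add: airy_moment_def airy_Omega.simps)
qed

section \<open>Coefficients of the powers of Z\<close>

context
  fixes m :: nat
  assumes m: "m \<ge> 2"
begin


lemma m_pos: "m > 0" using m by simp

lemma tree_fps_nth: "fps_nth (tree_fps m) n = tree_count m n" by (simp add: tree_fps_def)

lemma W_Z_power: "ser_W m * ser_Z m ^ (r + 2) = fps_const (1 / (real m - 1)) * (fps_const (real m) * ser_Z m ^ (r + 2) - fps_const (real m + 1) * ser_Z m ^ (r + 1) + ser_Z m ^ r)"
proof -
  define A where "A = ser_Z m ^ (r + 2)"
  have "A * ser_Y m = ser_Z m ^ (r + 1) * (ser_Y m * ser_Z m)" "A * (ser_Y m)\<^sup>2 = ser_Z m ^ r * (ser_Y m * ser_Z m) * (ser_Y m * ser_Z m)"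
    by (simp_all add: A_def algebra_simps power2_eq_square)
  then have eq: "A * ser_Y m = ser_Z m ^ (r + 1)" "A * (ser_Y m)\<^sup>2 = ser_Z m ^ r" by (simp_all add: Y_mult_Z[OF m])
  have "ser_W m * A = fps_const (1 / (real m - 1)) * (fps_const (real m) * A - fps_const (real m + 1) * (A * ser_Y m) + A * (ser_Y m)\<^sup>2)"
    by (simp add: ser_W_def[OF m] algebra_simps)
  then show ?thesis unfolding eq by (simp only: A_def)
qed

text \<open>The coefficients of \<open>euler_op_Z_power\<close>, solved for the highest power of Z.
  The factor n in the first term carries the growth; this recursion replaces a transfer
  theorem.\<close>

lemma Z_power_rec:
  assumes r: "r \<ge> 1"
  shows "fps_nth (ser_Z m ^ (r + 2)) n = (real m - 1) / (real r * real m) * real n * fps_nth (ser_Z m ^ r) n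
    + (real m + 1) / real m * fps_nth (ser_Z m ^ (r + 1)) n - fps_nth (ser_Z m ^ r) n / real m"
proof -
  define A B C where "A = fps_nth (ser_Z m ^ (r + 2)) n" and "B = fps_nth (ser_Z m ^ (r + 1)) n" and "C = fps_nth (ser_Z m ^ r) n"
  have "fps_nth (euler_op (ser_Z m ^ r)) n = fps_nth (fps_const (real r) * (ser_W m * ser_Z m ^ (r + 2))) n"
    unfolding euler_op_Z_power[OF m] by (simp only: mult.assoc)
  then have "real n * C = real r * (1 / (real m - 1) * (real m * A - (real m + 1) * B + C))"
    unfolding W_Z_power by (simp add: A_def B_def C_def)
  then have "A = (real m - 1) / (real r * real m) * real n * C + (real m + 1) / real m * B - C / real m"
  proof -
    have aux: "q / (R * M) * N * C + u / M * B - C / M = (q * (N * C) + R * (u * B) - R * C) / (R * M)" if "R > 0" "M > 0" for q u N M R :: real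
      using that by (simp add: field_simps)
    have "(real m - 1) * (real n * C) = real r * (real m * A - (real m + 1) * B + C)"
      unfolding \<open>real n * C = _\<close> using m by simp
    then have "(real m - 1) * (real n * C) + real r * ((real m + 1) * B) - real r * C = A * (real r * real m)"
      by (simp add: algebra_simps)
    moreover have "real r > 0" "real m > 0" using r m by simp_all
    ultimately show ?thesis by (subst aux) simp_all
  qed
  then show ?thesis by (simp only: A_def B_def C_def)
qed

text \<open>Reduced by Y Z = 1, the product W Z is linear in Z, so \<open>euler_op_Y\<close>
  expresses the coefficients of Z by tree numbers.\<close>

lemma Z_nth:
  assumes n: "n > 0"
  shows "fps_nth (ser_Z m) n = (real m - 1) / real m * real (m * n choose n)"
proof -
  have "ser_W m * ser_Z m = fps_const (1 / (real m - 1)) * (fps_const (real m) * ser_Z m - fps_const (real m + 1) + ser_Y m)"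
  proof -
    have "ser_Y m * ser_Z m = 1" "ser_Y m ^ 2 * ser_Z m = ser_Y m" using Y_mult_Z[OF m] by (simp_all add: power2_eq_square mult.assoc)
    moreover have "ser_W m * ser_Z m = fps_const (1 / (real m - 1)) * (fps_const (real m) * ser_Z m - fps_const (real m + 1) * (ser_Y m * ser_Z m) + (ser_Y m)\<^sup>2 * ser_Z m)"
      by (simp add: ser_W_def[OF m] algebra_simps)
    ultimately show ?thesis by simp
  qed
  then have W: "fps_nth (ser_W m * ser_Z m) n = 1 / (real m - 1) * (real m * fps_nth (ser_Z m) n + fps_nth (ser_Y m) n)" using n by simp
  have Yn: "fps_nth (ser_Y m) n = - (real m - 1) * tree_count m n" using n by (simp add: ser_Y_def tree_fps_nth algebra_simps)
  have "real n * fps_nth (ser_Y m) n = - fps_nth (ser_W m * ser_Z m) n"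
    using arg_cong[OF euler_op_Y[OF m], of "\<lambda>f. fps_nth f n"] by simp
  then have "real m * fps_nth (ser_Z m) n = (real m - 1) * ((real m - 1) * real n + 1) * tree_count m n"
    using m unfolding W Yn by (simp add: divide_simps) (simp add: algebra_simps)
  also have "\<dots> = (real m - 1) * real (m * n choose n)"
  proof -
    have "(real m - 1) * real n + 1 > 0" using m by (simp add: add_nonneg_pos)
    then show ?thesis using m by (simp add: tree_count_eq of_nat_diff)
  qed
  finally show ?thesis using m by (simp add: field_simps)
qed

lemma sqrt_lim: "(\<lambda>n. 1 / sqrt (real n)) \<longlonglongrightarrow> 0" by real_asymp

lemma inv_lim: "(\<lambda>n. 1 / real n) \<longlonglongrightarrow> 0" by real_asymp

lemma kappa_rec:
  assumes r: "r \<ge> 1"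
  shows "kappa m (r + 2) = (real m - 1) / (real r * real m) * kappa m r"
proof -
  define b where "b = (real m - 1) / (2 * real m)"
  have b: "b \<ge> 0" using m by (simp add: b_def)
  have "real r / 2 \<notin> \<int>\<^sub>\<le>\<^sub>0" using r by (auto elim!: nonpos_Ints_cases)
  then have G: "Gamma (real (r + 2) / 2) = (real r / 2) * Gamma (real r / 2)"
    using Gamma_plus1[of "real r / 2"] r by (simp add: add_divide_distrib add.commute)
  have S: "sqrt b ^ (r + 2 + 1) = sqrt b ^ (r + 1) * b" using b by (simp add: power_add power2_eq_square)
  have E: "(real m - 1) / (real r * real m) = 2 * b / real r" using m r by (simp add: b_def field_simps)
  show ?thesis unfolding kappa_def b_def[symmetric] G S E by simp
qed

lemma scaled_Z1: "scaled_coeff m 1 (ser_Z m) \<longlonglongrightarrow> kappa m 1"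
proof -
  have "(\<lambda>n. (real m - 1) / real m * ((real m - 1) + 1 / real n)) \<longlonglongrightarrow> (real m - 1) / real m * ((real m - 1) + 0)"
    by (intro tendsto_intros inv_lim)
  moreover have "(real m - 1) / real m * ((real m - 1) + 0) = kappa m 1"
    using m by (simp add: kappa_def Gamma_one_half_real power2_eq_square)
  moreover have "\<forall>\<^sub>F n in sequentially. (real m - 1) / real m * ((real m - 1) + 1 / real n) = scaled_coeff m 1 (ser_Z m) n"
    using eventually_gt_at_top[of 0]
  proof eventually_elim
    case (elim n)
    have D: "(real m - 1) * real n + 1 > 0" using m by (simp add: add_nonneg_pos)
    define C where "C = real (m * n choose n)"
    have C: "C > 0" using m by (simp add: C_def zero_less_binomial_iff)
    have "scaled_coeff m 1 (ser_Z m) n = ((real m - 1) / real m * C) / (C / ((real m - 1) * real n + 1) * real n)"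
      using elim m by (simp add: scaled_coeff_def Z_nth tree_count_eq of_nat_diff C_def)
    also have "\<dots> = (real m - 1) / real m * ((real m - 1) + 1 / real n)"
      using C D elim m by (simp add: field_simps)
    finally show ?case by simp
  qed
  ultimately show ?thesis using Lim_transform_eventually by fastforce
qed

text \<open>After normalisation by \<rho>^n the coefficients of Z are asymptotic to a multiple of
  \<open>central_binomial\<close>, whose self-convolution is 1; hence those of Z^2 tend to a
  constant. Together with r = 1 this starts the recursion in steps of two.\<close>

lemma scaled_Z2: "scaled_coeff m 2 (ser_Z m ^ 2) \<longlonglongrightarrow> kappa m 2"
proof -
  \<comment> \<open>The radius of convergence of the tree series.\<close>
  define \<rho> where "\<rho> = (real m - 1) ^ (m - 1) / real m ^ m"
  have rho: "\<rho> > 0" using m by (simp add: \<rho>_def)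
  define b where "b = (real m - 1) / (2 * real m)"
  have b: "b > 0" using m by (simp add: b_def)
  define c where "c = sqrt (real m / (2 * (real m - 1)))"
  have c: "c = 1 / (2 * sqrt b)" "c > 0"
  proof -
    have "real m / (2 * (real m - 1)) = 1 / (4 * b)" using m by (simp add: b_def field_simps)
    then show "c = 1 / (2 * sqrt b)" unfolding c_def by (simp add: real_sqrt_divide real_sqrt_mult)
    then show "c > 0" using b by simp
  qed
  define a where "a n = real (m * n choose n) * \<rho> ^ n / central_binomial n" for n
  have a: "a \<longlonglongrightarrow> c" unfolding a_def c_def \<rho>_def by (rule binomial_asymptotics[OF m])
  define u where "u n = fps_nth (ser_Z m) n * \<rho> ^ n" for n
  have "(\<lambda>n. (real m - 1) / real m * a n) \<longlonglongrightarrow> (real m - 1) / real m * c" by (intro tendsto_intros a)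
  moreover have "\<forall>\<^sub>F n in sequentially. (real m - 1) / real m * a n = u n / central_binomial n"
    using eventually_gt_at_top[of 0] by eventually_elim (simp add: u_def a_def Z_nth)
  ultimately have u: "(\<lambda>n. u n / central_binomial n) \<longlonglongrightarrow> (real m - 1) / real m * c"
    by (rule Lim_transform_eventually)
  have "(\<lambda>n. \<Sum>k\<le>n. u k * u (n - k)) \<longlonglongrightarrow> ((real m - 1) / real m * c)\<^sup>2"
    by (rule convolution_square_tendsto[OF central_binomial_pos central_binomial_tendsto_0 central_binomial_convolution u])
  moreover have "(\<Sum>k\<le>n. u k * u (n - k)) = fps_nth (ser_Z m ^ 2) n * \<rho> ^ n" for n
    unfolding power2_eq_square fps_mult_nth sum_distrib_right atLeast0AtMost
    by (intro sum.cong refl) (auto simp: u_def simp flip: power_add)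
  ultimately have z2: "(\<lambda>n. fps_nth (ser_Z m ^ 2) n * \<rho> ^ n) \<longlonglongrightarrow> ((real m - 1) / real m * c)\<^sup>2" by simp
  have "(\<lambda>n. real n / ((real m - 1) * real n + 1)) \<longlonglongrightarrow> 1 / (real m - 1)"
    using m by real_asymp (simp add: inverse_eq_divide)
  then have den: "(\<lambda>n. a n * (central_binomial n * sqrt (real n)) * (real n / ((real m - 1) * real n + 1))) \<longlonglongrightarrow> c * (1 / sqrt pi) * (1 / (real m - 1))"
    by (intro tendsto_mult a central_binomial_asymptotics)
  have "(\<lambda>n. (fps_nth (ser_Z m ^ 2) n * \<rho> ^ n) / (a n * (central_binomial n * sqrt (real n)) * (real n / ((real m - 1) * real n + 1))))
     \<longlonglongrightarrow> ((real m - 1) / real m * c)\<^sup>2 / (c * (1 / sqrt pi) * (1 / (real m - 1)))"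
    using c m by (intro tendsto_divide z2 den) auto
  moreover have "((real m - 1) / real m * c)\<^sup>2 / (c * (1 / sqrt pi) * (1 / (real m - 1))) = kappa m 2"
  proof -
    define p where "p = real m - 1"
    have p: "p > 0" using m by (simp add: p_def)
    have E: "p / real m = 2 * b" using m by (simp add: p_def b_def field_simps)
    have "sqrt b ^ 3 = b * sqrt b" using b by (simp add: power3_eq_cube)
    have "b / sqrt b = sqrt b" using b by (simp add: real_div_sqrt)
    have "((real m - 1) / real m * c)\<^sup>2 / (c * (1 / sqrt pi) * (1 / (real m - 1))) = (2 * b)\<^sup>2 * c * sqrt pi * (real m - 1)"
      unfolding E p_def[symmetric] using c(2) p by (simp add: power2_eq_square)
    also have "\<dots> = 2 * sqrt pi * (real m - 1) * (b * (b / sqrt b))" unfolding c(1) using b by (simp add: power2_eq_square)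
    also have "\<dots> = kappa m 2"
      unfolding kappa_def b_def[symmetric] \<open>b / sqrt b = sqrt b\<close> by (simp add: \<open>sqrt b ^ 3 = b * sqrt b\<close>)
    finally show ?thesis .
  qed
  moreover have "\<forall>\<^sub>F n in sequentially. (fps_nth (ser_Z m ^ 2) n * \<rho> ^ n) / (a n * (central_binomial n * sqrt (real n)) * (real n / ((real m - 1) * real n + 1)))
      = scaled_coeff m 2 (ser_Z m ^ 2) n"
    using eventually_gt_at_top[of 0]
  proof eventually_elim
    case (elim n)
    have cb: "central_binomial n \<noteq> 0" using central_binomial_pos[of n] by simp
    have "a n * (central_binomial n * sqrt (real n)) * (real n / ((real m - 1) * real n + 1)) = \<rho> ^ n * (tree_count m n * sqrt (real n) ^ 3)"
      using m cb by (simp add: a_def tree_count_eq of_nat_diff power3_eq_cube)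
    then show ?case using rho by (simp add: scaled_coeff_def)
  qed
  ultimately show ?thesis using Lim_transform_eventually by fastforce
qed

text \<open>Scaling turns the three terms of \<open>Z_power_rec\<close> into one of constant order
  and two that carry factors 1 / sqrt n and 1 / n.\<close>

lemma scaled_Z_power: "r \<ge> 1 \<Longrightarrow> scaled_coeff m r (ser_Z m ^ r) \<longlonglongrightarrow> kappa m r"
proof (induction r rule: less_induct)
  case (less r)
  consider "r = 1" | "r = 2" | k where "k \<ge> 1" "r = k + 2"
  proof atomize_elim
    have "r = 1 \<or> r = 2 \<or> (r - 2 \<ge> 1 \<and> r = (r - 2) + 2)" using less.prems by arith
    then show "r = 1 \<or> r = 2 \<or> (\<exists>k\<ge>1. r = k + 2)" by blast
  qed
  then show ?case
  proof cases
    case 1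
    then show ?thesis using scaled_Z1 by simp
  next
    case 2
    then show ?thesis using scaled_Z2 by simp
  next
    case (3 k)
    have lim: "(\<lambda>n. (real m - 1) / (real k * real m) * scaled_coeff m k (ser_Z m ^ k) n
       + (real m + 1) / real m * scaled_coeff m (k + 1) (ser_Z m ^ (k + 1)) n * (1 / sqrt (real n))
       - scaled_coeff m k (ser_Z m ^ k) n / real m * (1 / real n))
      \<longlonglongrightarrow> (real m - 1) / (real k * real m) * kappa m k + (real m + 1) / real m * kappa m (k + 1) * 0 - kappa m k / real m * 0"
      using 3 m by (intro tendsto_intros less.IH sqrt_lim inv_lim) auto
    have "\<forall>\<^sub>F n in sequentially. (real m - 1) / (real k * real m) * scaled_coeff m k (ser_Z m ^ k) n
       + (real m + 1) / real m * scaled_coeff m (k + 1) (ser_Z m ^ (k + 1)) n * (1 / sqrt (real n))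
       - scaled_coeff m k (ser_Z m ^ k) n / real m * (1 / real n) = scaled_coeff m (k + 2) (ser_Z m ^ (k + 2)) n"
      using eventually_gt_at_top[of 0]
    proof eventually_elim
      case (elim n)
      define s where "s = sqrt (real n)"
      have s: "s > 0" "real n = s * s" using elim by (simp_all add: s_def)
      define w where "w = tree_count m n * s ^ (k + 1)"
      have w: "w > 0" using s tree_count_pos[OF m_pos] by (simp add: w_def)
      define A B C where "A = fps_nth (ser_Z m ^ (k + 2)) n" and "B = fps_nth (ser_Z m ^ (k + 1)) n" and "C = fps_nth (ser_Z m ^ k) n"
      have A: "A = (real m - 1) / (real k * real m) * (s * s) * C + (real m + 1) / real m * B - C / real m"
        using Z_power_rec[OF 3(1), of n] unfolding A_def B_def C_def s(2) .
      have e: "scaled_coeff m (k + 2) (ser_Z m ^ (k + 2)) n = A / (w * (s * s))"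
        "scaled_coeff m k (ser_Z m ^ k) n = C / w" "scaled_coeff m (k + 1) (ser_Z m ^ (k + 1)) n = B / (w * s)"
        by (simp_all add: scaled_coeff_def w_def s_def[symmetric] A_def B_def C_def mult.assoc mult.commute mult.left_commute)
      have "(real m - 1) / (real k * real m) * (C / w) + (real m + 1) / real m * (B / (w * s)) * (1 / s) - C / w / real m * (1 / (s * s)) = A / (w * (s * s))"
        unfolding A using w s(1) 3(1) m by (simp add: field_simps)
      then show ?case unfolding e s_def[symmetric] unfolding s(2) .
    qed
    from Lim_transform_eventually[OF lim this] show ?thesis using kappa_rec[OF 3(1)] 3 by simp
  qed
qed

section \<open>Contributions of lower pole order\<close>

lemma Y_power_bound: "\<exists>C. \<forall>n>0. \<bar>fps_nth (ser_Y m ^ i) n\<bar> \<le> C * tree_count m n"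
proof -
  \<comment> \<open>Generalised by a power of T, because each factor Y is expanded as m - (m - 1)
    T.\<close>
  have "\<exists>C. \<forall>n>0. \<bar>fps_nth (ser_Y m ^ i * tree_fps m ^ j) n\<bar> \<le> C * tree_count m n" for j
  proof (induction i arbitrary: j)
    case 0
    show ?case using tree_fps_power_bound[OF m, of _ j] by auto
  next
    case (Suc i)
    obtain C1 C2 where C: "\<And>n. n > 0 \<Longrightarrow> \<bar>fps_nth (ser_Y m ^ i * tree_fps m ^ j) n\<bar> \<le> C1 * tree_count m n"
       "\<And>n. n > 0 \<Longrightarrow> \<bar>fps_nth (ser_Y m ^ i * tree_fps m ^ (Suc j)) n\<bar> \<le> C2 * tree_count m n"
      using Suc by meson
    have eq: "ser_Y m ^ Suc i * tree_fps m ^ j = fps_const (real m) * (ser_Y m ^ i * tree_fps m ^ j) - fps_const (real m - 1) * (ser_Y m ^ i * tree_fps m ^ Suc j)"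
      by (simp add: ser_Y_def algebra_simps)
    have "\<bar>fps_nth (ser_Y m ^ Suc i * tree_fps m ^ j) n\<bar> \<le> (real m * C1 + (real m - 1) * C2) * tree_count m n" if "n > 0" for n
    proof -
      have "\<bar>fps_nth (ser_Y m ^ Suc i * tree_fps m ^ j) n\<bar> \<le> \<bar>real m * fps_nth (ser_Y m ^ i * tree_fps m ^ j) n\<bar> + \<bar>(real m - 1) * fps_nth (ser_Y m ^ i * tree_fps m ^ Suc j) n\<bar>"
        unfolding eq by (simp del: power_Suc)
      also have "\<dots> \<le> real m * (C1 * tree_count m n) + (real m - 1) * (C2 * tree_count m n)"
        using C[OF that] m unfolding abs_mult by (intro add_mono mult_mono) auto
      finally show ?thesis by (simp add: algebra_simps)
    qed
    then show ?case by blast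
  qed
  from this[of 0] show ?thesis by simp
qed

lemma sqrt_power_lim: "j \<ge> 1 \<Longrightarrow> (\<lambda>n. 1 / sqrt (real n) ^ j) \<longlonglongrightarrow> 0"
  using tendsto_power[OF sqrt_lim, of j] by (simp add: power_divide power_0_left)

text \<open>Factors Y and Z cancel in pairs. Either a smaller pole remains, which loses n^(-i/2), or
  a power of Y, whose coefficients are of the order of the tree numbers.\<close>

lemma scaled_lower:
  assumes i: "i \<ge> 1"
  shows "scaled_coeff m r (ser_Z m ^ r * ser_Y m ^ i) \<longlonglongrightarrow> 0"
proof (cases "i < r")
  case True
  define s where "s = r - i"
  have r: "r = s + i" "s \<ge> 1" using True by (simp_all add: s_def)
  have "ser_Z m ^ r * ser_Y m ^ i = ser_Z m ^ s * (ser_Y m * ser_Z m) ^ i" by (simp add: r power_add power_mult_distrib)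
  then have eq: "ser_Z m ^ r * ser_Y m ^ i = ser_Z m ^ s" by (simp add: Y_mult_Z[OF m])
  have "(\<lambda>n. scaled_coeff m s (ser_Z m ^ s) n * (1 / sqrt (real n) ^ i)) \<longlonglongrightarrow> kappa m s * 0"
    by (intro tendsto_mult scaled_Z_power sqrt_power_lim i r)
  moreover have "scaled_coeff m s (ser_Z m ^ s) n * (1 / sqrt (real n) ^ i) = scaled_coeff m r (ser_Z m ^ r * ser_Y m ^ i) n" for n
    unfolding scaled_coeff_def eq using r(1) by (simp add: power_add)
  ultimately show ?thesis by simp
next
  case False
  define s where "s = i - r"
  have "ser_Z m ^ r * ser_Y m ^ i = ser_Y m ^ s * (ser_Y m * ser_Z m) ^ r" using False by (simp add: s_def power_mult_distrib mult.left_commute flip: power_add)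
  then have eq: "ser_Z m ^ r * ser_Y m ^ i = ser_Y m ^ s" by (simp add: Y_mult_Z[OF m])
  obtain C where C: "\<And>n. n > 0 \<Longrightarrow> \<bar>fps_nth (ser_Y m ^ s) n\<bar> \<le> C * tree_count m n" using Y_power_bound by blast
  have "(\<lambda>n. C * (1 / sqrt (real n) ^ (r + 1))) \<longlonglongrightarrow> C * 0" by (intro tendsto_intros sqrt_power_lim) simp
  then have lim: "(\<lambda>n. C * (1 / sqrt (real n) ^ (r + 1))) \<longlonglongrightarrow> 0" by simp
  show ?thesis
  proof (rule Lim_null_comparison[OF _ lim])
    show "\<forall>\<^sub>F n in sequentially. norm (scaled_coeff m r (ser_Z m ^ r * ser_Y m ^ i) n) \<le> C * (1 / sqrt (real n) ^ (r + 1))"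
      using eventually_gt_at_top[of 0]
    proof eventually_elim
      case (elim n)
      have t: "tree_count m n > 0" by (rule tree_count_pos[OF m_pos])
      have s: "sqrt (real n) ^ (r + 1) > 0" using elim by simp
      have "norm (scaled_coeff m r (ser_Z m ^ r * ser_Y m ^ i) n) = \<bar>fps_nth (ser_Y m ^ s) n\<bar> / (tree_count m n * sqrt (real n) ^ (r + 1))"
        unfolding eq scaled_coeff_def real_norm_def abs_divide using t s by (simp add: abs_mult)
      also have "\<dots> \<le> (C * tree_count m n) / (tree_count m n * sqrt (real n) ^ (r + 1))"
        using C[OF elim] t s by (intro divide_right_mono) auto
      also have "\<dots> = C * (1 / sqrt (real n) ^ (r + 1))" using t by simp
      finally show ?case .
    qed
  qed
qed

lemma scaled_coeff_Y_polys: "p \<in> Y_polys m \<Longrightarrow> scaled_coeff m r (ser_Z m ^ r * (ser_Y m * p)) \<longlonglongrightarrow> 0"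
proof (induction p rule: Y_polys.induct)
  case zero
  then show ?case by (simp add: scaled_coeff_def[abs_def])
next
  case (step p a i)
  have "(\<lambda>n. a * scaled_coeff m r (ser_Z m ^ r * ser_Y m ^ Suc i) n + scaled_coeff m r (ser_Z m ^ r * (ser_Y m * p)) n) \<longlonglongrightarrow> a * 0 + 0"
    by (intro tendsto_intros scaled_lower step) simp
  moreover have "ser_Z m ^ r * (ser_Y m * (fps_const a * ser_Y m ^ i + p)) = fps_const a * (ser_Z m ^ r * ser_Y m ^ Suc i) + ser_Z m ^ r * (ser_Y m * p)"
    by (simp add: algebra_simps)
  then have "scaled_coeff m r (ser_Z m ^ r * (ser_Y m * (fps_const a * ser_Y m ^ i + p))) n =
     a * scaled_coeff m r (ser_Z m ^ r * ser_Y m ^ Suc i) n + scaled_coeff m r (ser_Z m ^ r * (ser_Y m * p)) n" for n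
    by (simp add: scaled_coeff_def add_divide_distrib del: power_Suc)
  ultimately show ?case by simp
qed

theorem scaled_coeff_tendsto:
  assumes "has_lead m r c g" "r \<ge> 1"
  shows "scaled_coeff m r g \<longlonglongrightarrow> c * kappa m r"
proof -
  obtain p where p: "p \<in> Y_polys m" "g = ser_Z m ^ r * (fps_const c + ser_Y m * p)" using assms by (auto simp: has_lead_def)
  have "(\<lambda>n. c * scaled_coeff m r (ser_Z m ^ r) n + scaled_coeff m r (ser_Z m ^ r * (ser_Y m * p)) n) \<longlonglongrightarrow> c * kappa m r + 0"
    by (intro tendsto_intros scaled_Z_power scaled_coeff_Y_polys p assms)
  moreover have "g = fps_const c * ser_Z m ^ r + ser_Z m ^ r * (ser_Y m * p)" by (simp add: p algebra_simps)
  then have "scaled_coeff m r g n = c * scaled_coeff m r (ser_Z m ^ r) n + scaled_coeff m r (ser_Z m ^ r * (ser_Y m * p)) n" for n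
    by (simp add: scaled_coeff_def add_divide_distrib)
  then have "scaled_coeff m r g = (\<lambda>n. c * scaled_coeff m r (ser_Z m ^ r) n + scaled_coeff m r (ser_Z m ^ r * (ser_Y m * p)) n)" by (rule ext)
  ultimately show ?thesis by (simp only: add_0_right)
qed

text \<open>For k > 0 the pole order 3 k - 1 gives the normalisation sqrt n ^ (3 k), that is n^(3/2)
  for each factor of the area. For k = 0 there is no pole, and the claim is the normalisation of the
  Airy moments.\<close>

theorem area_moment_tendsto:
  "(\<lambda>n. (\<Sum>S\<in>word_trees m n. (sqrt (8 / (real m * (real m - 1))) * real n powr (- 3 / 2) * real (area m S)) ^ k) / tree_count m n)
     \<longlonglongrightarrow> airy_moment k"
proof (cases "k = 0")
  case True
  have "tree_count m n \<noteq> 0" for n using tree_count_pos[OF m_pos, of n] by simp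
  then show ?thesis using True by (simp add: airy_moment_0 flip: tree_count_def)
next
  case False
  then have k: "k \<ge> 1" by simp
  define M b \<sigma> l where "M = real m" and "b = (M - 1) / (2 * M)" and "\<sigma> = sqrt (8 / (M * (M - 1)))" and "l = M\<^sup>2 / (M - 1)"
  have M: "M > 1" using m by (simp add: M_def)
  have b: "b > 0" using M by (simp add: b_def)
  have "(\<lambda>n. fact k * \<sigma> ^ k * scaled_coeff m (3 * k - 1) (moment_fps m k) n)
     \<longlonglongrightarrow> fact k * \<sigma> ^ k * (real m / (real m - 1) * airy_phi m k * kappa m (3 * k - 1))"
    using k by (intro tendsto_intros scaled_coeff_tendsto moment_fps_lead[OF m]) auto
  moreover have "fact k * \<sigma> ^ k * (real m / (real m - 1) * airy_phi m k * kappa m (3 * k - 1)) = airy_moment k"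
  proof -
    have g: "real (3 * k - 1) / 2 = (3 * real k - 1) / 2" using k by (simp add: of_nat_diff)
    have e: "3 * k - 1 + 1 = 3 * k" using k by simp
    have ka: "kappa m (3 * k - 1) = 2 * sqrt pi * (M - 1) * (sqrt b ^ 3) ^ k / Gamma ((3 * real k - 1) / 2)"
      unfolding kappa_def g e power_mult by (simp add: M_def b_def)
    \<comment> \<open>The origin of the constant sqrt (8 / (m (m - 1))): it is the \<sigma> for
      which the geometric factor of the k-th moment is 1.\<close>
    have unit: "\<sigma> * l * sqrt b ^ 3 = 1"
    proof -
      have "(\<sigma> * l * sqrt b ^ 3)\<^sup>2 = \<sigma>\<^sup>2 * l\<^sup>2 * ((sqrt b)\<^sup>2) ^ 3" by (simp add: power_mult_distrib flip: power_mult)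
      also have "\<dots> = 8 / (M * (M - 1)) * l\<^sup>2 * b ^ 3" using M b by (simp add: \<sigma>_def)
      also have "\<dots> = 1" using M by (simp add: l_def b_def power2_eq_square power3_eq_cube divide_simps)
      finally have "(\<sigma> * l * sqrt b ^ 3)\<^sup>2 = 1\<^sup>2" by simp
      moreover have "\<sigma> * l * sqrt b ^ 3 \<ge> 0" using M b by (simp add: \<sigma>_def l_def)
      ultimately show ?thesis by (rule power2_eq_imp_eq) simp
    qed
    have "fact k * \<sigma> ^ k * (real m / (real m - 1) * airy_phi m k * kappa m (3 * k - 1)) =
       (\<sigma> * l * sqrt b ^ 3) ^ k * (2 * sqrt pi / Gamma ((3 * real k - 1) / 2) * airy_Omega k)"
      unfolding ka using M by (simp add: airy_phi_def M_def[symmetric] l_def[symmetric] power_mult_distrib)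
    then show ?thesis by (simp add: unit airy_moment_def)
  qed
  moreover have "\<forall>\<^sub>F n in sequentially. fact k * \<sigma> ^ k * scaled_coeff m (3 * k - 1) (moment_fps m k) n =
     (\<Sum>S\<in>word_trees m n. (\<sigma> * real n powr (- 3 / 2) * real (area m S)) ^ k) / tree_count m n"
    using eventually_gt_at_top[of 0]
  proof eventually_elim
    case (elim n)
    have "real n powr (- 3 / 2) = 1 / sqrt (real n) ^ 3"
    proof -
      have "real n powr (- 3 / 2) = 1 / real n powr (3 * (1 / 2))" using powr_minus_divide[of "real n" "3/2"] by simp
      also have "real n powr (3 * (1 / 2)) = (real n powr (1/2)) powr 3" by (simp add: powr_powr)
      also have "\<dots> = sqrt (real n) ^ 3" using elim by (simp add: powr_half_sqrt)
      finally show ?thesis .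
    qed
    then have p: "(\<sigma> * real n powr (- 3 / 2) * real (area m S)) ^ k = \<sigma> ^ k / sqrt (real n) ^ (3 * k) * real (area m S) ^ k" for S
      by (simp add: power_mult_distrib power_divide power_mult)
    have e: "3 * k - 1 + 1 = 3 * k" using k by simp
    show ?case unfolding p scaled_coeff_def e moment_fps_def
      by (simp add: sum_divide_distrib[symmetric] sum_distrib_left[symmetric])
  qed
  ultimately show ?thesis unfolding \<sigma>_def M_def using Lim_transform_eventually by fastforce
qed

end

section \<open>The method of moments\<close>

text \<open>The growth hypothesis makes the Taylor remainder of the characteristic function tend to
  0 for every t, so that the function is the limit of polynomials built from the moments
  alone.\<close>

lemma moment_determinacy:
  fixes \<mu> \<nu> :: "real measure"
  assumes \<mu>: "real_distribution \<mu>" "\<And>k. integrable \<mu> (\<lambda>x. x ^ k)" "\<And>k. (\<integral>x. x ^ k \<partial>\<mu>) = a k"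
    and \<nu>: "real_distribution \<nu>" "\<And>k. integrable \<nu> (\<lambda>x. x ^ k)" "\<And>k. (\<integral>x. x ^ k \<partial>\<nu>) = a k"
    and growth: "\<And>t. (\<lambda>n. t ^ (2 * n) * a (2 * n) / fact (2 * n)) \<longlonglongrightarrow> 0"
  shows "\<mu> = \<nu>"
proof -
  interpret \<mu>: real_distribution \<mu> by fact
  interpret \<nu>: real_distribution \<nu> by fact
  have "char \<mu> t = char \<nu> t" for t
  proof -
    define S where "S n = (\<Sum>k\<le>2 * n. ((\<i> * t) ^ k / fact k) * a k)" for n
    define e where "e n = 2 * (t ^ (2 * n) * a (2 * n) / fact (2 * n))" for n
    \<comment> \<open>Only even orders are used, since the remainder involves absolute
      moments.\<close>
    have abs: "\<bar>x\<bar> ^ (2 * n) = x ^ (2 * n)" for x :: real and n by (simp add: power_mult)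
    have b1: "cmod (char \<mu> t - S n) \<le> e n" for n
      using \<mu>.char_approx1[of "2 * n" t] \<mu>(2,3) unfolding abs by (simp add: S_def e_def)
    have b2: "cmod (char \<nu> t - S n) \<le> e n" for n
      using \<nu>.char_approx1[of "2 * n" t] \<nu>(2,3) unfolding abs by (simp add: S_def e_def)
    have "e \<longlonglongrightarrow> 2 * 0" unfolding e_def by (intro tendsto_intros growth)
    then have e: "e \<longlonglongrightarrow> 0" by simp
    have "(\<lambda>n. char \<mu> t - S n) \<longlonglongrightarrow> 0" "(\<lambda>n. char \<nu> t - S n) \<longlonglongrightarrow> 0"
      by (rule Lim_null_comparison[OF _ e]; simp add: b1 b2)+
    then have "(\<lambda>n. (char \<mu> t - S n) - (char \<nu> t - S n)) \<longlonglongrightarrow> 0 - 0" by (rule tendsto_diff)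
    then show ?thesis by (simp add: LIMSEQ_const_iff)
  qed
  then show ?thesis by (intro Levy_uniqueness \<mu> \<nu> ext)
qed

text \<open>A bounded continuous substitute for x^k, as weak convergence only tests such
  functions.\<close>

definition clamp_power :: "real \<Rightarrow> nat \<Rightarrow> real \<Rightarrow> real" where
  "clamp_power L k x = (max (- L) (min L x)) ^ k"

section \<open>Truncated powers and convergence of moments\<close>

lemma clamp_power_le: "L \<ge> 0 \<Longrightarrow> \<bar>clamp_power L k x\<bar> \<le> L ^ k"
  unfolding clamp_power_def power_abs by (intro power_mono) auto

lemma clamp_power_eq: "\<bar>x\<bar> \<le> L \<Longrightarrow> clamp_power L k x = x ^ k"
proof -
  assume "\<bar>x\<bar> \<le> L"
  then have "max (- L) (min L x) = x" by auto
  then show ?thesis by (simp add: clamp_power_def)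
qed

lemma clamp_power_even_le:
  assumes "L \<ge> 0"
  shows "clamp_power L (2 * k) x \<le> x ^ (2 * k)"
proof -
  have "\<bar>max (- L) (min L x)\<bar> \<le> \<bar>x\<bar>" using assms by (auto simp: max_def min_def abs_if)
  then have "(max (- L) (min L x))\<^sup>2 \<le> x\<^sup>2" unfolding abs_le_square_iff .
  then show ?thesis unfolding clamp_power_def power_mult by (rule power_mono) (rule zero_le_power2)
qed

lemma clamp_power_even_mono:
  assumes "0 \<le> L" "L \<le> L'"
  shows "clamp_power L (2 * k) x \<le> clamp_power L' (2 * k) x"
proof -
  have "\<bar>max (- L) (min L x)\<bar> \<le> \<bar>max (- L') (min L' x)\<bar>" using assms by (auto simp: max_def min_def abs_if)
  then have "(max (- L) (min L x))\<^sup>2 \<le> (max (- L') (min L' x))\<^sup>2" unfolding abs_le_square_iff .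
  then show ?thesis unfolding clamp_power_def power_mult by (rule power_mono) (rule zero_le_power2)
qed

lemma isCont_clamp_power: "isCont (clamp_power L k) x"
  unfolding clamp_power_def[abs_def] by (intro continuous_intros)

lemma clamp_power_measurable [measurable]: "clamp_power L k \<in> borel_measurable borel"
  unfolding clamp_power_def[abs_def] by measurable

text \<open>The error vanishes for |x| at most L; beyond that both terms are at most |x|^k, and
  |x|^k / L^k is at least 1. The error is thus controlled by the moment of order 2 k, which provides
  uniform integrability.\<close>

lemma clamp_power_error:
  assumes L: "L > 0" and k: "k \<ge> 1"
  shows "\<bar>x ^ k - clamp_power L k x\<bar> \<le> 2 * x ^ (2 * k) / L ^ k"
proof (cases "\<bar>x\<bar> \<le> L")
  case True
  then have "clamp_power L k x = x ^ k" by (rule clamp_power_eq)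
  then show ?thesis using L by (simp add: power_mult)
next
  case False
  have L1: "L ^ k \<le> \<bar>x\<bar> ^ k" using L False by (intro power_mono) auto
  have "\<bar>x ^ k - clamp_power L k x\<bar> \<le> \<bar>x\<bar> ^ k + L ^ k"
    using clamp_power_le[of L k x] L by (intro order_trans[OF abs_triangle_ineq4]) (simp add: power_abs)
  also have "\<dots> \<le> 2 * \<bar>x\<bar> ^ k" using L1 by simp
  also have "\<dots> \<le> 2 * (\<bar>x\<bar> ^ k * (\<bar>x\<bar> ^ k / L ^ k))"
  proof -
    have "1 \<le> \<bar>x\<bar> ^ k / L ^ k" using L1 L by simp
    then have "\<bar>x\<bar> ^ k * 1 \<le> \<bar>x\<bar> ^ k * (\<bar>x\<bar> ^ k / L ^ k)" by (intro mult_left_mono) auto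
    then show ?thesis by simp
  qed
  also have "\<dots> = 2 * x ^ (2 * k) / L ^ k"
  proof -
    have "\<bar>x\<bar> ^ k * \<bar>x\<bar> ^ k = x ^ (2 * k)" by (simp add: power_mult power2_eq_square flip: power_mult_distrib)
    then show ?thesis by simp
  qed
  finally show ?thesis .
qed

lemma (in real_distribution) integrable_clamp_power: "L \<ge> 0 \<Longrightarrow> integrable M (clamp_power L k)"
  using clamp_power_le by (intro integrable_const_bound[of _ "L ^ k"]) (auto simp: space_eq_univ)

lemma (in real_distribution) expectation_clamp_power_error:
  assumes L: "L > 0" and k: "k \<ge> 1" and int: "integrable M (\<lambda>x. x ^ k)" "integrable M (\<lambda>x. x ^ (2 * k))"
  shows "\<bar>expectation (\<lambda>x. x ^ k) - expectation (clamp_power L k)\<bar> \<le> 2 * expectation (\<lambda>x. x ^ (2 * k)) / L ^ k"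
proof -
  have c: "integrable M (clamp_power L k)" using L by (intro integrable_clamp_power) simp
  have "\<bar>expectation (\<lambda>x. x ^ k) - expectation (clamp_power L k)\<bar> = \<bar>expectation (\<lambda>x. x ^ k - clamp_power L k x)\<bar>"
    using int c by (subst Bochner_Integration.integral_diff) auto
  also have "\<dots> \<le> expectation (\<lambda>x. \<bar>x ^ k - clamp_power L k x\<bar>)" by (rule integral_abs_bound)
  also have "\<dots> \<le> expectation (\<lambda>x. 2 * x ^ (2 * k) / L ^ k)"
    using int c by (intro integral_mono clamp_power_error L k) auto
  also have "\<dots> = 2 * expectation (\<lambda>x. x ^ (2 * k)) / L ^ k" by simp
  finally show ?thesis .
qed

lemma weak_limit_moments:
  fixes \<mu> :: "nat \<Rightarrow> real measure"
  assumes \<mu>: "\<And>n. real_distribution (\<mu> n)" "\<And>n k. integrable (\<mu> n) (\<lambda>x. x ^ k)"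
    and lim: "\<And>k. (\<lambda>n. \<integral>x. x ^ k \<partial>\<mu> n) \<longlonglongrightarrow> a k"
    and \<nu>: "real_distribution \<nu>" "weak_conv_m \<mu> \<nu>"
  shows "integrable \<nu> (\<lambda>x. x ^ k)" "(\<integral>x. x ^ k \<partial>\<nu>) = a k"
proof -
  interpret \<mu>: real_distribution "\<mu> n" for n by (rule \<mu>)
  interpret \<nu>: real_distribution \<nu> by (rule \<nu>)
  have cl: "(\<lambda>n. \<integral>x. clamp_power L k x \<partial>\<mu> n) \<longlonglongrightarrow> (\<integral>x. clamp_power L k x \<partial>\<nu>)" if "L \<ge> 0" for L k
    by (rule weak_conv_imp_integral_bdd_continuous_conv[OF \<mu>(1) \<nu>, of _ "L ^ k"])
      (auto simp: isCont_clamp_power clamp_power_le that)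
  have even_le: "(\<integral>x. clamp_power L (2 * k) x \<partial>\<nu>) \<le> a (2 * k)" if "L \<ge> 0" for L k
    using that by (intro LIMSEQ_le[OF cl lim] exI[of _ 0] allI impI integral_mono \<mu>(2) \<mu>.integrable_clamp_power clamp_power_even_le)
  \<comment> \<open>Even orders come first: there the truncations increase with L, and monotone
    convergence yields integrability from the bound on their integrals. Odd orders are dominated by
    1 + x^(2k).\<close>
  have even: "integrable \<nu> (\<lambda>x. x ^ (2 * k)) \<and> (\<integral>x. x ^ (2 * k) \<partial>\<nu>) \<le> a (2 * k)" for k
  proof -
    define I where "I n = (\<integral>x. clamp_power (real n) (2 * k) x \<partial>\<nu>)" for n
    have "incseq I" unfolding I_def incseq_def
      by (intro allI impI integral_mono \<nu>.integrable_clamp_power clamp_power_even_mono) auto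
    moreover have "I n \<le> a (2 * k)" for n unfolding I_def by (rule even_le) simp
    ultimately obtain J where J: "I \<longlonglongrightarrow> J" using incseq_convergent[of I "a (2 * k)"] by metis
    have pw: "(\<lambda>n. clamp_power (real n) (2 * k) x) \<longlonglongrightarrow> x ^ (2 * k)" for x
    proof (rule tendsto_eventually)
      obtain N where N: "\<bar>x\<bar> \<le> real N" using real_arch_simple by blast
      have "clamp_power (real n) (2 * k) x = x ^ (2 * k)" if "n \<ge> N" for n
      proof -
        have "\<bar>x\<bar> \<le> real n" using N that by linarith
        then show ?thesis by (rule clamp_power_eq)
      qed
      then show "\<forall>\<^sub>F n in sequentially. clamp_power (real n) (2 * k) x = x ^ (2 * k)"
        by (auto simp: eventually_sequentially)
    qed
    have mono: "AE x in \<nu>. mono (\<lambda>n. clamp_power (real n) (2 * k) x)"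
      by (intro AE_I2 monoI clamp_power_even_mono) auto
    have "has_bochner_integral \<nu> (\<lambda>x. x ^ (2 * k)) J"
      by (rule has_bochner_integral_monotone_convergence[where f = "\<lambda>n. clamp_power (real n) (2 * k)"])
        (use J mono pw in \<open>auto simp: I_def[abs_def] \<nu>.integrable_clamp_power\<close>)
    moreover have "J \<le> a (2 * k)" using J \<open>\<And>n. I n \<le> a (2 * k)\<close> by (intro LIMSEQ_le_const2) auto
    ultimately show ?thesis by (auto simp: has_bochner_integral_iff)
  qed
  show int: "integrable \<nu> (\<lambda>x. x ^ k)" for k
  proof (rule Bochner_Integration.integrable_bound[of _ "\<lambda>x. 1 + x ^ (2 * k)"])
    show "integrable \<nu> (\<lambda>x. 1 + x ^ (2 * k))" using even[of k] by simp
    have "\<bar>x ^ k\<bar> \<le> 1 + x ^ (2 * k)" for x :: real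
    proof -
      have "0 \<le> (\<bar>x ^ k\<bar> - 1)\<^sup>2" by simp
      then have "2 * \<bar>x ^ k\<bar> \<le> 1 + (x ^ k)\<^sup>2" by (simp add: power2_diff)
      also have "(x ^ k)\<^sup>2 = x ^ (2 * k)" by (simp add: power_mult mult.commute flip: power_mult)
      finally show ?thesis using abs_ge_zero[of "x ^ k"] by linarith
    qed
    then show "AE x in \<nu>. norm (x ^ k) \<le> norm (1 + x ^ (2 * k))" by (intro AE_I2) (use abs_ge_self order_trans in \<open>fastforce simp del: power_abs\<close>)
  qed auto
  show "(\<integral>x. x ^ k \<partial>\<nu>) = a k"
  proof (cases "k = 0")
    case True
    have "(\<lambda>n. \<integral>x. x ^ 0 \<partial>\<mu> n) \<longlonglongrightarrow> a 0" by (rule lim)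
    moreover have "\<mu>.prob n UNIV = 1" for n using \<mu>.prob_space[of n] by simp
    moreover have "\<nu>.prob UNIV = 1" using \<nu>.prob_space by simp
    ultimately show ?thesis using True by (simp add: LIMSEQ_const_iff)
  next
    case False
    then have k: "k \<ge> 1" by simp
    \<comment> \<open>The truncation error counts twice, once for the approximating laws in the
      limit and once for \<nu>; both parts vanish as the truncation level grows.\<close>
    have "\<bar>(\<integral>x. x ^ k \<partial>\<nu>) - a k\<bar> \<le> 4 * a (2 * k) / real (Suc N) ^ k" for N
    proof -
      define L where "L = real (Suc N)"
      have L: "L > 0" by (simp add: L_def)
      have "(\<lambda>n. \<bar>(\<integral>x. x ^ k \<partial>\<mu> n) - (\<integral>x. clamp_power L k x \<partial>\<mu> n)\<bar>) \<longlonglongrightarrow> \<bar>a k - (\<integral>x. clamp_power L k x \<partial>\<nu>)\<bar>"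
        using L by (intro tendsto_intros lim cl) simp
      moreover have "(\<lambda>n. 2 * (\<integral>x. x ^ (2 * k) \<partial>\<mu> n) / L ^ k) \<longlonglongrightarrow> 2 * a (2 * k) / L ^ k"
        using L by (intro tendsto_intros lim) simp
      ultimately have "\<bar>a k - (\<integral>x. clamp_power L k x \<partial>\<nu>)\<bar> \<le> 2 * a (2 * k) / L ^ k"
        by (rule LIMSEQ_le) (intro exI[of _ 0] allI impI \<mu>.expectation_clamp_power_error L k \<mu>(2))
      moreover have "\<bar>(\<integral>x. x ^ k \<partial>\<nu>) - (\<integral>x. clamp_power L k x \<partial>\<nu>)\<bar> \<le> 2 * (\<integral>x. x ^ (2 * k) \<partial>\<nu>) / L ^ k"
        by (intro \<nu>.expectation_clamp_power_error L k int)
      moreover have "2 * (\<integral>x. x ^ (2 * k) \<partial>\<nu>) / L ^ k \<le> 2 * a (2 * k) / L ^ k"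
        using even[of k] L by (intro divide_right_mono) auto
      ultimately have "\<bar>(\<integral>x. x ^ k \<partial>\<nu>) - a k\<bar> \<le> 2 * a (2 * k) / L ^ k + 2 * a (2 * k) / L ^ k" by linarith
      then show ?thesis by (simp add: L_def)
    qed
    moreover have "(\<lambda>N. 4 * a (2 * k) / real (Suc N) ^ k) \<longlonglongrightarrow> 0"
    proof -
      have "(\<lambda>N. 4 * a (2 * k) * (inverse (real (Suc N))) ^ k) \<longlonglongrightarrow> 4 * a (2 * k) * 0 ^ k"
        by (intro tendsto_intros LIMSEQ_inverse_real_of_nat)
      then show ?thesis using k by (simp add: power_0_left power_inverse divide_inverse)
    qed
    ultimately have "\<bar>(\<integral>x. x ^ k \<partial>\<nu>) - a k\<bar> \<le> 0" by (intro LIMSEQ_le_const) auto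
    then show ?thesis by simp
  qed
qed

text \<open>Chebyshev's inequality with a bound common to all laws.\<close>

lemma tight_second_moment:
  assumes \<mu>: "\<And>n. real_distribution (\<mu> n)" "\<And>n. integrable (\<mu> n) (\<lambda>x. x\<^sup>2)"
    and B: "\<And>n. (\<integral>x. x\<^sup>2 \<partial>\<mu> n) \<le> B"
  shows "tight \<mu>"
  unfolding tight_def
proof (intro conjI allI impI \<mu>)
  fix \<epsilon> :: real assume \<epsilon>: "\<epsilon> > 0"
  interpret \<mu>: real_distribution "\<mu> n" for n by (rule \<mu>)
  have "B \<ge> 0" by (rule order_trans[OF _ B[of 0]]) simp
  \<comment> \<open>The summand 1 keeps L positive for B = 0 and makes the final inequality
    strict.\<close>
  define L where "L = sqrt (B / \<epsilon> + 1)"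
  have L: "L > 0" "L\<^sup>2 > B / \<epsilon>" using \<open>B \<ge> 0\<close> \<epsilon> by (simp_all add: L_def add_nonneg_pos)
  have "measure (\<mu> n) {- L<..L} > 1 - \<epsilon>" for n
  proof -
    have "measure (\<mu> n) {x \<in> space (\<mu> n). x\<^sup>2 \<ge> L\<^sup>2} \<le> (\<integral>x. x\<^sup>2 \<partial>\<mu> n) / L\<^sup>2"
      using L by (intro integral_Markov_inequality_measure[where A = "{}"] \<mu>) auto
    also have "\<dots> \<le> B / L\<^sup>2" using B L by (intro divide_right_mono) auto
    also have "\<dots> < \<epsilon>" using L \<epsilon> by (simp add: field_simps)
    finally have "measure (\<mu> n) {x \<in> space (\<mu> n). x\<^sup>2 \<ge> L\<^sup>2} < \<epsilon>" .
    moreover have "1 - measure (\<mu> n) {- L<..L} = measure (\<mu> n) (space (\<mu> n) - {- L<..L})"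
      using \<mu>.prob_compl[of "{- L<..L}" n] by simp
    moreover have "measure (\<mu> n) (space (\<mu> n) - {- L<..L}) \<le> measure (\<mu> n) {x \<in> space (\<mu> n). x\<^sup>2 \<ge> L\<^sup>2}"
    proof (rule \<mu>.finite_measure_mono)
      have "x\<^sup>2 \<ge> L\<^sup>2" if "x \<notin> {- L<..L}" for x
      proof -
        have "\<bar>L\<bar> \<le> \<bar>x\<bar>" using that L by auto
        then show ?thesis by (simp add: abs_le_square_iff)
      qed
      then show "space (\<mu> n) - {- L<..L} \<subseteq> {x \<in> space (\<mu> n). L\<^sup>2 \<le> x\<^sup>2}" by auto
    qed simp
    ultimately show ?thesis by linarith
  qed
  then show "\<exists>a b. a < b \<and> (\<forall>n. 1 - \<epsilon> < measure (\<mu> n) {a<..b})"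
    using L by (intro exI[of _ "- L"] exI[of _ L]) auto
qed

text \<open>Tightness provides a weakly convergent subsequence. Every subsequential limit has the
  moments a, hence is the same law by \<open>moment_determinacy\<close>, and so the whole sequence
  converges.\<close>

theorem method_of_moments:
  fixes \<mu> :: "nat \<Rightarrow> real measure"
  assumes \<mu>: "\<And>n. real_distribution (\<mu> n)" "\<And>n k. integrable (\<mu> n) (\<lambda>x. x ^ k)"
    and lim: "\<And>k. (\<lambda>n. \<integral>x. x ^ k \<partial>\<mu> n) \<longlonglongrightarrow> a k"
    and growth: "\<And>t. (\<lambda>n. t ^ (2 * n) * a (2 * n) / fact (2 * n)) \<longlonglongrightarrow> 0"
  obtains \<nu> where "real_distribution \<nu>" "\<And>k. integrable \<nu> (\<lambda>x. x ^ k)" "\<And>k. (\<integral>x. x ^ k \<partial>\<nu>) = a k" "weak_conv_m \<mu> \<nu>"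
proof -
  have "convergent (\<lambda>n. \<integral>x. x\<^sup>2 \<partial>\<mu> n)" using lim by (auto simp: convergent_def)
  then obtain B where B: "\<And>n. norm (\<integral>x. x\<^sup>2 \<partial>\<mu> n) \<le> B"
    using convergent_imp_Bseq Bseq_def by metis
  have "tight \<mu>"
  proof (rule tight_second_moment[OF \<mu>])
    show "(\<integral>x. x\<^sup>2 \<partial>\<mu> n) \<le> B" for n using B[of n] by simp
  qed
  have sub: "integrable \<nu> (\<lambda>x. x ^ k)" "(\<integral>x. x ^ k \<partial>\<nu>) = a k"
    if "strict_mono s" "real_distribution \<nu>" "weak_conv_m (\<mu> \<circ> s) \<nu>" for s \<nu> k
    using weak_limit_moments[of "\<mu> \<circ> s" a \<nu>] \<mu> that lim[THEN LIMSEQ_subseq_LIMSEQ, OF that(1)]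
    by (auto simp: comp_def)
  obtain r \<nu> where r: "strict_mono r" and \<nu>: "real_distribution \<nu>" "weak_conv_m (\<mu> \<circ> id \<circ> r) \<nu>"
    using tight_imp_convergent_subsubsequence[OF \<open>tight \<mu>\<close> strict_mono_id] by blast
  have c: "weak_conv_m (\<mu> \<circ> r) \<nu>" using \<nu>(2) by simp
  have "weak_conv_m \<mu> \<nu>"
  proof (rule tight_subseq_weak_converge[OF \<mu>(1) \<nu>(1) \<open>tight \<mu>\<close>])
    fix s \<nu>' assume s: "strict_mono s" "real_distribution \<nu>'" "weak_conv_m (\<mu> \<circ> s) \<nu>'"
    have "\<nu>' = \<nu>"
      by (rule moment_determinacy[OF s(2) sub[OF s] \<nu>(1) sub[OF r \<nu>(1) c] growth])
    then show "weak_conv_m (\<mu> \<circ> s) \<nu>" using s by simp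
  qed
  then show ?thesis using that \<nu>(1) sub[OF r \<nu>(1) c] by blast
qed

section \<open>Growth of the Airy moments\<close>

text \<open>Among the products of factorials of two positive numbers with sum k, the largest is (k -
  1)!; this controls the convolution in \<open>airy_Omega_bound\<close>.\<close>

lemma fact_mult_fact_le: "1 \<le> i \<Longrightarrow> fact i * fact (Suc j) \<le> (fact (i + j) :: real)"
proof (induction j)
  case 0
  then show ?case by simp
next
  case (Suc j)
  have "fact i * fact (Suc (Suc j)) = (real j + 2) * (fact i * fact (Suc j) :: real)" by (simp add: fact_Suc[of "Suc j"] del: fact_Suc)
  also have "\<dots> \<le> (real j + 2) * fact (i + j)" using Suc by (intro mult_left_mono) auto
  also have "\<dots> \<le> real (Suc (i + j)) * fact (i + j)" using Suc by (intro mult_right_mono) auto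
  finally show ?case by simp
qed

text \<open>The bound is tuned to the recursion: |3 k - 4| is at most 3 k, which explains the base 3
  and the squared factorial; the k - 1 terms of the convolution together obey the same bound, and
  the division by 2 closes the induction.\<close>

lemma airy_Omega_bound: "\<bar>airy_Omega k\<bar> \<le> 3 ^ k * (fact k)\<^sup>2"
proof (induction k rule: less_induct)
  case (less k)
  show ?case
  proof (cases "k = 0")
    case True
    then show ?thesis by (simp add: airy_Omega.simps)
  next
    case False
    then have k: "k \<ge> 1" by simp
    have f: "fact k = real k * fact (k - 1)" using False by (intro fact_reduce) auto
    have "\<bar>(3 * real k - 4) * real k * airy_Omega (k - 1)\<bar> \<le> (3 * real k) * real k * (3 ^ (k - 1) * (fact (k - 1))\<^sup>2)"
      unfolding abs_mult using less[of "k - 1"] k by (intro mult_mono) auto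
    also have "\<dots> = (3 * 3 ^ (k - 1)) * (real k * fact (k - 1))\<^sup>2" by (simp add: power2_eq_square)
    also have "\<dots> = 3 ^ k * (fact k)\<^sup>2" using k unfolding f by (simp flip: power_Suc)
    finally have A: "\<bar>(3 * real k - 4) * real k * airy_Omega (k - 1)\<bar> \<le> 3 ^ k * (fact k)\<^sup>2" .
    have "\<bar>\<Sum>i=1..k-1. real (k choose i) * airy_Omega i * airy_Omega (k - i)\<bar>
       \<le> (\<Sum>i=1..k-1. \<bar>real (k choose i) * airy_Omega i * airy_Omega (k - i)\<bar>)" by (rule sum_abs)
    also have "\<dots> \<le> (\<Sum>i=1..k-1. 3 ^ k * fact k * fact (k - 1))"
    proof (rule sum_mono)
      fix i assume i: "i \<in> {1..k - 1}"
      have p: "(3::real) ^ k = 3 ^ i * 3 ^ (k - i)" 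
      proof -
        have "i + (k - i) = k" using i by auto
        then show ?thesis by (simp flip: power_add)
      qed
      have "\<bar>real (k choose i) * airy_Omega i * airy_Omega (k - i)\<bar>
         \<le> real (k choose i) * (3 ^ i * (fact i)\<^sup>2) * (3 ^ (k - i) * (fact (k - i))\<^sup>2)"
        unfolding abs_mult using less[of i] less[of "k - i"] i by (intro mult_mono) auto
      also have "\<dots> = 3 ^ k * fact k * (fact i * fact (k - i))"
      proof -
        have "real (k choose i) = fact k / (fact i * fact (k - i))" using i by (intro binomial_fact) auto
        then show ?thesis unfolding p by (simp add: power2_eq_square)
      qed
      also have "\<dots> \<le> 3 ^ k * fact k * fact (k - 1)"
      proof -
        have "k - i = Suc (k - i - 1)" "i + (k - i - 1) = k - 1" using i by auto
        then have "fact i * fact (k - i) \<le> (fact (k - 1) :: real)" using fact_mult_fact_le[of i "k - i - 1"] i by simp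
        then show ?thesis by (intro mult_left_mono) auto
      qed
      finally show "\<bar>real (k choose i) * airy_Omega i * airy_Omega (k - i)\<bar> \<le> 3 ^ k * fact k * fact (k - 1)" .
    qed
    also have "\<dots> = real (k - 1) * (3 ^ k * fact k * fact (k - 1))" by simp
    also have "\<dots> \<le> real k * (3 ^ k * fact k * fact (k - 1))" by (intro mult_right_mono) auto
    also have "\<dots> = 3 ^ k * (fact k)\<^sup>2" by (simp add: f power2_eq_square)
    finally have B: "\<bar>\<Sum>i=1..k-1. real (k choose i) * airy_Omega i * airy_Omega (k - i)\<bar> \<le> 3 ^ k * (fact k)\<^sup>2" .
    have eq: "airy_Omega k = ((3 * real k - 4) * real k * airy_Omega (k - 1) + (\<Sum>i=1..k-1. real (k choose i) * airy_Omega i * airy_Omega (k - i))) / 2"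
      using k by (subst airy_Omega.simps) simp
    have half: "\<bar>(x + y) / 2\<bar> \<le> c" if "\<bar>x\<bar> \<le> c" "\<bar>y\<bar> \<le> c" for x y c :: real using that by (simp add: abs_le_iff)
    show ?thesis unfolding eq by (rule half[OF A B])
  qed
qed

text \<open>By \<open>airy_Omega_bound\<close> it suffices to treat x^n (2n)! / Gamma (3n - 1/2).
  From n to n + 1 the Gamma function gains a cubic factor and the factorial a quadratic one, so the
  ratio test applies.\<close>

lemma airy_moment_growth: "(\<lambda>n. t ^ (2 * n) * airy_moment (2 * n) / fact (2 * n)) \<longlonglongrightarrow> 0"
proof -
  \<comment> \<open>The 9 takes up the factor 3^(2n) of the bound on
    \<open>airy_Omega (2 * n)\<close>.\<close>
  define x where "x = 9 * t\<^sup>2"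
  define r where "r n = x ^ n * fact (2 * n) / Gamma (3 * real n - 1 / 2)" for n
  define q where "q n = x * ((2 * real n + 1) * (2 * real n + 2) / ((3 * real n - 1 / 2) * (3 * real n + 1 / 2) * (3 * real n + 3 / 2)))" for n
  have Gpos: "Gamma (3 * real n - 1 / 2) > 0" if "n \<ge> 1" for n using that by (intro Gamma_real_pos) simp
  have step: "r (Suc n) = q n * r n" if n: "n \<ge> 1" for n
  proof -
    have G1: "Gamma (y + 1) = y * Gamma y" if "y > 0" for y :: real 
    proof (rule Gamma_plus1)
      show "y \<notin> \<int>\<^sub>\<le>\<^sub>0" using that by (auto elim!: nonpos_Ints_cases')
    qed
    define y where "y = 3 * real n - 1 / 2"
    have y: "y > 0" using n by (simp add: y_def)
    have "Gamma (3 * real (Suc n) - 1 / 2) = Gamma (y + 1 + 1 + 1)" by (simp add: y_def algebra_simps)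
    also have "\<dots> = (y + 1 + 1) * Gamma (y + 1 + 1)" using y by (intro G1) simp
    also have "Gamma (y + 1 + 1) = (y + 1) * Gamma (y + 1)" using y by (intro G1) simp
    also have "Gamma (y + 1) = y * Gamma y" using y by (intro G1)
    finally have G: "Gamma (3 * real (Suc n) - 1 / 2) = (y + 1 + 1) * ((y + 1) * (y * Gamma y))" .
    have F: "fact (2 * Suc n) = (2 * real n + 2) * ((2 * real n + 1) * fact (2 * n))" by (simp add: algebra_simps)
    have Q: "q n = x * ((2 * real n + 1) * (2 * real n + 2) / (y * (y + 1) * (y + 1 + 1)))" by (simp add: q_def y_def algebra_simps)
    show ?thesis unfolding r_def G F Q y_def[symmetric] using Gpos[OF n] y by (simp add: y_def[symmetric] ac_simps)
  qed
  have "(\<lambda>n. (2 * real n + 1) * (2 * real n + 2) / ((3 * real n - 1 / 2) * (3 * real n + 1 / 2) * (3 * real n + 3 / 2))) \<longlonglongrightarrow> 0"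
    by real_asymp
  then have "q \<longlonglongrightarrow> x * 0" unfolding q_def by (intro tendsto_intros)
  then have "q \<longlonglongrightarrow> 0" by simp
  then have "\<forall>\<^sub>F n in sequentially. norm (q n) < 1 / 2" by (intro order_tendstoD(2)[OF tendsto_norm_zero]) auto
  then obtain N where N: "\<And>n. n \<ge> N \<Longrightarrow> norm (q n) < 1 / 2" by (auto simp: eventually_sequentially)
  have "summable r"
  proof (rule summable_ratio_test[where c = "1 / 2" and N = "max N 1"])
    fix n assume n: "n \<ge> max N 1"
    then have "norm (r (Suc n)) = norm (q n) * norm (r n)" by (simp add: step abs_mult)
    also have "\<dots> \<le> 1 / 2 * norm (r n)" using N[of n] n by (intro mult_right_mono) auto
    finally show "norm (r (Suc n)) \<le> 1 / 2 * norm (r n)" .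
  qed simp
  then have "r \<longlonglongrightarrow> 0" by (rule summable_LIMSEQ_zero)
  then have "(\<lambda>n. 2 * sqrt pi * r n) \<longlonglongrightarrow> 2 * sqrt pi * 0" by (intro tendsto_intros)
  then have lim: "(\<lambda>n. 2 * sqrt pi * r n) \<longlonglongrightarrow> 0" by simp
  show ?thesis
  proof (rule Lim_null_comparison[OF _ lim])
    show "\<forall>\<^sub>F n in sequentially. norm (t ^ (2 * n) * airy_moment (2 * n) / fact (2 * n)) \<le> 2 * sqrt pi * r n"
      using eventually_ge_at_top[of 1]
    proof eventually_elim
      case (elim n)
      define G where "G = Gamma (3 * real n - 1 / 2)"
      have G: "G > 0" using Gpos[OF elim] by (simp add: G_def)
      have e: "(3 * real (2 * n) - 1) / 2 = 3 * real n - 1 / 2" by simp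
      have "norm (t ^ (2 * n) * airy_moment (2 * n) / fact (2 * n)) = t ^ (2 * n) * (2 * sqrt pi / G * \<bar>airy_Omega (2 * n)\<bar>) / fact (2 * n)"
        unfolding airy_moment_def e G_def[symmetric] using G by (simp add: abs_mult power_mult)
      also have "\<dots> \<le> t ^ (2 * n) * (2 * sqrt pi / G * (3 ^ (2 * n) * (fact (2 * n))\<^sup>2)) / fact (2 * n)"
        using G airy_Omega_bound[of "2 * n"] by (intro divide_right_mono mult_left_mono) (auto simp: power_mult)
      also have "\<dots> = 2 * sqrt pi * r n"
      proof -
        have "x ^ n = t ^ (2 * n) * 3 ^ (2 * n)" by (simp add: x_def power_mult power_mult_distrib)
        then show ?thesis using G by (simp add: r_def G_def[symmetric] power2_eq_square)
      qed
      finally show ?case .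
    qed
  qed
qed

section \<open>Trees of small area\<close>

text \<open>Every letter other than m - 1 has positive weight, so nodes of small path weight have
  few such letters. Unlike the exact weight, their number leads to a closed generating
  function.\<close>

definition low_count :: "nat \<Rightarrow> nat \<Rightarrow> nat list set \<Rightarrow> nat" where
  "low_count m k S = card {u \<in> S. length (filter (\<lambda>l. l \<noteq> m - 1) u) = k}"

lemma low_count_eq_sum: "finite S \<Longrightarrow> low_count m k S = (\<Sum>u\<in>S. if length (filter (\<lambda>l. l \<noteq> m - 1) u) = k then 1 else 0)"
  by (simp add: low_count_def sum.If_cases Int_def)

text \<open>The last branch prepends a free letter and the others one that counts; the summand 1 for
  k = 0 is the root.\<close>

lemma low_count_graft:
  assumes g: "g \<in> {..<m} \<rightarrow>\<^sub>E all_trees m" and m: "m > 0"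
  shows "low_count m k (graft m g) =
    (if k = 0 then 1 else (\<Sum>i<m - 1. low_count m (k - 1) (g i))) + low_count m k (g (m - 1))"
proof -
  have fin: "finite (g i)" if "i < m" for i using g that finite_all_trees by (auto simp: PiE_iff)
  have finG: "finite (graft m g)" using fin by (simp add: graft_def)
  have split: "{..<m} = insert (m - 1) {..<m - 1}" using m by auto
  define h :: "nat \<Rightarrow> nat" where "h i = (\<Sum>u\<in>g i. if length (filter (\<lambda>l. l \<noteq> m - 1) (i # u)) = k then 1 else 0)" for i
  have last: "h (m - 1) = low_count m k (g (m - 1))"
    unfolding h_def using fin m by (simp add: low_count_eq_sum)
  have other: "h i = (if k = 0 then 0 else low_count m (k - 1) (g i))" if "i < m - 1" for i
    unfolding h_def using fin[of i] that by (cases k) (simp_all add: low_count_eq_sum)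
  have "low_count m k (graft m g) = (if k = 0 then 1 else 0) + sum h {..<m}"
    unfolding low_count_eq_sum[OF finG] h_def by (subst sum_graft[OF fin]) auto
  also have "sum h {..<m} = h (m - 1) + sum h {..<m - 1}" by (subst split, rule sum.insert) auto
  also have "sum h {..<m - 1} = (\<Sum>i<m - 1. if k = 0 then 0 else low_count m (k - 1) (g i))"
    by (intro sum.cong refl other) simp
  finally show ?thesis unfolding last by simp
qed

definition low_fps :: "nat \<Rightarrow> nat \<Rightarrow> real fps" where
  "low_fps m k = Abs_fps (\<lambda>n. \<Sum>S\<in>word_trees m n. real (low_count m k S))"

text \<open>Branch j carries the marked node, and each of the other m - 1 branches contributes a
  factor T.\<close>

lemma marked_branch_sum:
  assumes "j < m"
  shows "fps_nth (tree_fps m ^ (m - 1) * low_fps m k) n =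
    (\<Sum>g\<in>{g \<in> {..<m} \<rightarrow>\<^sub>E all_trees m. (\<Sum>i<m. card (g i)) = n}. real (low_count m k (g j)))"
proof -
  define w where "w i S = (if i = j then real (low_count m k S) else 1)" for i :: nat and S
  have fin: "finite {t \<in> all_trees m. card t = n}" for n using finite_word_trees by (simp add: word_trees_eq)
  have "(\<Prod>i<m. Abs_fps (\<lambda>n. \<Sum>t\<in>{t \<in> all_trees m. card t = n}. w i t)) = (\<Prod>i<m. if i = j then low_fps m k else tree_fps m)"
  proof (intro prod.cong refl)
    fix i
    show "Abs_fps (\<lambda>n. \<Sum>t\<in>{t \<in> all_trees m. card t = n}. w i t) = (if i = j then low_fps m k else tree_fps m)"
      by (rule fps_ext) (simp add: w_def low_fps_def tree_fps_def tree_count_def word_trees_eq)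
  qed
  also have "\<dots> = low_fps m k * (\<Prod>i\<in>{..<m} - {j}. tree_fps m)"
    using assms by (subst prod.remove[of _ j]) auto
  also have "\<dots> = tree_fps m ^ (m - 1) * low_fps m k" using assms by (simp add: mult.commute)
  finally have "fps_nth (tree_fps m ^ (m - 1) * low_fps m k) n =
     (\<Sum>g\<in>{g \<in> {..<m} \<rightarrow>\<^sub>E all_trees m. (\<Sum>i<m. card (g i)) = n}. \<Prod>i<m. w i (g i))"
    using fps_nth_prod_generating_functions(1)[OF fin, of "{..<m}" w n] by simp
  also have "\<dots> = (\<Sum>g\<in>{g \<in> {..<m} \<rightarrow>\<^sub>E all_trees m. (\<Sum>i<m. card (g i)) = n}. real (low_count m k (g j)))"
  proof (intro sum.cong refl)
    fix g
    have "(\<Prod>i<m. w i (g i)) = w j (g j) * (\<Prod>i\<in>{..<m} - {j}. w i (g i))" using assms by (intro prod.remove) auto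
    also have "(\<Prod>i\<in>{..<m} - {j}. w i (g i)) = 1" by (intro prod.neutral) (simp add: w_def)
    finally show "(\<Prod>i<m. w i (g i)) = real (low_count m k (g j))" by (simp add: w_def)
  qed
  finally show ?thesis .
qed

lemma tree_fps_power_m_nth:
  "fps_nth (tree_fps m ^ m) n = real (card {g \<in> {..<m} \<rightarrow>\<^sub>E all_trees m. (\<Sum>i<m. card (g i)) = n})"
proof -
  have "fps_nth (fps_X * tree_fps m ^ m) (Suc n) = tree_count m (Suc n)"
    using arg_cong[OF tree_fps_eq[of m], of "\<lambda>f. fps_nth f (Suc n)"] by (simp add: tree_fps_def)
  then show ?thesis using bij_betw_same_card[OF word_trees_Suc[of m n]] by (simp add: tree_count_def)
qed

lemma low_fps_rec:
  assumes m: "m > 0"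
  shows "low_fps m k = fps_X * ((if k = 0 then tree_fps m ^ m else of_nat (m - 1) * (tree_fps m ^ (m - 1) * low_fps m (k - 1)))
    + tree_fps m ^ (m - 1) * low_fps m k)"
proof (rule fps_ext)
  fix n
  show "fps_nth (low_fps m k) n = fps_nth (fps_X * ((if k = 0 then tree_fps m ^ m else of_nat (m - 1) * (tree_fps m ^ (m - 1) * low_fps m (k - 1)))
    + tree_fps m ^ (m - 1) * low_fps m k)) n"
  proof (cases n)
    case 0
    then show ?thesis by (simp add: low_fps_def word_trees_0 low_count_def)
  next
    case (Suc n')
    define G where "G = {g \<in> {..<m} \<rightarrow>\<^sub>E all_trees m. (\<Sum>i<m. card (g i)) = n'}"
    have "fps_nth (low_fps m k) n = (\<Sum>g\<in>G. real (low_count m k (graft m g)))"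
      unfolding low_fps_def fps_nth_Abs_fps Suc G_def by (rule sum.reindex_bij_betw[OF word_trees_Suc, symmetric])
    also have "\<dots> = (\<Sum>g\<in>G. (if k = 0 then 1 else (\<Sum>i<m - 1. real (low_count m (k - 1) (g i)))) + real (low_count m k (g (m - 1))))"
      by (intro sum.cong refl, subst low_count_graft) (auto simp: G_def m)
    also have "\<dots> = (if k = 0 then real (card G) else (\<Sum>i<m - 1. \<Sum>g\<in>G. real (low_count m (k - 1) (g i))))
       + (\<Sum>g\<in>G. real (low_count m k (g (m - 1))))"
      unfolding sum.distrib by (simp add: sum.swap[of _ G])
    also have "(\<Sum>i<m - 1. \<Sum>g\<in>G. real (low_count m (k - 1) (g i))) = real (m - 1) * fps_nth (tree_fps m ^ (m - 1) * low_fps m (k - 1)) n'"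
    proof -
      have "(\<Sum>g\<in>G. real (low_count m (k - 1) (g i))) = fps_nth (tree_fps m ^ (m - 1) * low_fps m (k - 1)) n'" if "i < m - 1" for i
        unfolding G_def by (rule marked_branch_sum[symmetric]) (use that in simp)
      then have "(\<Sum>i<m - 1. \<Sum>g\<in>G. real (low_count m (k - 1) (g i))) = (\<Sum>i<m - 1. fps_nth (tree_fps m ^ (m - 1) * low_fps m (k - 1)) n')"
        by (intro sum.cong refl) simp
      then show ?thesis by simp
    qed
    also have "(\<Sum>g\<in>G. real (low_count m k (g (m - 1)))) = fps_nth (tree_fps m ^ (m - 1) * low_fps m k) n'"
      unfolding G_def by (rule marked_branch_sum[symmetric]) (use m in simp)
    also have "real (card G) = fps_nth (tree_fps m ^ m) n'" by (simp add: G_def tree_fps_power_m_nth)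
    finally show ?thesis by (simp add: Suc fps_of_nat[symmetric])
  qed
qed

text \<open>After multiplication by T the unknown series occurs on the right with factor X T^m = T -
  1, so it can be eliminated. What remains is a geometric recursion in k.\<close>

lemma low_fps_eq:
  assumes m: "m > 0"
  shows "low_fps m k = of_nat ((m - 1) ^ k) * (fps_X ^ (k + 1) * tree_fps m ^ (m * (k + 1) + 1))"
proof -
  let ?T = "tree_fps m" and ?L = "low_fps m"
  have X: "fps_X * ?T ^ m = ?T - 1" using tree_fps_eq[of m] by (metis add_diff_cancel_left')
  have T: "?T * ?T ^ (m - 1) = ?T ^ m" using m by (simp flip: power_Suc)
  have rec: "?L k = fps_X * ?T ^ m * (if k = 0 then ?T else of_nat (m - 1) * ?L (k - 1))" for k
  proof -
    define R where "R = (if k = 0 then ?T ^ m else of_nat (m - 1) * (?T ^ (m - 1) * ?L (k - 1)))"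
    have R: "?T * R = ?T ^ m * (if k = 0 then ?T else of_nat (m - 1) * ?L (k - 1))"
    proof (cases "k = 0")
      case False
      have "?T * (of_nat (m - 1) * (?T ^ (m - 1) * ?L (k - 1))) = (?T * ?T ^ (m - 1)) * (of_nat (m - 1) * ?L (k - 1))" by (simp only: ac_simps)
      then show ?thesis unfolding T using False by (simp only: R_def if_False)
    qed (simp add: R_def mult.commute)
    have "?L k = fps_X * (R + ?T ^ (m - 1) * ?L k)" unfolding R_def by (rule low_fps_rec[OF m])
    then have "?T * ?L k = ?T * (fps_X * (R + ?T ^ (m - 1) * ?L k))" by (rule arg_cong)
    also have "\<dots> = fps_X * (?T * R) + fps_X * (?T * ?T ^ (m - 1)) * ?L k" by (simp only: algebra_simps)
    also have "\<dots> = fps_X * (?T * R) + (?T - 1) * ?L k" unfolding T X ..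
    finally have "?L k = fps_X * (?T * R)" by (simp add: left_diff_distrib)
    then show ?thesis unfolding R by (simp only: mult.assoc)
  qed
  show ?thesis
  proof (induction k)
    case 0
    show ?case by (subst rec) (simp add: ac_simps)
  next
    case (Suc k)
    have "?L (Suc k) = fps_X * ?T ^ m * (of_nat (m - 1) * ?L k)" by (subst rec) simp
    also have "\<dots> = (of_nat (m - 1) * of_nat ((m - 1) ^ k)) * ((fps_X * fps_X ^ (k + 1)) * (?T ^ m * ?T ^ (m * (k + 1) + 1)))"
      unfolding Suc by (simp only: ac_simps)
    also have "of_nat (m - 1) * of_nat ((m - 1) ^ k) = (of_nat ((m - 1) ^ Suc k) :: real fps)" by (simp only: of_nat_mult[symmetric] power_Suc)
    also have "?T ^ m * ?T ^ (m * (k + 1) + 1) = ?T ^ (m * (Suc k + 1) + 1)" by (simp only: power_add[symmetric]) (simp add: algebra_simps)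
    also have "fps_X * fps_X ^ (k + 1) = (fps_X ^ (Suc k + 1) :: real fps)" by simp
    finally show ?case .
  qed
qed

section \<open>Mean number of nodes of small weight\<close>

lemma low_fps_nth:
  "m > 0 \<Longrightarrow> fps_nth (low_fps m k) n = real (m - 1) ^ k * (if n < k + 1 then 0 else raney m (n - (k + 1)) (m * (k + 1) + 1))"
  by (subst low_fps_eq, assumption)
    (simp only: fps_of_nat[symmetric] fps_mult_left_const_nth fps_X_power_mult_nth fps_nth_tree_fps_power of_nat_power)

text \<open>With N = m n + 1 and i < n, the ratio (N - i) / (i + 1) of consecutive binomial
  coefficients is at least m - 1.\<close>

lemma binomial_shift_le:
  assumes "m > 0" "j \<le> n"
  shows "real (m - 1) ^ j * real (m * n + 1 choose (n - j)) \<le> real (m * n + 1 choose n)"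
  using assms(2)
proof (induction j)
  case (Suc j)
  define i where "i = n - Suc j"
  have i: "n - j = Suc i" "i < n" using Suc by (auto simp: i_def)
  define N where "N = m * n + 1"
  have "Suc i * (N choose Suc i) = (N - i) * (N choose i)" by (simp only: binomial_absorption binomial_absorb_comp)
  then have "real (Suc i * (N choose Suc i)) = real ((N - i) * (N choose i))" by (rule arg_cong)
  then have ab: "real (Suc i) * real (N choose Suc i) = real (N - i) * real (N choose i)" by (simp only: of_nat_mult)
  have "real (m - 1) * real (Suc i) \<le> real (N - i)"
  proof -
    have "(m - 1) * Suc i \<le> (m - 1) * n" using i by (intro mult_le_mono2) auto
    moreover have "(m - 1) * n = m * n - n" by (simp add: diff_mult_distrib)
    ultimately have "(m - 1) * Suc i \<le> N - i" using i by (simp add: N_def)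
    then have "real ((m - 1) * Suc i) \<le> real (N - i)" by (rule of_nat_mono)
    then show ?thesis by (simp only: of_nat_mult)
  qed
  then have "real (m - 1) * real (Suc i) * real (N choose i) \<le> real (N - i) * real (N choose i)"
    by (rule mult_right_mono) simp
  then have "real (Suc i) * (real (m - 1) * real (N choose i)) \<le> real (Suc i) * real (N choose Suc i)"
    unfolding ab by (simp only: ac_simps)
  then have "real (m - 1) * real (N choose i) \<le> real (N choose Suc i)"
    by (rule mult_left_le_imp_le) simp
  then have "real (m - 1) ^ j * (real (m - 1) * real (N choose i)) \<le> real (m - 1) ^ j * real (N choose Suc i)"
    by (rule mult_left_mono) simp
  also have "\<dots> \<le> real (m * n + 1 choose n)" using Suc i unfolding N_def by simp
  finally show ?case unfolding i_def[symmetric] N_def[symmetric] power_Suc by (simp only: ac_simps)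
qed simp

text \<open>The mean stays bounded as n grows: by \<open>low_fps_nth\<close> the sum is a Raney
  number, and it is compared with the tree number through binomial coefficients with common upper
  index m n + 1.\<close>

lemma mean_low_count_le:
  assumes m: "m \<ge> 2"
  shows "(\<Sum>S\<in>word_trees m n. real (low_count m k S)) \<le> real (m * (k + 1) + 1) * tree_count m n"
proof (cases "k + 1 \<le> n")
  case False
  have "fps_nth (low_fps m k) n = 0" using False by (simp add: low_fps_nth m_pos[OF m])
  then show ?thesis using tree_count_pos[OF m_pos[OF m], of n] by (simp add: low_fps_def)
next
  case True
  define x where "x = m * (k + 1) + 1"
  define j where "j = n - (k + 1)"
  have n: "n = j + (k + 1)" using True by (simp add: j_def)
  have N: "m * j + x = m * n + 1" by (simp add: n x_def algebra_simps)
  have x: "x > 0" by (simp add: x_def)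
  have ra: "raney m j x = real x / real (m * n + 1) * real (m * n + 1 choose j)"
  proof (cases "j = 0")
    case True
    then have "m * n + 1 = x" using N by simp
    then show ?thesis unfolding \<open>m * n + 1 = x\<close> using True x by (simp add: raney_def)
  next
    case False
    then show ?thesis unfolding raney_def N by simp
  qed
  \<comment> \<open>One more factor m - 1, which is at least 1, brings the exponent to k + 1 = n -
    j, the shift treated in \<open>binomial_shift_le\<close>.\<close>
  have r: "(real (m - 1) ^ k) * raney m j x \<le> real x / real (m * n + 1) * (real (m - 1) ^ (k + 1) * real (m * n + 1 choose j))"
  proof -
    have "real (m - 1) ^ k * real (m * n + 1 choose j) \<le> real (m - 1) ^ (k + 1) * real (m * n + 1 choose j)"
      using m by (intro mult_right_mono power_increasing) auto
    then have "real x / real (m * n + 1) * (real (m - 1) ^ k * real (m * n + 1 choose j))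
       \<le> real x / real (m * n + 1) * (real (m - 1) ^ (k + 1) * real (m * n + 1 choose j))" by (rule mult_left_mono) simp
    then show ?thesis unfolding ra by (simp only: ac_simps)
  qed
  note r
  also have "\<dots> \<le> real x / real (m * n + 1) * real (m * n + 1 choose n)"
    using binomial_shift_le[of m "k + 1" n] m True by (intro mult_left_mono) (auto simp: j_def)
  also have "\<dots> = real x * tree_count m n"
    using True m by (simp add: tree_count_eq_raney raney_def)
  finally have "real (m - 1) ^ k * raney m j x \<le> real x * tree_count m n" .
  moreover have "fps_nth (low_fps m k) n = real (m - 1) ^ k * raney m j x"
    unfolding low_fps_nth[OF m_pos[OF m]] x_def j_def using True by simp
  ultimately show ?thesis by (simp add: low_fps_def x_def)
qed

lemma path_weight_ge:
  assumes "set u \<subseteq> {..<m}"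
  shows "length (filter (\<lambda>l. l \<noteq> m - 1) u) \<le> path_weight m u"
  using assms by (induction u) (auto simp: path_weight_def)

text \<open>A node with more than K letters other than m - 1 has weight at least K + 1; all
  remaining nodes are counted by the sum.\<close>

lemma area_low_count:
  assumes S: "S \<in> word_trees m n"
  shows "(K + 1) * n \<le> area m S + (K + 1) * (\<Sum>k\<le>K. low_count m k S)"
proof -
  define f where "f u = length (filter (\<lambda>l. l \<noteq> m - 1) u)" for u
  have fin: "finite S" and card: "card S = n" and sub: "\<And>u. u \<in> S \<Longrightarrow> set u \<subseteq> {..<m}"
    using S by (auto simp: word_trees_def prefix_closed_def)
  define A where "A = {u \<in> S. f u \<le> K}"
  have low: "(\<Sum>k\<le>K. low_count m k S) = card A"
  proof -
    have "(\<Sum>k\<le>K. low_count m k S) = card (\<Union>k\<le>K. {u \<in> S. f u = k})"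
      unfolding low_count_def f_def using fin by (intro card_UN_disjoint[symmetric]) auto
    also have "(\<Union>k\<le>K. {u \<in> S. f u = k}) = A" by (auto simp: A_def)
    finally show ?thesis .
  qed
  have A: "A \<subseteq> S" "finite A" using fin by (auto simp: A_def)
  have total: "card A + card (S - A) = n"
    using card_Diff_subset[OF A(2,1)] card_mono[OF fin A(1)] card by linarith
  have "(K + 1) * card (S - A) = (\<Sum>u\<in>S - A. K + 1)" by simp
  also have "\<dots> \<le> (\<Sum>u\<in>S - A. path_weight m u)"
  proof (rule sum_mono)
    fix u assume u: "u \<in> S - A"
    then have "f u \<le> path_weight m u" unfolding f_def using sub by (intro path_weight_ge) simp
    moreover have "K < f u" using u unfolding A_def by (simp add: not_le)
    ultimately show "K + 1 \<le> path_weight m u" by linarith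
  qed
  also have "\<dots> \<le> area m S" unfolding area_def by (rule sum_mono2[OF fin]) auto
  finally have "(K + 1) * card (S - A) \<le> area m S" .
  then show ?thesis unfolding low total[symmetric] distrib_left[of _ "card A"] by linarith
qed

text \<open>Markov's inequality for the number of nodes with at most K letters other than m - 1: an
  area of at most K n / 2 forces this number to be at least n / 2, whereas its mean is
  O(K^2).\<close>

lemma small_area_count:
  assumes m: "m \<ge> 2"
  shows "real (card {S \<in> word_trees m n. 2 * area m S \<le> K * n}) * real n \<le> 4 * real m * (real K + 2)\<^sup>2 * tree_count m n"
proof -
  define A where "A = {S \<in> word_trees m n. 2 * area m S \<le> K * n}"
  have finW: "finite (word_trees m n)" by (rule finite_word_trees)
  have "real n \<le> 2 * (\<Sum>k\<le>K. real (low_count m k S))" if "S \<in> A" for S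
  proof -
    have "(K + 1) * n \<le> area m S + (K + 1) * (\<Sum>k\<le>K. low_count m k S)" using that by (intro area_low_count) (simp add: A_def)
    moreover have "2 * area m S \<le> (K + 1) * n" using that by (simp add: A_def)
    ultimately have "(K + 1) * n \<le> (K + 1) * (2 * (\<Sum>k\<le>K. low_count m k S))" by linarith
    then have "n \<le> 2 * (\<Sum>k\<le>K. low_count m k S)" unfolding mult_le_cancel1 by simp
    then have "real n \<le> real (2 * (\<Sum>k\<le>K. low_count m k S))" by (rule of_nat_mono)
    then show ?thesis by simp
  qed
  then have "real (card A) * real n \<le> (\<Sum>S\<in>A. 2 * (\<Sum>k\<le>K. real (low_count m k S)))"
    using sum_mono[of A "\<lambda>_. real n"] by simp
  also have "\<dots> \<le> (\<Sum>S\<in>word_trees m n. 2 * (\<Sum>k\<le>K. real (low_count m k S)))"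
    using finW by (intro sum_mono2) (auto simp: A_def intro!: sum_nonneg)
  also have "\<dots> = 2 * (\<Sum>k\<le>K. \<Sum>S\<in>word_trees m n. real (low_count m k S))"
    by (simp add: sum_distrib_left sum.swap[of _ "word_trees m n"])
  also have "\<dots> \<le> 2 * (\<Sum>k\<le>K. real (m * (K + 1) + 1) * tree_count m n)"
  proof (intro mult_left_mono sum_mono)
    fix k assume "k \<in> {..K}"
    then have "real (m * (k + 1) + 1) \<le> real (m * (K + 1) + 1)" by (intro of_nat_mono) simp
    then have "real (m * (k + 1) + 1) * tree_count m n \<le> real (m * (K + 1) + 1) * tree_count m n"
      using tree_count_pos[OF m_pos[OF m], of n] by (intro mult_right_mono) auto
    then show "(\<Sum>S\<in>word_trees m n. real (low_count m k S)) \<le> real (m * (K + 1) + 1) * tree_count m n"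
      using mean_low_count_le[OF m, of k n] by linarith
  qed simp
  also have "\<dots> = 2 * ((real K + 1) * (real m * (real K + 1) + 1)) * tree_count m n" by (simp add: algebra_simps)
  also have "\<dots> \<le> 2 * ((real K + 2) * (real m * (real K + 2) + real m * (real K + 2))) * tree_count m n"
  proof -
    have "1 \<le> real m * (real K + 2)" using m mult_mono[of 1 "real m" 1 "real K + 2"] by simp
    then show ?thesis using tree_count_pos[OF m_pos[OF m], of n]
      by (intro mult_right_mono mult_left_mono mult_mono add_mono) auto
  qed
  also have "\<dots> = 4 * real m * (real K + 2)\<^sup>2 * tree_count m n" by (simp add: power2_eq_square)
  finally show ?thesis by (simp add: A_def)
qed

section \<open>The limit law\<close>

context
  fixes m :: nat
  assumes m: "m \<ge> 2"
begin

lemma word_trees_nonempty: "word_trees m d \<noteq> {}"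
  using tree_count_pos[OF m_pos[OF m], of d] by (auto simp: tree_count_def)

definition area_pmf :: "nat \<Rightarrow> nat pmf" where
  "area_pmf d = map_pmf (area m) (pmf_of_set (word_trees m d))"

text \<open>By \<open>area_plus_codim\<close> a tree of size d contributes in this degree exactly if
  its area is k. In negative degrees no tree qualifies, in agreement with the vanishing of
  cohomology.\<close>

lemma pmf_area_pmf:
  "pmf (area_pmf d) k =
    real (betti_number ((int m - 1) * int d * (int d - 1) - 2 * int k) (nc_hilbert m d))
      / real_of_int (euler_characteristic (nc_hilbert m d))"
proof -
  have "int (2 * cell_codim m S) = (int m - 1) * int d * (int d - 1) - 2 * int k \<longleftrightarrow> area m S = k"
    if "S \<in> word_trees m d" for S
  proof -
    have "2 * (int (area m S) + int (cell_codim m S)) = (int m - 1) * int d * (int d - 1)"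
      using area_plus_codim[OF _ m_pos[OF m], of S] that by (auto simp: word_trees_eq)
    then show ?thesis by auto
  qed
  then have "{S \<in> word_trees m d. int (2 * cell_codim m S) = (int m - 1) * int d * (int d - 1) - 2 * int k} =
      word_trees m d \<inter> area m -` {k}"
    by auto
  then show ?thesis
    unfolding area_pmf_def pmf_map betti_number_nc_hilbert euler_characteristic_nc_hilbert
    by (simp add: measure_pmf_of_set[OF word_trees_nonempty finite_word_trees])
qed

section \<open>The rescaled area and its limit\<close>

definition area_law :: "nat \<Rightarrow> real measure" where
  "area_law d = distr (measure_pmf (area_pmf d)) borel
     (\<lambda>k. sqrt (8 / (real m * (real m - 1))) * real d powr (- 3 / 2) * real k)"

lemma real_distribution_area_law: "real_distribution (area_law d)"
  unfolding area_law_def by (rule prob_space.real_distribution_distr[OF measure_pmf.prob_space_axioms]) simp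

lemma area_law_integral:
  assumes [measurable]: "f \<in> borel_measurable borel"
  shows "(\<integral>x. f x \<partial>area_law d) =
    (\<Sum>S\<in>word_trees m d. f (sqrt (8 / (real m * (real m - 1))) * real d powr (- 3 / 2) * real (area m S))) / tree_count m d"
  unfolding area_law_def area_pmf_def
  by (simp add: integral_distr integral_pmf_of_set[OF word_trees_nonempty finite_word_trees] tree_count_def)

lemma area_law_integrable:
  "integrable (area_law d) (\<lambda>x. x ^ k)"
proof -
  have "finite (set_pmf (area_pmf d))"
    by (simp add: area_pmf_def set_pmf_of_set[OF word_trees_nonempty finite_word_trees] finite_word_trees)
  then show ?thesis unfolding area_law_def
    by (subst integrable_distr_eq) (auto intro: integrable_measure_pmf_finite)
qed

text \<open>An area of at most \<eta> d^(3/2) is at most K d / 2 with K close to 2 \<eta> sqrt d. So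
  \<open>small_area_count\<close> applies, and for large d the bound is close to 16 m
  \<eta>^2.\<close>

lemma area_law_cdf_bound:
  assumes \<eta>: "\<eta> > 0" and d: "d > 0"
  shows "measure (area_law d) {..sqrt (8 / (real m * (real m - 1))) * \<eta>} \<le> 4 * real m * ((2 * \<eta> * sqrt (real d) + 3)\<^sup>2 / real d)"
proof -
  define c where "c = sqrt (8 / (real m * (real m - 1)))"
  define K where "K = nat \<lceil>2 * \<eta> * sqrt (real d)\<rceil>"
  have c: "c > 0" using m by (simp add: c_def)
  have "2 * \<eta> * sqrt (real d) \<ge> 0" using \<eta> by simp
  then have K: "2 * \<eta> * sqrt (real d) \<le> real K" "real K \<le> 2 * \<eta> * sqrt (real d) + 1"
    unfolding K_def by linarith+
  have p: "real d powr (- 3 / 2) = 1 / (real d * sqrt (real d))"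
  proof -
    have "real d powr (- 3 / 2) = 1 / real d powr (1 + 1 / 2)" using powr_minus_divide[of "real d" "3/2"] by simp
    also have "real d powr (1 + 1 / 2) = real d * sqrt (real d)" using d by (subst powr_add) (simp add: powr_half_sqrt)
    finally show ?thesis .
  qed
  have small: "2 * area m S \<le> K * d" if "c * real d powr (- 3 / 2) * real (area m S) \<le> c * \<eta>" for S
  proof -
    have "c * (real (area m S) / (real d * sqrt (real d))) \<le> c * \<eta>" using that unfolding p by simp
    then have "real (area m S) / (real d * sqrt (real d)) \<le> \<eta>" unfolding mult_le_cancel_left_pos[OF c] .
    then have "real (area m S) \<le> \<eta> * (real d * sqrt (real d))" using d by (simp add: divide_le_eq)
    then have "2 * real (area m S) \<le> (2 * \<eta> * sqrt (real d)) * real d" by (simp add: ac_simps)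
    also have "\<dots> \<le> real K * real d" using K by (intro mult_right_mono) auto
    finally have "real (2 * area m S) \<le> real (K * d)" by simp
    then show ?thesis by (simp only: of_nat_le_iff)
  qed
  have "measure (area_law d) {..c * \<eta>} = (\<integral>x. indicator {..c * \<eta>} x \<partial>area_law d)"
    by (simp add: area_law_def)
  also have "\<dots> = (\<Sum>S\<in>word_trees m d. indicator {..c * \<eta>} (c * real d powr (- 3 / 2) * real (area m S))) / tree_count m d"
    unfolding c_def by (rule area_law_integral) simp
  also have "\<dots> \<le> (\<Sum>S\<in>word_trees m d. if 2 * area m S \<le> K * d then 1 else 0) / tree_count m d"
    using tree_count_pos[OF m_pos[OF m], of d] small
    by (intro divide_right_mono sum_mono) (auto simp: indicator_def)
  also have "\<dots> = real (card {S \<in> word_trees m d. 2 * area m S \<le> K * d}) / tree_count m d"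
    by (simp add: sum.If_cases[OF finite_word_trees] Int_def)
  also have "\<dots> \<le> 4 * real m * (real K + 2)\<^sup>2 / real d"
    using small_area_count[OF m, of d K] tree_count_pos[OF m_pos[OF m], of d] d by (simp add: divide_le_eq le_divide_eq)
  also have "\<dots> \<le> 4 * real m * (2 * \<eta> * sqrt (real d) + 3)\<^sup>2 / real d"
    using K by (intro divide_right_mono mult_left_mono power_mono) auto
  finally show ?thesis by (simp add: c_def)
qed

text \<open>The bounds of \<open>area_law_cdf_bound\<close> tend to 16 m \<eta>^2 with \<eta>
  arbitrary. A continuous step function replaces the indicator, so that it does not matter whether
  the limit law has an atom at 0.\<close>

lemma area_law_limit_positive:
  assumes \<nu>: "real_distribution \<nu>" and lim: "weak_conv_m area_law \<nu>"
  shows "AE x in \<nu>. 0 < x"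
proof -
  interpret \<nu>: real_distribution \<nu> by fact
  define c where "c = sqrt (8 / (real m * (real m - 1)))"
  have c: "c > 0" using m by (simp add: c_def)
  have bound: "measure \<nu> {..0} \<le> 16 * real m * \<eta>\<^sup>2" if \<eta>: "\<eta> > 0" for \<eta>
  proof -
    have pos: "0 < c * \<eta>" using c \<eta> by simp
    have cont: "isCont (cts_step 0 (c * \<eta>)) x" for x
      using uniformly_continuous_imp_continuous[OF cts_step_uniformly_continuous[OF pos]]
      by (simp add: continuous_on_eq_continuous_at)
    have "(\<lambda>d. integral\<^sup>L (area_law d) (cts_step 0 (c * \<eta>))) \<longlonglongrightarrow> integral\<^sup>L \<nu> (cts_step 0 (c * \<eta>))"
    proof (rule weak_conv_imp_integral_bdd_continuous_conv[OF real_distribution_area_law \<nu> lim cont])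
      show "norm (cts_step 0 (c * \<eta>) x) \<le> 1" for x using pos by (auto simp: cts_step_def)
    qed
    moreover have "(\<lambda>d. 4 * real m * ((2 * \<eta> * sqrt (real d) + 3)\<^sup>2 / real d)) \<longlonglongrightarrow> 4 * real m * (4 * \<eta>\<^sup>2)"
    proof (intro tendsto_intros)
      show "(\<lambda>d. (2 * \<eta> * sqrt (real d) + 3)\<^sup>2 / real d) \<longlonglongrightarrow> 4 * \<eta>\<^sup>2"
        using \<eta> by real_asymp
    qed
    moreover have "integral\<^sup>L (area_law d) (cts_step 0 (c * \<eta>)) \<le> 4 * real m * ((2 * \<eta> * sqrt (real d) + 3)\<^sup>2 / real d)" if "d \<ge> 1" for d
      using real_distribution.cdf_cts_step(2)[OF real_distribution_area_law pos, of d] area_law_cdf_bound[OF \<eta>, of d] that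
      by (simp add: cdf_def c_def)
    ultimately have "integral\<^sup>L \<nu> (cts_step 0 (c * \<eta>)) \<le> 4 * real m * (4 * \<eta>\<^sup>2)"
      by (intro LIMSEQ_le) auto
    then show ?thesis using \<nu>.cdf_cts_step(1)[OF pos] by (simp add: cdf_def)
  qed
  have "measure \<nu> {..0} \<le> 0"
  proof (rule LIMSEQ_le_const)
    show "(\<lambda>n. 16 * real m * (1 / real (Suc n))\<^sup>2) \<longlonglongrightarrow> 0" by real_asymp
    show "\<exists>N. \<forall>n\<ge>N. measure \<nu> {..0} \<le> 16 * real m * (1 / real (Suc n))\<^sup>2"
      by (intro exI[of _ 0] allI impI bound) simp
  qed
  then have "measure \<nu> {..0} = 0" using measure_nonneg[of \<nu> "{..0}"] by linarith
  then have "{..0} \<in> null_sets \<nu>" by (simp add: null_sets_def \<nu>.emeasure_eq_measure)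
  then show ?thesis by (rule AE_I') (auto simp: not_less)
qed

text \<open>The law produced by \<open>method_of_moments\<close> shows existence, and
  \<open>moment_determinacy\<close> uniqueness; only then is the description
  \<open>airy_distribution\<close> known to denote this law.\<close>

lemma area_law_tendsto_airy: "weak_conv_m area_law airy_distribution"
proof -
  have lim: "(\<lambda>d. \<integral>x. x ^ k \<partial>area_law d) \<longlonglongrightarrow> airy_moment k" for k
    by (subst area_law_integral) (simp_all only: area_moment_tendsto[OF m], measurable)
  show ?thesis
  proof (rule method_of_moments[of area_law airy_moment, OF real_distribution_area_law area_law_integrable lim airy_moment_growth])
    fix \<nu> assume \<nu>: "real_distribution \<nu>" "\<And>k. integrable \<nu> (\<lambda>x. x ^ k)"
        "\<And>k. (\<integral>x. x ^ k \<partial>\<nu>) = airy_moment k" "weak_conv_m area_law \<nu>"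
    have "airy_distribution = \<nu>"
      unfolding airy_distribution_def
    proof (rule the_equality)
      show "is_airy_distribution \<nu>"
        using \<nu> area_law_limit_positive[OF \<nu>(1,4)] by (simp add: is_airy_distribution_def airy_moment_def)
      show "\<mu> = \<nu>" if "is_airy_distribution \<mu>" for \<mu>
        using that by (intro moment_determinacy[OF _ _ _ \<nu>(1-3) airy_moment_growth])
          (auto simp: is_airy_distribution_def airy_moment_def)
    qed
    then show ?thesis using \<nu>(4) by simp
  qed
qed

end

text \<open>Quantifying over probability mass functions includes the claim that the Betti numbers in
  the given degrees add up to the Euler characteristic. The formula for \<open>pmf\<close>
  determines X, so the existential statement concerns precisely these laws.\<close>

theorem theorem1p5:
  fixes m :: nat
  assumes "m \<ge> 2"
  shows "\<exists>X :: nat \<Rightarrow> nat pmf.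
    (\<forall>d k. pmf (X d) k =
       real (betti_number ((int m - 1) * int d * (int d - 1) - 2 * int k) (nc_hilbert m d))
         / real_of_int (euler_characteristic (nc_hilbert m d))) \<and>
    weak_conv_m
      (\<lambda>d. distr (measure_pmf (X d)) borel
             (\<lambda>k. sqrt (8 / (real m * (real m - 1))) * real d powr (- 3 / 2) * real k))
      airy_distribution"
proof (intro exI[of _ "area_pmf m"] conjI allI)
  show "pmf (area_pmf m d) k =
       real (betti_number ((int m - 1) * int d * (int d - 1) - 2 * int k) (nc_hilbert m d))
         / real_of_int (euler_characteristic (nc_hilbert m d))" for d k
    by (rule pmf_area_pmf[OF assms])
  show "weak_conv_m
      (\<lambda>d. distr (measure_pmf (area_pmf m d)) borel
             (\<lambda>k. sqrt (8 / (real m * (real m - 1))) * real d powr (- 3 / 2) * real k))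
      airy_distribution"
    using area_law_tendsto_airy[OF assms] by (simp add: area_law_def[OF assms, abs_def] area_law_def)
qed

end
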